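(* Let $(M,F)$ be a connected Finsler manifold of dimension $n\ge 2$. Assume that the vector space of almost Killing vector fields on $(M,F)$ has dimension greater than $\tfrac{n^2-n}{2}+1$. Then $F$ is a Randers metric, i.e., there exist a Riemannian metric $g$ on $M$ and a 1-form $\tau$ on $M$ with $|\tau|_g<1$ at every point such that $F(x,y)=\sqrt{g_x(y,y)}+\tau(y)$ for all $x\in M$, $y\in T_xM$.
   Context: All objects are assumed sufficiently smooth. A Finsler metric $F:TM\to[0,\infty)$ is positively homogeneous of degree 1 on each tangent space, positive and smooth away from the zero section, and strictly convex; it is not assumed to be reversible (i.e. $F(x,-y)\neq F(x,y)$ is allowed). The associated (generally nonsymmetric) distance is $d(p,q)=\inf\{\int_0^1 F(c(t),c'(t))\,dt : c\in C^1([0,1];M),\ c(0)=p,\ c(1)=q\}$. Put $T(p,q,r):=d(p,q)+d(q,r)-d(p,r)$. A diffeomorphism $\phi:U\to V$ with $U,V\subseteq M$ is an almost isometry if $T(p,q,r)=T(\phi(p),\phi(q),\phi(r))$ for all $p,q,r\in U$. A vector field $K$ is almost Killing if its local flow acts by almost isometries; all considerations being local, this means that every point has a neighborhood $U$ such that, for all sufficiently small $|t|$, the time-$t$ flow of $K$ restricted to $U$ is an almost isometry onto its image. $|\tau|_g$ denotes the pointwise $g$-norm of the 1-form $\tau$. *)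

theory Defs
  imports "HOL-Analysis.Analysis" "HOL-Library.Function_Algebras"
begin

text \<open>
  Pointwise scalar multiplication, so that tangent vectors and vector fields (which are functions)
  live in a real vector space and the library notion of linear independence applies to them.
\<close>

instantiation "fun" :: (type, real_vector) real_vector
begin

definition scaleR_fun :: "real \<Rightarrow> ('a \<Rightarrow> 'b) \<Rightarrow> 'a \<Rightarrow> 'b"
  where "scaleR_fun r f = (\<lambda>x. r *\<^sub>R f x)"

instance
  by standard (auto simp: scaleR_fun_def plus_fun_def scaleR_add_right scaleR_add_left)

end

text \<open>Smoothness means \<open>C\<^sup>\<infinity>\<close>; the set \<open>S\<close> is always meant to be open.\<close>

primrec C_diff_on ::
  "nat \<Rightarrow> 'a::real_normed_vector set \<Rightarrow> ('a \<Rightarrow> 'b::real_normed_vector) \<Rightarrow> bool"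
  where
    "C_diff_on 0 S f \<longleftrightarrow> continuous_on S f"
  | "C_diff_on (Suc k) S f \<longleftrightarrow>
       (\<forall>x\<in>S. f differentiable (at x)) \<and>
       (\<forall>v. C_diff_on k S (\<lambda>x. frechet_derivative f (at x) v))"

definition smooth_on ::
  "'a::real_normed_vector set \<Rightarrow> ('a \<Rightarrow> 'b::real_normed_vector) \<Rightarrow> bool"
  where "smooth_on S f \<longleftrightarrow> (\<forall>k. C_diff_on k S f)"


subsection \<open>Smooth manifolds\<close>

text \<open>
  A chart is a pair of its domain and its coordinate map; the values of the coordinate map
  outside the domain are irrelevant. The manifold is \<open>topspace X\<close>, with the smooth structure
  given by an atlas \<open>A\<close> (not necessarily maximal); its dimension is \<open>DIM('e)\<close>.
\<close>

type_synonym ('a, 'e) chart = "'a set \<times> ('a \<Rightarrow> 'e)"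

definition chart_inv :: "('a, 'e) chart \<Rightarrow> 'e \<Rightarrow> 'a"
  where "chart_inv c = inv_into (fst c) (snd c)"

definition is_chart :: "'a topology \<Rightarrow> ('a, 'e::euclidean_space) chart \<Rightarrow> bool"
  where "is_chart X c \<longleftrightarrow>
    openin X (fst c) \<and> open (snd c ` fst c) \<and>
    homeomorphic_map (subtopology X (fst c)) (top_of_set (snd c ` fst c)) (snd c)"

definition smooth_atlas :: "'a topology \<Rightarrow> ('a, 'e::euclidean_space) chart set \<Rightarrow> bool"
  where "smooth_atlas X A \<longleftrightarrow>
    (\<forall>c\<in>A. is_chart X c) \<and> \<Union> (fst ` A) = topspace X \<and>
    (\<forall>c\<in>A. \<forall>c'\<in>A. smooth_on (snd c ` (fst c \<inter> fst c')) (snd c' \<circ> chart_inv c))"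

definition smooth_manifold :: "'a topology \<Rightarrow> ('a, 'e::euclidean_space) chart set \<Rightarrow> bool"
  where "smooth_manifold X A \<longleftrightarrow> Hausdorff_space X \<and> second_countable X \<and> smooth_atlas X A"

definition charts_at :: "('a, 'e) chart set \<Rightarrow> 'a \<Rightarrow> ('a, 'e) chart set"
  where "charts_at A p = {c \<in> A. p \<in> fst c}"

text \<open>
  A tangent vector at \<open>p\<close> is the family \<open>v\<close> of its coordinate vectors \<open>v c\<close> in all charts
  \<open>c \<in> A\<close> around \<open>p\<close>, transforming by the derivatives of the coordinate changes; the remaining
  entries are set to \<open>0\<close> so that equality of tangent vectors is equality of functions.
\<close>

type_synonym ('a, 'e) tvec = "('a, 'e) chart \<Rightarrow> 'e"

definition tangent_space ::
  "('a, 'e::euclidean_space) chart set \<Rightarrow> 'a \<Rightarrow> ('a, 'e) tvec set"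
  where "tangent_space A p = {v.
    (\<forall>c. c \<notin> charts_at A p \<longrightarrow> v c = 0) \<and>
    (\<forall>c\<in>charts_at A p. \<forall>c'\<in>charts_at A p.
       v c' = frechet_derivative (snd c' \<circ> chart_inv c) (at (snd c p)) (v c))}"

text \<open>The tangent vector at \<open>p\<close> whose coordinate vector in the chart \<open>c\<close> is \<open>w\<close>.\<close>

definition tvec_of ::
  "('a, 'e::euclidean_space) chart set \<Rightarrow> ('a, 'e) chart \<Rightarrow> 'a \<Rightarrow> 'e \<Rightarrow> ('a, 'e) tvec"
  where "tvec_of A c p w = (\<lambda>c'. if c' \<in> charts_at A p
    then frechet_derivative (snd c' \<circ> chart_inv c) (at (snd c p)) w else 0)"

definition smooth_map_on ::
  "'a topology \<Rightarrow> ('a, 'e::euclidean_space) chart set \<Rightarrow> 'a set \<Rightarrow> ('a \<Rightarrow> 'a) \<Rightarrow> bool"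
  where "smooth_map_on X A U f \<longleftrightarrow>
    continuous_map (subtopology X U) X f \<and>
    (\<forall>c\<in>A. \<forall>c'\<in>A.
       smooth_on (snd c ` (fst c \<inter> U \<inter> f -` fst c')) (snd c' \<circ> f \<circ> chart_inv c))"

definition diffeomorphism_on ::
  "'a topology \<Rightarrow> ('a, 'e::euclidean_space) chart set \<Rightarrow> 'a set \<Rightarrow> 'a set \<Rightarrow> ('a \<Rightarrow> 'a) \<Rightarrow> bool"
  where "diffeomorphism_on X A U V f \<longleftrightarrow>
    openin X U \<and> openin X V \<and> bij_betw f U V \<and>
    smooth_map_on X A U f \<and> smooth_map_on X A V (inv_into U f)"

text \<open>Vector fields are extended by \<open>0\<close> outside of the manifold.\<close>

definition smooth_vector_field ::
  "'a topology \<Rightarrow> ('a, 'e::euclidean_space) chart set \<Rightarrow> ('a \<Rightarrow> ('a, 'e) tvec) \<Rightarrow> bool"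
  where "smooth_vector_field X A K \<longleftrightarrow>
    (\<forall>p\<in>topspace X. K p \<in> tangent_space A p) \<and> (\<forall>p. p \<notin> topspace X \<longrightarrow> K p = 0) \<and>
    (\<forall>c\<in>A. smooth_on (snd c ` fst c) (\<lambda>x. K (chart_inv c x) c))"

definition smooth_one_form ::
  "'a topology \<Rightarrow> ('a, 'e::euclidean_space) chart set \<Rightarrow> ('a \<Rightarrow> ('a, 'e) tvec \<Rightarrow> real) \<Rightarrow> bool"
  where "smooth_one_form X A \<tau> \<longleftrightarrow>
    (\<forall>p\<in>topspace X. \<forall>u\<in>tangent_space A p. \<forall>v\<in>tangent_space A p. \<forall>a b.
       \<tau> p (a *\<^sub>R u + b *\<^sub>R v) = a * \<tau> p u + b * \<tau> p v) \<and>
    (\<forall>c\<in>A. \<forall>w. smooth_on (snd c ` fst c)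
       (\<lambda>x. \<tau> (chart_inv c x) (tvec_of A c (chart_inv c x) w)))"

definition riemannian_metric ::
  "'a topology \<Rightarrow> ('a, 'e::euclidean_space) chart set
     \<Rightarrow> ('a \<Rightarrow> ('a, 'e) tvec \<Rightarrow> ('a, 'e) tvec \<Rightarrow> real) \<Rightarrow> bool"
  where "riemannian_metric X A g \<longleftrightarrow>
    (\<forall>p\<in>topspace X.
       (\<forall>u\<in>tangent_space A p. \<forall>v\<in>tangent_space A p. g p u v = g p v u) \<and>
       (\<forall>u\<in>tangent_space A p. \<forall>v\<in>tangent_space A p. \<forall>w\<in>tangent_space A p. \<forall>a b.
          g p (a *\<^sub>R u + b *\<^sub>R v) w = a * g p u w + b * g p v w) \<and>
       (\<forall>v\<in>tangent_space A p. v \<noteq> 0 \<longrightarrow> g p v v > 0)) \<and>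
    (\<forall>c\<in>A. \<forall>w w'. smooth_on (snd c ` fst c)
       (\<lambda>x. g (chart_inv c x) (tvec_of A c (chart_inv c x) w) (tvec_of A c (chart_inv c x) w')))"

definition one_form_norm ::
  "('a, 'e::euclidean_space) chart set \<Rightarrow> ('a \<Rightarrow> ('a, 'e) tvec \<Rightarrow> ('a, 'e) tvec \<Rightarrow> real)
     \<Rightarrow> ('a \<Rightarrow> ('a, 'e) tvec \<Rightarrow> real) \<Rightarrow> 'a \<Rightarrow> real"
  where "one_form_norm A g \<tau> p = Sup {\<bar>\<tau> p v\<bar> |v. v \<in> tangent_space A p \<and> g p v v \<le> 1}"


subsection \<open>Finsler metrics and almost Killing vector fields\<close>

text \<open>
  Strict convexity is strict convexity of the unit balls of the tangent spaces. It is implied by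
  positive definiteness of the fibrewise Hessian of \<open>F\<^sup>2 / 2\<close> away from the zero section.
\<close>

definition finsler_metric ::
  "'a topology \<Rightarrow> ('a, 'e::euclidean_space) chart set \<Rightarrow> ('a \<Rightarrow> ('a, 'e) tvec \<Rightarrow> real) \<Rightarrow> bool"
  where "finsler_metric X A F \<longleftrightarrow>
    (\<forall>p\<in>topspace X.
       (\<forall>v\<in>tangent_space A p. \<forall>a>0. F p (a *\<^sub>R v) = a * F p v) \<and>
       (\<forall>v\<in>tangent_space A p. F p v \<ge> 0) \<and>
       (\<forall>v\<in>tangent_space A p. v \<noteq> 0 \<longrightarrow> F p v > 0) \<and>
       (\<forall>u\<in>tangent_space A p. \<forall>v\<in>tangent_space A p. \<forall>t.
          F p u = 1 \<and> F p v = 1 \<and> u \<noteq> v \<and> 0 < t \<and> t < 1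
            \<longrightarrow> F p ((1 - t) *\<^sub>R u + t *\<^sub>R v) < 1)) \<and>
    (\<forall>c\<in>A. smooth_on ((snd c ` fst c) \<times> (UNIV - {0}))
       (\<lambda>(x, w). F (chart_inv c x) (tvec_of A c (chart_inv c x) w)))"

definition velocity ::
  "('a, 'e::euclidean_space) chart set \<Rightarrow> real set \<Rightarrow> (real \<Rightarrow> 'a) \<Rightarrow> real \<Rightarrow> ('a, 'e) tvec"
  where "velocity A I \<gamma> t = (\<lambda>c. if c \<in> charts_at A (\<gamma> t)
    then vector_derivative (snd c \<circ> \<gamma>) (at t within I) else 0)"

definition C1_curve ::
  "'a topology \<Rightarrow> ('a, 'e::euclidean_space) chart set \<Rightarrow> real set \<Rightarrow> (real \<Rightarrow> 'a) \<Rightarrow> bool"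
  where "C1_curve X A I \<gamma> \<longleftrightarrow>
    continuous_map (top_of_set I) X \<gamma> \<and>
    (\<forall>c\<in>A.
       (\<forall>t \<in> I \<inter> \<gamma> -` fst c. (snd c \<circ> \<gamma>) differentiable (at t within I)) \<and>
       continuous_on (I \<inter> \<gamma> -` fst c) (\<lambda>t. velocity A I \<gamma> t c))"

definition finsler_dist ::
  "'a topology \<Rightarrow> ('a, 'e::euclidean_space) chart set \<Rightarrow> ('a \<Rightarrow> ('a, 'e) tvec \<Rightarrow> real)
     \<Rightarrow> 'a \<Rightarrow> 'a \<Rightarrow> real"
  where "finsler_dist X A F p q = Inf {integral {0..1} (\<lambda>t. F (\<gamma> t) (velocity A {0..1} \<gamma> t)) |\<gamma>.
    C1_curve X A {0..1} \<gamma> \<and> \<gamma> 0 = p \<and> \<gamma> 1 = q}"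

definition triangle_defect ::
  "'a topology \<Rightarrow> ('a, 'e::euclidean_space) chart set \<Rightarrow> ('a \<Rightarrow> ('a, 'e) tvec \<Rightarrow> real)
     \<Rightarrow> 'a \<Rightarrow> 'a \<Rightarrow> 'a \<Rightarrow> real"
  where "triangle_defect X A F p q r =
    finsler_dist X A F p q + finsler_dist X A F q r - finsler_dist X A F p r"

definition almost_isometry ::
  "'a topology \<Rightarrow> ('a, 'e::euclidean_space) chart set \<Rightarrow> ('a \<Rightarrow> ('a, 'e) tvec \<Rightarrow> real)
     \<Rightarrow> 'a set \<Rightarrow> 'a set \<Rightarrow> ('a \<Rightarrow> 'a) \<Rightarrow> bool"
  where "almost_isometry X A F U V f \<longleftrightarrow>
    diffeomorphism_on X A U V f \<and>
    (\<forall>p\<in>U. \<forall>q\<in>U. \<forall>r\<in>U.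
       triangle_defect X A F p q r = triangle_defect X A F (f p) (f q) (f r))"

definition integral_curve ::
  "'a topology \<Rightarrow> ('a, 'e::euclidean_space) chart set \<Rightarrow> ('a \<Rightarrow> ('a, 'e) tvec)
     \<Rightarrow> real set \<Rightarrow> (real \<Rightarrow> 'a) \<Rightarrow> bool"
  where "integral_curve X A K I \<gamma> \<longleftrightarrow>
    C1_curve X A I \<gamma> \<and> (\<forall>t\<in>I. velocity A I \<gamma> t = K (\<gamma> t))"

text \<open>
  \<open>\<Phi> t\<close> is the time-\<open>t\<close> flow of \<open>K\<close> on \<open>U\<close> for \<open>\<bar>t\<bar> < \<epsilon>\<close>. Since integral curves are determined by
  their initial points, \<open>\<Phi> t\<close> is unique on \<open>U\<close>.
\<close>

definition local_flow ::
  "'a topology \<Rightarrow> ('a, 'e::euclidean_space) chart set \<Rightarrow> ('a \<Rightarrow> ('a, 'e) tvec)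
     \<Rightarrow> 'a set \<Rightarrow> real \<Rightarrow> (real \<Rightarrow> 'a \<Rightarrow> 'a) \<Rightarrow> bool"
  where "local_flow X A K U \<epsilon> \<Phi> \<longleftrightarrow>
    (\<forall>x\<in>U. \<Phi> 0 x = x \<and> integral_curve X A K {-\<epsilon><..<\<epsilon>} (\<lambda>t. \<Phi> t x))"

definition almost_killing ::
  "'a topology \<Rightarrow> ('a, 'e::euclidean_space) chart set \<Rightarrow> ('a \<Rightarrow> ('a, 'e) tvec \<Rightarrow> real)
     \<Rightarrow> ('a \<Rightarrow> ('a, 'e) tvec) \<Rightarrow> bool"
  where "almost_killing X A F K \<longleftrightarrow>
    smooth_vector_field X A K \<and>
    (\<forall>p\<in>topspace X. \<exists>U \<epsilon> \<Phi>. openin X U \<and> p \<in> U \<and> \<epsilon> > 0 \<and> local_flow X A K U \<epsilon> \<Phi> \<and>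
       (\<forall>t. \<bar>t\<bar> < \<epsilon> \<longrightarrow> almost_isometry X A F U (\<Phi> t ` U) (\<Phi> t)))"

text \<open>
  The library function \<open>dim\<close> is \<open>0\<close> on infinite-dimensional spaces, so it cannot be used for lower
  bounds on the dimension of a space not known to be finite-dimensional.
\<close>

definition dim_greater :: "'v::real_vector set \<Rightarrow> real \<Rightarrow> bool"
  where "dim_greater V d \<longleftrightarrow> (\<exists>B\<subseteq>V. finite B \<and> independent B \<and> real (card B) > d)"

definition randers_metric ::
  "'a topology \<Rightarrow> ('a, 'e::euclidean_space) chart set \<Rightarrow> ('a \<Rightarrow> ('a, 'e) tvec \<Rightarrow> real) \<Rightarrow> bool"
  where "randers_metric X A F \<longleftrightarrow> (\<exists>g \<tau>.
    riemannian_metric X A g \<and> smooth_one_form X A \<tau> \<and>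
    (\<forall>p\<in>topspace X. one_form_norm A g \<tau> p < 1) \<and>
    (\<forall>p\<in>topspace X. \<forall>v\<in>tangent_space A p. F p v = sqrt (g p v v) + \<tau> p v))"

end

theory Submission
  imports Defs
begin

text \<open>
  An almost isometry changes the distance by a coboundary, so by the Busemann--Mayer theorem it
  changes \<open>F\<close> by a one-form. Hence the Lie derivative of \<open>F\<close> along an almost Killing field is a
  one-form, and the field is an honest Killing field of the symmetrised metric. The differentiated
  Killing equation and Gronwall's inequality show that such a field is determined by its first jet
  at a point. The fields vanishing at a given point therefore have linear parts forming a space of
  dimension greater than \<open>(n - 1) (n - 2) / 2\<close>. These linear parts preserve the symmetrised norm,
  hence by averaging a Euclidean norm, and so lie in a subalgebra of \<open>so(n)\<close> of that dimension. Such
  an algebra is so large that every plane is rotated by one of its elements. On every plane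
  \<open>F\<close> is then a multiple of the Euclidean norm plus a linear form, which makes \<open>F\<close> a Randers norm.
\<close>

subsection \<open>Large algebras of skew maps\<close>

text \<open>The threshold is tuned to isotropy: vanishing at a point costs at most n dimensions, and
  n(n-1)/2 + 1 - n = (n-1)(n-2)/2 is the dimension of so(n-1). Since the bound is strict, so(n-1)
  itself is just excluded; it is the symmetry algebra of norms of revolution, which need not be
  Randers. The delicate dimension is four: u(2) has dimension 4 > 3 and is a proper subalgebra of
  so(4), so one cannot hope for all of so(n). This is why the algebraic goal is only that each plane
  is rotated by some element, and why a quaternionic triple turns up. The other obstacle is that
  \<open>F\<close> is preserved only modulo one-forms. One-forms are odd in the fibre and cancel
  from F(y) + F(-y), so every rigidity statement is drawn from this symmetrisation, and
  \<open>F\<close> itself returns only when it is integrated along circles. The flows enter only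
  through a first-order estimate for the difference of two solutions.\<close>

definition rot :: "'e::euclidean_space \<Rightarrow> 'e \<Rightarrow> 'e \<Rightarrow> 'e"
  where "rot a b = (\<lambda>x. (a \<bullet> x) *\<^sub>R b - (b \<bullet> x) *\<^sub>R a)"

definition bracket :: "('e \<Rightarrow> 'e) \<Rightarrow> ('e \<Rightarrow> 'e) \<Rightarrow> 'e \<Rightarrow> 'e::euclidean_space"
  where "bracket X Y = (\<lambda>x. X (Y x) - Y (X x))"

definition skew_maps :: "('e::euclidean_space \<Rightarrow> 'e) set"
  where "skew_maps = {X. linear X \<and> (\<forall>x. X x \<bullet> x = 0)}"

lemmas fun_vs = plus_fun_def scaleR_fun_def zero_fun_def fun_Compl_def fun_diff_def

lemma sum_fun_apply: "(\<Sum>i\<in>I. f i) x = (\<Sum>i\<in>I. f i x)" for f :: "'i \<Rightarrow> 'x \<Rightarrow> 'b::comm_monoid_add"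
  by (induction I rule: infinite_finite_induct) (auto simp: fun_vs)

lemma skew_mapsD:
  assumes "X \<in> skew_maps"
  shows "linear X" "X x \<bullet> y = - (x \<bullet> X y)"
proof -
  show l: "linear X" using assms by (auto simp: skew_maps_def)
  have "X (x + y) \<bullet> (x + y) = 0" "X x \<bullet> x = 0" "X y \<bullet> y = 0"
    using assms by (auto simp: skew_maps_def)
  then show "X x \<bullet> y = - (x \<bullet> X y)"
    using l by (simp add: linear_add inner_simps inner_commute)
qed

lemma linear_rot: "linear (rot a b)"
  by (rule linearI) (auto simp: rot_def inner_simps algebra_simps)

lemma rot_in_skew: "rot a b \<in> skew_maps"
  unfolding skew_maps_def using linear_rot[of a b] by (simp add: rot_def inner_diff_left)

lemma rot_swap: "rot b a = - rot a b"
  by (auto simp: rot_def fun_vs)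

lemma rot_self [simp]: "rot a a = 0"
  by (auto simp: rot_def fun_vs)

lemma rot_add_right: "rot a (b + b') = rot a b + rot a b'"
  by (rule ext) (auto simp: rot_def fun_vs inner_simps algebra_simps)

lemma rot_add_left: "rot (a + a') b = rot a b + rot a' b"
  by (rule ext) (auto simp: rot_def fun_vs inner_simps algebra_simps)

lemma rot_scale_right: "rot a (r *\<^sub>R b) = r *\<^sub>R rot a b"
  by (rule ext) (auto simp: rot_def fun_vs inner_simps algebra_simps)

lemma rot_scale_left: "rot (r *\<^sub>R a) b = r *\<^sub>R rot a b"
  by (rule ext) (auto simp: rot_def fun_vs inner_simps algebra_simps)

lemma rot_zero [simp]: "rot 0 b = 0" "rot a 0 = 0"
  by (auto simp: rot_def fun_vs)

lemma rot_minus: "rot (- a) b = - rot a b" "rot a (- b) = - rot a b"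
  by (auto simp: rot_def fun_vs inner_simps algebra_simps)

text \<open>\<open>rot a b\<close> is the bivector a wedge b read as a skew map, and bracketing with
  a skew map acts on bivectors as a derivation. This rule moves known rotation planes to new
  ones.\<close>

lemma bracket_rot:
  assumes "X \<in> skew_maps"
  shows "bracket X (rot a b) = rot (X a) b + rot a (X b)"
  using skew_mapsD[OF assms]
  by (auto simp: fun_eq_iff bracket_def rot_def fun_vs linear_diff linear_scale)

text \<open>The sum runs over ordered pairs of basis vectors, so every coordinate plane occurs
  twice; hence the factor 1/2.\<close>

lemma skew_eq_sum_rot:
  assumes "X \<in> skew_maps"
  shows "X = (\<Sum>a\<in>Basis. \<Sum>b\<in>Basis. ((X a \<bullet> b) / 2) *\<^sub>R rot a b)"
proof
  fix x
  note X = skew_mapsD[OF assms]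
  have Xx: "X x = (\<Sum>a\<in>Basis. (a \<bullet> x) *\<^sub>R X a)"
  proof -
    have "X x = X (\<Sum>a\<in>Basis. (x \<bullet> a) *\<^sub>R a)" by (simp add: euclidean_representation)
    also have "\<dots> = (\<Sum>a\<in>Basis. (a \<bullet> x) *\<^sub>R X a)"
      using X(1) by (simp add: linear_sum linear_scale inner_commute)
    finally show ?thesis .
  qed
  have 1: "(\<Sum>a\<in>Basis. \<Sum>b\<in>Basis. (X a \<bullet> b) *\<^sub>R (a \<bullet> x) *\<^sub>R b) = X x"
  proof -
    have "(\<Sum>b\<in>Basis. (X a \<bullet> b) *\<^sub>R (a \<bullet> x) *\<^sub>R b) = (a \<bullet> x) *\<^sub>R X a" for a
    proof -
      have "(\<Sum>b\<in>Basis. (X a \<bullet> b) *\<^sub>R (a \<bullet> x) *\<^sub>R b) = (a \<bullet> x) *\<^sub>R (\<Sum>b\<in>Basis. (X a \<bullet> b) *\<^sub>R b)"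
        by (simp add: scaleR_sum_right mult.commute)
      then show ?thesis by (simp add: euclidean_representation)
    qed
    then show ?thesis using Xx by simp
  qed
  have 2: "(\<Sum>a\<in>Basis. \<Sum>b\<in>Basis. (X a \<bullet> b) *\<^sub>R (b \<bullet> x) *\<^sub>R a) = - X x"
  proof -
    have "(\<Sum>b\<in>Basis. (X a \<bullet> b) *\<^sub>R (b \<bullet> x) *\<^sub>R a) = - ((X x \<bullet> a) *\<^sub>R a)" for a
    proof -
      have "(\<Sum>b\<in>Basis. (X a \<bullet> b) *\<^sub>R (b \<bullet> x) *\<^sub>R a) = (\<Sum>b\<in>Basis. (X a \<bullet> b) * (x \<bullet> b)) *\<^sub>R a"
        by (simp add: scaleR_sum_left inner_commute)
      also have "\<dots> = (X a \<bullet> x) *\<^sub>R a" by (simp add: euclidean_inner[symmetric])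
      finally show ?thesis using X(2)[of x a] by (simp add: inner_commute)
    qed
    then show ?thesis by (simp add: sum_negf euclidean_representation)
  qed
  have "(\<Sum>a\<in>Basis. \<Sum>b\<in>Basis. ((X a \<bullet> b) / 2) *\<^sub>R rot a b) x
     = (1/2) *\<^sub>R ((\<Sum>a\<in>Basis. \<Sum>b\<in>Basis. (X a \<bullet> b) *\<^sub>R (a \<bullet> x) *\<^sub>R b)
        - (\<Sum>a\<in>Basis. \<Sum>b\<in>Basis. (X a \<bullet> b) *\<^sub>R (b \<bullet> x) *\<^sub>R a))"
    by (simp add: sum_fun_apply scaleR_fun_def rot_def scaleR_sum_right sum_subtractf[symmetric] algebra_simps)
  also have "\<dots> = X x" unfolding 1 2 by (simp add: scaleR_2[symmetric])
  finally show "X x = (\<Sum>a\<in>Basis. \<Sum>b\<in>Basis. ((X a \<bullet> b) / 2) *\<^sub>R rot a b) x" by simp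
qed

lemma independent_skew_card_le:
  fixes T :: "('e::euclidean_space \<Rightarrow> 'e) set"
  assumes "T \<subseteq> skew_maps" "independent T"
  shows "card T \<le> DIM('e) choose 2"
proof -
  define P where "P = {s::'e set. s \<subseteq> Basis \<and> card s = 2}"
  \<comment> \<open>An arbitrary orientation is chosen for each unordered pair; the opposite one
    differs by a sign and stays in the span.\<close>
  define g where "g s = (SOME r. \<exists>a b. s = {a, b} \<and> a \<noteq> b \<and> r = rot a b)" for s :: "'e set"
  have fin: "finite P" by (rule finite_subset[of _ "Pow Basis"]) (auto simp: P_def)
  have cardP: "card P = DIM('e) choose 2"
    unfolding P_def by (rule n_subsets) simp
  have rs: "rot a b \<in> span (g ` P)" if "a \<in> Basis" "b \<in> Basis" for a b :: 'e
  proof (cases "a = b")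
    case True then show ?thesis by (simp add: span_zero)
  next
    case False
    then have "\<exists>r. \<exists>a' b'. {a, b} = {a', b'} \<and> a' \<noteq> b' \<and> r = rot a' b'" by blast
    then have "\<exists>a' b'. {a, b} = {a', b'} \<and> a' \<noteq> b' \<and> g {a, b} = rot a' b'"
      unfolding g_def by (rule someI_ex)
    then have "g {a,b} = rot a b \<or> g {a,b} = rot b a" by (auto simp: doubleton_eq_iff)
    moreover have "g {a,b} \<in> span (g ` P)"
      using that False by (intro span_base imageI) (auto simp: P_def)
    ultimately show ?thesis using span_neg[of "g {a,b}" "g ` P"] rot_swap[of b a] by auto
  qed
  have "T \<subseteq> span (g ` P)"
  proof
    fix X assume "X \<in> T"
    then have "X = (\<Sum>a\<in>Basis. \<Sum>b\<in>Basis. ((X a \<bullet> b) / 2) *\<^sub>R rot a b)"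
      using assms(1) skew_eq_sum_rot by blast
    moreover have "\<dots> \<in> span (g ` P)" by (intro span_sum span_scale rs)
    ultimately show "X \<in> span (g ` P)" by simp
  qed
  then have "card T \<le> card (g ` P)"
    using independent_span_bound[of "g ` P" T] fin assms(2) by auto
  also have "\<dots> \<le> card P" by (rule card_image_le[OF fin])
  finally show ?thesis using cardP by simp
qed

section \<open>Dimension counts and orthogonal frames\<close>

lemma independent_Un_trivial_Int:
  fixes S T :: "'v::real_vector set"
  assumes "independent S" "independent T" "finite S" "finite T" "span S \<inter> span T \<subseteq> {0}"
  shows "independent (S \<union> T)" "S \<inter> T = {}"
proof -
  show disj: "S \<inter> T = {}"
  proof (rule ccontr)
    assume "S \<inter> T \<noteq> {}"
    then obtain x where x: "x \<in> S" "x \<in> T" by blast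
    then have "x = 0" using assms(5) span_base[of x S] span_base[of x T] by blast
    then show False using x assms(1) dependent_zero by blast
  qed
  have fin: "finite (S \<union> T)" using assms by simp
  show "independent (S \<union> T)"
    unfolding dependent_finite[OF fin]
  proof (rule notI, elim exE conjE bexE)
    fix u v assume v: "v \<in> S \<union> T" "u v \<noteq> 0" and s: "(\<Sum>v\<in>S \<union> T. u v *\<^sub>R v) = 0"
    have "(\<Sum>v\<in>S. u v *\<^sub>R v) + (\<Sum>v\<in>T. u v *\<^sub>R v) = 0"
      using s disj assms by (simp add: sum.union_disjoint)
    then have eq: "(\<Sum>v\<in>S. u v *\<^sub>R v) = - (\<Sum>v\<in>T. u v *\<^sub>R v)" by (simp add: eq_neg_iff_add_eq_0)
    have "(\<Sum>v\<in>S. u v *\<^sub>R v) \<in> span S" by (intro span_sum span_scale span_base)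
    moreover have "- (\<Sum>v\<in>T. u v *\<^sub>R v) \<in> span T" by (intro span_neg span_sum span_scale span_base)
    ultimately have z: "(\<Sum>v\<in>S. u v *\<^sub>R v) = 0" "(\<Sum>v\<in>T. u v *\<^sub>R v) = 0" using assms(5) eq by auto
    then show False using v assms dependent_finite[OF assms(3)] dependent_finite[OF assms(4)] by blast
  qed
qed

lemma unit_orthogonal_exists:
  fixes S :: "'e::euclidean_space set"
  assumes "finite S" "card S < DIM('e)"
  obtains e where "norm e = 1" "\<And>s. s \<in> S \<Longrightarrow> e \<bullet> s = 0"
proof -
  have "dim S < DIM('e)" using assms dim_le_card'[of S] by linarith
  then obtain x where x: "x \<noteq> 0" "\<And>y. y \<in> span S \<Longrightarrow> orthogonal x y"
    using orthogonal_to_subspace_exists by metis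
  show ?thesis
    by (rule that[of "x /\<^sub>R norm x"]) (use x span_base in \<open>auto simp: orthogonal_def\<close>)
qed

lemma orthogonal_to_orthonormal_frame:
  fixes S :: "'e::euclidean_space set"
  assumes "finite S" "card S = DIM('e)" "\<And>s t. s \<in> S \<Longrightarrow> t \<in> S \<Longrightarrow> s \<noteq> t \<Longrightarrow> s \<bullet> t = 0"
    "0 \<notin> S" "\<And>s. s \<in> S \<Longrightarrow> x \<bullet> s = 0"
  shows "x = 0"
proof -
  have "independent S"
    by (rule pairwise_orthogonal_independent) (use assms in \<open>auto simp: pairwise_def orthogonal_def\<close>)
  then have "span S = UNIV"
    by (metis assms(2) dim_eq_full dim_eq_card_independent)
  then have "x \<in> span S" by simp
  then have "orthogonal x x"
    using orthogonal_to_span[of x S x] assms(5) by (auto simp: orthogonal_def)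
  then show ?thesis by (simp add: orthogonal_def)
qed

text \<open>Two linear conditions cannot be injective in dimension three or more: otherwise the pair
  of inner products with \<open>a\<close> and \<open>b\<close> would embed \<open>V\<close> into a
  plane.\<close>

lemma subspace_orthogonal_pair:
  fixes V :: "'e::euclidean_space set"
  assumes "subspace V" "dim V \<ge> 3"
  obtains c where "c \<in> V" "c \<noteq> 0" "a \<bullet> c = 0" "b \<bullet> c = 0"
proof (rule ccontr)
  assume n: "\<not> thesis"
  let ?f = "\<lambda>c. (a \<bullet> c, b \<bullet> c)"
  have l: "linear ?f" by (rule linearI) (auto simp: inner_simps)
  have "inj_on ?f (span V)"
    unfolding span_eq_iff[THEN iffD2, OF assms(1)]
  proof (rule inj_onI)
    fix x y assume "x \<in> V" "y \<in> V" "?f x = ?f y"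
    then have "x - y \<in> V" "a \<bullet> (x - y) = 0" "b \<bullet> (x - y) = 0"
      using assms(1) by (auto simp: inner_simps subspace_diff)
    then show "x = y" using n that by (metis eq_iff_diff_eq_0)
  qed
  then have "dim (?f ` V) = dim V" by (rule dim_image_eq[OF l])
  moreover have "dim (?f ` V) \<le> DIM(real \<times> real)" by (rule dim_subset_UNIV)
  ultimately show False using assms(2) by simp
qed

lemma linear_rot_right: "linear (rot a)"
  by (rule linearI) (auto simp: rot_add_right rot_scale_right)

text \<open>The bound says that the dimension of \<open>G\<close> exceeds that of so(n-1), written
  without division. Adding the dimension n - 1 of a hyperplane then exceeds the dimension n(n-1)/2
  of all skew maps.\<close>

locale large_skew_algebra =
  fixes G :: "('e::euclidean_space \<Rightarrow> 'e) set"
  assumes subspace_G: "subspace G"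
    and G_skew: "G \<subseteq> skew_maps"
    and bracket_G: "X \<in> G \<Longrightarrow> Y \<in> G \<Longrightarrow> bracket X Y \<in> G"
    and large: "\<exists>B\<subseteq>G. finite B \<and> independent B \<and> (DIM('e) - 1) * (DIM('e) - 2) < 2 * card B"
    and dim_ge_2: "2 \<le> DIM('e)"
begin

lemmas G_add = subspace_add[OF subspace_G]
lemmas G_diff = subspace_diff[OF subspace_G]
lemmas G_scale = subspace_scale[OF subspace_G]
lemmas G_neg = subspace_neg[OF subspace_G]
lemmas G_0 = subspace_0[OF subspace_G]

lemma G_scale_cancel: "r \<noteq> 0 \<Longrightarrow> r *\<^sub>R X \<in> G \<Longrightarrow> X \<in> G"
  using G_scale[of "r *\<^sub>R X" "inverse r"] by simp

lemma bracket_rot_G: "X \<in> G \<Longrightarrow> rot a b \<in> G \<Longrightarrow> rot (X a) b + rot a (X b) \<in> G"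
  using bracket_G[of X "rot a b"] bracket_rot[of X a b] G_skew by auto

text \<open>Both spaces lie in the skew maps, whose dimension is too small for them to be independent.\<close>

lemma meets_hyperplane_image:
  fixes L :: "'e \<Rightarrow> 'e \<Rightarrow> 'e"
  assumes "y \<noteq> 0" "linear L"
    and inj: "\<And>u. y \<bullet> u = 0 \<Longrightarrow> L u = 0 \<Longrightarrow> u = 0"
    and skew: "\<And>u. y \<bullet> u = 0 \<Longrightarrow> L u \<in> skew_maps"
  obtains u where "u \<noteq> 0" "y \<bullet> u = 0" "L u \<in> G"
proof -
  let ?H = "{u. y \<bullet> u = 0}"
  obtain B where B: "B \<subseteq> G" "finite B" "independent B" "(DIM('e) - 1) * (DIM('e) - 2) < 2 * card B"
    using large by blast
  have sH: "subspace ?H" by (rule subspace_hyperplane)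
  obtain C where C: "C \<subseteq> ?H" "independent C" "?H \<subseteq> span C" "card C = dim ?H"
    using basis_exists[of ?H] by blast
  have spC: "span C = ?H" using C sH span_minimal by blast
  have finC: "finite C" using C(2) independent_imp_finite by blast
  have cC: "card C = DIM('e) - 1" using C(4) dim_hyperplane[OF assms(1)] by simp
  have injL: "inj_on L (span C)"
    unfolding spC
  proof (rule inj_onI)
    fix u v assume "u \<in> ?H" "v \<in> ?H" "L u = L v"
    then have "y \<bullet> (u - v) = 0" "L (u - v) = 0"
      using linear_diff[OF assms(2)] by (auto simp: inner_simps)
    then show "u = v" using inj by force
  qed
  have indL: "independent (L ` C)"
    by (rule linear_independent_injective_image[OF assms(2) C(2) injL])
  have injC: "inj_on L C" by (rule inj_on_subset[OF injL]) (simp add: span_superset)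
  have "\<not> span B \<inter> span (L ` C) \<subseteq> {0}"
  proof
    assume "span B \<inter> span (L ` C) \<subseteq> {0}"
    then have i: "independent (B \<union> L ` C)" "B \<inter> L ` C = {}"
      using independent_Un_trivial_Int[OF B(3) indL B(2)] finC by auto
    have "card (B \<union> L ` C) \<le> DIM('e) choose 2"
      by (rule independent_skew_card_le[OF _ i(1)]) (use B(1) G_skew C(1) skew in auto)
    moreover have "card (B \<union> L ` C) = card B + (DIM('e) - 1)"
      using i(2) B(2) finC cC card_image[OF injC] by (simp add: card_Un_disjoint)
    \<comment> \<open>The contradiction is numerical: (n-1)(n-2) + 2(n-1) = n(n-1), while
      \<open>B\<close> alone already exceeds the first summand.\<close>
    ultimately have "2 * card B + 2 * (DIM('e) - 1) \<le> 2 * (DIM('e) choose 2)" by linarith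
    moreover have "2 * (DIM('e) choose 2) = DIM('e) * (DIM('e) - 1)"
      unfolding choose_two by (rule dvd_mult_div_cancel) auto
    moreover have "DIM('e) * (DIM('e) - 1) = (DIM('e) - 1) * (DIM('e) - 2) + 2 * (DIM('e) - 1)"
    proof -
      obtain m where "DIM('e) = Suc (Suc m)" using dim_ge_2 by (metis add_2_eq_Suc le_Suc_ex)
      then show ?thesis by (simp add: algebra_simps)
    qed
    ultimately show False using B(4) by linarith
  qed
  then obtain X where X: "X \<in> span B" "X \<in> span (L ` C)" "X \<noteq> 0" by blast
  then obtain u where u: "u \<in> ?H" "X = L u"
    using linear_span_image[OF assms(2), of C] spC by auto
  have "X \<in> G" using X(1) B(1) subspace_G span_minimal by blast
  moreover have "u \<noteq> 0" using X(3) u linear_0[OF assms(2)] by auto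
  ultimately show ?thesis using that u by auto
qed

text \<open>For \<open>u\<close> orthogonal to \<open>y\<close>, the map \<open>rot y u\<close>
  sends \<open>y\<close> to \<open>(y \<bullet> y)\<close> times \<open>u\<close>, so
  \<open>rot y\<close> is injective on the hyperplane and its image meets \<open>G\<close>. Every
  vector thus lies in a plane whose rotation belongs to \<open>G\<close>.\<close>

lemma rot_in_G_exists:
  assumes "y \<noteq> 0"
  obtains v where "v \<noteq> 0" "y \<bullet> v = 0" "rot y v \<in> G"
proof (rule meets_hyperplane_image[OF assms linear_rot_right[of y]])
  fix u assume "y \<bullet> u = 0" "rot y u = 0"
  then have "rot y u y = 0" by (simp add: zero_fun_def)
  then show "u = 0" using \<open>y \<bullet> u = 0\<close> assms by (simp add: rot_def inner_commute)
qed (use rot_in_skew that in auto)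

text \<open>\<open>full V\<close> says that \<open>G\<close> contains so(V), each rotation being
  extended by zero to the orthogonal complement.\<close>

definition full :: "'e set \<Rightarrow> bool"
  where "full V \<longleftrightarrow> subspace V \<and> (\<forall>a\<in>V. \<forall>b\<in>V. rot a b \<in> G)"

text \<open>One rotation mixing \<open>V\<close> with the normal direction \<open>w\<close>
  suffices: for \<open>d'\<close> in \<open>V\<close> orthogonal to \<open>a\<close>, bracketing
  \<open>rot a w\<close> with \<open>rot d' a\<close> yields a multiple of
  \<open>rot d' w\<close>.\<close>

lemma full_insert:
  assumes V: "full V" and a: "a \<in> V" "a \<noteq> 0" and w: "\<And>v. v \<in> V \<Longrightarrow> v \<bullet> w = 0" and aw: "rot a w \<in> G"
  shows "full (span (insert w V))"
proof -
  have sV: "subspace V" and rV: "\<And>a b. a \<in> V \<Longrightarrow> b \<in> V \<Longrightarrow> rot a b \<in> G" using V by (auto simp: full_def)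
  have dw: "rot d w \<in> G" if "d \<in> V" for d
  proof -
    define d' where "d' = d - ((d \<bullet> a) / (a \<bullet> a)) *\<^sub>R a"
    have d': "d' \<in> V" "d' \<bullet> a = 0"
      using that a sV by (auto simp: d'_def subspace_diff subspace_scale inner_simps)
    have "rot (rot d' a a) w + rot a (rot d' a w) \<in> G"
      by (rule bracket_rot_G[OF rV aw]) (use d' a in auto)
    moreover have "rot d' a a = - ((a \<bullet> a) *\<^sub>R d')" "rot d' a w = 0"
      using d' a w by (auto simp: rot_def)
    ultimately have "(a \<bullet> a) *\<^sub>R rot d' w \<in> G"
      using G_neg[of "- ((a \<bullet> a) *\<^sub>R rot d' w)"] by (simp add: rot_minus rot_scale_left)
    then have "rot d' w \<in> G" by (rule G_scale_cancel[rotated]) (use a in simp)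
    moreover have "rot d w = rot d' w + ((d \<bullet> a) / (a \<bullet> a)) *\<^sub>R rot a w"
      unfolding rot_scale_left[symmetric] rot_add_left[symmetric] by (simp add: d'_def)
    ultimately show ?thesis using aw by (simp add: G_add G_scale)
  qed
  show ?thesis
    unfolding full_def
  proof (intro conjI ballI)
    fix x y assume "x \<in> span (insert w V)" "y \<in> span (insert w V)"
    then obtain k l where "x - k *\<^sub>R w \<in> span V" "y - l *\<^sub>R w \<in> span V"
      by (auto simp: span_insert)
    then have "x - k *\<^sub>R w \<in> V" "y - l *\<^sub>R w \<in> V"
      unfolding span_eq_iff[THEN iffD2, OF sV] .
    then obtain p q where p: "p \<in> V" "x = p + k *\<^sub>R w" and q: "q \<in> V" "y = q + l *\<^sub>R w"
      using that[of "x - k *\<^sub>R w" "y - l *\<^sub>R w"] by simp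
    have "rot x y = rot p q + l *\<^sub>R rot p w - k *\<^sub>R rot q w"
      unfolding p(2) q(2) rot_add_left rot_add_right rot_scale_left rot_scale_right
        rot_swap[where a = q and b = w] rot_self by simp
    then show "rot x y \<in> G" using p q rV dw by (simp add: G_add G_scale G_diff)
  qed (rule subspace_span)
qed

text \<open>A rotation in a plane through \<open>a + b\<close>, with \<open>a\<close> in
  \<open>V\<close> and \<open>b\<close> normal to \<open>V\<close>, is corrected by an element of
  so(V) to a map \<open>Z\<close> that carries \<open>V\<close> into its complement. If
  \<open>Z\<close> kills \<open>c\<close>, its bracket with \<open>rot c d\<close> is
  \<open>rot c (Z d)\<close>, which mixes \<open>V\<close> with a normal direction as
  \<open>full_insert\<close> requires.\<close>

lemma full_extend:
  assumes V: "full V" and dV: "dim V \<ge> 3" and nV: "V \<noteq> UNIV"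
  obtains V' where "full V'" "dim V < dim V'"
proof -
  have sV: "subspace V" and rV: "\<And>a b. a \<in> V \<Longrightarrow> b \<in> V \<Longrightarrow> rot a b \<in> G" using V by (auto simp: full_def)
  have spV: "span V = V" by (rule span_eq_iff[THEN iffD2, OF sV])
  note ext = that
  have ins: thesis if "a \<in> V" "a \<noteq> 0" "\<And>v. v \<in> V \<Longrightarrow> v \<bullet> w = 0" "w \<noteq> 0" "rot a w \<in> G" for a w
  proof -
    have "w \<notin> V" using that(3)[of w] that(4) by auto
    then have "w \<notin> span V" unfolding spV .
    then have "dim (span (insert w V)) = dim V + 1" by (simp add: dim_insert)
    then show thesis
      using ext[of "span (insert w V)"] full_insert[OF V that(1,2,3,5)] by linarith
  qed
  obtain b0 where b0: "b0 \<noteq> 0" "\<And>x. x \<in> V \<Longrightarrow> orthogonal b0 x"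
  proof -
    have "dim V \<noteq> DIM('e)" using nV spV dim_eq_full[of V] by metis
    then have "dim V < DIM('e)" using dim_subset_UNIV[of V] by linarith
    then obtain x where "x \<noteq> 0" "\<And>y. y \<in> span V \<Longrightarrow> orthogonal x y"
      using orthogonal_to_subspace_exists by metis
    then show ?thesis using that spV by blast
  qed
  define b where "b = b0 /\<^sub>R norm b0"
  have b: "b \<bullet> b = 1" "\<And>x. x \<in> V \<Longrightarrow> b \<bullet> x = 0"
    using b0 by (auto simp: b_def orthogonal_def norm_eq_sqrt_inner[symmetric] power2_norm_eq_inner[symmetric] field_simps power2_eq_square)
  obtain a0 where a0: "a0 \<in> V" "a0 \<noteq> 0"
    using subspace_orthogonal_pair[OF sV dV, of 0 0] by blast
  define a where "a = a0 /\<^sub>R norm a0"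
  have a: "a \<bullet> a = 1" "a \<in> V"
    using a0 sV by (auto simp: a_def subspace_scale power2_norm_eq_inner[symmetric] field_simps power2_eq_square)
  have "a + b \<noteq> 0"
  proof
    assume "a + b = 0"
    then have "(a + b) \<bullet> a = 0" by simp
    then show False using a b(2)[OF a(2)] by (simp add: inner_add_left)
  qed
  then obtain v where v: "v \<noteq> 0" "(a + b) \<bullet> v = 0" "rot (a + b) v \<in> G"
    by (rule rot_in_G_exists)
  obtain v1 v2 where v12: "v1 \<in> span V" "\<And>w. w \<in> span V \<Longrightarrow> orthogonal v2 w" "v = v1 + v2"
    using orthogonal_subspace_decomp_exists[of V v] by metis
  have v1: "v1 \<in> V" and v2: "\<And>w. w \<in> V \<Longrightarrow> v2 \<bullet> w = 0" using v12 spV by (auto simp: orthogonal_def)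
  have b': "x \<bullet> b = 0" and v2': "x \<bullet> v2 = 0" if "x \<in> V" for x
    using b(2)[OF that] v2[OF that] by (simp_all add: inner_commute)
  note orth = b(2) v2 b' v2'
  define Z where "Z = rot (a + b) v - rot a v1"
  have ZG: "Z \<in> G" unfolding Z_def using v(3) rV[OF a(2) v1] by (rule G_diff)
  define M where "M d = (a \<bullet> d) *\<^sub>R v2 - (v1 \<bullet> d) *\<^sub>R b" for d
  have Z: "Z d = M d" if "d \<in> V" for d
    using that by (simp add: Z_def v12(3) rot_def fun_diff_def M_def inner_simps orth algebra_simps)
  \<comment> \<open>Dimension three enters here: \<open>c\<close> is orthogonal to both vectors on
    which \<open>M\<close> depends, so \<open>Z c = 0\<close>.\<close>
  obtain c where c: "c \<in> V" "c \<noteq> 0" "a \<bullet> c = 0" "v1 \<bullet> c = 0"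
    using subspace_orthogonal_pair[OF sV dV] by blast
  have Mperp: "x \<bullet> M d = 0" if "x \<in> V" for d x
    using that orth by (simp add: M_def inner_simps)
  show thesis
  proof (cases "\<exists>d\<in>V. M d \<noteq> 0")
    case True
    then obtain d where d: "d \<in> V" "M d \<noteq> 0" by blast
    have "rot (Z c) d + rot c (Z d) \<in> G" by (rule bracket_rot_G[OF ZG rV]) (use c d in auto)
    moreover have "Z c = 0" "Z d = M d" using Z c d by (auto simp: M_def)
    ultimately show thesis using ins[OF c(1,2), of "M d"] Mperp d by simp
  next
    case False
    then have M0: "M d = 0" if "d \<in> V" for d using that by blast
    \<comment> \<open>If \<open>M\<close> vanishes on \<open>V\<close>, both components of
      \<open>v\<close> carry the same coefficient, so \<open>v\<close> is a multiple of
      \<open>a + b\<close>; but \<open>v\<close> is nonzero and orthogonal to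
      \<open>a + b\<close>.\<close>
    have e1: "v2 = (v1 \<bullet> a) *\<^sub>R b" using M0[OF a(2)] a by (simp add: M_def)
    define d where "d = v1 - (v1 \<bullet> a) *\<^sub>R a"
    have d: "d \<in> V" "a \<bullet> d = 0" "v1 \<bullet> d = d \<bullet> d"
      using sV v1 a by (auto simp: d_def subspace_diff subspace_scale inner_simps inner_commute algebra_simps)
    have "(v1 \<bullet> d) *\<^sub>R b = 0" using M0[OF d(1)] d by (simp add: M_def)
    then have "d = 0" using d b by auto
    then have e2: "v1 = (v1 \<bullet> a) *\<^sub>R a" by (simp add: d_def)
    have vv: "v = (v1 \<bullet> a) *\<^sub>R (a + b)"
      using arg_cong2[OF e2 e1, of "(+)"] v12(3) by (simp add: scaleR_add_right)
    moreover have "(a + b) \<bullet> (a + b) \<noteq> 0" using \<open>a + b \<noteq> 0\<close> by simp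
    moreover note v(2)
    ultimately have "v1 \<bullet> a = 0" by (metis inner_scaleR_right mult_eq_0_iff)
    then show thesis using v(1) vv by simp
  qed
qed

lemma full_UNIV_if_dim_ge_3:
  assumes "full V" "dim V \<ge> 3"
  shows "full UNIV"
proof -
  let ?P = "\<lambda>k. \<exists>V. full V \<and> dim V \<ge> 3 \<and> dim V = k"
  have "\<exists>k. ?P k \<and> (\<forall>j. ?P j \<longrightarrow> j \<le> k)"
    by (rule Nat.ex_has_greatest_nat[of ?P "dim V" "DIM('e)"])
      (use assms dim_subset_UNIV in auto)
  then obtain V' where V': "full V'" "dim V' \<ge> 3" "\<And>W. full W \<Longrightarrow> dim W \<ge> 3 \<Longrightarrow> dim W \<le> dim V'"
    by blast
  show ?thesis
  proof (cases "V' = UNIV")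
    case False
    then obtain W where "full W" "dim V' < dim W" using full_extend[OF V'(1,2)] by blast
    then show ?thesis using V'(2) V'(3)[of W] by linarith
  qed (use V' in simp)
qed

lemma rotation_if_full_UNIV:
  assumes "full UNIV" "norm y = 1" "norm u = 1" "y \<bullet> u = 0"
  shows "\<exists>B\<in>G. B y = u \<and> B u = - y"
  using assms by (intro bexI[of _ "rot y u"]) (simp_all add: full_def, simp add: rot_def inner_commute norm_eq_1)

text \<open>The vectors \<open>y\<close>, \<open>I y\<close>, \<open>J y\<close>, \<open>K y\<close>
  form an orthonormal basis, so \<open>u\<close> is a unit combination of the last three. The same
  combination of \<open>I\<close>, \<open>J\<close>, \<open>K\<close> sends \<open>y\<close> to
  \<open>u\<close>, and its square is minus the identity because the mixed terms cancel by
  anticommutation.\<close>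

lemma rotation_if_quaternionic:
  assumes IG: "I \<in> G" "J \<in> G" "K \<in> G"
    and sq: "\<And>x. I (I x) = - x" "\<And>x. J (J x) = - x" "\<And>x. K (K x) = - x"
    and anti: "\<And>x. I (J x) = - J (I x)" "\<And>x. J (K x) = - K (J x)" "\<And>x. I (K x) = - K (I x)"
    and dim4: "DIM('e) = 4" and yu: "norm y = 1" "norm u = 1" "y \<bullet> u = 0"
  shows "\<exists>B\<in>G. B y = u \<and> B u = - y"
proof -
  have sk: "X x \<bullet> z = - (x \<bullet> X z)" "linear X" if "X \<in> G" for X x z
    using skew_mapsD[of X] G_skew that by auto
  have y1: "y \<bullet> y = 1" "u \<bullet> u = 1" using yu by (auto simp: norm_eq_1)
  have z: "X y \<bullet> y = 0" "y \<bullet> X y = 0" if "X \<in> G" for X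
    using sk(1)[OF that, of y y] by (simp_all add: inner_commute)
  have unit: "X y \<bullet> X y = 1" if "X \<in> G" "X (X y) = - y" for X
    using sk(1)[OF that(1), of y "X y"] that(2) y1 by simp
  have orth: "X y \<bullet> Y y = 0" if "X \<in> G" "Y \<in> G" "X (Y y) = - Y (X y)" for X Y
  proof -
    have "X y \<bullet> Y y = y \<bullet> Y (X y)" using sk(1)[OF that(1), of y "Y y"] that(3) by simp
    moreover have "Y y \<bullet> X y = - (y \<bullet> Y (X y))" using sk(1)[OF that(2), of y "X y"] .
    ultimately show ?thesis by (simp add: inner_commute)
  qed
  note o = orth[OF IG(1,2) anti(1)] orth[OF IG(2,3) anti(2)] orth[OF IG(1,3) anti(3)]
  note o' = o[THEN trans[OF inner_commute]]
  note zs = z[OF IG(1)] z[OF IG(2)] z[OF IG(3)]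
  note us = unit[OF IG(1) sq(1)] unit[OF IG(2) sq(2)] unit[OF IG(3) sq(3)]
  have une: "p \<noteq> q" if "p \<bullet> p = 1" "p \<bullet> q = 0" for p q :: 'e using that by auto
  define i j k where "i = u \<bullet> I y" and "j = u \<bullet> J y" and "k = u \<bullet> K y"
  have "u - (i *\<^sub>R I y + j *\<^sub>R J y + k *\<^sub>R K y) = 0"
  proof (rule orthogonal_to_orthonormal_frame[of "{y, I y, J y, K y}"])
    have ne: "y \<noteq> I y" "y \<noteq> J y" "y \<noteq> K y" "I y \<noteq> J y" "I y \<noteq> K y" "J y \<noteq> K y"
      using une[OF y1(1) zs(2)] une[OF y1(1) zs(4)] une[OF y1(1) zs(6)]
        une[OF us(1) o(1)] une[OF us(1) o(3)] une[OF us(2) o(2)] .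
    then show "card {y, I y, J y, K y} = DIM('e)" using dim4 by simp
    show "0 \<notin> {y, I y, J y, K y}" using y1 us by force
    show "s \<bullet> t = 0" if "s \<in> {y, I y, J y, K y}" "t \<in> {y, I y, J y, K y}" "s \<noteq> t" for s t
      using that zs o o' by auto
    show "(u - (i *\<^sub>R I y + j *\<^sub>R J y + k *\<^sub>R K y)) \<bullet> s = 0" if "s \<in> {y, I y, J y, K y}" for s
      using that zs o o' us yu(3) by (auto simp: inner_simps i_def j_def k_def inner_commute[of u y])
  qed simp
  then have u: "u = i *\<^sub>R I y + j *\<^sub>R J y + k *\<^sub>R K y" by simp
  have ijk: "i * i + j * j + k * k = 1"
  proof -
    have "u \<bullet> u = u \<bullet> (i *\<^sub>R I y + j *\<^sub>R J y + k *\<^sub>R K y)" using u by simp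
    then show ?thesis using y1 by (simp add: inner_simps i_def j_def k_def)
  qed
  define B where "B = i *\<^sub>R I + j *\<^sub>R J + k *\<^sub>R K"
  have BG: "B \<in> G" unfolding B_def by (intro G_add G_scale IG)
  have Bx: "B x = i *\<^sub>R I x + j *\<^sub>R J x + k *\<^sub>R K x" for x by (simp add: B_def fun_vs)
  have "B (B y) = - ((i * i + j * j + k * k) *\<^sub>R y)"
    using sk(2)[OF IG(1)] sk(2)[OF IG(2)] sk(2)[OF IG(3)]
    by (simp add: Bx linear_add linear_scale sq anti scaleR_add_right scaleR_add_left algebra_simps)
  then show ?thesis using BG Bx[of y] u ijk by (intro bexI[of _ B]) auto
qed

text \<open>If some pair is not rotated, no \<open>full\<close> subspace has dimension three or
  more. This leaves only dimensions two to four: in dimension two a \<open>full\<close> plane is the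
  whole space, dimension three contradicts \<open>caseA\<close>, and in dimension four
  \<open>G\<close> is forced to contain a quaternionic triple, as u(2) does.\<close>

theorem rotation_exists:
  assumes yu: "norm y = 1" "norm u = 1" "y \<bullet> u = 0"
  shows "\<exists>B\<in>G. B y = u \<and> B u = - y"
proof (rule ccontr)
  assume contra: "\<not> ?thesis"
  have no3: "\<not> (full V \<and> dim V \<ge> 3)" for V
    using full_UNIV_if_dim_ge_3 rotation_if_full_UNIV[OF _ yu] contra by blast
  obtain a :: 'e where a1: "norm a = 1" using vector_choose_size[of 1] by auto
  have "a \<noteq> 0" using a1 by (metis norm_zero zero_neq_one)
  then obtain c0 where c0: "c0 \<noteq> 0" "a \<bullet> c0 = 0" "rot a c0 \<in> G" by (rule rot_in_G_exists)
  define c where "c = c0 /\<^sub>R norm c0"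
  have acG: "rot a c \<in> G" using c0 by (simp add: c_def rot_scale_right G_scale)
  have c1: "norm c = 1" using c0 by (simp add: c_def)
  have ac: "a \<bullet> c = 0" "c \<bullet> a = 0" using c0 by (auto simp: c_def inner_commute)
  have aa: "a \<bullet> a = 1" "c \<bullet> c = 1" using a1 c1 by (auto simp: norm_eq_1)
  define V where "V = span {a, c}"
  have sV: "subspace V" by (simp add: V_def)
  have aV: "a \<in> V" "c \<in> V" by (auto simp: V_def span_base)
  have Vex: "\<exists>s t. x = s *\<^sub>R a + t *\<^sub>R c" if "x \<in> V" for x
  proof -
    have "\<exists>s t. x - s *\<^sub>R a - t *\<^sub>R c \<in> span {}"
      using that unfolding V_def span_breakdown_eq .
    then have "\<exists>s t. x - s *\<^sub>R a - t *\<^sub>R c = 0" by simp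
    then obtain s t where "x - s *\<^sub>R a - t *\<^sub>R c = 0" by (elim exE)
    then have "x = s *\<^sub>R a + t *\<^sub>R c" by (simp add: algebra_simps)
    then show ?thesis by (intro exI)
  qed
  have fullV: "full V" unfolding full_def
  proof (intro conjI ballI sV)
    fix x y assume "x \<in> V" "y \<in> V"
    then obtain s t s' t' where x: "x = s *\<^sub>R a + t *\<^sub>R c" and y: "y = s' *\<^sub>R a + t' *\<^sub>R c"
      using Vex by meson
    have "rot x y = (s * t' - t * s') *\<^sub>R rot a c"
      unfolding x y rot_add_left rot_add_right rot_scale_left rot_scale_right
        rot_swap[where a = c and b = a] rot_self by (simp add: algebra_simps)
    then show "rot x y \<in> G" using acG G_scale by simp
  qed
  have ne: "a \<noteq> 0" "c \<noteq> 0" "a \<noteq> c" using a1 c1 ac aa by auto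
  have indac: "independent {a, c}"
    by (rule pairwise_orthogonal_independent) (use ne ac in \<open>auto simp: pairwise_def orthogonal_def\<close>)
  have dimV: "dim V = 2" unfolding V_def dim_span using dim_eq_card_independent[OF indac] ne by simp
  define P where "P = {w. a \<bullet> w = 0 \<and> c \<bullet> w = 0}"
  have sP: "subspace P" by (auto simp: P_def subspace_def inner_simps)
  have Pin: "a \<bullet> w = 0" "c \<bullet> w = 0" "w \<bullet> a = 0" "w \<bullet> c = 0" if "w \<in> P" for w
    using that by (simp_all add: P_def inner_commute)
  have PV: "v \<bullet> w = 0" if "v \<in> V" "w \<in> P" for v w
    using Vex[OF that(1)] that(2) by (auto simp: P_def inner_simps)
  text \<open>A rotation in a plane meeting \<open>V\<close> in a line would enlarge \<open>V\<close>.\<close>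
  have caseA: "w = 0" if "p \<in> V" "p \<noteq> 0" "w \<in> P" "rot p w \<in> G" for p w
  proof (rule ccontr)
    assume "w \<noteq> 0"
    have "w \<notin> span V"
      unfolding span_eq_iff[THEN iffD2, OF sV] using PV[of w w] that(3) \<open>w \<noteq> 0\<close> by auto
    then have "dim (span (insert w V)) = 3" using dimV by (simp add: dim_insert)
    then show False using full_insert[OF fullV that(1,2) PV[OF _ that(3)] that(4)] no3[of "span (insert w V)"] by simp
  qed
  have Pexists: "\<exists>e\<in>P. norm e = 1 \<and> (\<forall>s\<in>S. s \<bullet> e = 0)" if "finite S" "card S + 2 < DIM('e)" for S
  proof -
    have "card ({a, c} \<union> S) < DIM('e)"
      using card_Un_le[of "{a,c}" S] ne that by simp
    moreover have "finite ({a, c} \<union> S)" using that(1) by simp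
    ultimately obtain e where "norm e = 1" "\<And>s. s \<in> {a, c} \<union> S \<Longrightarrow> e \<bullet> s = 0"
      using unit_orthogonal_exists by metis
    then show ?thesis by (intro bexI[of _ e]) (auto simp: P_def inner_commute)
  qed
  \<comment> \<open>If \<open>rot w x\<close> were missing, \<open>L\<close> would be injective on
    the hyperplane orthogonal to \<open>a\<close>, and \<open>G\<close> would meet its image.
    Bracketing twice with \<open>rot a c\<close> kills the part with \<open>rot w x\<close> and
    isolates \<open>- rot a v'\<close>, so \<open>caseA\<close> gives \<open>v' = 0\<close>; what
    remains is a nonzero multiple of \<open>rot w x\<close>.\<close>
  have Pfull: "rot w x \<in> G" if "w \<in> P" "x \<in> P" for w x
  proof (rule ccontr)
    assume nG: "rot w x \<notin> G"
    then have rn: "rot w x \<noteq> 0" using G_0 by metis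
    define L where "L v = (c \<bullet> v) *\<^sub>R rot w x + rot a (v - (c \<bullet> v) *\<^sub>R c)" for v
    have linL: "linear L"
      by (rule linearI) (auto simp: L_def fun_eq_iff fun_vs rot_def inner_simps algebra_simps)
    have inj: "v = 0" if "a \<bullet> v = 0" "L v = 0" for v
    proof -
      have "L v a = 0" using that(2) by (simp add: zero_fun_def)
      then have v: "v = (c \<bullet> v) *\<^sub>R c"
        using that(1) Pin[OF \<open>w \<in> P\<close>] Pin[OF \<open>x \<in> P\<close>] aa ac
        by (simp add: L_def fun_vs rot_def inner_simps inner_commute[of v a])
      then have "L v = (c \<bullet> v) *\<^sub>R rot w x" by (simp add: L_def)
      then have "c \<bullet> v = 0" using that(2) rn by simp
      then show ?thesis using v by simp
    qed
    have "L v \<in> skew_maps" for v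
      using rot_in_skew[of w x] rot_in_skew[of a "v - (c \<bullet> v) *\<^sub>R c"]
      by (simp add: L_def skew_maps_def fun_vs linear_compose_add linear_compose_scale_right inner_simps)
    then obtain v where v: "v \<noteq> 0" "a \<bullet> v = 0" "L v \<in> G"
      using meets_hyperplane_image[OF \<open>a \<noteq> 0\<close> linL inj] by blast
    define v' where "v' = v - (c \<bullet> v) *\<^sub>R c"
    have v'P: "v' \<in> P" using v aa ac by (simp add: v'_def P_def inner_simps)
    have L: "L v = (c \<bullet> v) *\<^sub>R rot w x + rot a v'" by (simp add: L_def v'_def)
    have b1: "bracket (rot a c) (L v) = rot c v'"
      using Pin[OF v'P] Pin[OF \<open>w \<in> P\<close>] Pin[OF \<open>x \<in> P\<close>] ac aa
      by (simp add: L bracket_def fun_eq_iff fun_vs rot_def inner_simps algebra_simps)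
    have b2: "bracket (rot a c) (rot c v') = - rot a v'"
      using Pin[OF v'P] ac aa
      by (simp add: bracket_def fun_eq_iff fun_vs rot_def inner_simps algebra_simps)
    have "- rot a v' \<in> G" using bracket_G[OF acG bracket_G[OF acG v(3)]] b1 b2 by simp
    then have avG: "rot a v' \<in> G" using G_neg by fastforce
    then have "v' = 0" using caseA[OF aV(1) ne(1) v'P] by blast
    then have "v = (c \<bullet> v) *\<^sub>R c" "L v = (c \<bullet> v) *\<^sub>R rot w x" using L by (auto simp: v'_def)
    then have "c \<bullet> v \<noteq> 0" using v(1) by force
    then show False using G_scale_cancel[of "c \<bullet> v"] v(3) \<open>L v = (c \<bullet> v) *\<^sub>R rot w x\<close> nG by simp
  qed
  \<comment> \<open>From dimension five on, the complement \<open>P\<close> contains three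
    orthonormal vectors and is itself \<open>full\<close>, which \<open>no3\<close>
    excludes.\<close>
  have d4: "DIM('e) \<le> 4"
  proof (rule ccontr)
    assume d: "\<not> DIM('e) \<le> 4"
    obtain e1 where e1: "e1 \<in> P" "norm e1 = 1" using Pexists[of "{}"] d by auto
    obtain e2 where e2: "e2 \<in> P" "norm e2 = 1" "e1 \<bullet> e2 = 0" using Pexists[of "{e1}"] d by auto
    have "card {e1, e2} \<le> 2" by (simp add: card_insert_if)
    then obtain e3 where e3: "e3 \<in> P" "norm e3 = 1" "e1 \<bullet> e3 = 0" "e2 \<bullet> e3 = 0"
      using Pexists[of "{e1, e2}"] d by auto
    have "full P" using sP Pfull by (auto simp: full_def)
    have ne: "e1 \<noteq> e2" "e1 \<noteq> e3" "e2 \<noteq> e3" "e1 \<noteq> 0" "e2 \<noteq> 0" "e3 \<noteq> 0"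
      using e1 e2 e3 by (auto simp: norm_eq_1)
    have "independent {e1, e2, e3}"
      by (rule pairwise_orthogonal_independent)
        (use ne e2 e3 in \<open>auto simp: pairwise_def orthogonal_def inner_commute\<close>)
    then have "card {e1, e2, e3} \<le> dim P" by (rule independent_card_le_dim[rotated]) (use e1 e2 e3 in auto)
    then show False using no3[of P] \<open>full P\<close> ne by auto
  qed
  consider "DIM('e) = 2" | "DIM('e) = 3" | "DIM('e) = 4" using d4 dim_ge_2 by linarith
  then show False
  proof cases
    case 1
    then have "V = UNIV" using dimV dim_eq_full[of V] span_eq_iff[THEN iffD2, OF sV] by auto
    then show False using fullV rotation_if_full_UNIV[OF _ yu] contra by auto
  next
    case 2
    then obtain e where e: "e \<in> P" "norm e = 1" using Pexists[of "{}"] by auto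
    have ee: "e \<bullet> e = 1" "e \<noteq> 0" using e by (auto simp: norm_eq_1)
    \<comment> \<open>In dimension three, a rotation plane through the normal \<open>e\<close> of
      \<open>V\<close> meets \<open>V\<close> in a line, which \<open>caseA\<close> forbids.\<close>
    have "linear (\<lambda>v. rot v e)" by (rule linearI) (auto simp: rot_add_left rot_scale_left)
    then obtain v where v: "v \<noteq> 0" "e \<bullet> v = 0" "rot v e \<in> G"
    proof (rule meets_hyperplane_image[OF ee(2)])
      fix u assume "e \<bullet> u = 0" "rot u e = 0"
      then have "rot u e e = 0" by (simp add: zero_fun_def)
      then show "u = 0" using \<open>e \<bullet> u = 0\<close> ee by (simp add: rot_def inner_commute)
    qed (use rot_in_skew in auto)
    have "v - (a \<bullet> v) *\<^sub>R a - (c \<bullet> v) *\<^sub>R c = 0"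
    proof (rule orthogonal_to_orthonormal_frame[of "{a, c, e}"])
      have "a \<noteq> e" "c \<noteq> e" using e aa by (auto simp: P_def)
      then show "card {a, c, e} = DIM('e)" using 2 ne by simp
    qed (use e ne ee ac aa v in \<open>auto simp: P_def inner_simps inner_commute\<close>)
    then have "v = (a \<bullet> v) *\<^sub>R a + (c \<bullet> v) *\<^sub>R c" by (simp add: algebra_simps)
    then have "v \<in> V" using sV aV by (metis subspace_add subspace_scale)
    then show False using caseA[OF _ v(1) e(1) v(3)] ee by simp
  next
    case 3
    obtain e1 where e1: "e1 \<in> P" "norm e1 = 1" using Pexists[of "{}"] 3 by auto
    obtain e2 where e2: "e2 \<in> P" "norm e2 = 1" "e1 \<bullet> e2 = 0" using Pexists[of "{e1}"] 3 by auto
    have orth: "a \<bullet> e1 = 0" "c \<bullet> e1 = 0" "a \<bullet> e2 = 0" "c \<bullet> e2 = 0" "e1 \<bullet> e2 = 0"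
      "e1 \<bullet> a = 0" "e1 \<bullet> c = 0" "e2 \<bullet> a = 0" "e2 \<bullet> c = 0" "e2 \<bullet> e1 = 0"
      using e1 e2 by (auto simp: P_def inner_commute)
    have un: "e1 \<bullet> e1 = 1" "e2 \<bullet> e2 = 1" using e1 e2 by (auto simp: norm_eq_1)
    have dec: "x = (a \<bullet> x) *\<^sub>R a + (c \<bullet> x) *\<^sub>R c + (e1 \<bullet> x) *\<^sub>R e1 + (e2 \<bullet> x) *\<^sub>R e2" for x
    proof -
      have "x - ((a \<bullet> x) *\<^sub>R a + (c \<bullet> x) *\<^sub>R c + (e1 \<bullet> x) *\<^sub>R e1 + (e2 \<bullet> x) *\<^sub>R e2) = 0"
      proof (rule orthogonal_to_orthonormal_frame[of "{a, c, e1, e2}"])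
        have "a \<noteq> e1" "a \<noteq> e2" "c \<noteq> e1" "c \<noteq> e2" "e1 \<noteq> e2" using orth un aa by auto
        then show "card {a, c, e1, e2} = DIM('e)" using 3 ne by simp
        show "0 \<notin> {a, c, e1, e2}" using un aa by auto
        fix s t assume "s \<in> {a, c, e1, e2}" "t \<in> {a, c, e1, e2}" "s \<noteq> t"
        then show "s \<bullet> t = 0" using orth ac by auto
      next
        fix s assume "s \<in> {a, c, e1, e2}"
        then show "(x - ((a \<bullet> x) *\<^sub>R a + (c \<bullet> x) *\<^sub>R c + (e1 \<bullet> x) *\<^sub>R e1 + (e2 \<bullet> x) *\<^sub>R e2)) \<bullet> s = 0"
          using orth ac un aa by (auto simp: inner_simps inner_commute[of x])
      qed simp
      then show ?thesis by simp
    qed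
    have decP: "x = (e1 \<bullet> x) *\<^sub>R e1 + (e2 \<bullet> x) *\<^sub>R e2" if "x \<in> P" for x
      using dec[of x] that by (simp add: P_def)
    \<comment> \<open>The same dimension count with \<open>rot c e1\<close> as the extra direction.
      In the element found, the coefficient of \<open>rot c e1\<close> is nonzero by
      \<open>caseA\<close> and is normalised to one in \<open>X\<close>.\<close>
    define L where "L v = rot a (v - (c \<bullet> v) *\<^sub>R c) + (c \<bullet> v) *\<^sub>R rot c e1" for v
    have linL: "linear L"
      by (rule linearI) (auto simp: L_def fun_eq_iff fun_vs rot_def inner_simps algebra_simps)
    have inj: "v = 0" if "a \<bullet> v = 0" "L v = 0" for v
    proof -
      have "L v a = 0" "L v c = 0" using that(2) by (simp_all add: zero_fun_def)
      then have "v - (c \<bullet> v) *\<^sub>R c = 0" "(c \<bullet> v) *\<^sub>R e1 = 0"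
        using that(1) aa ac orth
        by (simp_all add: L_def fun_vs rot_def inner_simps inner_commute[of v a] inner_commute[of v c])
      then show ?thesis using un by force
    qed
    have "L v \<in> skew_maps" for v
      using rot_in_skew[of c e1] rot_in_skew[of a "v - (c \<bullet> v) *\<^sub>R c"]
      by (simp add: L_def skew_maps_def fun_vs linear_compose_add linear_compose_scale_right inner_simps)
    then obtain v where v: "v \<noteq> 0" "a \<bullet> v = 0" "L v \<in> G"
      using meets_hyperplane_image[OF \<open>a \<noteq> 0\<close> linL inj] by blast
    define v' where "v' = v - (c \<bullet> v) *\<^sub>R c"
    have v'P: "v' \<in> P" using v aa ac by (simp add: v'_def P_def inner_simps)
    have cv: "c \<bullet> v \<noteq> 0"
    proof
      assume "c \<bullet> v = 0"
      then have "rot a v \<in> G" "v \<in> P" using v by (auto simp: L_def P_def)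
      then show False using caseA[OF aV(1) ne(1)] v(1) by blast
    qed
    define \<alpha> \<beta> where "\<alpha> = (e1 \<bullet> v') / (c \<bullet> v)" and "\<beta> = (e2 \<bullet> v') / (c \<bullet> v)"
    define X where "X = \<alpha> *\<^sub>R rot a e1 + \<beta> *\<^sub>R rot a e2 + rot c e1"
    have "L v = (c \<bullet> v) *\<^sub>R X"
      unfolding L_def v'_def[symmetric] X_def \<alpha>_def \<beta>_def
      by (subst decP[OF v'P]) (use cv in \<open>simp add: rot_add_right rot_scale_right scaleR_add_right\<close>)
    then have XG: "X \<in> G" using v(3) cv G_scale_cancel by metis
    have rG: "rot e1 e2 \<in> G" using Pfull e1 e2 by blast
    define Z where "Z = \<alpha> *\<^sub>R rot a e2 - \<beta> *\<^sub>R rot a e1 + rot c e2"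
    have "bracket (rot e1 e2) X = Z"
      using orth un ac aa by (simp add: X_def Z_def bracket_def fun_eq_iff fun_vs rot_def inner_simps algebra_simps)
    then have ZG: "Z \<in> G" using bracket_G[OF rG XG] by simp
    define Y where "Y = \<alpha> *\<^sub>R rot c e1 + \<beta> *\<^sub>R rot c e2 - rot a e1"
    have "bracket (rot a c) X = Y"
      using orth un ac aa by (simp add: X_def Y_def bracket_def fun_eq_iff fun_vs rot_def inner_simps algebra_simps)
    then have YG: "Y \<in> G" using bracket_G[OF acG XG] by simp
    \<comment> \<open>In the combination of \<open>Y\<close>, \<open>X\<close> and \<open>Z\<close>
      below all terms with \<open>c\<close> cancel, leaving a rotation that mixes \<open>a\<close>
      with \<open>P\<close>. By \<open>caseA\<close> its vector \<open>q\<close> is zero, which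
      forces \<open>\<alpha> = 0\<close> and \<open>\<beta> * \<beta> = 1\<close>.\<close>
    define q where "q = (\<beta> * \<beta> - \<alpha> * \<alpha> - 1) *\<^sub>R e1 - (\<alpha> * \<beta>) *\<^sub>R e2 - (\<alpha> * \<beta>) *\<^sub>R e2"
    have "Y - \<alpha> *\<^sub>R X - \<beta> *\<^sub>R Z = rot a q"
      by (simp add: X_def Y_def Z_def q_def fun_eq_iff fun_vs rot_def inner_simps algebra_simps)
        (simp add: algebra_simps flip: scaleR_add_left)
    then have "rot a q \<in> G" using XG YG ZG by (metis G_diff G_scale)
    moreover have "q \<in> P" using sP e1 e2 by (simp add: q_def subspace_diff subspace_scale)
    ultimately have "q = 0" using caseA[OF aV(1) ne(1)] by blast
    then have "e1 \<bullet> q = 0" "e2 \<bullet> q = 0" by auto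
    then have "\<beta> * \<beta> - \<alpha> * \<alpha> - 1 = 0" "2 * \<alpha> * \<beta> = 0" using orth un by (simp_all add: q_def inner_simps)
    then have \<alpha>\<beta>: "\<alpha> = 0" "\<beta> * \<beta> = 1" by auto
      (smt (verit) not_square_less_zero)+
    \<comment> \<open>Replacing \<open>e2\<close> by \<open>f\<close> absorbs the sign \<beta>. Then
      \<open>X\<close> is \<open>J\<close>, \<open>Z\<close> is \<open>K\<close> up to the sign, and
      \<open>I\<close> adds up the rotations of \<open>V\<close> and of \<open>P\<close>.\<close>
    define f where "f = \<beta> *\<^sub>R e2"
    have e2f: "e2 = \<beta> *\<^sub>R f" using \<alpha>\<beta> by (simp add: f_def)
    have orthf: "a \<bullet> f = 0" "c \<bullet> f = 0" "f \<bullet> a = 0" "f \<bullet> c = 0" "e1 \<bullet> f = 0" "f \<bullet> e1 = 0" "f \<bullet> f = 1"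
      using orth un \<alpha>\<beta> by (auto simp: f_def)
    have decf: "x = (a \<bullet> x) *\<^sub>R a + (c \<bullet> x) *\<^sub>R c + (e1 \<bullet> x) *\<^sub>R e1 + (f \<bullet> x) *\<^sub>R f" for x
    proof -
      have "\<beta> * (e2 \<bullet> x) * \<beta> = e2 \<bullet> x" using \<alpha>\<beta>(2) by (metis mult.assoc mult.commute mult_1)
      then have "(f \<bullet> x) *\<^sub>R f = (e2 \<bullet> x) *\<^sub>R e2" unfolding f_def by (simp add: mult.commute)
      then show ?thesis using dec[of x] by argo
    qed
    define I J K where "I = rot a c + rot e1 f" and "J = rot a f + rot c e1" and "K = rot c f - rot a e1"
    have "J = X" using \<alpha>\<beta> by (simp add: J_def X_def f_def rot_scale_right)
    moreover have "K = \<beta> *\<^sub>R Z"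
      using \<alpha>\<beta> by (simp add: K_def Z_def f_def rot_scale_right scaleR_diff_right scaleR_add_right)
    moreover have "rot e1 f \<in> G" using rG by (simp add: f_def rot_scale_right G_scale)
    ultimately have IJK: "I \<in> G" "J \<in> G" "K \<in> G" using XG ZG acG by (auto simp: I_def G_add G_scale)
    note sim = I_def J_def K_def fun_vs rot_def inner_simps orth orthf ac aa un
    have neg: "z = - x" if "z = - ((a \<bullet> x) *\<^sub>R a + (c \<bullet> x) *\<^sub>R c + (e1 \<bullet> x) *\<^sub>R e1 + (f \<bullet> x) *\<^sub>R f)" for x z
      using that decf[of x] by simp
    have "I (I x) = - x" "J (J x) = - x" "K (K x) = - x" for x
      by (rule neg, simp add: sim algebra_simps)+
    moreover have "I (J x) = - J (I x)" "J (K x) = - K (J x)" "I (K x) = - K (I x)" for x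
      by (simp_all add: sim algebra_simps)
    ultimately show False
      using rotation_if_quaternionic[OF IJK _ _ _ _ _ _ 3 yu] contra by blast
  qed
qed

end

subsection \<open>Invariant inner products\<close>

definition lin_exp :: "('e::euclidean_space \<Rightarrow> 'e) \<Rightarrow> real \<Rightarrow> 'e \<Rightarrow> 'e"
  where "lin_exp B t y = (\<Sum>n. (t ^ n / fact n) *\<^sub>R (B ^^ n) y)"

lemma linear_funpow: "linear B \<Longrightarrow> linear (B ^^ n)" for B :: "'e::real_vector \<Rightarrow> 'e"
proof (induction n)
  case 0 then show ?case by (simp add: linear_id[unfolded id_def] id_def)
next
  case (Suc n) then show ?case using linear_compose[of "B ^^ n" B] by (simp add: o_def)
qed

lemma summable_lin_exp:
  fixes B :: "'e::euclidean_space \<Rightarrow> 'e"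
  assumes "linear B"
  shows "summable (\<lambda>n. (t ^ n / fact n) *\<^sub>R (B ^^ n) y)"
proof -
  obtain K where K: "K > 0" "\<And>x. norm (B x) \<le> K * norm x"
    using linear_bounded_pos[OF assms] by (metis mult.commute)
  have b: "norm ((B ^^ n) y) \<le> K ^ n * norm y" for n
  proof (induction n)
    case (Suc n)
    have "norm ((B ^^ Suc n) y) \<le> K * norm ((B ^^ n) y)" using K(2) by simp
    also have "\<dots> \<le> K * (K ^ n * norm y)" using Suc K(1) by (intro mult_left_mono) auto
    finally show ?case by (simp add: mult_ac)
  qed simp
  have "summable (\<lambda>n. inverse (fact n) * (\<bar>t\<bar> * K) ^ n * norm y)"
    by (intro summable_mult2 summable_exp)
  then show ?thesis
  proof (rule summable_comparison_test')
    fix n :: nat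
    have "norm ((t ^ n / fact n) *\<^sub>R (B ^^ n) y) = (\<bar>t\<bar> ^ n / fact n) * norm ((B ^^ n) y)"
      by (simp add: power_abs)
    also have "\<dots> \<le> (\<bar>t\<bar> ^ n / fact n) * (K ^ n * norm y)"
      by (intro mult_left_mono b) auto
    also have "\<dots> = inverse (fact n) * (\<bar>t\<bar> * K) ^ n * norm y"
      by (simp add: power_mult_distrib field_simps)
    finally show "norm ((t ^ n / fact n) *\<^sub>R (B ^^ n) y) \<le> inverse (fact n) * (\<bar>t\<bar> * K) ^ n * norm y" .
  qed
qed

lemma lin_exp_0 [simp]: "lin_exp B 0 y = y"
proof -
  have "lin_exp B 0 y = (\<Sum>n. if n = 0 then y else 0)"
    unfolding lin_exp_def by (rule suminf_cong) (auto simp: power_0_left)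
  also have "\<dots> = y" using suminf_finite[of "{0}" "\<lambda>n. if n = 0 then y else 0"] by simp
  finally show ?thesis .
qed

lemma linear_lin_exp:
  assumes "linear B"
  shows "linear (lin_exp B t)"
proof (rule linearI)
  fix x y :: 'a and r :: real
  show "lin_exp B t (x + y) = lin_exp B t x + lin_exp B t y"
    unfolding lin_exp_def using summable_lin_exp[OF assms] linear_add[OF linear_funpow[OF assms]]
    by (simp add: suminf_add scaleR_add_right)
  have "lin_exp B t (r *\<^sub>R x) = (\<Sum>n. r *\<^sub>R ((t ^ n / fact n) *\<^sub>R (B ^^ n) x))"
    unfolding lin_exp_def using linear_scale[OF linear_funpow[OF assms]] by (simp add: mult.commute)
  then show "lin_exp B t (r *\<^sub>R x) = r *\<^sub>R lin_exp B t x"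
    unfolding lin_exp_def using suminf_scaleR_right[OF summable_lin_exp[OF assms]] by metis
qed

lemma lin_exp_commute:
  assumes "linear B"
  shows "lin_exp B t (B y) = B (lin_exp B t y)"
proof -
  have bl: "bounded_linear B" using assms by (simp add: linear_conv_bounded_linear)
  have "B (lin_exp B t y) = (\<Sum>n. B ((t ^ n / fact n) *\<^sub>R (B ^^ n) y))"
    unfolding lin_exp_def by (rule bounded_linear.suminf[OF bl summable_lin_exp[OF assms]])
  also have "\<dots> = lin_exp B t (B y)"
    unfolding lin_exp_def using linear_scale[OF assms] by (simp add: funpow_swap1)
  finally show ?thesis by simp
qed

text \<open>Each coordinate is a real power series in \<open>t\<close> that converges everywhere, so
  it may be differentiated termwise; the shift of the index turns the result into the series for
  \<open>B y\<close>.\<close>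

lemma lin_exp_has_vector_derivative:
  assumes "linear B"
  shows "((\<lambda>t. lin_exp B t y) has_vector_derivative B (lin_exp B t y)) (at t)"
proof -
  have inner: "lin_exp B s z \<bullet> b = (\<Sum>n. ((B ^^ n) z \<bullet> b / fact n) * s ^ n)"
    and summ: "summable (\<lambda>n. ((B ^^ n) z \<bullet> b / fact n) * s ^ n)" for s z b
  proof -
    have eq: "(\<lambda>n. ((s ^ n / fact n) *\<^sub>R (B ^^ n) z) \<bullet> b) = (\<lambda>n. ((B ^^ n) z \<bullet> b / fact n) * s ^ n)"
      by (auto simp: field_simps)
    have bl: "bounded_linear (\<lambda>x. x \<bullet> b)" by (rule bounded_linear_inner_left)
    show "lin_exp B s z \<bullet> b = (\<Sum>n. ((B ^^ n) z \<bullet> b / fact n) * s ^ n)"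
      using bounded_linear.suminf[OF bl summable_lin_exp[OF assms, of s z]] unfolding eq lin_exp_def .
    show "summable (\<lambda>n. ((B ^^ n) z \<bullet> b / fact n) * s ^ n)"
      using bounded_linear.summable[OF bl summable_lin_exp[OF assms, of s z]] unfolding eq .
  qed
  show ?thesis
    unfolding has_vector_derivative_def
  proof (subst has_derivative_componentwise_within, rule ballI)
    fix b :: 'a
    have "((\<lambda>s. \<Sum>n. ((B ^^ n) y \<bullet> b / fact n) * s ^ n) has_field_derivative
        (\<Sum>n. diffs (\<lambda>n. (B ^^ n) y \<bullet> b / fact n) n * t ^ n)) (at t)"
      by (rule termdiffs_strong_converges_everywhere) (rule summ)
    moreover have "diffs (\<lambda>n. (B ^^ n) y \<bullet> b / fact n) = (\<lambda>n. (B ^^ n) (B y) \<bullet> b / fact n)"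
      by (rule ext) (simp add: diffs_def funpow_swap1 del: of_nat_Suc)
    ultimately have "((\<lambda>s. lin_exp B s y \<bullet> b) has_field_derivative lin_exp B t (B y) \<bullet> b) (at t)"
      unfolding inner by simp
    then have "((\<lambda>s. lin_exp B s y \<bullet> b) has_derivative (\<lambda>s. s * (B (lin_exp B t y) \<bullet> b))) (at t)"
      unfolding has_field_derivative_def lin_exp_commute[OF assms] by (simp add: mult.commute[of _ "B _ \<bullet> _"] mult_commute_abs)
    then show "((\<lambda>s. lin_exp B s y \<bullet> b) has_derivative (\<lambda>s. s *\<^sub>R B (lin_exp B t y) \<bullet> b)) (at t)"
      by simp
  qed
qed

section \<open>Euclidean structures invariant under the isometries of a norm\<close>

lemma homogeneous_bounds:
  fixes N :: "'e::euclidean_space \<Rightarrow> real"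
  assumes cont: "continuous_on (UNIV - {0}) N" and pos: "\<And>y. y \<noteq> 0 \<Longrightarrow> 0 < N y"
    and hom: "\<And>a y. a > 0 \<Longrightarrow> N (a *\<^sub>R y) = a * N y" and N0: "N 0 = 0"
  obtains m C where "m > 0" "C > 0" "\<And>y. m * norm y \<le> N y" "\<And>y. N y \<le> C * norm y"
proof -
  let ?S = "sphere 0 1 :: 'e set"
  have comp: "compact ?S" and ne: "?S \<noteq> {}" by (auto simp: sphere_eq_empty)
  have c: "continuous_on ?S N" by (rule continuous_on_subset[OF cont]) auto
  obtain p where p: "p \<in> ?S" "\<And>y. y \<in> ?S \<Longrightarrow> N p \<le> N y" using continuous_attains_inf[OF comp ne c] by blast
  obtain q where q: "q \<in> ?S" "\<And>y. y \<in> ?S \<Longrightarrow> N y \<le> N q" using continuous_attains_sup[OF comp ne c] by blast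
  have N: "N y = norm y * N (y /\<^sub>R norm y)" if "y \<noteq> 0" for y
    using hom[of "norm y" "y /\<^sub>R norm y"] that by simp
  have s: "y /\<^sub>R norm y \<in> ?S" if "y \<noteq> 0" for y using that by simp
  have "N p > 0" "N q > 0" using p(1) q(1) by (auto intro!: pos)
  moreover have "N p * norm y \<le> N y" "N y \<le> N q * norm y" for y
    using N[of y] p(2)[OF s[of y]] q(2)[OF s[of y]] N0
    by (cases "y = 0"; simp add: mult.commute mult_left_mono)+
  ultimately show ?thesis using that by blast
qed

text \<open>
  Kakutani's argument: the isometry group \<open>?G\<close> is compact, and the convex function
  \<open>\<lambda>L. Sup {q g L | g \<in> ?G}\<close> has a unique minimiser among the positive forms dominating \<open>N\<^sup>2\<close>,
  which is therefore invariant.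
\<close>

lemma invariant_inner_product:
  fixes N :: "'e::euclidean_space \<Rightarrow> real"
  assumes cont: "continuous_on (UNIV - {0}) N" and pos: "\<And>y. y \<noteq> 0 \<Longrightarrow> 0 < N y"
    and hom: "\<And>a y. a > 0 \<Longrightarrow> N (a *\<^sub>R y) = a * N y" and N0: "N 0 = 0"
  obtains L :: "'e \<Rightarrow>\<^sub>L 'e" where "\<And>x y. x \<bullet> L y = y \<bullet> L x" "\<And>y. y \<noteq> 0 \<Longrightarrow> 0 < y \<bullet> L y"
    "\<And>g x y. linear g \<Longrightarrow> (\<And>y. N (g y) = N y) \<Longrightarrow> g x \<bullet> L (g y) = x \<bullet> L y"
proof -
  obtain m C where mC: "m > 0" "C > 0" "\<And>y. m * norm y \<le> N y" "\<And>y. N y \<le> C * norm y"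
    using homogeneous_bounds[OF assms] by blast
  have contN: "isCont N y" for y
  proof (cases "y = 0")
    case False
    then show ?thesis using cont by (auto simp: continuous_on_eq_continuous_at open_delete)
  next
    case True
    have "(N \<longlongrightarrow> 0) (at 0)"
    proof (rule tendsto_sandwich[of "\<lambda>_. 0" _ _ "\<lambda>y. C * norm y"])
      have "0 \<le> N y" for y using mC(1) mC(3)[of y] by (meson mult_nonneg_nonneg less_imp_le norm_ge_zero order_trans)
      then show "\<forall>\<^sub>F y in at 0. 0 \<le> N y" by simp
      show "\<forall>\<^sub>F y in at 0. N y \<le> C * norm y" using mC by simp
      have "((\<lambda>y::'e. C * norm y) \<longlongrightarrow> C * norm (0::'e)) (at 0)" by (intro tendsto_intros)
      then show "((\<lambda>y::'e. C * norm y) \<longlongrightarrow> 0) (at 0)" by simp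
    qed simp
    then show ?thesis using True N0 by (simp add: isCont_def)
  qed
  define G where "G = {g :: 'e \<Rightarrow>\<^sub>L 'e. \<forall>y. N (g y) = N y}"
  \<comment> \<open>Domination of the square of \<open>N\<close> survives limits and averages, which
    mere positivity would not, and keeps the limit form definite.\<close>
  define P where "P = {L :: 'e \<Rightarrow>\<^sub>L 'e. (\<forall>x y. x \<bullet> L y = y \<bullet> L x) \<and> (\<forall>y. (N y)\<^sup>2 \<le> y \<bullet> L y)}"
  \<comment> \<open>\<open>q g L\<close> is the squared Hilbert-Schmidt norm of the form
    \<open>L\<close> pulled back by \<open>g\<close>. The parallelogram law for this norm is the
    source of uniqueness.\<close>
  define q where "q g L = (\<Sum>b\<in>Basis. \<Sum>b'\<in>Basis. (blinfun_apply g b \<bullet> blinfun_apply L (g b'))\<^sup>2)" for g L :: "'e \<Rightarrow>\<^sub>L 'e"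
  have idG: "id_blinfun \<in> G" by (simp add: G_def)
  have compG: "compact G"
  proof (rule compact_eq_bounded_closed[THEN iffD2], intro conjI)
    have "norm g \<le> C / m" if "g \<in> G" for g
    proof (rule norm_blinfun_bound)
      fix y
      have "m * norm (g y) \<le> C * norm y" using mC(3)[of "g y"] mC(4)[of y] that by (simp add: G_def)
      then show "norm (g y) \<le> C / m * norm y" using mC(1) by (simp add: field_simps)
    qed (use mC in simp)
    then show "bounded G" unfolding bounded_iff by blast
    have cl: "closed {g :: 'e \<Rightarrow>\<^sub>L 'e. N (g y) = N y}" for y
      by (intro closed_Collect_eq continuous_at_imp_continuous_on ballI
          continuous_within_compose3[OF contN] continuous_intros) 
    have "G = (\<Inter>y. {g :: 'e \<Rightarrow>\<^sub>L 'e. N (g y) = N y})" by (auto simp: G_def)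
    then show "closed G" using cl by auto
  qed
  have contq: "continuous_on S (\<lambda>g. q g L)" for S L
    unfolding q_def by (intro continuous_intros)
  have contq': "continuous_on S (\<lambda>L. q g L)" for S g
    unfolding q_def by (intro continuous_intros)
  define \<Phi> where "\<Phi> L = Sup ((\<lambda>g. q g L) ` G)" for L
  have att: "\<exists>g\<in>G. q g L = \<Phi> L \<and> (\<forall>h\<in>G. q h L \<le> \<Phi> L)" for L
  proof -
    obtain g where g: "g \<in> G" "\<And>h. h \<in> G \<Longrightarrow> q h L \<le> q g L"
      using continuous_attains_sup[OF compG _ contq] idG by blast
    then have "\<Phi> L = q g L" unfolding \<Phi>_def by (intro cSup_eq_maximum) auto
    then show ?thesis using g by (intro bexI[of _ g]) auto
  qed
  have q0: "0 \<le> q g L" for g L unfolding q_def by (intro sum_nonneg) auto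
  have \<Phi>0: "0 \<le> \<Phi> L" for L using att[of L] q0 by metis
  have P_ne: "(C^2) *\<^sub>R id_blinfun \<in> P"
  proof -
    have "(N y)\<^sup>2 \<le> C\<^sup>2 * (y \<bullet> y)" for y
    proof -
      have "0 \<le> N y" using mC(1) mC(3)[of y] by (meson mult_nonneg_nonneg less_imp_le norm_ge_zero order_trans)
      then have "(N y)\<^sup>2 \<le> (C * norm y)\<^sup>2" using mC(4)[of y] by (intro power_mono)
      then show ?thesis by (simp add: power_mult_distrib power2_norm_eq_inner)
    qed
    then show ?thesis by (auto simp: P_def blinfun.scaleR_left inner_commute)
  qed
  define \<mu> where "\<mu> = Inf (\<Phi> ` P)"
  have bdd: "bdd_below (\<Phi> ` P)" using \<Phi>0 by (intro bdd_belowI[of _ 0]) auto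
  have \<mu>_le: "\<mu> \<le> \<Phi> L" if "L \<in> P" for L unfolding \<mu>_def using bdd that by (intro cInf_lower) auto
  have "\<exists>L\<in>P. \<Phi> L < \<mu> + 1 / Suc k" for k
  proof -
    have "\<exists>x\<in>\<Phi> ` P. x < \<mu> + 1 / Suc k"
      unfolding \<mu>_def by (rule cInf_lessD) (use P_ne in auto)
    then show ?thesis by blast
  qed
  then obtain Ls where Ls: "\<And>k. Ls k \<in> P" "\<And>k. \<Phi> (Ls k) < \<mu> + 1 / Suc k" by metis
  \<comment> \<open>The identity belongs to \<open>G\<close>, so a bound on \<Phi> bounds the matrix
    entries of the form itself.\<close>
  have "bounded (range Ls)"
  proof -
    have "norm (Ls k) \<le> sqrt (\<mu> + 1) * (real DIM('e) * real DIM('e))" for k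
    proof -
      have "q id_blinfun (Ls k) \<le> \<Phi> (Ls k)" using att[of "Ls k"] idG by blast
      also have "\<dots> \<le> \<mu> + 1" using Ls(2)[of k] by (smt (verit) divide_le_eq_1 of_nat_0_less_iff of_nat_Suc of_nat_0_le_iff)
      finally have qk: "q id_blinfun (Ls k) \<le> \<mu> + 1" .
      have ent: "\<bar>b \<bullet> Ls k b'\<bar> \<le> sqrt (\<mu> + 1)" if "b \<in> Basis" "b' \<in> Basis" for b b'
      proof -
        have "(b \<bullet> Ls k b')\<^sup>2 \<le> (\<Sum>b'\<in>Basis. (b \<bullet> Ls k b')\<^sup>2)"
          using that by (intro member_le_sum) auto
        also have "\<dots> \<le> q id_blinfun (Ls k)"
          using member_le_sum[of b Basis "\<lambda>b. \<Sum>b'\<in>Basis. (b \<bullet> Ls k b')\<^sup>2"] that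
          by (simp add: q_def sum_nonneg)
        finally show ?thesis using qk by (metis real_le_rsqrt power2_abs order_trans real_sqrt_abs real_sqrt_le_mono)
      qed
      have "norm (Ls k b') \<le> real DIM('e) * sqrt (\<mu> + 1)" if "b' \<in> Basis" for b'
      proof -
        have "norm (Ls k b') \<le> (\<Sum>b\<in>Basis. \<bar>Ls k b' \<bullet> b\<bar>)" by (rule norm_le_l1)
        also have "\<dots> \<le> (\<Sum>b\<in>(Basis::'e set). sqrt (\<mu> + 1))"
          using ent that by (intro sum_mono) (simp add: inner_commute)
        finally show ?thesis by simp
      qed
      then have "(\<Sum>b\<in>Basis. norm (Ls k b)) \<le> (\<Sum>b\<in>(Basis::'e set). real DIM('e) * sqrt (\<mu> + 1))"
        by (intro sum_mono) auto
      then show ?thesis using norm_blinfun_euclidean_le[of "Ls k"] by (simp add: mult_ac)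
    qed
    then show ?thesis unfolding bounded_iff by blast
  qed
  then obtain L r where L: "strict_mono (r :: nat \<Rightarrow> nat)" "(Ls \<circ> r) \<longlonglongrightarrow> L"
    using bounded_imp_convergent_subsequence[of Ls] by blast
  have lim: "(\<lambda>k. Ls (r k)) \<longlonglongrightarrow> L" using L(2) by (simp add: o_def)
  have LP: "L \<in> P"
  proof -
    have l: "(\<lambda>k. x \<bullet> Ls (r k) y) \<longlonglongrightarrow> x \<bullet> L y" for x y by (intro tendsto_intros lim)
    have "x \<bullet> L y = y \<bullet> L x" for x y
    proof -
      have "(\<lambda>k. x \<bullet> Ls (r k) y) = (\<lambda>k. y \<bullet> Ls (r k) x)" using Ls(1) by (auto simp: P_def)
      then show ?thesis using LIMSEQ_unique[OF l[of x y]] l[of y x] by simp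
    qed
    moreover have "(N y)\<^sup>2 \<le> y \<bullet> L y" for y
      by (rule LIMSEQ_le_const[OF l]) (use Ls(1) in \<open>auto simp: P_def\<close>)
    ultimately show ?thesis by (simp add: P_def)
  qed
  have qL: "q g L \<le> \<mu>" if "g \<in> G" for g
  proof (rule LIMSEQ_le)
    show "(\<lambda>k. q g (Ls (r k))) \<longlonglongrightarrow> q g L" unfolding q_def by (intro tendsto_intros lim)
    have "(\<lambda>k. \<mu> + 1 / Suc (r k)) \<longlonglongrightarrow> \<mu> + 0"
      using LIMSEQ_subseq_LIMSEQ[OF LIMSEQ_inverse_real_of_nat L(1)]
      by (intro tendsto_add tendsto_const) (simp add: o_def inverse_eq_divide)
    then show "(\<lambda>k. \<mu> + 1 / Suc (r k)) \<longlonglongrightarrow> \<mu>" by simp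
    show "\<exists>N. \<forall>k\<ge>N. q g (Ls (r k)) \<le> \<mu> + 1 / Suc (r k)"
      using att Ls(2) that by (meson less_imp_le order_trans)
  qed
  have uniq: "L' = L" if L': "L' \<in> P" "\<And>g. g \<in> G \<Longrightarrow> q g L' \<le> \<mu>" for L'
  proof -
    define M where "M = (1/2) *\<^sub>R (L + L')"
    have MP: "M \<in> P"
    proof -
      have "(N y)\<^sup>2 \<le> (y \<bullet> L y + y \<bullet> L' y) / 2" for y
      proof -
        have "(N y)\<^sup>2 \<le> y \<bullet> L y" "(N y)\<^sup>2 \<le> y \<bullet> L' y" using LP L'(1) by (auto simp: P_def)
        then show ?thesis by argo
      qed
      moreover have "x \<bullet> L y = y \<bullet> L x" "x \<bullet> L' y = y \<bullet> L' x" for x y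
        using LP L'(1) by (auto simp: P_def)
      ultimately show ?thesis
        by (simp add: P_def M_def blinfun.bilinear_simps inner_simps)
    qed
    obtain g where g: "g \<in> G" "q g M = \<Phi> M" using att by blast
    \<comment> \<open>The parallelogram law is applied at the isometry where \<Phi> of the midpoint
      \<open>M\<close> is attained. It shows that the half difference \<open>D\<close> has zero
      pullback under \<open>g\<close>; since \<open>g\<close> is onto, \<open>D\<close>
      vanishes.\<close>
    define D where "D = (1/2) *\<^sub>R (L - L')"
    have "q g M + q g D = (q g L + q g L') / 2"
    proof -
      have t: "(u \<bullet> M v)\<^sup>2 + (u \<bullet> D v)\<^sup>2 = ((u \<bullet> L v)\<^sup>2 + (u \<bullet> L' v)\<^sup>2) / 2" for u v
        by (simp add: M_def D_def blinfun.bilinear_simps inner_simps power2_eq_square field_simps)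
      then show ?thesis unfolding q_def sum.distrib[symmetric] sum_divide_distrib by (simp only: t)
    qed
    moreover have "\<mu> \<le> q g M" using \<mu>_le[OF MP] g by simp
    moreover have "q g L \<le> \<mu>" "q g L' \<le> \<mu>" using qL L'(2) g(1) by auto
    ultimately have "q g D \<le> 0" by argo
    then have "q g D = 0" using q0[of g D] by linarith
    then have z: "g b \<bullet> D (g b') = 0" if "b \<in> Basis" "b' \<in> Basis" for b b'
      using that unfolding q_def by (subst (asm) sum_nonneg_eq_0_iff, simp, simp add: sum_nonneg, subst (asm) sum_nonneg_eq_0_iff) auto
    have "g x \<bullet> D (g y) = 0" for x y
    proof -
      have "g x \<bullet> D (g y) = (\<Sum>b\<in>Basis. \<Sum>b'\<in>Basis. (x \<bullet> b) * (y \<bullet> b') * (g b \<bullet> D (g b')))"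
        by (subst (1) euclidean_representation[of x, symmetric], subst (1) euclidean_representation[of y, symmetric])
          (simp add: blinfun.bilinear_simps blinfun.sum_right inner_sum_left inner_sum_right sum_distrib_left mult_ac, rule sum.swap)
      then show ?thesis using z by simp
    qed
    moreover have "surj g"
    proof -
      have "linear g" by (rule bounded_linear.linear[OF blinfun.bounded_linear_right])
      moreover have "inj g"
        unfolding linear_injective_0[OF \<open>linear g\<close>] using g(1) pos N0 unfolding G_def
        by (metis (mono_tags, lifting) less_irrefl mem_Collect_eq)
      ultimately show ?thesis by (rule linear_injective_imp_surjective) simp
    qed
    ultimately have "x \<bullet> D y = 0" for x y by (metis surjD)
    then have "D y = 0" for y by (metis inner_eq_zero_iff)
    then have "D = 0" by (intro blinfun_eqI) simp
    then show ?thesis by (simp add: D_def)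
  qed
  show ?thesis
  proof
    show "x \<bullet> L y = y \<bullet> L x" for x y using LP by (auto simp: P_def)
    show "0 < y \<bullet> L y" if "y \<noteq> 0" for y
      using LP pos[OF that] by (auto simp: P_def) (metis less_le_trans zero_less_power)
    fix g :: "'e \<Rightarrow> 'e" and x y assume g: "linear g" "\<And>y. N (g y) = N y"
    have blg: "bounded_linear g" using g(1) by (simp add: linear_conv_bounded_linear)
    define h where "h = Blinfun g"
    have h: "blinfun_apply h = g" unfolding h_def by (rule bounded_linear_Blinfun_apply[OF blg])
    have hG: "h \<in> G" using g(2) by (simp add: G_def h)
    have la: "linear (adjoint g)" by (rule adjoint_linear[OF g(1)])
    \<comment> \<open>The pullback of \<open>L\<close> by \<open>g\<close>. As \<open>G\<close> is
      closed under composition, every value of \<open>q\<close> for \<open>L'\<close> is also one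
      for \<open>L\<close>, so \<open>L'\<close> is a minimiser too and uniqueness applies.\<close>
    define L' where "L' = Blinfun (\<lambda>y. adjoint g (L (g y)))"
    have "bounded_linear (\<lambda>y. adjoint g (L (g y)))"
      using bounded_linear_compose[OF la[unfolded linear_conv_bounded_linear]
          bounded_linear_compose[OF blinfun.bounded_linear_right[of L] blg]] .
    then have L': "blinfun_apply L' = (\<lambda>y. adjoint g (L (g y)))"
      unfolding L'_def by (rule bounded_linear_Blinfun_apply)
    have xL': "x \<bullet> L' y = g x \<bullet> L (g y)" for x y
      using adjoint_works[OF g(1)] by (simp add: L')
    have "L' \<in> P" using LP g(2) unfolding P_def by (auto simp: xL') metis
    moreover have "q k L' \<le> \<mu>" if "k \<in> G" for k
    proof -
      have "q k L' = q (h o\<^sub>L k) L" unfolding q_def by (simp add: xL' h)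
      moreover have "h o\<^sub>L k \<in> G" using that hG by (simp add: G_def)
      ultimately show ?thesis using qL by simp
    qed
    ultimately have "L' = L" by (rule uniq)
    then show "g x \<bullet> L (g y) = x \<bullet> L y" using xL' by metis
  qed
qed

lemma linear_inv_bij:
  assumes f: "linear f" and "bij f"
  shows "linear (inv f)"
proof (rule linearI)
  have fi: "inv f (f x) = x" "f (inv f y) = y" for x y
    using assms(2) by (simp_all add: bij_is_inj bij_is_surj surj_f_inv_f)
  show "inv f (x + y) = inv f x + inv f y" for x y
    using fi(1)[of "inv f x + inv f y"] by (simp add: linear_add[OF f] fi(2))
  show "inv f (r *\<^sub>R x) = r *\<^sub>R inv f x" for r x
    using fi(1)[of "r *\<^sub>R inv f x"] by (simp add: linear_scale[OF f] fi(2))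
qed

text \<open>\<open>T\<close> maps the standard basis to a maximal orthonormal system of the
  invariant form, hence the standard inner product to that form. In this frame all later skewness
  arguments can use the fixed inner product of the type.\<close>

lemma isometry_adapted_frame:
  fixes N :: "'e::euclidean_space \<Rightarrow> real"
  assumes cont: "continuous_on (UNIV - {0}) N" and pos: "\<And>y. y \<noteq> 0 \<Longrightarrow> 0 < N y"
    and hom: "\<And>a y. a > 0 \<Longrightarrow> N (a *\<^sub>R y) = a * N y" and N0: "N 0 = 0"
  obtains T :: "'e \<Rightarrow> 'e" where "linear T" "bij T"
    "\<And>g y. linear g \<Longrightarrow> (\<And>y. N (T (g y)) = N (T y)) \<Longrightarrow> norm (g y) = norm y"
proof -
  obtain L :: "'e \<Rightarrow>\<^sub>L 'e" where L: "\<And>x y. x \<bullet> L y = y \<bullet> L x" "\<And>y. y \<noteq> 0 \<Longrightarrow> 0 < y \<bullet> L y"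
    "\<And>g x y. linear g \<Longrightarrow> (\<And>y. N (g y) = N y) \<Longrightarrow> g x \<bullet> L (g y) = x \<bullet> L y"
    using invariant_inner_product[OF assms] by blast
  define Q where "Q x y = x \<bullet> L y" for x y
  have Qlin: "Q (a + b) y = Q a y + Q b y" "Q (r *\<^sub>R a) y = r * Q a y" "Q y (a + b) = Q y a + Q y b"
    "Q y (r *\<^sub>R a) = r * Q y a" "Q (a - b) y = Q a y - Q b y" "Q y (a - b) = Q y a - Q y b" "Q 0 y = 0" "Q y 0 = 0" for a b y r
    by (simp_all add: Q_def inner_simps blinfun.bilinear_simps)
  have Qsum: "Q (\<Sum>i\<in>I. f i) y = (\<Sum>i\<in>I. Q (f i) y)" "Q y (\<Sum>i\<in>I. f i) = (\<Sum>i\<in>I. Q y (f i))" for I y and f :: "'e \<Rightarrow> 'e"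
    by (simp_all add: Q_def inner_sum_left inner_sum_right blinfun.sum_right)
  have Qsym: "Q x y = Q y x" for x y unfolding Q_def by (rule L(1))
  define ON where "ON S \<longleftrightarrow> finite S \<and> (\<forall>s\<in>S. \<forall>t\<in>S. Q s t = (if s = t then 1 else 0))" for S
  have coef: "Q (\<Sum>s\<in>S. u s *\<^sub>R s) t = u t" if "ON S" "t \<in> S" for S t u
  proof -
    have "Q (\<Sum>s\<in>S. u s *\<^sub>R s) t = (\<Sum>s\<in>S. if s = t then u s else 0)"
      unfolding Qsum by (rule sum.cong) (use that in \<open>auto simp: ON_def Qlin\<close>)
    then show ?thesis using that by (simp add: ON_def)
  qed
  have ind: "independent S" if "ON S" for S
  proof -
    have fin: "finite S" using that by (simp add: ON_def)
    have "\<not> (\<exists>u. (\<exists>v\<in>S. u v \<noteq> 0) \<and> (\<Sum>v\<in>S. u v *\<^sub>R v) = 0)"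
      using coef[OF that] Qlin(7) by metis
    then show ?thesis using dependent_finite[OF fin] by blast
  qed
  have le: "card S \<le> DIM('e)" if "ON S" for S using independent_bound[OF ind[OF that]] by simp
  have ex: "\<exists>S. ON S \<and> card S = DIM('e)"
  proof -
    let ?P = "\<lambda>k. \<exists>S. ON S \<and> card S = k"
    have "?P 0" by (auto simp: ON_def intro!: exI[of _ "{}"])
    then have "\<exists>k. ?P k \<and> (\<forall>j. ?P j \<longrightarrow> j \<le> k)"
      by (rule Nat.ex_has_greatest_nat[of ?P 0 "DIM('e)"]) (use le in auto)
    then obtain S where S: "ON S" "\<And>S'. ON S' \<Longrightarrow> card S' \<le> card S" by blast
    have fin: "finite S" using S(1) by (simp add: ON_def)
    show ?thesis
    proof (rule ccontr)
      assume "\<not> ?thesis"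
      then have "card S \<noteq> DIM('e)" using S(1) by blast
      then have "card S < DIM('e)" using le[OF S(1)] by simp
      then have "dim S < DIM('e)" using dim_eq_card_independent[OF ind[OF S(1)]] by simp
      then have "span S \<noteq> UNIV" using dim_eq_full[of S] by simp
      then obtain v where v: "v \<notin> span S" by blast
      define w where "w = v - (\<Sum>s\<in>S. Q v s *\<^sub>R s)"
      have sp: "(\<Sum>s\<in>S. Q v s *\<^sub>R s) \<in> span S" by (intro span_sum span_scale span_base)
      have w0: "w \<noteq> 0" using v sp by (auto simp: w_def)
      have wt: "Q w t = 0" if "t \<in> S" for t using coef[OF S(1) that] by (simp add: w_def Qlin)
      define k where "k = sqrt (Q w w)"
      have Qw: "Q w w > 0" using L(2)[OF w0] by (simp add: Q_def)
      have k: "k > 0" "k * k = Q w w" using Qw by (auto simp: k_def)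
      define w' where "w' = (1 / k) *\<^sub>R w"
      have w'1: "Q w' w' = 1" using k Qw by (simp add: w'_def Qlin field_simps)
      have w't: "Q w' t = 0" "Q t w' = 0" if "t \<in> S" for t
        using wt[OF that] Qsym[of t w'] by (simp_all add: w'_def Qlin)
      have "w' \<notin> S" using w'1 w't(1) by fastforce
      then have "card (insert w' S) = Suc (card S)" using fin by simp
      moreover have "ON (insert w' S)" using S(1) w'1 w't \<open>w' \<notin> S\<close> by (auto simp: ON_def)
      ultimately show False using S(2)[of "insert w' S"] by simp
    qed
  qed
  then obtain S where S: "ON S" "card S = DIM('e)" by blast
  have "finite S" using S(1) by (simp add: ON_def)
  then obtain f :: "'e \<Rightarrow> 'e" where f: "bij_betw f Basis S"
    using finite_same_card_bij[OF finite_Basis] S(2) by metis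
  have fS: "f b \<in> S" if "b \<in> Basis" for b using f that by (auto simp: bij_betw_def)
  have Qf: "Q (f a) (f b) = (if a = b then 1 else 0)" if "a \<in> Basis" "b \<in> Basis" for a b
    using S(1) fS[OF that(1)] fS[OF that(2)] f that by (auto simp: ON_def bij_betw_def inj_on_def)
  define T where "T x = (\<Sum>b\<in>Basis. (x \<bullet> b) *\<^sub>R f b)" for x
  have linT: "linear T"
    by (rule linearI) (auto simp: T_def inner_simps scaleR_add_left sum.distrib scaleR_sum_right)
  have QT: "Q (T x) (T y) = x \<bullet> y" for x y
  proof -
    have "Q (T x) (T y) = (\<Sum>a\<in>Basis. \<Sum>b\<in>Basis. (x \<bullet> a) * ((y \<bullet> b) * Q (f a) (f b)))"
      unfolding T_def Qsum by (subst sum.swap) (simp add: Qlin mult_ac)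
    also have "\<dots> = (\<Sum>a\<in>Basis. \<Sum>b\<in>Basis. if a = b then (x \<bullet> a) * (y \<bullet> b) else 0)"
      by (intro sum.cong refl) (simp add: Qf)
    also have "\<dots> = (\<Sum>a\<in>Basis. (x \<bullet> a) * (y \<bullet> a))" by simp
    finally show ?thesis by (simp add: euclidean_inner[of x y])
  qed
  have injT: "inj T"
    unfolding linear_injective_0[OF linT]
  proof (intro allI impI)
    fix x assume "T x = 0"
    then show "x = 0" using QT[of x x] by (simp add: Qlin)
  qed
  have surjT: "surj T" by (rule linear_injective_imp_surjective[OF linT injT]) simp
  have bijT: "bij T" using injT surjT by (simp add: bij_def)
  note TiT = inv_f_f[OF injT] and TTi = surj_f_inv_f[OF surjT]
  have linTi: "linear (inv T)" by (rule linear_inv_bij[OF linT bijT])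
  show thesis
  proof (rule that[OF linT bijT])
    fix g y assume g: "linear g" "\<And>y. N (T (g y)) = N (T y)"
    define h where "h = T \<circ> (g \<circ> inv T)"
    have "linear h" unfolding h_def by (intro linear_compose linTi g(1) linT)
    moreover have "N (h z) = N z" for z
      using g(2)[of "inv T z"] surj_f_inv_f[OF surjT] by (simp add: h_def)
    ultimately have "Q (h (T y)) (h (T y)) = Q (T y) (T y)" unfolding Q_def by (rule L(3))
    then have "g y \<bullet> g y = y \<bullet> y" using QT injT by (simp add: h_def)
    then show "norm (g y) = norm y" by (simp add: norm_eq)
  qed
qed

lemma norm_preserving_imp_inner_preserving:
  fixes g :: "'e::real_inner \<Rightarrow> 'e"
  assumes "linear g" "\<And>y. norm (g y) = norm y"
  shows "g x \<bullet> g y = x \<bullet> y"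
proof -
  have "orthogonal_transformation g" using assms by (simp add: orthogonal_transformation)
  then show ?thesis by (simp add: orthogonal_transformation_def)
qed

subsection \<open>Minkowski norms with a large symmetry algebra\<close>

locale round_norm =
  fixes N :: "'e::euclidean_space \<Rightarrow> real" and DN :: "'e \<Rightarrow> 'e \<Rightarrow> real"
  assumes DN: "y \<noteq> 0 \<Longrightarrow> (N has_derivative DN y) (at y)"
    and bounded_N: "\<exists>C. \<forall>y. \<bar>N y\<bar> \<le> C * norm y"
    and isometry: "linear g \<Longrightarrow> (\<And>y. N (g y) = N y) \<Longrightarrow> norm (g y) = norm y"
    and nonneg_N: "N y \<ge> 0"
begin

text \<open>The square of \<open>N\<close> is differentiable at \<open>0\<close>, so the flow need not be kept away from \<open>0\<close>.\<close>

lemma square_has_derivative: "((\<lambda>y. (N y)\<^sup>2) has_derivative (\<lambda>v. if y = 0 then 0 else 2 * N y * DN y v)) (at y)"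
proof (cases "y = 0")
  case False
  have "((\<lambda>y. (N y)\<^sup>2) has_derivative (\<lambda>v. of_nat 2 * DN y v * N y ^ (2 - 1))) (at y)"
    by (rule has_derivative_power[OF DN[OF False]])
  then show ?thesis using False by (simp add: mult_ac)
next
  case True
  obtain C where C: "\<And>y. \<bar>N y\<bar> \<le> C * norm y" using bounded_N by blast
  have N0: "N 0 = 0" using C[of 0] by simp
  have "((\<lambda>v. (N v)\<^sup>2 / norm v) \<longlongrightarrow> 0) (at 0)"
  proof (rule tendsto_sandwich[of "\<lambda>_. 0" _ _ "\<lambda>v. C\<^sup>2 * norm v"])
    have "(N v)\<^sup>2 / norm v \<le> C\<^sup>2 * norm v" for v
    proof (cases "v = 0")
      case False
      have "(N v)\<^sup>2 \<le> (C * norm v)\<^sup>2" using power_mono[OF C[of v], of 2] by simp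
      then show ?thesis using False by (simp add: divide_le_eq power2_eq_square mult_ac)
    qed simp
    then show "\<forall>\<^sub>F v in at 0. (N v)\<^sup>2 / norm v \<le> C\<^sup>2 * norm v" by simp
    have "((\<lambda>v::'e. C\<^sup>2 * norm v) \<longlongrightarrow> C\<^sup>2 * norm (0::'e)) (at 0)" by (intro tendsto_intros)
    then show "((\<lambda>v::'e. C\<^sup>2 * norm v) \<longlongrightarrow> 0) (at 0)" by simp
  qed simp_all
  then show ?thesis using True N0 by (simp add: has_derivative_at)
qed

lemma lin_exp_preserves:
  assumes B: "linear B" "\<And>y. y \<noteq> 0 \<Longrightarrow> DN y (B y) = 0"
  shows "N (lin_exp B t y) = N y"
proof -
  have "((\<lambda>t. (N (lin_exp B t y))\<^sup>2) has_real_derivative 0) (at t)" for t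
  proof -
    let ?z = "lin_exp B t y"
    have "((\<lambda>t. (N (lin_exp B t y))\<^sup>2) has_derivative
        (\<lambda>s. if ?z = 0 then 0 else 2 * N ?z * DN ?z (s *\<^sub>R B ?z))) (at t)"
      using has_derivative_compose[OF lin_exp_has_vector_derivative[OF B(1), unfolded has_vector_derivative_def]
          square_has_derivative[of ?z]] .
    moreover have "DN ?z (s *\<^sub>R B ?z) = 0" if "?z \<noteq> 0" for s
      using linear_scale[OF has_derivative_linear[OF DN[OF that]]] B(2)[OF that] by simp
    then have "(\<lambda>s. if ?z = 0 then 0 else 2 * N ?z * DN ?z (s *\<^sub>R B ?z)) = (\<lambda>s. 0)" by auto
    ultimately have "((\<lambda>t. (N (lin_exp B t y))\<^sup>2) has_derivative (\<lambda>s. 0)) (at t)" by simp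
    then show ?thesis by (simp add: has_field_derivative_def lambda_zero)
  qed
  then have "(N (lin_exp B t y))\<^sup>2 = (N (lin_exp B 0 y))\<^sup>2"
    using DERIV_isconst_all[of "\<lambda>t. (N (lin_exp B t y))\<^sup>2"] by blast
  then show ?thesis using nonneg_N by (simp add: power2_eq_iff_nonneg)
qed

lemma norm_lin_exp:
  assumes B: "linear B" "\<And>y. y \<noteq> 0 \<Longrightarrow> DN y (B y) = 0"
  shows "norm (lin_exp B t y) = norm y"
  by (rule isometry[OF linear_lin_exp[OF B(1)] lin_exp_preserves[OF B]])

text \<open>The exponentials of \<open>B\<close> are isometries of \<open>N\<close>, hence
  orthogonal by the choice of frame; differentiating the constant squared length of an orbit at time
  zero gives skewness.\<close>

lemma tangent_imp_skew:
  assumes B: "linear B" "\<And>y. y \<noteq> 0 \<Longrightarrow> DN y (B y) = 0"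
  shows "B \<in> skew_maps"
proof -
  have "B y \<bullet> y = 0" for y
  proof -
    have v: "((\<lambda>t. lin_exp B t y) has_derivative (\<lambda>s. s *\<^sub>R B y)) (at 0)"
      using lin_exp_has_vector_derivative[OF B(1), of y 0] by (simp add: has_vector_derivative_def)
    have "((\<lambda>t. lin_exp B t y \<bullet> lin_exp B t y) has_derivative
        (\<lambda>s. lin_exp B 0 y \<bullet> (s *\<^sub>R B y) + (s *\<^sub>R B y) \<bullet> lin_exp B 0 y)) (at 0)"
      by (rule has_derivative_inner[OF v v])
    moreover have "(\<lambda>t. lin_exp B t y \<bullet> lin_exp B t y) = (\<lambda>t. y \<bullet> y)"
      using norm_lin_exp[OF B] by (simp add: norm_eq)
    ultimately have "((\<lambda>t::real. y \<bullet> y) has_derivative (\<lambda>s. y \<bullet> (s *\<^sub>R B y) + (s *\<^sub>R B y) \<bullet> y)) (at 0)" by simp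
    then have "(\<lambda>s. y \<bullet> (s *\<^sub>R B y) + (s *\<^sub>R B y) \<bullet> y) = (\<lambda>s::real. 0)"
      using has_derivative_unique[OF _ has_derivative_const] by blast
    from fun_cong[OF this, of 1] show ?thesis by (simp add: inner_commute)
  qed
  then show ?thesis using B(1) by (simp add: skew_maps_def)
qed

end

text \<open>
  A Minkowski norm in a frame in which the linear isometries of its symmetrisation are orthogonal.
  Derivatives at the origin are set to \<open>0\<close>, where \<open>F\<close> is not differentiable.
\<close>

locale adapted_minkowski_norm =
  fixes F :: "'e::euclidean_space \<Rightarrow> real" and DF :: "'e \<Rightarrow> 'e \<Rightarrow> real"
  assumes DF: "y \<noteq> 0 \<Longrightarrow> (F has_derivative DF y) (at y)"
    and F_0: "F 0 = 0" and DF_0: "DF 0 = (\<lambda>v. 0)"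
    and F_scale: "a > 0 \<Longrightarrow> F (a *\<^sub>R y) = a * F y"
    and F_pos: "y \<noteq> 0 \<Longrightarrow> 0 < F y"
    and orthogonal_isometry:
      "linear g \<Longrightarrow> (\<And>y. F (g y) + F (- g y) = F y + F (- y)) \<Longrightarrow> norm (g y) = norm y"
begin

lemma linear_DF: "linear (DF y)"
  by (cases "y = 0") (auto simp: DF_0 linear_zero intro: has_derivative_linear DF)

lemma F_minus_has_derivative:
  assumes "y \<noteq> 0"
  shows "((\<lambda>y. F (- y)) has_derivative (\<lambda>v. - DF (- y) v)) (at y)"
proof -
  have "((\<lambda>y. F (- y)) has_derivative (\<lambda>v. DF (- y) (- v))) (at y)"
    by (rule has_derivative_compose[of uminus uminus y UNIV F, OF _ DF])
      (use assms in \<open>auto intro: has_derivative_minus[OF has_derivative_ident]\<close>)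
  then show ?thesis by (simp add: linear_neg[OF linear_DF])
qed

lemma F_nonneg: "0 \<le> F y"
  using F_pos[of y] F_0 by (cases "y = 0") auto

sublocale sym: round_norm "\<lambda>y. F y + F (- y)" "\<lambda>y v. DF y v - DF (- y) v"
proof
  show "((\<lambda>y. F y + F (- y)) has_derivative (\<lambda>v. DF y v - DF (- y) v)) (at y)" if "y \<noteq> 0" for y
    using has_derivative_add[OF DF[OF that] F_minus_has_derivative[OF that]] by simp
  have "continuous_on (UNIV - {0}) F"
    by (intro continuous_at_imp_continuous_on ballI) (auto intro: has_derivative_continuous DF)
  then obtain m C where mC: "m > 0" "C > 0" "\<And>y. m * norm y \<le> F y" "\<And>y. F y \<le> C * norm y"
    using homogeneous_bounds F_pos F_scale F_0 by blast
  have "\<bar>F y + F (- y)\<bar> \<le> (2 * C) * norm y" for y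
    using mC(4)[of y] mC(4)[of "- y"] F_nonneg[of y] F_nonneg[of "- y"] by simp
  then show "\<exists>C. \<forall>y. \<bar>F y + F (- y)\<bar> \<le> C * norm y" by blast
  show "0 \<le> F y + F (- y)" for y using F_nonneg by (simp add: add_nonneg_nonneg)
qed (rule orthogonal_isometry; simp)

text \<open>The stabiliser of \<open>F\<close> modulo linear forms, on the level of Lie algebras.
  Linear parts of almost Killing fields that vanish at the point lie here, because for them the Lie
  derivative reduces to a fibre derivative.\<close>

definition alg :: "('e \<Rightarrow> 'e) set"
  where "alg = {B. linear B \<and> linear (\<lambda>y. DF y (B y))}"

text \<open>A linear form is odd, so it drops out of the derivative of the symmetrised norm. In this
  way a condition modulo linear forms produces honest skew maps.\<close>

lemma alg_tangent:
  assumes "B \<in> alg"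
  shows "DF y (B y) - DF (- y) (B y) = 0"
proof -
  have l: "linear B" "linear (\<lambda>y. DF y (B y))" using assms by (auto simp: alg_def)
  have "DF (- y) (B (- y)) = - DF y (B y)" using linear_neg[OF l(2), of y] .
  then show ?thesis using linear_neg[OF l(1), of y] linear_neg[OF linear_DF, of "- y" "B y"] by simp
qed

lemma alg_skew: "B \<in> alg \<Longrightarrow> B \<in> skew_maps"
  by (rule sym.tangent_imp_skew) (auto simp: alg_tangent alg_def)

lemma alg_norm_lin_exp: "B \<in> alg \<Longrightarrow> norm (lin_exp B t y) = norm y"
  by (rule sym.norm_lin_exp) (auto simp: alg_tangent alg_def)

lemma subspace_alg: "subspace alg"
  unfolding subspace_def
proof (intro conjI ballI allI)
  have "linear (\<lambda>x::'e. 0::'e)" "linear (\<lambda>x::'e. 0::real)" by (auto intro: linear_zero)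
  then show "0 \<in> alg" using linear_0[OF linear_DF] by (simp add: alg_def zero_fun_def)
  fix X Y r assume X: "X \<in> alg" and Y: "Y \<in> alg"
  show "X + Y \<in> alg"
    using linear_compose_add[of X Y] linear_compose_add[of "\<lambda>y. DF y (X y)" "\<lambda>y. DF y (Y y)"] X Y
    by (simp add: alg_def plus_fun_def linear_add[OF linear_DF])
  show "r *\<^sub>R X \<in> alg"
    using linear_compose_scale_right[of X r] linear_compose_scale_right[of "\<lambda>y. DF y (X y)" r] X
    by (simp add: alg_def scaleR_fun_def linear_scale[OF linear_DF])
qed

lemma F_lin_exp_has_derivative:
  assumes "B \<in> alg"
  shows "((\<lambda>t. F (lin_exp B t y)) has_real_derivative DF (lin_exp B t y) (B (lin_exp B t y))) (at t)"
proof (cases "y = 0")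
  case True
  have "lin_exp B s 0 = 0" for s using alg_norm_lin_exp[OF assms, of s 0] by simp
  then show ?thesis using True by (simp add: DF_0)
next
  case False
  let ?z = "lin_exp B t y"
  have B: "linear B" using assms by (simp add: alg_def)
  have "?z \<noteq> 0" using alg_norm_lin_exp[OF assms, of t y] False by auto
  then have "((\<lambda>t. F (lin_exp B t y)) has_derivative (\<lambda>s. DF ?z (s *\<^sub>R B ?z))) (at t)"
    using has_derivative_compose[OF lin_exp_has_vector_derivative[OF B, unfolded has_vector_derivative_def] DF] by blast
  then show ?thesis
    by (simp add: has_field_derivative_def linear_scale[OF linear_DF] mult_commute_abs)
qed

text \<open>The integrated form of membership in \<open>alg\<close>. Along the flow, the time
  derivative of \<open>F\<close> is a linear form of the moving point, so the defects of additivity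
  and homogeneity of \<open>F\<close> keep their values from time zero and cancel in the
  difference.\<close>

lemma linear_F_lin_exp_diff:
  assumes "B \<in> alg"
  shows "linear (\<lambda>y. F (lin_exp B t y) - F y)"
proof -
  have l: "linear B" "linear (\<lambda>y. DF y (B y))" using assms by (auto simp: alg_def)
  note E = linear_lin_exp[OF l(1)]
  show ?thesis
  proof (rule linearI)
    fix y z :: 'e and r :: real
    have "((\<lambda>t. F (lin_exp B t (y + z)) - F (lin_exp B t y) - F (lin_exp B t z)) has_real_derivative 0) (at t)" for t
    proof -
      let ?d = "\<lambda>y. DF (lin_exp B t y) (B (lin_exp B t y))"
      have "((\<lambda>t. F (lin_exp B t (y + z)) - F (lin_exp B t y) - F (lin_exp B t z)) has_real_derivative
          ?d (y + z) - ?d y - ?d z) (at t)"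
        by (intro DERIV_diff F_lin_exp_has_derivative assms)
      moreover have "?d (y + z) - ?d y - ?d z = 0" by (simp add: linear_add[OF E] linear_add[OF l(2)])
      ultimately show ?thesis by metis
    qed
    then have "F (lin_exp B t (y + z)) - F (lin_exp B t y) - F (lin_exp B t z)
        = F (lin_exp B 0 (y + z)) - F (lin_exp B 0 y) - F (lin_exp B 0 z)"
      by (intro DERIV_isconst_all) blast
    then show "F (lin_exp B t (y + z)) - F (y + z) = F (lin_exp B t y) - F y + (F (lin_exp B t z) - F z)"
      by simp
    have "((\<lambda>t. F (lin_exp B t (r *\<^sub>R y)) - r * F (lin_exp B t y)) has_real_derivative 0) (at t)" for t
    proof -
      let ?d = "\<lambda>y. DF (lin_exp B t y) (B (lin_exp B t y))"
      have "((\<lambda>t. F (lin_exp B t (r *\<^sub>R y)) - r * F (lin_exp B t y)) has_real_derivative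
          ?d (r *\<^sub>R y) - r * ?d y) (at t)"
        by (intro DERIV_diff DERIV_cmult F_lin_exp_has_derivative assms)
      moreover have "?d (r *\<^sub>R y) - r * ?d y = 0" by (simp add: linear_scale[OF E] linear_scale[OF l(2)])
      ultimately show ?thesis by metis
    qed
    then have "F (lin_exp B t (r *\<^sub>R y)) - r * F (lin_exp B t y)
        = F (lin_exp B 0 (r *\<^sub>R y)) - r * F (lin_exp B 0 y)"
      by (intro DERIV_isconst_all) blast
    then show "F (lin_exp B t (r *\<^sub>R y)) - F (r *\<^sub>R y) = r *\<^sub>R (F (lin_exp B t y) - F y)"
      by (simp add: algebra_simps)
  qed
qed

definition grad :: "'e \<Rightarrow> 'e"
  where "grad y = (\<Sum>b\<in>Basis. DF y b *\<^sub>R b)"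

lemma DF_grad: "DF y v = v \<bullet> grad y"
proof -
  have "DF y v = DF y (\<Sum>b\<in>Basis. (v \<bullet> b) *\<^sub>R b)" by (simp add: euclidean_representation)
  also have "\<dots> = (\<Sum>b\<in>Basis. (v \<bullet> b) * DF y b)"
    by (simp add: linear_sum[OF linear_DF] linear_scale[OF linear_DF])
  finally show ?thesis by (simp add: grad_def inner_sum_right mult.commute)
qed

text \<open>Preparation for the bracket using only first derivatives of \<open>F\<close>.
  Differentiating \<open>F (E y) = F y + \<beta> y\<close> in \<open>y\<close> tells how the
  gradient moves under the orthogonal map \<open>E\<close>; in the direction
  \<open>adjoint E (C (E y))\<close> this writes the expression as a difference of two linear
  functions of \<open>y\<close>.\<close>

lemma inner_linear_of_lin_exp:
  assumes "B \<in> alg" "C \<in> alg"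
  shows "linear (\<lambda>y. C (lin_exp B t y) \<bullet> lin_exp B t (grad y))"
proof -
  have lB: "linear B" using assms(1) by (simp add: alg_def)
  have lC: "linear C" "linear (\<lambda>y. DF y (C y))" using assms(2) by (auto simp: alg_def)
  define E where "E = lin_exp B t"
  have E: "linear E" unfolding E_def by (rule linear_lin_exp[OF lB])
  have nE: "norm (E y) = norm y" for y unfolding E_def by (rule alg_norm_lin_exp[OF assms(1)])
  note iE = norm_preserving_imp_inner_preserving[OF E nE]
  define \<beta> where "\<beta> y = F (E y) - F y" for y
  have l\<beta>: "linear \<beta>" unfolding \<beta>_def E_def by (rule linear_F_lin_exp_diff[OF assms(1)])
  have ad: "linear (adjoint E)" by (rule adjoint_linear[OF E])
  have "inj E" unfolding linear_injective_0[OF E] using nE by (metis norm_eq_zero)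
  then have "surj E" using linear_injective_imp_surjective[OF E] by simp
  have Ead: "E (adjoint E x) = x" for x
  proof -
    obtain z where z: "x = E z" using \<open>surj E\<close> by (metis surjD)
    have "adjoint E x = z"
    proof (rule vector_eq_rdot[THEN iffD1, rule_format])
      fix w show "adjoint E x \<bullet> w = z \<bullet> w"
        using adjoint_works[OF E, of w x] iE[of w z] z by (simp add: inner_commute)
    qed
    then show ?thesis using z by simp
  qed
  have "C (E y) \<bullet> E (grad y) = DF (E y) (C (E y)) - \<beta> (adjoint E (C (E y)))" for y
  proof (cases "y = 0")
    case True
    then show ?thesis using linear_0[OF E] linear_0[OF lC(1)] linear_0[OF l\<beta>] linear_0[OF ad] linear_0[OF linear_DF] by simp
  next
    case False
    then have Ey: "E y \<noteq> 0" using nE by (metis norm_eq_zero)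
    have E': "(E has_derivative E) (at y)" using E by (simp add: linear_imp_has_derivative)
    have "((\<lambda>y. F (E y)) has_derivative (\<lambda>v. DF (E y) (E v))) (at y)"
      by (rule has_derivative_compose[OF E' DF[OF Ey]])
    moreover have "((\<lambda>y. F y + \<beta> y) has_derivative (\<lambda>v. DF y v + \<beta> v)) (at y)"
      by (rule has_derivative_add[OF DF[OF False] linear_imp_has_derivative[OF l\<beta>]])
    moreover have "(\<lambda>y. F y + \<beta> y) = (\<lambda>y. F (E y))" by (simp add: \<beta>_def)
    ultimately have "(\<lambda>v. DF (E y) (E v)) = (\<lambda>v. DF y v + \<beta> v)"
      using has_derivative_unique by metis
    from fun_cong[OF this, of "adjoint E (C (E y))"]
    have "DF (E y) (C (E y)) = adjoint E (C (E y)) \<bullet> grad y + \<beta> (adjoint E (C (E y)))"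
      by (simp add: Ead DF_grad)
    moreover have "adjoint E (C (E y)) \<bullet> grad y = C (E y) \<bullet> E (grad y)"
      using adjoint_works[OF E, of "grad y" "C (E y)"] by (simp add: inner_commute)
    ultimately show ?thesis by simp
  qed
  moreover have "linear (\<lambda>y. DF (E y) (C (E y)) - \<beta> (adjoint E (C (E y))))"
    by (intro linear_compose_sub linear_compose[OF E lC(2), unfolded o_def]
        linear_compose[OF linear_compose[OF linear_compose[OF E lC(1)] ad] l\<beta>, unfolded o_def])
  ultimately show ?thesis unfolding E_def by simp
qed

text \<open>Each \<open>k t\<close> is linear, and since \<open>B\<close> is skew its time
  derivative at zero is \<open>DF y (bracket C B y)\<close>; a pointwise derivative of linear
  functions is linear. A direct computation would call for second derivatives of
  \<open>F\<close>.\<close>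

lemma alg_bracket:
  assumes "B \<in> alg" "C \<in> alg"
  shows "bracket C B \<in> alg"
proof -
  have lB: "linear B" using assms(1) by (simp add: alg_def)
  have lC: "linear C" using assms(2) by (simp add: alg_def)
  define k where "k t y = C (lin_exp B t y) \<bullet> lin_exp B t (grad y)" for t y
  have lk: "linear (k t)" for t unfolding k_def by (rule inner_linear_of_lin_exp[OF assms])
  have dk: "((\<lambda>t. k t y) has_real_derivative DF y (bracket C B y)) (at 0)" for y
  proof -
    have 1: "((\<lambda>t. lin_exp B t z) has_derivative (\<lambda>s. s *\<^sub>R B z)) (at 0)" for z
      using lin_exp_has_vector_derivative[OF lB, of z 0] by (simp add: has_vector_derivative_def)
    have 2: "((\<lambda>t. C (lin_exp B t y)) has_derivative (\<lambda>s. C (s *\<^sub>R B y))) (at 0)"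
      using has_derivative_compose[OF 1 linear_imp_has_derivative[OF lC]] .
    have "((\<lambda>t. k t y) has_derivative
        (\<lambda>s. C (lin_exp B 0 y) \<bullet> (s *\<^sub>R B (grad y)) + C (s *\<^sub>R B y) \<bullet> lin_exp B 0 (grad y))) (at 0)"
      unfolding k_def by (rule has_derivative_inner[OF 2 1])
    moreover have "C y \<bullet> B (grad y) = - (B (C y) \<bullet> grad y)"
      using skew_mapsD(2)[OF alg_skew[OF assms(1)], of "C y" "grad y"] by simp
    ultimately have "((\<lambda>t. k t y) has_derivative
        (\<lambda>s. s * (C (B y) \<bullet> grad y) - s * (B (C y) \<bullet> grad y))) (at 0)"
      by (simp add: linear_scale[OF lC])
    moreover have "(\<lambda>s. s * (C (B y) \<bullet> grad y) - s * (B (C y) \<bullet> grad y)) = (*) (DF y (bracket C B y))"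
      by (auto simp: DF_grad bracket_def inner_diff_left algebra_simps)
    ultimately show ?thesis by (simp add: has_field_derivative_def)
  qed
  have "linear (bracket C B)"
    unfolding bracket_def
    by (intro linear_compose_sub linear_compose[OF lB lC, unfolded o_def] linear_compose[OF lC lB, unfolded o_def])
  moreover have "linear (\<lambda>y. DF y (bracket C B y))"
  proof (rule linearI)
    fix y z :: 'e and r :: real
    have "((\<lambda>t. k t (y + z)) has_real_derivative DF y (bracket C B y) + DF z (bracket C B z)) (at 0)"
      using DERIV_add[OF dk[of y] dk[of z]] by (simp add: linear_add[OF lk])
    then show "DF (y + z) (bracket C B (y + z)) = DF y (bracket C B y) + DF z (bracket C B z)"
      using DERIV_unique[OF dk] by blast
    have "((\<lambda>t. k t (r *\<^sub>R y)) has_real_derivative r * DF y (bracket C B y)) (at 0)"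
      using DERIV_cmult[OF dk[of y], of r] by (simp add: linear_scale[OF lk])
    then show "DF (r *\<^sub>R y) (bracket C B (r *\<^sub>R y)) = r *\<^sub>R DF y (bracket C B y)"
      using DERIV_unique[OF dk] by simp
  qed
  ultimately show ?thesis by (simp add: alg_def)
qed

text \<open>The circle is an orbit of the flow of \<open>B\<close>, so the derivative of
  \<open>F\<close> along it is a linear form of the moving point, a combination of
  \<open>cos t\<close> and \<open>sin t\<close> that integrates at once.\<close>

lemma F_on_circle:
  assumes B: "B \<in> alg" "B y = u" "B u = - y" and n: "norm y = 1"  "norm u = 1" "y \<bullet> u = 0"
  shows "F (cos t *\<^sub>R y + sin t *\<^sub>R u) = F y + sin t * DF y u + (1 - cos t) * DF u (- y)"
proof -
  have l: "linear B" "linear (\<lambda>y. DF y (B y))" using B(1) by (auto simp: alg_def)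
  define c where "c t = cos t *\<^sub>R y + sin t *\<^sub>R u" for t
  have c0: "c t \<noteq> 0" for t
  proof
    assume "c t = 0"
    then have "c t \<bullet> y = 0" "c t \<bullet> u = 0" by auto
    moreover have "c t \<bullet> y = cos t" "c t \<bullet> u = sin t"
      using n by (auto simp: c_def inner_simps norm_eq_1 inner_commute)
    ultimately show False using sin_cos_squared_add[of t] by simp
  qed
  have ell: "DF (c t) (B (c t)) = cos t * DF y u + sin t * DF u (- y)" for t
    using linear_add[OF l(2)] linear_scale[OF l(2)] B(2,3) by (simp add: c_def)
  have Bc: "B (c t) = (- sin t) *\<^sub>R y + cos t *\<^sub>R u" for t
    using B(2,3) by (simp add: c_def linear_add[OF l(1)] linear_scale[OF l(1)])
  have dc: "(c has_derivative (\<lambda>s. s *\<^sub>R B (c t))) (at t)" for t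
    unfolding c_def Bc[unfolded c_def]
    by (auto intro!: derivative_eq_intros simp: algebra_simps)
  have dF: "((\<lambda>t. F (c t)) has_real_derivative cos t * DF y u + sin t * DF u (- y)) (at t)" for t
    using has_derivative_compose[OF dc[of t] DF[OF c0[of t]]] unfolding ell[symmetric]
    by (simp add: has_field_derivative_def linear_scale[OF linear_DF] mult_commute_abs)
  have "((\<lambda>t. F (c t) - (sin t * DF y u - cos t * DF u (- y))) has_real_derivative 0) (at t)" for t
    by (rule DERIV_cong[OF DERIV_diff[OF dF]]) (auto intro!: derivative_eq_intros)
  then have "F (c t) - (sin t * DF y u - cos t * DF u (- y)) = F (c 0) - (sin 0 * DF y u - cos 0 * DF u (- y))"
    by (intro DERIV_isconst_all) blast
  then show ?thesis by (simp add: c_def algebra_simps)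
qed

text \<open>On every great circle \<open>F\<close> is a constant plus a combination of
  \<open>cos t\<close> and \<open>sin t\<close>. Its even part is therefore constant on great
  circles, hence on the unit sphere, and its odd part is linear on planes, hence linear.\<close>

theorem Randers_of_large_alg:
  assumes dim2: "2 \<le> DIM('e)"
    and large: "\<exists>B\<subseteq>alg. finite B \<and> independent B \<and> (DIM('e) - 1) * (DIM('e) - 2) < 2 * card B"
  obtains c \<beta> where "c > 0" "linear \<beta>" "\<And>y. F y = c * norm y + \<beta> y"
proof -
  interpret large_skew_algebra alg
    by unfold_locales (use subspace_alg alg_skew alg_bracket large dim2 in auto)
  have circle: "\<exists>r q. \<forall>t. F (cos t *\<^sub>R y + sin t *\<^sub>R u) = F y + sin t * r + (1 - cos t) * q"
    if "norm y = 1" "norm u = 1" "y \<bullet> u = 0" for y u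
    using rotation_exists[OF that] F_on_circle that by metis
  define \<beta> where "\<beta> y = (F y - F (- y)) / 2" for y
  define M where "M y = (F y + F (- y)) / 2" for y
  have FM: "F y = M y + \<beta> y" for y by (simp add: M_def \<beta>_def field_simps)
  have circ: "M (cos t *\<^sub>R y + sin t *\<^sub>R u) = M y \<and>
      \<beta> (cos t *\<^sub>R y + sin t *\<^sub>R u) = cos t * \<beta> y + sin t * \<beta> u"
    if n: "norm y = 1" "norm u = 1" "y \<bullet> u = 0" for y u t
  proof -
    obtain r q where rq: "\<And>t. F (cos t *\<^sub>R y + sin t *\<^sub>R u) = F y + sin t * r + (1 - cos t) * q"
      using circle[OF n] by blast
    \<comment> \<open>The values at \<open>pi\<close> and at plus and minus \<open>pi / 2\<close>
      express \<open>r\<close> and \<open>q\<close> through \<open>F\<close>; shifting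
      \<open>t\<close> by \<open>pi\<close> supplies the antipodal point.\<close>
    have 1: "F (- y) = F y + 2 * q" using rq[of pi] by simp
    have 2: "F u = F y + r + q" using rq[of "pi / 2"] by simp
    have 3: "F (- u) = F y - r + q" using rq[of "- (pi / 2)"] by simp
    have 4: "F (- (cos t *\<^sub>R y + sin t *\<^sub>R u)) = F y - sin t * r + (1 + cos t) * q"
      using rq[of "t + pi"] by simp
    show ?thesis
      unfolding M_def \<beta>_def 4 rq[of t] 1 2 3 by (simp add: field_simps)
  qed
  have \<beta>scale: "\<beta> (a *\<^sub>R y) = a * \<beta> y" for a y
  proof -
    consider "a > 0" | "a = 0" | "a < 0" by linarith
    then show ?thesis
    proof cases
      case 1
      then show ?thesis using F_scale[OF 1, of y] F_scale[OF 1, of "- y"] by (simp add: \<beta>_def algebra_simps)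
    next
      case 2 then show ?thesis by (simp add: \<beta>_def)
    next
      case 3
      then have "- a > 0" by simp
      from F_scale[OF this, of y] F_scale[OF this, of "- y"] show ?thesis by (simp add: \<beta>_def algebra_simps)
    qed
  qed
  have polar: "\<exists>r t. r \<ge> 0 \<and> a = r * cos t \<and> b = r * sin t" for a b :: real
  proof (cases "a\<^sup>2 + b\<^sup>2 = 0")
    case True
    then show ?thesis by (intro exI[of _ 0]) auto
  next
    case False
    define r where "r = sqrt (a\<^sup>2 + b\<^sup>2)"
    have "a\<^sup>2 + b\<^sup>2 > 0" using False by (smt (verit) zero_le_power2)
    then have r: "r > 0" "r\<^sup>2 = a\<^sup>2 + b\<^sup>2" by (auto simp: r_def)
    have "(a / r)\<^sup>2 + (b / r)\<^sup>2 = r\<^sup>2 / r\<^sup>2"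
      unfolding r(2) power_divide by (rule add_divide_distrib[symmetric])
    then have "(a / r)\<^sup>2 + (b / r)\<^sup>2 = 1" using r(1) by simp
    then obtain t where "a / r = cos t" "b / r = sin t" using sincos_total_2pi by metis
    then have "a = r * cos t" "b = r * sin t" using r(1) by (auto simp: field_simps)
    then show ?thesis using r(1) by (intro exI[of _ r] exI[of _ t]) auto
  qed
  have \<beta>plane: "\<beta> (a *\<^sub>R y + b *\<^sub>R u) = a * \<beta> y + b * \<beta> u"
    if n: "norm y = 1" "norm u = 1" "y \<bullet> u = 0" for y u a b
  proof -
    obtain r t where rt: "a = r * cos t" "b = r * sin t" using polar by blast
    have "a *\<^sub>R y + b *\<^sub>R u = r *\<^sub>R (cos t *\<^sub>R y + sin t *\<^sub>R u)" by (simp add: rt scaleR_add_right)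
    then have "\<beta> (a *\<^sub>R y + b *\<^sub>R u) = r * \<beta> (cos t *\<^sub>R y + sin t *\<^sub>R u)"
      using \<beta>scale by simp
    then show ?thesis using circ[OF n, of t] by (simp add: rt algebra_simps)
  qed
  have split: "\<exists>a b u. z = a *\<^sub>R y + b *\<^sub>R u \<and> norm u = 1 \<and> y \<bullet> u = 0" if y: "norm y = 1" for y z :: 'e
  proof (cases "z = (y \<bullet> z) *\<^sub>R y")
    case True
    obtain u where "norm u = 1" "\<And>s. s \<in> {y} \<Longrightarrow> u \<bullet> s = 0"
      using unit_orthogonal_exists[of "{y}"] dim2 by auto
    then show ?thesis using True by (intro exI[of _ "y \<bullet> z"] exI[of _ 0] exI[of _ u]) (auto simp: inner_commute)
  next
    case False
    define w where "w = z - (y \<bullet> z) *\<^sub>R y"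
    have w: "w \<noteq> 0" "y \<bullet> w = 0" using False y by (auto simp: w_def inner_simps norm_eq_1)
    have "z = (y \<bullet> z) *\<^sub>R y + norm w *\<^sub>R (w /\<^sub>R norm w)" using w by (simp add: w_def)
    then show ?thesis
      by (intro exI[of _ "y \<bullet> z"] exI[of _ "norm w"] exI[of _ "w /\<^sub>R norm w"]) (use w in auto)
  qed
  have \<beta>add: "\<beta> (p + q) = \<beta> p + \<beta> q" for p q
  proof (cases "p = 0")
    case True then show ?thesis by (simp add: \<beta>_def F_0)
  next
    case False
    define y where "y = p /\<^sub>R norm p"
    have y: "norm y = 1" "p = norm p *\<^sub>R y" using False by (auto simp: y_def)
    obtain a b u where u: "q = a *\<^sub>R y + b *\<^sub>R u" "norm u = 1" "y \<bullet> u = 0" using split[OF y(1)] by metis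
    have "p + q = (norm p + a) *\<^sub>R y + b *\<^sub>R u" using y(2) u(1) by (simp add: scaleR_add_left)
    then have "\<beta> (p + q) = (norm p + a) * \<beta> y + b * \<beta> u" using \<beta>plane[OF y(1) u(2,3)] by simp
    moreover have "\<beta> q = a * \<beta> y + b * \<beta> u" using \<beta>plane[OF y(1) u(2,3)] u(1) by simp
    moreover have "\<beta> p = norm p * \<beta> y" using \<beta>scale y(2) by metis
    ultimately show ?thesis by (simp add: algebra_simps)
  qed
  obtain e :: 'e where e: "norm e = 1" using vector_choose_size[of 1] by auto
  have Munit: "M z = M e" if z: "norm z = 1" for z
  proof -
    obtain a b u where u: "z = a *\<^sub>R e + b *\<^sub>R u" "norm u = 1" "e \<bullet> u = 0" using split[OF e] by metis
    obtain r t where rt: "r \<ge> 0" "a = r * cos t" "b = r * sin t" using polar by blast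
    have zz: "z = r *\<^sub>R (cos t *\<^sub>R e + sin t *\<^sub>R u)" using u(1) by (simp add: rt scaleR_add_right)
    have "(norm (cos t *\<^sub>R e + sin t *\<^sub>R u))\<^sup>2 = 1"
      using e u(2,3) by (simp add: power2_norm_eq_inner inner_simps norm_eq_1 inner_commute power2_eq_square[symmetric])
    then have "norm (cos t *\<^sub>R e + sin t *\<^sub>R u) = 1" by (simp add: power2_eq_1_iff) (smt (verit) norm_ge_zero)
    then have "r = 1" using z rt(1) by (simp add: zz)
    then show ?thesis using circ[OF e u(2,3), of t] zz by simp
  qed
  have M: "M y = M e * norm y" for y
  proof (cases "y = 0")
    case False
    have "F y = norm y * F (y /\<^sub>R norm y)" using F_scale[of "norm y" "y /\<^sub>R norm y"] False by simp
    moreover have "F (- y) = norm y * F (- (y /\<^sub>R norm y))"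
      using F_scale[of "norm y" "- (y /\<^sub>R norm y)"] False by simp
    ultimately have "M y = norm y * M (y /\<^sub>R norm y)" by (simp add: M_def algebra_simps)
    then show ?thesis using Munit[of "y /\<^sub>R norm y"] False by simp
  qed (simp add: M_def F_0)
  have "e \<noteq> 0" using e by auto
  then have "M e > 0" using F_pos[of e] F_pos[of "- e"] by (simp add: M_def)
  moreover have "linear \<beta>" by (rule linearI) (auto simp: \<beta>add \<beta>scale)
  ultimately show ?thesis using that FM M by metis
qed

end

subsection \<open>Smooth functions\<close>

lemma has_derivative_cong_open:
  assumes "open S" "x \<in> S" "\<And>y. y \<in> S \<Longrightarrow> f y = g y"
  shows "(f has_derivative D) (at x) \<longleftrightarrow> (g has_derivative D) (at x)"
  using has_derivative_transform_within_open[of f D x UNIV S g]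
    has_derivative_transform_within_open[of g D x UNIV S f] assms by auto

lemma frechet_derivative_cong_open:
  assumes "open S" "x \<in> S" "\<And>y. y \<in> S \<Longrightarrow> f y = g y"
  shows "frechet_derivative f (at x) = frechet_derivative g (at x)"
    and "f differentiable (at x) \<longleftrightarrow> g differentiable (at x)"
  unfolding frechet_derivative_def differentiable_def
  using has_derivative_cong_open[OF assms] by auto

lemma C_diff_on_cong:
  assumes "open S" "\<And>y. y \<in> S \<Longrightarrow> f y = g y" "C_diff_on k S f"
  shows "C_diff_on k S g"
  using assms(2,3)
proof (induction k arbitrary: f g)
  case 0 then show ?case by (metis C_diff_on.simps(1) continuous_on_cong)
next
  case (Suc k)
  have *: "frechet_derivative f (at x) = frechet_derivative g (at x)"
    "f differentiable (at x) \<longleftrightarrow> g differentiable (at x)" if "x \<in> S" for x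
    using frechet_derivative_cong_open[OF assms(1) that, of f g] Suc.prems(1) by auto
  have "C_diff_on k S (\<lambda>x. frechet_derivative g (at x) v)" for v
    by (rule Suc.IH[of "\<lambda>x. frechet_derivative f (at x) v"]) (use Suc.prems * in auto)
  then show ?case using Suc.prems * by auto
qed

lemma C_diff_on_SucD: "C_diff_on (Suc k) S f \<Longrightarrow> C_diff_on k S f"
proof (induction k arbitrary: f)
  case 0
  then show ?case
    by (auto intro!: continuous_at_imp_continuous_on differentiable_imp_continuous_within)
next
  case (Suc k)
  then show ?case by (metis C_diff_on.simps(2))
qed

lemma smooth_on_continuous_on: "smooth_on S f \<Longrightarrow> continuous_on S f"
  unfolding smooth_on_def by (metis C_diff_on.simps(1))

lemma smooth_on_has_derivative:
  "smooth_on S f \<Longrightarrow> x \<in> S \<Longrightarrow> (f has_derivative frechet_derivative f (at x)) (at x)"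
  unfolding smooth_on_def frechet_derivative_works[symmetric] by (metis C_diff_on.simps(2))

lemma smooth_on_frechet_derivative:
  "smooth_on S f \<Longrightarrow> smooth_on S (\<lambda>x. frechet_derivative f (at x) v)"
  unfolding smooth_on_def by (metis C_diff_on.simps(2))

lemma smooth_on_linear_frechet:
  "smooth_on S f \<Longrightarrow> x \<in> S \<Longrightarrow> linear (frechet_derivative f (at x))"
  using smooth_on_has_derivative has_derivative_linear by blast

lemma smooth_on_cong: "open S \<Longrightarrow> (\<And>y. y \<in> S \<Longrightarrow> f y = g y) \<Longrightarrow> smooth_on S f \<Longrightarrow> smooth_on S g"
  unfolding smooth_on_def using C_diff_on_cong by blast

lemma C_diff_on_const: "C_diff_on k S (\<lambda>x. c)"
  by (induction k arbitrary: c) auto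

lemma C_diff_on_add:
  assumes "open S"
  shows "C_diff_on k S f \<Longrightarrow> C_diff_on k S g \<Longrightarrow> C_diff_on k S (\<lambda>x. f x + g x)"
proof (induction k arbitrary: f g)
  case 0 then show ?case by (auto intro: continuous_on_add)
next
  case (Suc k)
  have fd: "frechet_derivative f (at x) v + frechet_derivative g (at x) v
      = frechet_derivative (\<lambda>x. f x + g x) (at x) v" if "x \<in> S" for x v
  proof -
    have "f differentiable (at x)" "g differentiable (at x)" using Suc.prems that by auto
    then have "((\<lambda>x. f x + g x) has_derivative
        (\<lambda>v. frechet_derivative f (at x) v + frechet_derivative g (at x) v)) (at x)"
      unfolding frechet_derivative_works by (rule has_derivative_add)
    then show ?thesis by (rule fun_cong[OF frechet_derivative_at])
  qed
  have c: "C_diff_on k S (\<lambda>x. frechet_derivative f (at x) v + frechet_derivative g (at x) v)" for v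
    by (rule Suc.IH) (use Suc.prems in auto)
  have "C_diff_on k S (\<lambda>x. frechet_derivative (\<lambda>x. f x + g x) (at x) v)" for v
    by (rule C_diff_on_cong[OF assms fd c])
  then show ?case using Suc.prems by (auto intro: differentiable_add)
qed

lemma C_diff_on_mult:
  fixes f g :: "'a::real_normed_vector \<Rightarrow> real"
  assumes "open S"
  shows "C_diff_on k S f \<Longrightarrow> C_diff_on k S g \<Longrightarrow> C_diff_on k S (\<lambda>x. f x * g x)"
proof (induction k arbitrary: f g)
  case 0 then show ?case by (auto intro: continuous_on_mult)
next
  case (Suc k)
  have fd: "frechet_derivative (\<lambda>x. f x * g x) (at x) v
      = f x * frechet_derivative g (at x) v + frechet_derivative f (at x) v * g x" if "x \<in> S" for x v
  proof -
    have "f differentiable (at x)" "g differentiable (at x)" using Suc.prems that by auto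
    then have "((\<lambda>x. f x * g x) has_derivative
        (\<lambda>v. f x * frechet_derivative g (at x) v + frechet_derivative f (at x) v * g x)) (at x)"
      unfolding frechet_derivative_works by (rule has_derivative_mult)
    then show ?thesis by (rule fun_cong[OF frechet_derivative_at, symmetric])
  qed
  have "C_diff_on k S (\<lambda>x. f x * frechet_derivative g (at x) v + frechet_derivative f (at x) v * g x)" for v
    by (intro C_diff_on_add[OF assms] Suc.IH) (use Suc.prems C_diff_on_SucD in auto)
  then have "C_diff_on k S (\<lambda>x. frechet_derivative (\<lambda>x. f x * g x) (at x) v)" for v
    by (rule C_diff_on_cong[OF assms, rotated]) (simp add: fd)
  then show ?case using Suc.prems by (auto intro: differentiable_mult)
qed

lemma C_diff_on_affine_compose:
  assumes "open S" "open T" "bounded_linear L" "\<And>x. x \<in> T \<Longrightarrow> a + L x \<in> S"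
  shows "C_diff_on k S f \<Longrightarrow> C_diff_on k T (\<lambda>x. f (a + L x))"
proof (induction k arbitrary: f)
  case 0
  have "continuous_on T (\<lambda>x. a + L x)"
    by (intro continuous_intros linear_continuous_on assms(3))
  then show ?case
    using continuous_on_compose2[of S f T "\<lambda>x. a + L x"] 0 assms(4) by auto
next
  case (Suc k)
  have hd: "((\<lambda>x. f (a + L x)) has_derivative (\<lambda>v. frechet_derivative f (at (a + L x)) (L v))) (at x)" if "x \<in> T" for x
  proof -
    have 1: "((\<lambda>x. a + L x) has_derivative L) (at x)"
      using has_derivative_add[OF has_derivative_const bounded_linear_imp_has_derivative[OF assms(3)]] by simp
    have 2: "(f has_derivative frechet_derivative f (at (a + L x))) (at (a + L x))"
      using Suc.prems assms(4)[OF that] by (auto simp: frechet_derivative_works[symmetric])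
    show ?thesis by (rule has_derivative_compose[OF 1 2])
  qed
  have c: "C_diff_on k T (\<lambda>x. frechet_derivative f (at (a + L x)) (L v))" for v
    using Suc.IH[of "\<lambda>y. frechet_derivative f (at y) (L v)"] Suc.prems by auto
  have "C_diff_on k T (\<lambda>x. frechet_derivative (\<lambda>x. f (a + L x)) (at x) v)" for v
    by (rule C_diff_on_cong[OF assms(2) fun_cong[OF frechet_derivative_at[OF hd]] c])
  then show ?case using hd by (auto simp: differentiable_def)
qed

lemma smooth_on_const: "smooth_on S (\<lambda>x. c)"
  unfolding smooth_on_def using C_diff_on_const by blast

lemma smooth_on_add: "open S \<Longrightarrow> smooth_on S f \<Longrightarrow> smooth_on S g \<Longrightarrow> smooth_on S (\<lambda>x. f x + g x)"
  unfolding smooth_on_def using C_diff_on_add by blast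

lemma smooth_on_mult:
  fixes f g :: "'a::real_normed_vector \<Rightarrow> real"
  shows "open S \<Longrightarrow> smooth_on S f \<Longrightarrow> smooth_on S g \<Longrightarrow> smooth_on S (\<lambda>x. f x * g x)"
  unfolding smooth_on_def using C_diff_on_mult by blast

lemma smooth_on_affine_compose:
  assumes "open S" "open T" "bounded_linear L" "\<And>x. x \<in> T \<Longrightarrow> a + L x \<in> S" "smooth_on S f"
  shows "smooth_on T (\<lambda>x. f (a + L x))"
  using assms C_diff_on_affine_compose[OF assms(1-4)] unfolding smooth_on_def by blast

section \<open>Strict differentiability and symmetry of second derivatives\<close>

lemma linear_norm_le_sum:
  fixes f :: "'a::euclidean_space \<Rightarrow> 'b::real_normed_vector"
  assumes "linear f"
  shows "norm (f v) \<le> (\<Sum>b\<in>Basis. norm (f b)) * norm v"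
proof -
  have "f v = f (\<Sum>b\<in>Basis. (v \<bullet> b) *\<^sub>R b)" by (simp add: euclidean_representation)
  also have "\<dots> = (\<Sum>b\<in>Basis. (v \<bullet> b) *\<^sub>R f b)"
    by (simp add: linear_sum[OF assms] linear_scale[OF assms])
  finally have "norm (f v) \<le> (\<Sum>b\<in>Basis. norm ((v \<bullet> b) *\<^sub>R f b))" by (simp only: norm_sum)
  also have "\<dots> \<le> (\<Sum>b\<in>Basis. norm v * norm (f b))"
    by (intro sum_mono) (auto intro: mult_right_mono Basis_le_norm)
  finally show ?thesis by (simp add: sum_distrib_left mult.commute)
qed

text \<open>The mean value inequality is applied to the map minus its linearisation at
  \<open>x0\<close>, whose derivative is small near \<open>x0\<close>. Both endpoints vary freely,
  as the second difference below and the flow estimate require.\<close>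

lemma smooth_on_strict_derivative:
  fixes f :: "'a::euclidean_space \<Rightarrow> 'b::real_normed_vector"
  assumes "smooth_on S f" "open S" "x0 \<in> S" "0 < e"
  obtains d where "d > 0" "ball x0 d \<subseteq> S"
    "\<And>a b. a \<in> ball x0 d \<Longrightarrow> b \<in> ball x0 d \<Longrightarrow>
      norm (f a - f b - frechet_derivative f (at x0) (a - b)) \<le> e * norm (a - b)"
proof -
  let ?D = "\<lambda>x. frechet_derivative f (at x)"
  define h where "h x = (\<Sum>b\<in>Basis. norm (?D x b - ?D x0 b))" for x
  have ch: "isCont h x0"
    unfolding h_def
  proof (intro continuous_intros)
    fix b :: 'a
    show "isCont (\<lambda>x. ?D x b) x0"
      using smooth_on_continuous_on[OF smooth_on_frechet_derivative[OF assms(1), of b]] assms(2,3)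
      by (simp add: continuous_on_eq_continuous_at)
  qed
  have "h x0 = 0" by (simp add: h_def)
  then have "\<forall>\<^sub>F x in nhds x0. h x < e"
    using ch assms(4) by (metis isCont_def tendsto_nhds_iff order_tendstoD(2))
  moreover have "\<forall>\<^sub>F x in nhds x0. x \<in> S" using assms(2,3) by (rule eventually_nhds_in_open)
  ultimately have "\<forall>\<^sub>F x in nhds x0. h x < e \<and> x \<in> S" by eventually_elim auto
  then obtain d where d: "d > 0" "\<And>x. dist x x0 < d \<Longrightarrow> h x < e \<and> x \<in> S"
    unfolding eventually_nhds_metric by blast
  have dS: "ball x0 d \<subseteq> S" using d(2) by (auto simp: dist_commute)
  have l0: "linear (?D x0)" by (rule smooth_on_linear_frechet[OF assms(1,3)])
  have "norm ((f a - ?D x0 a) - (f b - ?D x0 b)) \<le> e * norm (a - b)" if "a \<in> ball x0 d" "b \<in> ball x0 d" for a b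
  proof (rule differentiable_bound[where S = "ball x0 d" and f' = "\<lambda>x v. ?D x v - ?D x0 v"])
    fix x assume x: "x \<in> ball x0 d"
    have xS: "x \<in> S" using x dS by blast
    have D: "(f has_derivative ?D x) (at x)" by (rule smooth_on_has_derivative[OF assms(1) xS])
    show "((\<lambda>x. f x - ?D x0 x) has_derivative (\<lambda>v. ?D x v - ?D x0 v)) (at x within ball x0 d)"
      by (rule has_derivative_at_withinI[OF has_derivative_diff[OF D linear_imp_has_derivative[OF l0]]])
    have l: "linear (\<lambda>v. ?D x v - ?D x0 v)" by (rule linear_compose_sub[OF has_derivative_linear[OF D] l0])
    have "norm (?D x v - ?D x0 v) \<le> e * norm v" for v
    proof -
      have "norm (?D x v - ?D x0 v) \<le> h x * norm v" using linear_norm_le_sum[OF l, of v] by (simp add: h_def)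
      also have "\<dots> \<le> e * norm v" using d(2)[of x] x by (intro mult_right_mono) (auto simp: dist_commute)
      finally show ?thesis .
    qed
    then show "onorm (\<lambda>v. ?D x v - ?D x0 v) \<le> e" by (rule onorm_le)
  qed (use that in auto)
  then show ?thesis
    using that[OF d(1) dS] by (simp add: linear_diff[OF l0] algebra_simps)
qed

lemma affine_line_has_derivative: "((\<lambda>t. a + t *\<^sub>R c) has_derivative (\<lambda>h. h *\<^sub>R c)) (at t within S)"
  by (auto intro!: derivative_eq_intros)

text \<open>
  The second difference \<open>f (x + v + w) - f (x + v) - f (x + w) + f x\<close> is symmetric, and strict
  differentiability of the first derivatives evaluates it in both orders.
\<close>

lemma symmetric_second_frechet_derivative:
  fixes f :: "'a::euclidean_space \<Rightarrow> 'b::real_normed_vector"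
  assumes f: "smooth_on S f" and S: "open S" "x \<in> S"
  shows "frechet_derivative (\<lambda>x. frechet_derivative f (at x) v) (at x) w
    = frechet_derivative (\<lambda>x. frechet_derivative f (at x) w) (at x) v"
proof -
  let ?D = "\<lambda>v x. frechet_derivative f (at x) v"
  let ?H = "\<lambda>v w. frechet_derivative (?D v) (at x) w"
  define \<Delta> where "\<Delta> s v w = f (x + s *\<^sub>R v + s *\<^sub>R w) - f (x + s *\<^sub>R v) - f (x + s *\<^sub>R w) + f x" for s v w
  have sym: "\<Delta> s v w = \<Delta> s w v" for s v w by (simp add: \<Delta>_def algebra_simps)
  have est: "\<exists>s0>0. \<forall>s. 0 < s \<and> s < s0 \<longrightarrow> norm (\<Delta> s v w - s\<^sup>2 *\<^sub>R ?H v w) \<le> e * s\<^sup>2 * norm w" if e: "e > 0" for v w e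
  proof -
    obtain d where d: "d > 0" "ball x d \<subseteq> S"
      "\<And>a b. a \<in> ball x d \<Longrightarrow> b \<in> ball x d \<Longrightarrow> norm (?D v a - ?D v b - ?H v (a - b)) \<le> e * norm (a - b)"
      using smooth_on_strict_derivative[OF smooth_on_frechet_derivative[OF f, of v] S e] by blast
    define s0 where "s0 = d / (norm v + norm w + 1)"
    have np: "norm v + norm w + 1 > 0" by (simp add: add_nonneg_pos)
    have s0: "s0 > 0" using d(1) np by (simp add: s0_def)
    have "norm (\<Delta> s v w - s\<^sup>2 *\<^sub>R ?H v w) \<le> e * s\<^sup>2 * norm w" if s: "0 < s" "s < s0" for s
    proof -
      have sd: "s * (norm v + norm w + 1) < d" using s(2) np by (simp add: s0_def field_simps)
      have nb: "x + u \<in> ball x d" if "norm u < d" for u using that by (simp add: dist_norm)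
      have inb: "x + t *\<^sub>R (s *\<^sub>R v) + k *\<^sub>R (s *\<^sub>R w) \<in> ball x d" if "0 \<le> t" "t \<le> 1" "0 \<le> k" "k \<le> 1" for t k
      proof -
        have "norm (t *\<^sub>R (s *\<^sub>R v) + k *\<^sub>R (s *\<^sub>R w)) \<le> t * (s * norm v) + k * (s * norm w)"
          using norm_triangle_ineq[of "t *\<^sub>R (s *\<^sub>R v)" "k *\<^sub>R (s *\<^sub>R w)"] that s by simp
        also have "\<dots> \<le> 1 * (s * norm v) + 1 * (s * norm w)"
          using that s by (intro add_mono mult_right_mono) auto
        also have "\<dots> \<le> s * (norm v + norm w + 1)" using s by (simp add: algebra_simps)
        finally have "norm (t *\<^sub>R (s *\<^sub>R v) + k *\<^sub>R (s *\<^sub>R w)) < d" using sd by (rule le_less_trans)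
        from nb[OF this] show ?thesis by (simp only: add.assoc)
      qed
      \<comment> \<open>The increment of \<open>g\<close> over the unit interval is the second
        difference minus its expected value, and its derivative is controlled by strict
        differentiability of the first derivative in direction \<open>v\<close>.\<close>
      define g where "g t = f (x + t *\<^sub>R (s *\<^sub>R v) + s *\<^sub>R w) - f (x + t *\<^sub>R (s *\<^sub>R v)) - t *\<^sub>R (s\<^sup>2 *\<^sub>R ?H v w)" for t
      define g' where "g' t = s *\<^sub>R (?D v (x + t *\<^sub>R (s *\<^sub>R v) + s *\<^sub>R w) - ?D v (x + t *\<^sub>R (s *\<^sub>R v)) - ?H v (s *\<^sub>R w))" for t
      have lH: "linear (?H v)" by (rule smooth_on_linear_frechet[OF smooth_on_frechet_derivative[OF f] S(2)])
      have "norm (g 1 - g 0) \<le> (e * s\<^sup>2 * norm w) * norm (1 - 0 :: real)"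
      proof (rule differentiable_bound[where S = "{0..1}" and f' = "\<lambda>t h. h *\<^sub>R g' t"])
        fix t :: real assume t: "t \<in> {0..1}"
        let ?a = "x + t *\<^sub>R (s *\<^sub>R v) + s *\<^sub>R w" and ?b = "x + t *\<^sub>R (s *\<^sub>R v)"
        have ab: "?a \<in> ball x d" "?b \<in> ball x d" using inb[of t 1] inb[of t 0] t by auto
        have Da: "(f has_derivative frechet_derivative f (at ?a)) (at ?a)"
          and Db: "(f has_derivative frechet_derivative f (at ?b)) (at ?b)"
          using smooth_on_has_derivative[OF f] ab d(2) by blast+
        note la = has_derivative_linear[OF Da] and lb = has_derivative_linear[OF Db]
        have pa: "((\<lambda>t. x + t *\<^sub>R (s *\<^sub>R v) + s *\<^sub>R w) has_derivative (\<lambda>h. h *\<^sub>R (s *\<^sub>R v))) (at t)"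
          and pb: "((\<lambda>t. x + t *\<^sub>R (s *\<^sub>R v)) has_derivative (\<lambda>h. h *\<^sub>R (s *\<^sub>R v))) (at t)"
          and pc: "((\<lambda>t. t *\<^sub>R (s\<^sup>2 *\<^sub>R ?H v w)) has_derivative (\<lambda>h. h *\<^sub>R (s\<^sup>2 *\<^sub>R ?H v w))) (at t)"
          using affine_line_has_derivative[of "x + s *\<^sub>R w" "s *\<^sub>R v" t UNIV]
            affine_line_has_derivative[of x "s *\<^sub>R v" t UNIV]
            affine_line_has_derivative[of 0 "s\<^sup>2 *\<^sub>R ?H v w" t UNIV]
          by (simp_all only: add_ac add_0)
        have "(g has_derivative (\<lambda>h. frechet_derivative f (at ?a) (h *\<^sub>R (s *\<^sub>R v))
            - frechet_derivative f (at ?b) (h *\<^sub>R (s *\<^sub>R v)) - h *\<^sub>R (s\<^sup>2 *\<^sub>R ?H v w))) (at t)"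
          unfolding g_def
          by (intro has_derivative_diff has_derivative_compose[OF pa Da] has_derivative_compose[OF pb Db] pc)
        moreover have "(\<lambda>h. frechet_derivative f (at ?a) (h *\<^sub>R (s *\<^sub>R v))
            - frechet_derivative f (at ?b) (h *\<^sub>R (s *\<^sub>R v)) - h *\<^sub>R (s\<^sup>2 *\<^sub>R ?H v w)) = (\<lambda>h. h *\<^sub>R g' t)"
          unfolding linear_scale[OF la] linear_scale[OF lb] g'_def linear_scale[OF lH]
          by (auto simp: algebra_simps power2_eq_square)
        ultimately show "(g has_derivative (\<lambda>h. h *\<^sub>R g' t)) (at t within {0..1})"
          by (metis has_derivative_at_withinI)
        have "norm (g' t) \<le> s * (e * norm (?a - ?b))"
          unfolding g'_def norm_scaleR using d(3)[OF ab] s by (simp add: mult_left_mono)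
        also have "\<dots> = e * s\<^sup>2 * norm w" using s by (simp add: power2_eq_square)
        finally show "onorm (\<lambda>h. h *\<^sub>R g' t) \<le> e * s\<^sup>2 * norm w"
          by (intro onorm_le) (auto simp: mult.commute intro!: mult_left_mono)
      qed auto
      moreover have "g 1 - g 0 = \<Delta> s v w - s\<^sup>2 *\<^sub>R ?H v w" by (simp add: g_def \<Delta>_def)
      ultimately show ?thesis by simp
    qed
    then show ?thesis using s0 by blast
  qed
  have "norm (?H v w - ?H w v) \<le> e" if "e > 0" for e
  proof -
    \<comment> \<open>With this scaling the two error terms add up to at most \<open>e\<close> times
      the square of \<open>s\<close>; the summand 1 prevents a zero denominator.\<close>
    define e' where "e' = e / (norm v + norm w + 1)"
    have np: "norm v + norm w + 1 > 0" by (simp add: add_nonneg_pos)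
    then have e': "e' > 0" using that by (simp add: e'_def)
    obtain s1 where s1: "s1 > 0" "\<And>s. 0 < s \<Longrightarrow> s < s1 \<Longrightarrow> norm (\<Delta> s v w - s\<^sup>2 *\<^sub>R ?H v w) \<le> e' * s\<^sup>2 * norm w"
      using est[OF e', of v w] by blast
    obtain s2 where s2: "s2 > 0" "\<And>s. 0 < s \<Longrightarrow> s < s2 \<Longrightarrow> norm (\<Delta> s w v - s\<^sup>2 *\<^sub>R ?H w v) \<le> e' * s\<^sup>2 * norm v"
      using est[OF e', of w v] by blast
    define s where "s = min s1 s2 / 2"
    have s: "0 < s" "s < s1" "s < s2" using s1(1) s2(1) by (auto simp: s_def min_def)
    have "s\<^sup>2 * norm (?H v w - ?H w v) = norm (s\<^sup>2 *\<^sub>R ?H v w - s\<^sup>2 *\<^sub>R ?H w v)"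
      using s by (simp flip: scaleR_diff_right)
    also have "\<dots> = norm ((\<Delta> s w v - s\<^sup>2 *\<^sub>R ?H w v) - (\<Delta> s v w - s\<^sup>2 *\<^sub>R ?H v w))"
      using sym[of s v w] by (simp add: algebra_simps)
    also have "\<dots> \<le> e' * s\<^sup>2 * norm v + e' * s\<^sup>2 * norm w"
      using norm_triangle_ineq4 s1(2)[OF s(1,2)] s2(2)[OF s(1,3)] by (meson add_mono order_trans)
    also have "\<dots> \<le> s\<^sup>2 * (e' * (norm v + norm w + 1))" using e' by (simp add: algebra_simps)
    also have "\<dots> = s\<^sup>2 * e" using np by (simp add: e'_def)
    finally show ?thesis using s by simp
  qed
  then have "norm (?H v w - ?H w v) \<le> 0" by (rule field_le_epsilon[of _ 0, simplified])
  then show ?thesis by simp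
qed

section \<open>Compactness and Gronwall arguments\<close>

lemma convergent_subsequence_family:
  fixes s :: "nat \<Rightarrow> 'i \<Rightarrow> 'b::heine_borel"
  assumes "finite I" "\<And>i. i \<in> I \<Longrightarrow> bounded (range (\<lambda>n. s n i))"
  shows "\<exists>r l. strict_mono (r :: nat \<Rightarrow> nat) \<and> (\<forall>i\<in>I. (\<lambda>n. s (r n) i) \<longlonglongrightarrow> l i)"
  using assms
proof (induction I rule: finite_induct)
  case empty
  show ?case by (intro exI[of _ id]) (auto simp: strict_mono_def)
next
  case (insert j I)
  then obtain r l where r: "strict_mono (r :: nat \<Rightarrow> nat)" "\<And>i. i \<in> I \<Longrightarrow> (\<lambda>n. s (r n) i) \<longlonglongrightarrow> l i" by auto
  have bj: "bounded (range (\<lambda>n. s n j))" using insert.prems by simp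
  have "bounded (range (\<lambda>n. s (r n) j))" by (rule bounded_subset[OF bj]) auto
  then obtain l' r' where r': "strict_mono (r' :: nat \<Rightarrow> nat)" "((\<lambda>n. s (r n) j) \<circ> r') \<longlonglongrightarrow> l'"
    using bounded_imp_convergent_subsequence[of "\<lambda>n. s (r n) j"] by blast
  show ?case
  proof (intro exI conjI ballI)
    show "strict_mono (r \<circ> r')" using r(1) r'(1) by (simp add: strict_mono_o)
    fix i assume "i \<in> insert j I"
    then show "(\<lambda>n. s ((r \<circ> r') n) i) \<longlonglongrightarrow> (if i = j then l' else l i)"
      using r'(2) LIMSEQ_subseq_LIMSEQ[OF r(2) r'(1)] insert.hyps by (auto simp: o_def)
  qed
qed

lemma bilinear_basis_expansion:
  assumes "bilinear S"
  shows "S u v = (\<Sum>b\<in>Basis. \<Sum>b'\<in>Basis. ((u \<bullet> b) * (v \<bullet> b')) *\<^sub>R S b b')"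
proof -
  have l: "linear (\<lambda>u. S u v)" "linear (S u)" for u v using assms by (auto simp: bilinear_def)
  have "S u v = S (\<Sum>b\<in>Basis. (u \<bullet> b) *\<^sub>R b) (\<Sum>b\<in>Basis. (v \<bullet> b) *\<^sub>R b)" by (simp add: euclidean_representation)
  then have "S u v = (\<Sum>a\<in>Basis. \<Sum>x\<in>Basis. (v \<bullet> a * (u \<bullet> x)) *\<^sub>R S x a)"
    by (simp only: linear_sum[OF l(1)] linear_scale[OF l(1)] linear_sum[OF l(2)] linear_scale[OF l(2)] scaleR_sum_right scaleR_scaleR)
  also have "\<dots> = (\<Sum>b\<in>Basis. \<Sum>b'\<in>Basis. ((u \<bullet> b) * (v \<bullet> b')) *\<^sub>R S b b')"
    by (subst sum.swap) (simp only: mult.commute)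
  finally show ?thesis .
qed

text \<open>Injectivity at \<open>x0\<close> of the linear problem for \<open>S\<close> persists
  nearby with a uniform constant. Otherwise counterexamples approaching \<open>x0\<close>, rescaled
  to total size one, subconverge to a symmetric bilinear map that solves the homogeneous equations
  at \<open>x0\<close>, hence is zero, although its total size is one. The limit equation is checked
  one unit vector at a time, so continuity in \<open>x\<close> for fixed \<open>y\<close> is what is
  used.\<close>

lemma uniformly_injective_near:
  fixes D :: "'x::metric_space \<Rightarrow> 'e::euclidean_space \<Rightarrow> 'e \<Rightarrow> real"
  assumes cont: "\<And>y v. norm y = 1 \<Longrightarrow> isCont (\<lambda>x. D x y v) x0"
    and lin: "\<And>x y. x \<in> U \<Longrightarrow> norm y = 1 \<Longrightarrow> linear (D x y)" and U: "open U" "x0 \<in> U"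
    and inj: "\<And>S b b'. bilinear S \<Longrightarrow> (\<And>u v. S u v = S v u) \<Longrightarrow>
      (\<And>b y. b \<in> Basis \<Longrightarrow> norm y = 1 \<Longrightarrow> D x0 y (S b y) = 0) \<Longrightarrow> b \<in> Basis \<Longrightarrow> b' \<in> Basis \<Longrightarrow> S b b' = 0"
  shows "\<exists>C>0. \<exists>r>0. ball x0 r \<subseteq> U \<and> (\<forall>x\<in>ball x0 r. \<forall>S M. bilinear S \<longrightarrow> (\<forall>u v. S u v = S v u) \<longrightarrow>
    (\<forall>b\<in>Basis. \<forall>y. norm y = 1 \<longrightarrow> \<bar>D x y (S b y)\<bar> \<le> M) \<longrightarrow> (\<forall>b\<in>Basis. \<forall>b'\<in>Basis. norm (S b b') \<le> C * M))"
proof (rule ccontr)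
  assume neg: "\<not> ?thesis"
  obtain r0 where r0: "r0 > 0" "ball x0 r0 \<subseteq> U" using U open_contains_ball by blast
  define rho where "rho n = min r0 (1 / Suc n)" for n
  have rho: "rho n > 0" "ball x0 (rho n) \<subseteq> U" for n using r0 by (auto simp: rho_def)
  have "\<exists>x S M b b'. x \<in> ball x0 (rho n) \<and> bilinear S \<and> (\<forall>u v. S u v = S v u) \<and>
    (\<forall>b\<in>Basis. \<forall>y. norm y = 1 \<longrightarrow> \<bar>D x y (S b y)\<bar> \<le> M) \<and> b \<in> Basis \<and> b' \<in> Basis \<and> norm (S b b') > real (Suc n) * M" for n
  proof -
    have "real (Suc n) > 0" by simp
    then show ?thesis using neg rho[of n] unfolding not_le[symmetric] by blast
  qed
  then obtain x S M b0 b1 where x: "\<And>n. x n \<in> ball x0 (rho n)" and S: "\<And>n. bilinear (S n)" "\<And>n u v. S n u v = S n v u"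
    and M: "\<And>n b y. b \<in> Basis \<Longrightarrow> norm y = 1 \<Longrightarrow> \<bar>D (x n) y (S n b y)\<bar> \<le> M n"
    and b: "\<And>n. b0 n \<in> Basis" "\<And>n. b1 n \<in> Basis" "\<And>n. norm (S n (b0 n) (b1 n)) > real (Suc n) * M n"
    by metis
  have M0: "M n \<ge> 0" for n
    by (rule order_trans[OF abs_ge_zero M[OF b(1) norm_Basis[OF b(1)]]])
  define m where "m n = (\<Sum>p\<in>Basis \<times> Basis. norm (S n (fst p) (snd p)))" for n
  have le_m: "norm (S n c c') \<le> m n" if "c \<in> Basis" "c' \<in> Basis" for n c c'
    unfolding m_def using member_le_sum[of "(c, c')" "Basis \<times> Basis" "\<lambda>p. norm (S n (fst p) (snd p))"] that by simp
  have m1: "real (Suc n) * M n < m n" for n using b(3)[of n] le_m[OF b(1,2), of n n n] by linarith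
  have m0: "m n > 0" for n using m1[of n] M0[of n] by (smt (verit) mult_nonneg_nonneg of_nat_0_le_iff)
  define R where "R n p = (1 / m n) *\<^sub>R S n (fst p) (snd p)" for n p
  have R1: "norm (R n p) \<le> 1" if "p \<in> Basis \<times> Basis" for n p
    using le_m[of "fst p" "snd p" n] m0[of n] that by (auto simp: R_def divide_le_eq)
  have fin: "finite (Basis \<times> Basis :: ('e \<times> 'e) set)" by simp
  have bd: "bounded (range (\<lambda>n. R n p))" if "p \<in> Basis \<times> Basis" for p
    unfolding bounded_iff using R1[OF that] by blast
  obtain k L where k: "strict_mono (k :: nat \<Rightarrow> nat)" "\<And>p. p \<in> Basis \<times> Basis \<Longrightarrow> (\<lambda>n. R (k n) p) \<longlonglongrightarrow> L p"
    using convergent_subsequence_family[OF fin, of R, OF bd] by blast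
  have xlim: "(\<lambda>n. x (k n)) \<longlonglongrightarrow> x0"
  proof -
    have "dist (x n) x0 \<le> 1 / Suc n" for n using x[of n] by (auto simp: rho_def dist_commute)
    then have "(\<lambda>n. dist (x n) x0) \<longlonglongrightarrow> 0"
      by (intro Lim_null_comparison[OF _ LIMSEQ_inverse_real_of_nat]) (simp add: inverse_eq_divide)
    then have "x \<longlonglongrightarrow> x0" by (rule tendsto_dist_iff[THEN iffD2])
    then show ?thesis using LIMSEQ_subseq_LIMSEQ[OF _ k(1)] by (auto simp: o_def)
  qed
  define T where "T u v = (\<Sum>b\<in>Basis. \<Sum>b'\<in>Basis. ((u \<bullet> b) * (v \<bullet> b')) *\<^sub>R L (b, b'))" for u v :: 'e
  have Tbil: "bilinear T"
    unfolding bilinear_def linear_iff T_def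
    by (auto simp: inner_simps algebra_simps sum.distrib scaleR_add_left scaleR_sum_right)
  define Tn where "Tn n u v = (1 / m n) *\<^sub>R S n u v" for n u v
  have Tnlim: "(\<lambda>n. Tn (k n) u v) \<longlonglongrightarrow> T u v" for u v
  proof -
    have "Tn n u v = (\<Sum>b\<in>Basis. \<Sum>b'\<in>Basis. ((u \<bullet> b) * (v \<bullet> b')) *\<^sub>R R n (b, b'))" for n
      unfolding Tn_def bilinear_basis_expansion[OF S(1), of n u v] R_def by (simp add: scaleR_sum_right mult_ac)
    then show ?thesis unfolding T_def by (auto intro!: tendsto_intros k(2))
  qed
  have Tsym: "T u v = T v u" for u v
  proof -
    have "(\<lambda>n. Tn (k n) u v) = (\<lambda>n. Tn (k n) v u)" using S(2) by (simp add: Tn_def)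
    then show ?thesis using LIMSEQ_unique[OF Tnlim[of u v]] Tnlim[of v u] by simp
  qed
  have z: "D x0 y (T c y) = 0" if c: "c \<in> Basis" and y: "norm y = 1" for c y
  proof -
    have exp: "D x' y v = (\<Sum>e\<in>Basis. (v \<bullet> e) * D x' y e)" if "x' \<in> U" for x' v
    proof -
      have "D x' y v = D x' y (\<Sum>e\<in>Basis. (v \<bullet> e) *\<^sub>R e)" by (simp add: euclidean_representation)
      then show ?thesis by (simp add: linear_sum[OF lin[OF that y]] linear_scale[OF lin[OF that y]])
    qed
    have xU: "x n \<in> U" for n using x rho(2) by blast
    have "(\<lambda>n. D (x (k n)) y e) \<longlonglongrightarrow> D x0 y e" for e
      using isCont_tendsto_compose[OF cont[OF y] xlim] .
    then have "(\<lambda>n. \<Sum>e\<in>Basis. (Tn (k n) c y \<bullet> e) * D (x (k n)) y e) \<longlonglongrightarrow> (\<Sum>e\<in>Basis. (T c y \<bullet> e) * D x0 y e)"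
      by (intro tendsto_intros Tnlim)
    then have lim1: "(\<lambda>n. D (x (k n)) y (Tn (k n) c y)) \<longlonglongrightarrow> D x0 y (T c y)"
      unfolding exp[OF xU, of _ "Tn _ c y"] exp[OF U(2), of "T c y"] .
    have bound: "norm (D (x n) y (Tn n c y)) \<le> 1 / Suc n" for n
    proof -
      have "D (x n) y (Tn n c y) = D (x n) y (S n c y) / m n"
        using linear_scale[OF lin[OF xU y], of n "1 / m n"] by (simp add: Tn_def)
      moreover have "\<bar>D (x n) y (S n c y)\<bar> \<le> M n" by (rule M[OF c y])
      ultimately have "norm (D (x n) y (Tn n c y)) \<le> M n / m n" using m0[of n] by (simp add: divide_right_mono)
      also have "\<dots> \<le> 1 / Suc n" using m1[of n] m0[of n] by (simp add: field_simps)
      finally show ?thesis .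
    qed
    have "(\<lambda>n. 1 / Suc (k n)) \<longlonglongrightarrow> (0::real)"
      using LIMSEQ_subseq_LIMSEQ[OF LIMSEQ_inverse_real_of_nat k(1)] by (simp add: o_def inverse_eq_divide)
    then have "(\<lambda>n. D (x (k n)) y (Tn (k n) c y)) \<longlonglongrightarrow> 0"
      by (rule Lim_null_comparison[rotated]) (use bound in simp)
    then show ?thesis using LIMSEQ_unique[OF lim1] by simp
  qed
  have T0: "T c c' = 0" if "c \<in> Basis" "c' \<in> Basis" for c c'
    by (rule inj[OF Tbil Tsym z that])
  have "(\<lambda>n. \<Sum>p\<in>Basis \<times> Basis. norm (Tn (k n) (fst p) (snd p))) \<longlonglongrightarrow> (\<Sum>p\<in>Basis \<times> Basis. norm (T (fst p) (snd p)))"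
    by (intro tendsto_intros Tnlim)
  moreover have "(\<Sum>p\<in>Basis \<times> Basis. norm (Tn n (fst p) (snd p))) = 1" for n
  proof -
    have "(\<Sum>p\<in>Basis \<times> Basis. norm (Tn n (fst p) (snd p))) = (1 / m n) * m n"
    proof -
      have "norm (Tn n (fst p) (snd p)) = (1 / m n) * norm (S n (fst p) (snd p))" for p
        using m0[of n] by (simp add: Tn_def)
      then show ?thesis by (simp only: sum_distrib_left[symmetric] m_def[symmetric])
    qed
    then show ?thesis using m0[of n] by simp
  qed
  moreover have "(\<Sum>p\<in>Basis \<times> Basis. norm (T (fst p) (snd p))) = 0" using T0 by (intro sum.neutral) auto
  ultimately have "(\<lambda>n. 1::real) \<longlonglongrightarrow> 0" by simp
  then show False using LIMSEQ_unique[OF tendsto_const] by fastforce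
qed

text \<open>The product of \<psi> with \<open>exp (- C * t)\<close> is non-increasing and starts at
  zero.\<close>

lemma Gronwall_zero:
  fixes \<psi> \<psi>' :: "real \<Rightarrow> real"
  assumes "\<And>t. 0 \<le> t \<Longrightarrow> t \<le> 1 \<Longrightarrow> (\<psi> has_real_derivative \<psi>' t) (at t)"
    "\<And>t. 0 \<le> t \<Longrightarrow> t \<le> 1 \<Longrightarrow> \<psi>' t \<le> C * \<psi> t" "\<psi> 0 = 0" "\<psi> 1 \<ge> 0"
  shows "\<psi> 1 = 0"
proof -
  have "exp (- C * 1) * \<psi> 1 \<le> exp (- C * 0) * \<psi> 0"
  proof (rule DERIV_nonpos_imp_nonincreasing[where f = "\<lambda>t. exp (- C * t) * \<psi> t" and a = 0 and b = 1])
    fix t :: real assume t: "0 \<le> t" "t \<le> 1"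
    have "((\<lambda>t. exp (- C * t) * \<psi> t) has_real_derivative exp (- C * t) * (\<psi>' t - C * \<psi> t)) (at t)"
      by (auto intro!: derivative_eq_intros assms(1) t simp: algebra_simps)
    moreover have "exp (- C * t) * (\<psi>' t - C * \<psi> t) \<le> 0"
      using assms(2)[OF t] by (simp add: mult_nonneg_nonpos)
    ultimately show "\<exists>y. ((\<lambda>t. exp (- C * t) * \<psi> t) has_real_derivative y) (at t) \<and> y \<le> 0" by blast
  qed simp
  then have "exp (- C) * \<psi> 1 \<le> 0" using assms(3) by simp
  then show ?thesis using assms(4) by (simp add: mult_le_0_iff)
qed

subsection \<open>Almost Killing fields in a chart\<close>

text \<open>A Finsler metric seen in one chart. Smoothness stops at the zero section, and convexity
  is recorded as the triangle inequality, the form in which supporting functionals and length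
  estimates use it.\<close>

locale minkowski_family =
  fixes \<Omega> :: "'e::euclidean_space set" and f :: "'e \<times> 'e \<Rightarrow> real"
  assumes open_\<Omega>: "open \<Omega>"
    and smooth_f: "smooth_on (\<Omega> \<times> (UNIV - {0})) f"
    and f_0: "x \<in> \<Omega> \<Longrightarrow> f (x, 0) = 0"
    and f_scale: "x \<in> \<Omega> \<Longrightarrow> a > 0 \<Longrightarrow> f (x, a *\<^sub>R y) = a * f (x, y)"
    and f_pos: "x \<in> \<Omega> \<Longrightarrow> y \<noteq> 0 \<Longrightarrow> 0 < f (x, y)"
    and f_triangle: "x \<in> \<Omega> \<Longrightarrow> f (x, y + z) \<le> f (x, y) + f (x, z)"
begin

lemma open_slit: "open (\<Omega> \<times> (UNIV - {0 :: 'e}))"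
  by (intro open_Times open_\<Omega> open_Diff open_UNIV closed_singleton)

lemma f_has_derivative:
  assumes "x \<in> \<Omega>" "y \<noteq> 0"
  shows "(f has_derivative frechet_derivative f (at (x, y))) (at (x, y))"
  by (rule smooth_on_has_derivative[OF smooth_f]) (use assms in auto)

text \<open>The value zero at the origin is a matter of convention but not arbitrary:
  \<open>fibre_deriv x y (B y)\<close> can be linear in \<open>y\<close> only if it vanishes at
  \<open>y = 0\<close>.\<close>

definition fibre_deriv :: "'e \<Rightarrow> 'e \<Rightarrow> 'e \<Rightarrow> real"
  where "fibre_deriv x y v = (if y = 0 then 0 else frechet_derivative f (at (x, y)) (0, v))"

lemma fibre_has_derivative:
  assumes "x \<in> \<Omega>" "y \<noteq> 0"
  shows "((\<lambda>y. f (x, y)) has_derivative fibre_deriv x y) (at y)"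
proof -
  have "((\<lambda>y. (x, y)) has_derivative (\<lambda>v. (0, v))) (at y)"
    by (intro has_derivative_Pair has_derivative_const has_derivative_ident)
  from has_derivative_compose[OF this f_has_derivative[OF assms]] show ?thesis
    using assms(2) by (simp add: fibre_deriv_def[abs_def])
qed

lemma linear_fibre_deriv: "x \<in> \<Omega> \<Longrightarrow> linear (fibre_deriv x y)"
  using has_derivative_linear[OF fibre_has_derivative, of x y] linear_zero
  by (cases "y = 0") (simp_all add: fibre_deriv_def[abs_def])

text \<open>The derivative of \<open>f\<close> along the complete lift of \<open>K\<close> to the
  tangent bundle; the second slot is the velocity of \<open>y\<close> under the differential of the
  flow.\<close>

definition lie :: "('e \<Rightarrow> 'e) \<Rightarrow> 'e \<Rightarrow> 'e \<Rightarrow> real"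
  where "lie K x y =
    (if y = 0 then 0 else frechet_derivative f (at (x, y)) (K x, frechet_derivative K (at x) y))"

text \<open>The infinitesimal form of the almost isometry condition: the Lie derivative is a one-form.\<close>

definition almost_killing_field :: "('e \<Rightarrow> 'e) \<Rightarrow> bool"
  where "almost_killing_field K \<longleftrightarrow> smooth_on \<Omega> K \<and> (\<forall>x\<in>\<Omega>. linear (lie K x))"

lemma adapted_frame:
  assumes x: "x \<in> \<Omega>"
  obtains T :: "'e \<Rightarrow> 'e" where "linear T" "bij T"
    "adapted_minkowski_norm (\<lambda>y. f (x, T y)) (\<lambda>y v. fibre_deriv x (T y) (T v))"
proof -
  let ?N = "\<lambda>y. f (x, y) + f (x, - y)"
  have cf: "continuous_on (UNIV - {0}) (\<lambda>y. f (x, y))"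
    by (intro continuous_at_imp_continuous_on ballI)
      (auto intro: has_derivative_continuous fibre_has_derivative[OF x])
  have "continuous_on (UNIV - {0}) (\<lambda>y. f (x, - y))"
    by (rule continuous_on_compose2[OF cf, of _ uminus]) (auto intro: continuous_intros)
  then have cont: "continuous_on (UNIV - {0}) ?N" by (intro continuous_on_add cf)
  have pos: "0 < ?N y" if "y \<noteq> 0" for y using f_pos[OF x that] f_pos[OF x, of "- y"] that by simp
  have scale: "?N (a *\<^sub>R y) = a * ?N y" if "a > 0" for a y
    using f_scale[OF x that, of y] f_scale[OF x that, of "- y"] by (simp add: algebra_simps)
  have zero: "?N 0 = 0" using f_0[OF x] by simp
  have "\<exists>T::'e \<Rightarrow> 'e. linear T \<and> bij T \<and>
      (\<forall>g. linear g \<longrightarrow> (\<forall>y. ?N (T (g y)) = ?N (T y)) \<longrightarrow> (\<forall>y. norm (g y) = norm y))"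
    by (rule isometry_adapted_frame[OF cont pos scale zero]) blast+
  then obtain T :: "'e \<Rightarrow> 'e" where T: "linear T" "bij T"
    "\<forall>g. linear g \<longrightarrow> (\<forall>y. ?N (T (g y)) = ?N (T y)) \<longrightarrow> (\<forall>y. norm (g y) = norm y)"
    by (elim exE conjE)
  have T0: "T y \<noteq> 0" if "y \<noteq> 0" for y
    using that T(2) linear_0[OF T(1)] by (metis bij_def injD)
  have "adapted_minkowski_norm (\<lambda>y. f (x, T y)) (\<lambda>y v. fibre_deriv x (T y) (T v))"
  proof
    show "((\<lambda>y. f (x, T y)) has_derivative (\<lambda>v. fibre_deriv x (T y) (T v))) (at y)" if "y \<noteq> 0" for y
      by (rule has_derivative_compose[OF linear_imp_has_derivative[OF T(1)] fibre_has_derivative[OF x T0[OF that]]])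
    show "f (x, T 0) = 0" using linear_0[OF T(1)] f_0[OF x] by simp
    show "(\<lambda>v. fibre_deriv x (T 0) (T v)) = (\<lambda>v. 0)" using linear_0[OF T(1)] by (simp add: fibre_deriv_def)
    show "f (x, T (a *\<^sub>R y)) = a * f (x, T y)" if "a > 0" for a y
      using f_scale[OF x that] linear_scale[OF T(1)] by simp
    show "0 < f (x, T y)" if "y \<noteq> 0" for y using f_pos[OF x T0[OF that]] .
    show "norm (g y) = norm y"
      if "linear g" "\<And>y. f (x, T (g y)) + f (x, T (- g y)) = f (x, T y) + f (x, T (- y))" for g y
      using T(3)[rule_format, OF that(1)] that(2) linear_neg[OF T(1)] by simp
  qed
  then show ?thesis using that T by blast
qed

text \<open>Conjugation by the adapted frame turns the given maps into elements of
  \<open>alg\<close> and preserves their independence, so the algebraic theorem applies to the norm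
  in that frame.\<close>

lemma Randers_at_point:
  assumes x: "x \<in> \<Omega>" and dim2: "2 \<le> DIM('e)"
    and Bs: "finite Bs" "independent Bs" "(DIM('e) - 1) * (DIM('e) - 2) < 2 * card Bs"
      "\<And>B. B \<in> Bs \<Longrightarrow> linear B \<and> linear (\<lambda>y. fibre_deriv x y (B y))"
  shows "\<exists>(T :: 'e \<Rightarrow> 'e) c l. linear T \<and> bij T \<and> c > 0 \<and> linear l \<and> (\<forall>y. f (x, T y) = c * norm y + l y)"
proof -
  obtain T :: "'e \<Rightarrow> 'e" where T: "linear T" "bij T"
    "adapted_minkowski_norm (\<lambda>y. f (x, T y)) (\<lambda>y v. fibre_deriv x (T y) (T v))"
    using adapted_frame[OF x] by blast
  interpret adapted_minkowski_norm "\<lambda>y. f (x, T y)" "\<lambda>y v. fibre_deriv x (T y) (T v)" by (rule T(3))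
  have TiT: "inv T (T y) = y" and TTi: "T (inv T y) = y" for y :: 'e
    using T(2) by (simp_all add: bij_is_inj bij_is_surj surj_f_inv_f)
  have lTi: "linear (inv T)" by (rule linear_inv_bij[OF T(1,2)])
  define c where "c B = (\<lambda>y. inv T (B (T y)))" for B :: "'e \<Rightarrow> 'e"
  have lc: "linear c"
    by (rule linearI) (auto simp: c_def fun_vs linear_add[OF lTi] linear_scale[OF lTi])
  have "inj c"
  proof (rule injI)
    fix A B assume "c A = c B"
    then have "T (c A (inv T y)) = T (c B (inv T y))" for y by simp
    then show "A = B" by (auto simp: c_def TTi)
  qed
  then have ind: "independent (c ` Bs)" and card: "card (c ` Bs) = card Bs"
    using linear_independent_injective_image[OF lc Bs(2)] by (auto intro: inj_on_subset card_image)
  have "c ` Bs \<subseteq> alg"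
  proof
    fix C assume "C \<in> c ` Bs"
    then obtain B where B: "B \<in> Bs" "C = c B" by blast
    have l: "linear B" "linear (\<lambda>y. fibre_deriv x y (B y))" using Bs(4)[OF B(1)] by auto
    have "linear C" unfolding B(2) c_def
      by (rule linear_compose[OF linear_compose[OF T(1) l(1)] lTi, unfolded o_def])
    moreover have "linear (\<lambda>y. fibre_deriv x (T y) (T (C y)))"
      unfolding B(2) c_def TTi by (rule linear_compose[OF T(1) l(2), unfolded o_def])
    ultimately show "C \<in> alg" by (simp add: alg_def)
  qed
  then have "\<exists>B\<subseteq>alg. finite B \<and> independent B \<and> (DIM('e) - 1) * (DIM('e) - 2) < 2 * card B"
    using Bs(1,3) ind card by (intro exI[of _ "c ` Bs"]) simp
  then obtain k l where "k > 0" "linear l" "\<And>y. f (x, T y) = k * norm y + l y"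
    using Randers_of_large_alg[OF dim2] by blast
  then show ?thesis using T(1,2) by (intro exI[of _ T] exI[of _ k] exI[of _ l]) simp
qed

section \<open>The symmetrised metric and its Killing equation\<close>

definition sym_f :: "'e \<times> 'e \<Rightarrow> real"
  where "sym_f = (\<lambda>(x, y). f (x, y) + f (x, - y))"

lemma smooth_reflected: "smooth_on (\<Omega> \<times> (UNIV - {0})) (\<lambda>p. f (fst p, - snd p))"
proof -
  have bl: "bounded_linear (\<lambda>p::'e \<times> 'e. (fst p, - snd p))"
    by (intro bounded_linear_Pair bounded_linear_fst bounded_linear_minus bounded_linear_snd)
  show ?thesis
    using smooth_on_affine_compose[OF open_slit open_slit bl _ smooth_f, of 0] by auto
qed

lemma smooth_sym_f: "smooth_on (\<Omega> \<times> (UNIV - {0})) sym_f"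
  using smooth_on_add[OF open_slit smooth_f smooth_reflected]
  by (simp add: sym_f_def case_prod_unfold)

lemma sym_f_deriv:
  assumes "x \<in> \<Omega>" "y \<noteq> 0"
  shows "frechet_derivative sym_f (at (x, y)) (a, v)
    = frechet_derivative f (at (x, y)) (a, v) + frechet_derivative f (at (x, - y)) (a, - v)"
proof -
  have r: "((\<lambda>p::'e \<times> 'e. (fst p, - snd p)) has_derivative (\<lambda>q. (fst q, - snd q))) (at (x, y))"
    by (intro has_derivative_Pair has_derivative_fst has_derivative_minus has_derivative_snd has_derivative_ident)
  have "((\<lambda>p. f p + f (fst p, - snd p)) has_derivative
      (\<lambda>q. frechet_derivative f (at (x, y)) q + frechet_derivative f (at (x, - y)) (fst q, - snd q))) (at (x, y))"
    using has_derivative_add[OF f_has_derivative[OF assms] has_derivative_compose[OF r, of f]]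
      f_has_derivative[of x "- y"] assms by simp
  moreover have "(\<lambda>p. f p + f (fst p, - snd p)) = sym_f" by (auto simp: sym_f_def)
  ultimately have "(sym_f has_derivative
      (\<lambda>q. frechet_derivative f (at (x, y)) q + frechet_derivative f (at (x, - y)) (fst q, - snd q))) (at (x, y))"
    by simp
  from fun_cong[OF frechet_derivative_at[OF this], of "(a, v)"] show ?thesis by simp
qed

text \<open>The one-form by which \<open>K\<close> changes \<open>f\<close> is odd in
  \<open>y\<close> and cancels between \<open>y\<close> and \<open>- y\<close>.\<close>

lemma killing_equation:
  assumes K: "almost_killing_field K" and x: "x \<in> \<Omega>" and y: "y \<noteq> 0"
  shows "frechet_derivative sym_f (at (x, y)) (K x, frechet_derivative K (at x) y) = 0"
proof -
  have l: "linear (lie K x)" using K x by (auto simp: almost_killing_field_def)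
  have lK: "linear (frechet_derivative K (at x))"
    using K x smooth_on_linear_frechet by (auto simp: almost_killing_field_def)
  show ?thesis
    using linear_neg[OF l, of y] y linear_neg[OF lK, of y] sym_f_deriv[OF x y] by (simp add: lie_def)
qed

text \<open>In the Killing equation both the derivative and its direction depend on
  \<open>x\<close>. The expansion separates them into products of scalar functions, ready for the
  product rule.\<close>

lemma pair_deriv_expand:
  fixes D :: "'e \<times> 'e \<Rightarrow> real"
  assumes "linear D"
  shows "D (a, v) = (\<Sum>b\<in>Basis. (a \<bullet> b) * D (b, 0) + (v \<bullet> b) * D (0, b))"
proof -
  have l1: "linear (\<lambda>a. D (a, 0))" and l2: "linear (\<lambda>v. D (0, v))"
    using linear_compose[of "\<lambda>a. (a, 0)" D] linear_compose[of "\<lambda>v. (0, v)" D] assms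
    by (auto simp: o_def linear_iff)
  have "D (a, v) = D ((a, 0) + (0, v))" by simp
  also have "\<dots> = D (a, 0) + D (0, v)" by (rule linear_add[OF assms])
  also have "D (a, 0) = D (\<Sum>b\<in>Basis. (a \<bullet> b) *\<^sub>R b, 0)" by (simp add: euclidean_representation)
  also have "\<dots> = (\<Sum>b\<in>Basis. (a \<bullet> b) * D (b, 0))"
    using linear_sum[OF l1, of "\<lambda>b. (a \<bullet> b) *\<^sub>R b" Basis] linear_scale[OF l1] by simp
  also have "D (0, v) = D (0, \<Sum>b\<in>Basis. (v \<bullet> b) *\<^sub>R b)" by (simp add: euclidean_representation)
  also have "\<dots> = (\<Sum>b\<in>Basis. (v \<bullet> b) * D (0, b))"
    using linear_sum[OF l2, of "\<lambda>b. (v \<bullet> b) *\<^sub>R b" Basis] linear_scale[OF l2] by simp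
  finally show ?thesis by (simp add: sum.distrib)
qed

text \<open>
  Differentiating the Killing equation bounds the part of the second derivative of \<open>K\<close> seen by
  the fibre derivative of the symmetrised metric by the first jet of \<open>K\<close>.
\<close>

definition second_jet_bound :: "'e \<Rightarrow> 'e \<Rightarrow> real"
  where "second_jet_bound x y = (\<Sum>b\<in>Basis. \<Sum>w\<in>Basis.
    \<bar>frechet_derivative sym_f (at (x, y)) (b, 0)\<bar>
    + \<bar>frechet_derivative (\<lambda>p. frechet_derivative sym_f (at p) (b, 0)) (at (x, y)) (w, 0)\<bar>
    + \<bar>frechet_derivative (\<lambda>p. frechet_derivative sym_f (at p) (0, b)) (at (x, y)) (w, 0)\<bar>)"

text \<open>The expanded Killing equation \<open>\<phi>\<close> vanishes identically in
  \<open>x\<close>, hence so does its derivative in direction \<open>w\<close>. There the second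
  derivative of \<open>K\<close> occurs only under the fibre derivative; every other term is an
  entry of the first jet times a coefficient collected in \<open>second_jet_bound\<close>.\<close>

lemma killing_second_derivative:
  assumes K: "almost_killing_field K" and x: "x \<in> \<Omega>" and y: "norm y = 1" and w: "w \<in> Basis"
  shows "\<bar>frechet_derivative sym_f (at (x, y))
      (0, frechet_derivative (\<lambda>x. frechet_derivative K (at x) y) (at x) w)\<bar>
    \<le> (norm (K x) + (\<Sum>b\<in>Basis. norm (frechet_derivative K (at x) b))) * second_jet_bound x y"
proof -
  let ?D = "\<lambda>p q. frechet_derivative sym_f (at p) q"
  let ?D2 = "\<lambda>q. frechet_derivative (\<lambda>p. ?D p q) (at (x, y))"
  let ?K' = "\<lambda>x. frechet_derivative K (at x)"
  let ?K2 = "frechet_derivative (\<lambda>x. ?K' x y) (at x) w"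
  let ?R = "norm (K x) + (\<Sum>b\<in>Basis. norm (?K' x b))"
  have y0: "y \<noteq> 0" using y by auto
  have sK: "smooth_on \<Omega> K" using K by (simp add: almost_killing_field_def)
  note lK = smooth_on_linear_frechet[OF sK x]
  have lD: "linear (?D (x', y))" if "x' \<in> \<Omega>" for x'
    by (rule smooth_on_linear_frechet[OF smooth_sym_f]) (use that y0 in auto)
  have dK: "(K has_derivative ?K' x) (at x)" by (rule smooth_on_has_derivative[OF sK x])
  have dK': "((\<lambda>x. ?K' x y) has_derivative frechet_derivative (\<lambda>x. ?K' x y) (at x)) (at x)"
    by (rule smooth_on_has_derivative[OF smooth_on_frechet_derivative[OF sK] x])
  have inc: "((\<lambda>x. (x, y)) has_derivative (\<lambda>v. (v, 0))) (at x)"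
    by (intro has_derivative_Pair has_derivative_ident has_derivative_const)
  have dD: "((\<lambda>x. ?D (x, y) q) has_derivative (\<lambda>v. ?D2 q (v, 0))) (at x)" for q
    by (rule has_derivative_compose[OF inc smooth_on_has_derivative[OF smooth_on_frechet_derivative[OF smooth_sym_f]]])
      (use x y0 in auto)
  define \<phi> where "\<phi> x = (\<Sum>b\<in>Basis. (K x \<bullet> b) * ?D (x, y) (b, 0) + (?K' x y \<bullet> b) * ?D (x, y) (0, b))" for x
  have \<phi>0: "\<phi> x' = 0" if "x' \<in> \<Omega>" for x'
    unfolding \<phi>_def pair_deriv_expand[OF lD[OF that], symmetric] by (rule killing_equation[OF K that y0])
  have "(\<phi> has_derivative (\<lambda>v. \<Sum>b\<in>Basis.
      ((K x \<bullet> b) * ?D2 (b, 0) (v, 0) + (?K' x v \<bullet> b) * ?D (x, y) (b, 0))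
      + ((?K' x y \<bullet> b) * ?D2 (0, b) (v, 0) + (frechet_derivative (\<lambda>x. ?K' x y) (at x) v \<bullet> b) * ?D (x, y) (0, b)))) (at x)"
    unfolding \<phi>_def
    by (intro has_derivative_sum has_derivative_add has_derivative_mult has_derivative_inner_left dK dK' dD)
  moreover have "(\<phi> has_derivative (\<lambda>v. 0)) (at x)"
    by (rule has_derivative_transform_within_open[OF has_derivative_const open_\<Omega> x]) (use \<phi>0 in auto)
  ultimately have "(\<lambda>v. \<Sum>b\<in>Basis.
      ((K x \<bullet> b) * ?D2 (b, 0) (v, 0) + (?K' x v \<bullet> b) * ?D (x, y) (b, 0))
      + ((?K' x y \<bullet> b) * ?D2 (0, b) (v, 0) + (frechet_derivative (\<lambda>x. ?K' x y) (at x) v \<bullet> b) * ?D (x, y) (0, b))) = (\<lambda>v. 0)"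
    by (rule has_derivative_unique)
  from fun_cong[OF this, of w] have "(\<Sum>b\<in>Basis.
      ((K x \<bullet> b) * ?D2 (b, 0) (w, 0) + (?K' x w \<bullet> b) * ?D (x, y) (b, 0) + (?K' x y \<bullet> b) * ?D2 (0, b) (w, 0))
      + (?K2 \<bullet> b) * ?D (x, y) (0, b)) = 0" by (simp add: algebra_simps)
  then have "(\<Sum>b\<in>Basis. (?K2 \<bullet> b) * ?D (x, y) (0, b)) = - (\<Sum>b\<in>Basis.
      (K x \<bullet> b) * ?D2 (b, 0) (w, 0) + (?K' x w \<bullet> b) * ?D (x, y) (b, 0) + (?K' x y \<bullet> b) * ?D2 (0, b) (w, 0))"
    unfolding sum.distrib[of _ "\<lambda>b. (?K2 \<bullet> b) * ?D (x, y) (0, b)"] by linarith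
  moreover have "?D (x, y) (0, ?K2) = (\<Sum>b\<in>Basis. (?K2 \<bullet> b) * ?D (x, y) (0, b))"
    using pair_deriv_expand[OF lD[OF x], of 0 ?K2] by simp
  ultimately have "\<bar>?D (x, y) (0, ?K2)\<bar> = \<bar>\<Sum>b\<in>Basis.
      (K x \<bullet> b) * ?D2 (b, 0) (w, 0) + (?K' x w \<bullet> b) * ?D (x, y) (b, 0) + (?K' x y \<bullet> b) * ?D2 (0, b) (w, 0)\<bar>"
    by simp
  also have "\<dots> \<le> (\<Sum>b\<in>Basis. ?R * (\<bar>?D (x, y) (b, 0)\<bar> + \<bar>?D2 (b, 0) (w, 0)\<bar> + \<bar>?D2 (0, b) (w, 0)\<bar>))"
  proof (rule order_trans[OF sum_abs sum_mono])
    fix b :: 'e assume b: "b \<in> Basis"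
    have P: "norm (?K' x v) \<le> ?R" if "norm v = 1" for v
      using linear_norm_le_sum[OF lK, of v] that by (simp add: add_increasing)
    have S0: "(\<Sum>b\<in>Basis. norm (?K' x b)) \<ge> 0" by (intro sum_nonneg) auto
    have 1: "\<bar>K x \<bullet> b\<bar> \<le> ?R" using Basis_le_norm[OF b, of "K x"] S0 by simp
    have 2: "\<bar>?K' x w \<bullet> b\<bar> \<le> ?R" using Basis_le_norm[OF b, of "?K' x w"] P[of w] w by simp
    have 3: "\<bar>?K' x y \<bullet> b\<bar> \<le> ?R" using Basis_le_norm[OF b, of "?K' x y"] P[of y] y by simp
    have t: "\<bar>p * q\<bar> \<le> ?R * \<bar>q\<bar>" if "\<bar>p\<bar> \<le> ?R" for p q :: real
      unfolding abs_mult by (rule mult_right_mono[OF that]) simp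
    show "\<bar>(K x \<bullet> b) * ?D2 (b, 0) (w, 0) + (?K' x w \<bullet> b) * ?D (x, y) (b, 0) + (?K' x y \<bullet> b) * ?D2 (0, b) (w, 0)\<bar>
      \<le> ?R * (\<bar>?D (x, y) (b, 0)\<bar> + \<bar>?D2 (b, 0) (w, 0)\<bar> + \<bar>?D2 (0, b) (w, 0)\<bar>)"
      using t[OF 1, of "?D2 (b, 0) (w, 0)"] t[OF 2, of "?D (x, y) (b, 0)"] t[OF 3, of "?D2 (0, b) (w, 0)"]
      unfolding distrib_left by linarith
  qed
  \<comment> \<open>Adding the terms of all basis vectors makes the bound independent of the
    direction of differentiation.\<close>
  also have "\<dots> \<le> (\<Sum>b\<in>Basis. ?R * (\<Sum>w\<in>Basis. \<bar>?D (x, y) (b, 0)\<bar> + \<bar>?D2 (b, 0) (w, 0)\<bar> + \<bar>?D2 (0, b) (w, 0)\<bar>))"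
  proof (intro sum_mono mult_left_mono)
    fix b :: 'e
    show "\<bar>?D (x, y) (b, 0)\<bar> + \<bar>?D2 (b, 0) (w, 0)\<bar> + \<bar>?D2 (0, b) (w, 0)\<bar>
      \<le> (\<Sum>w\<in>Basis. \<bar>?D (x, y) (b, 0)\<bar> + \<bar>?D2 (b, 0) (w, 0)\<bar> + \<bar>?D2 (0, b) (w, 0)\<bar>)"
      using member_le_sum[OF w, of "\<lambda>w. \<bar>?D (x, y) (b, 0)\<bar> + \<bar>?D2 (b, 0) (w, 0)\<bar> + \<bar>?D2 (0, b) (w, 0)\<bar>"] by simp
  qed (simp add: sum_nonneg)
  also have "\<dots> = ?R * second_jet_bound x y" by (simp only: second_jet_bound_def sum_distrib_left)
  finally show ?thesis .
qed

text \<open>This is the vanishing of the first prolongation of so(n). In the adapted frame each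
  \<open>S' u\<close> is tangent to the level sets of the symmetrised norm and therefore skew,
  whereas \<open>S'\<close> is symmetric in its two arguments.\<close>

lemma fibre_tangent_bilinear_zero:
  assumes x: "x \<in> \<Omega>" and S: "bilinear S" "\<And>u v. S u v = S v u"
    and tan: "\<And>b y. b \<in> Basis \<Longrightarrow> norm y = 1 \<Longrightarrow> frechet_derivative sym_f (at (x, y)) (0, S b y) = 0"
  shows "S u v = 0"
proof -
  obtain T :: "'e \<Rightarrow> 'e" where T: "linear T" "bij T"
    "adapted_minkowski_norm (\<lambda>y. f (x, T y)) (\<lambda>y v. fibre_deriv x (T y) (T v))"
    using adapted_frame[OF x] by blast
  interpret adapted_minkowski_norm "\<lambda>y. f (x, T y)" "\<lambda>y v. fibre_deriv x (T y) (T v)" by (rule T(3))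
  have TiT: "inv T (T y) = y" and TTi: "T (inv T y) = y" for y
    using T(2) by (simp_all add: bij_is_inj bij_is_surj surj_f_inv_f)
  have lTi: "linear (inv T)" by (rule linear_inv_bij[OF T(1,2)])
  have l1: "linear (\<lambda>u. S u v)" and l2: "linear (S u)" for u v using S(1) by (auto simp: bilinear_def)
  have T0: "T y \<noteq> 0" if "y \<noteq> 0" for y using that TiT linear_0[OF lTi] by metis
  have tan': "fibre_deriv x (T y) (S u (T y)) - fibre_deriv x (T (- y)) (S u (T y)) = 0" if "y \<noteq> 0" for u y
  proof -
    let ?z = "T y" and ?n = "norm (T y)"
    have z: "?z \<noteq> 0" by (rule T0[OF that])
    have ls: "linear (frechet_derivative sym_f (at (x, w)))" if "w \<noteq> 0" for w
      by (rule smooth_on_linear_frechet[OF smooth_sym_f]) (use that x in auto)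
    define e where "e = ?z /\<^sub>R ?n"
    have e: "norm e = 1" "?z = ?n *\<^sub>R e" "e \<noteq> 0" using z by (auto simp: e_def)
    have lin: "linear (\<lambda>u. frechet_derivative sym_f (at (x, e)) (0, S u e))"
      using linear_compose[OF l1[of e] linear_compose[OF _ ls[OF e(3)], of "\<lambda>v. (0, v)"]]
      by (simp add: o_def linear_iff)
    have "frechet_derivative sym_f (at (x, e)) (0, S u e) = 0" for u
    proof -
      have "frechet_derivative sym_f (at (x, e)) (0, S u e)
          = (\<lambda>u. frechet_derivative sym_f (at (x, e)) (0, S u e)) (\<Sum>b\<in>Basis. (u \<bullet> b) *\<^sub>R b)"
        by (simp add: euclidean_representation)
      also have "\<dots> = 0" unfolding linear_sum[OF lin] linear_scale[OF lin] using tan e(1) by simp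
      finally show ?thesis .
    qed
    then have se: "fibre_deriv x e (S u e) - fibre_deriv x (- e) (S u e) = 0"
      using sym_f_deriv[OF x e(3), of 0 "S u e"] e(3) linear_neg[OF linear_fibre_deriv[OF x], of "- e" "S u e"]
      by (simp add: fibre_deriv_def)
    \<comment> \<open>Fibre derivatives are homogeneous of degree zero, which carries the hypothesis
      from unit vectors to all nonzero vectors.\<close>
    have hom: "fibre_deriv x (r *\<^sub>R w) v = fibre_deriv x w v" if r: "r > 0" and w: "w \<noteq> 0" for r w v
    proof -
      have 1: "((\<lambda>y. f (x, r *\<^sub>R y)) has_derivative (\<lambda>v. fibre_deriv x (r *\<^sub>R w) (r *\<^sub>R v))) (at w)"
        by (rule has_derivative_compose[OF _ fibre_has_derivative[OF x]])
          (use r w in \<open>auto intro: has_derivative_scaleR_right[OF has_derivative_ident]\<close>)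
      have "((\<lambda>y. r * f (x, y)) has_derivative (\<lambda>v. r * fibre_deriv x w v)) (at w)"
        by (intro has_derivative_mult_right fibre_has_derivative[OF x w])
      moreover have "(\<lambda>y. r * f (x, y)) = (\<lambda>y. f (x, r *\<^sub>R y))" using f_scale[OF x r] by simp
      ultimately have "(\<lambda>v. fibre_deriv x (r *\<^sub>R w) (r *\<^sub>R v)) = (\<lambda>v. r * fibre_deriv x w v)"
        using has_derivative_unique[OF 1] by simp
      from fun_cong[OF this, of v] show ?thesis
        using r linear_scale[OF linear_fibre_deriv[OF x]] by simp
    qed
    have n0: "?n > 0" using z by simp
    have h1: "fibre_deriv x ?z v = fibre_deriv x e v" for v using hom[OF n0 e(3)] e(2) by metis
    have h2: "fibre_deriv x (- ?z) v = fibre_deriv x (- e) v" for v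
      using hom[OF n0, of "- e" v] e(2,3) by (metis neg_equal_0_iff_equal scaleR_minus_right)
    have "S u ?z = ?n *\<^sub>R S u e" using linear_scale[OF l2] e(2) by metis
    then show ?thesis
      using se linear_scale[OF linear_fibre_deriv[OF x]] h1 h2 linear_neg[OF T(1), of y]
      by (simp flip: right_diff_distrib)
  qed
  define S' where "S' u v = inv T (S (T u) (T v))" for u v
  have skew: "S' u \<in> skew_maps" for u
  proof (rule sym.tangent_imp_skew)
    show "linear (S' u)"
      unfolding S'_def by (rule linear_compose[OF linear_compose[OF T(1) l2] lTi, unfolded o_def])
    show "fibre_deriv x (T y) (T (S' u y)) - fibre_deriv x (T (- y)) (T (S' u y)) = 0" if "y \<noteq> 0" for y
      unfolding S'_def TTi by (rule tan'[OF that])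
  qed
  have sym': "S' u v = S' v u" for u v unfolding S'_def using S(2) by metis
  text \<open>A trilinear form that is symmetric in two slots and skew in two others vanishes.\<close>
  have "S' u v \<bullet> w = 0" for u v w
  proof -
    have sk: "S' a b \<bullet> c = - (S' a c \<bullet> b)" for a b c
      using skew_mapsD(2)[OF skew[of a], of b c] by (simp add: inner_commute)
    show ?thesis using sk[of u v w] sk[of w u v] sk[of v w u] sym'[of u v] sym'[of v w] sym'[of w u] by simp
  qed
  then have "S' (inv T u) (inv T v) = 0" by (metis inner_eq_zero_iff)
  then have "T (S' (inv T u) (inv T v)) = 0" using linear_0[OF T(1)] by simp
  then show ?thesis by (simp add: S'_def TTi)
qed

lemma continuous_on_second_jet_bound:
  "continuous_on (\<Omega> \<times> (UNIV - {0})) (\<lambda>p. second_jet_bound (fst p) (snd p))"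
  unfolding second_jet_bound_def prod.collapse
  by (intro continuous_intros smooth_on_continuous_on smooth_on_frechet_derivative smooth_sym_f)

text \<open>The bound on second derivatives closes the system for the first jet: along a segment its
  squared size \<open>\<psi>\<close> obeys a linear differential inequality. The radius does not
  depend on \<open>K\<close> or on the starting point \<open>x1\<close>; this uniformity is what the
  open-closed argument on the manifold uses.\<close>

theorem almost_killing_field_unique:
  assumes x0: "x0 \<in> \<Omega>"
  shows "\<exists>r>0. ball x0 r \<subseteq> \<Omega> \<and> (\<forall>K x1 x. almost_killing_field K \<longrightarrow> x1 \<in> ball x0 r \<longrightarrow> K x1 = 0 \<longrightarrow>
    (\<forall>v. frechet_derivative K (at x1) v = 0) \<longrightarrow> x \<in> ball x0 r \<longrightarrow> K x = 0)"
proof -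
  let ?D = "\<lambda>x y v. frechet_derivative sym_f (at (x, y)) (0, v)"
  have "\<exists>C>0. \<exists>r>0. ball x0 r \<subseteq> \<Omega> \<and> (\<forall>x\<in>ball x0 r. \<forall>S M. bilinear S \<longrightarrow> (\<forall>u v. S u v = S v u) \<longrightarrow>
    (\<forall>b\<in>Basis. \<forall>y. norm y = 1 \<longrightarrow> \<bar>?D x y (S b y)\<bar> \<le> M) \<longrightarrow> (\<forall>b\<in>Basis. \<forall>b'\<in>Basis. norm (S b b') \<le> C * M))"
  proof (rule uniformly_injective_near[OF _ _ open_\<Omega> x0])
    fix y v :: 'e assume "norm y = 1"
    then have y: "y \<noteq> 0" by auto
    have "continuous_on \<Omega> (\<lambda>x. ?D x y v)"
      by (rule continuous_on_compose2[OF smooth_on_continuous_on[OF smooth_on_frechet_derivative[OF smooth_sym_f, of "(0, v)"]], of _ "\<lambda>x. (x, y)"])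
        (use y in \<open>auto intro!: continuous_intros\<close>)
    then show "isCont (\<lambda>x. ?D x y v) x0"
      using open_\<Omega> x0 by (simp add: continuous_on_eq_continuous_at)
  next
    fix x y :: 'e assume x: "x \<in> \<Omega>" and "norm y = 1"
    then have y: "y \<noteq> 0" by auto
    have l: "linear (frechet_derivative sym_f (at (x, y)))"
      by (rule smooth_on_linear_frechet[OF smooth_sym_f]) (use x y in auto)
    show "linear (?D x y)"
      using linear_compose[OF _ l, of "\<lambda>v. (0, v)"] by (simp add: o_def linear_iff)
  next
    fix S :: "'e \<Rightarrow> 'e \<Rightarrow> 'e" and b b' :: 'e
    assume "bilinear S" "\<And>u v. S u v = S v u" "\<And>b y. b \<in> Basis \<Longrightarrow> norm y = 1 \<Longrightarrow> ?D x0 y (S b y) = 0"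
    then show "S b b' = 0" by (rule fibre_tangent_bilinear_zero[OF x0])
  qed
  then obtain C r1 where C: "C > 0" "r1 > 0" "ball x0 r1 \<subseteq> \<Omega>"
    and inj: "\<And>x S M b b'. x \<in> ball x0 r1 \<Longrightarrow> bilinear S \<Longrightarrow> (\<And>u v. S u v = S v u) \<Longrightarrow>
      (\<And>b y. b \<in> Basis \<Longrightarrow> norm y = 1 \<Longrightarrow> \<bar>?D x y (S b y)\<bar> \<le> M) \<Longrightarrow> b \<in> Basis \<Longrightarrow> b' \<in> Basis \<Longrightarrow>
      norm (S b b') \<le> C * M" by metis
  \<comment> \<open>Half the radius leaves room for a closed ball, on which
    \<open>second_jet_bound\<close> is bounded by compactness.\<close>
  define r where "r = r1 / 2"
  have r: "r > 0" "cball x0 r \<subseteq> ball x0 r1" using C(2) by (auto simp: r_def)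
  have "compact (cball x0 r \<times> sphere (0::'e) 1)" by (intro compact_Times compact_cball compact_sphere)
  moreover have "cball x0 r \<times> sphere (0::'e) 1 \<subseteq> \<Omega> \<times> (UNIV - {0})" using r C by auto
  ultimately have "bounded ((\<lambda>p. second_jet_bound (fst p) (snd p)) ` (cball x0 r \<times> sphere (0::'e) 1))"
    by (intro compact_imp_bounded compact_continuous_image continuous_on_subset[OF continuous_on_second_jet_bound])
  then obtain J where J: "\<And>x y. x \<in> cball x0 r \<Longrightarrow> norm y = 1 \<Longrightarrow> second_jet_bound x y \<le> J"
    unfolding bounded_iff by (force simp: abs_le_iff)
  define n where "n = real DIM('e)"
  have n0: "n \<ge> 0" by (simp add: n_def)
  show ?thesis
  proof (intro exI[of _ r] conjI r(1) allI impI)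
    show "ball x0 r \<subseteq> \<Omega>" using r(2) C(3) ball_subset_cball by blast
    fix K x1 x
    assume K: "almost_killing_field K" and x1: "x1 \<in> ball x0 r" and K1: "K x1 = 0"
      and K1': "\<forall>v. frechet_derivative K (at x1) v = 0" and x: "x \<in> ball x0 r"
    let ?K' = "\<lambda>x v. frechet_derivative K (at x) v"
    let ?K2 = "\<lambda>x b w. frechet_derivative (\<lambda>x. ?K' x b) (at x) w"
    define P where "P z = norm (K z) + (\<Sum>b\<in>Basis. norm (?K' z b))" for z
    have P0: "P z \<ge> 0" for z by (simp add: P_def sum_nonneg)
    have sK: "smooth_on \<Omega> K" using K by (simp add: almost_killing_field_def)
    note sK' = smooth_on_frechet_derivative[OF sK]
    have K2: "norm (?K2 z b b') \<le> C * (P z * J)" if z: "z \<in> cball x0 r" and bb: "b \<in> Basis" "b' \<in> Basis" for z b b'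
    proof (rule inj[of z "\<lambda>u v. ?K2 z u v", OF _ _ _ _ bb])
      show "z \<in> ball x0 r1" using z r(2) by blast
      then have zO: "z \<in> \<Omega>" using C(3) by blast
      show sym: "?K2 z u v = ?K2 z v u" for u v
        by (rule symmetric_second_frechet_derivative[OF sK open_\<Omega> zO])
      have l: "linear (?K2 z u)" for u by (rule smooth_on_linear_frechet[OF sK' zO])
      then have "linear (\<lambda>u. ?K2 z u v)" for v using sym[of _ v] by simp
      then show "bilinear (\<lambda>u v. ?K2 z u v)" using l by (simp add: bilinear_def)
      show "\<bar>?D z y (?K2 z c y)\<bar> \<le> P z * J" if c: "c \<in> Basis" and y: "norm y = 1" for c y
      proof -
        have "\<bar>?D z y (?K2 z y c)\<bar> \<le> P z * second_jet_bound z y"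
          unfolding P_def by (rule killing_second_derivative[OF K zO y c])
        also have "\<dots> \<le> P z * J" by (intro mult_left_mono J[OF z y] P0)
        finally show ?thesis using sym[of y c] by simp
      qed
    qed
    have "J \<ge> 0"
    proof -
      obtain e :: 'e where e: "norm e = 1" using vector_choose_size[of 1] by auto
      have "0 \<le> second_jet_bound x0 e" unfolding second_jet_bound_def by (intro sum_nonneg) auto
      also have "\<dots> \<le> J" by (rule J) (use r e in auto)
      finally show ?thesis .
    qed
    define d where "d = x - x1"
    define c where "c t = x1 + t *\<^sub>R d" for t
    have cb: "c t \<in> ball x0 r" if "0 \<le> t" "t \<le> 1" for t
    proof -
      have "c t = (1 - t) *\<^sub>R x1 + t *\<^sub>R x" by (simp add: c_def d_def algebra_simps)
      then show ?thesis using convexD[OF convex_ball x1 x, of "1 - t" t] that by simp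
    qed
    have cO: "c t \<in> \<Omega>" if "0 \<le> t" "t \<le> 1" for t
      using cb[OF that] r(2) C(3) ball_subset_cball[of x0 r] by blast
    have dc: "(c has_derivative (\<lambda>h. h *\<^sub>R d)) (at t)" for t
      unfolding c_def by (rule affine_line_has_derivative)
    \<comment> \<open>Unlike the sum of norms \<open>P\<close>, this sum of squares is
      differentiable; the square of \<open>P\<close> is at most \<open>2 * (1 + n)\<close> times
      \<open>\<psi>\<close>, which is enough for Gronwall.\<close>
    define \<psi> where "\<psi> t = K (c t) \<bullet> K (c t) + (\<Sum>b\<in>Basis. ?K' (c t) b \<bullet> ?K' (c t) b)" for t
    define \<psi>' where "\<psi>' t = 2 * (K (c t) \<bullet> ?K' (c t) d) + (\<Sum>b\<in>Basis. 2 * (?K' (c t) b \<bullet> ?K2 (c t) b d))" for t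
    have d\<psi>: "(\<psi> has_real_derivative \<psi>' t) (at t)" if t: "0 \<le> t" "t \<le> 1" for t
    proof -
      have D1: "((\<lambda>t. K (c t)) has_derivative (\<lambda>h. h *\<^sub>R ?K' (c t) d)) (at t)"
        using has_derivative_compose[OF dc smooth_on_has_derivative[OF sK cO[OF t]]]
          linear_scale[OF smooth_on_linear_frechet[OF sK cO[OF t]]] by simp
      have D2: "((\<lambda>t. ?K' (c t) b) has_derivative (\<lambda>h. h *\<^sub>R ?K2 (c t) b d)) (at t)" for b
        using has_derivative_compose[OF dc smooth_on_has_derivative[OF sK' cO[OF t]]]
          linear_scale[OF smooth_on_linear_frechet[OF sK' cO[OF t]]] by simp
      have "(\<psi> has_derivative (\<lambda>h. (K (c t) \<bullet> (h *\<^sub>R ?K' (c t) d) + (h *\<^sub>R ?K' (c t) d) \<bullet> K (c t))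
         + (\<Sum>b\<in>Basis. ?K' (c t) b \<bullet> (h *\<^sub>R ?K2 (c t) b d) + (h *\<^sub>R ?K2 (c t) b d) \<bullet> ?K' (c t) b))) (at t)"
        unfolding \<psi>_def by (intro has_derivative_add has_derivative_sum has_derivative_inner D1 D2)
      moreover have "(\<lambda>h. (K (c t) \<bullet> (h *\<^sub>R ?K' (c t) d) + (h *\<^sub>R ?K' (c t) d) \<bullet> K (c t))
         + (\<Sum>b\<in>Basis. ?K' (c t) b \<bullet> (h *\<^sub>R ?K2 (c t) b d) + (h *\<^sub>R ?K2 (c t) b d) \<bullet> ?K' (c t) b)) = (*) (\<psi>' t)"
        unfolding \<psi>'_def
        by (rule ext) (simp add: inner_commute distrib_left sum_distrib_left mult_ac)
      ultimately show ?thesis by (simp add: has_field_derivative_def)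
    qed
    define Ct where "Ct = (2 * norm d + 2 * (n * (C * J) * norm d)) * (2 * (1 + n))"
    have growth: "\<psi>' t \<le> Ct * \<psi> t" if t: "0 \<le> t" "t \<le> 1" for t
    proof -
      let ?z = "c t"
      have zc: "?z \<in> cball x0 r" using cb[OF t] by auto
      have S0: "(\<Sum>b\<in>Basis. norm (?K' ?z b)) \<ge> 0" by (simp add: sum_nonneg)
      have KP: "norm (K ?z) \<le> P ?z" using S0 by (simp add: P_def)
      have SP: "(\<Sum>b\<in>Basis. norm (?K' ?z b)) \<le> P ?z" by (simp add: P_def)
      have 1: "2 * (K ?z \<bullet> ?K' ?z d) \<le> 2 * norm d * (P ?z * P ?z)"
      proof -
        have "norm (?K' ?z d) \<le> P ?z * norm d"
          using linear_norm_le_sum[OF smooth_on_linear_frechet[OF sK cO[OF t]], of d] SP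
          by (meson mult_right_mono norm_ge_zero order_trans)
        then have "norm (K ?z) * norm (?K' ?z d) \<le> P ?z * (P ?z * norm d)"
          using KP P0 by (intro mult_mono) auto
        then show ?thesis using norm_cauchy_schwarz[of "K ?z" "?K' ?z d"] by (simp add: mult_ac)
      qed
      have b2: "norm (?K2 ?z b d) \<le> n * (C * J) * norm d * P ?z" if b: "b \<in> Basis" for b
      proof -
        have "norm (?K2 ?z b d) \<le> (\<Sum>b'\<in>Basis. norm (?K2 ?z b b')) * norm d"
          by (rule linear_norm_le_sum[OF smooth_on_linear_frechet[OF sK' cO[OF t]]])
        also have "\<dots> \<le> (\<Sum>b'\<in>(Basis::'e set). C * (P ?z * J)) * norm d"
          by (intro mult_right_mono sum_mono K2[OF zc b]) auto
        finally show ?thesis by (simp add: n_def mult_ac)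
      qed
      have 2: "(\<Sum>b\<in>Basis. 2 * (?K' ?z b \<bullet> ?K2 ?z b d)) \<le> 2 * (n * (C * J) * norm d) * (P ?z * P ?z)"
      proof -
        have "2 * (?K' ?z b \<bullet> ?K2 ?z b d) \<le> norm (?K' ?z b) * (2 * (n * (C * J) * norm d * P ?z))" if b: "b \<in> Basis" for b
          using norm_cauchy_schwarz[of "?K' ?z b" "?K2 ?z b d"] mult_left_mono[OF b2[OF b] norm_ge_zero[of "?K' ?z b"]] by linarith
        then have "(\<Sum>b\<in>Basis. 2 * (?K' ?z b \<bullet> ?K2 ?z b d)) \<le> (\<Sum>b\<in>Basis. norm (?K' ?z b)) * (2 * (n * (C * J) * norm d * P ?z))"
          unfolding sum_distrib_right by (rule sum_mono)
        also have "\<dots> \<le> P ?z * (2 * (n * (C * J) * norm d * P ?z))"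
          using SP P0 n0 C(1) \<open>J \<ge> 0\<close> by (intro mult_right_mono) auto
        finally show ?thesis by (simp add: mult_ac)
      qed
      have 3: "P ?z * P ?z \<le> 2 * (1 + n) * \<psi> t"
      proof -
        have sq: "(\<Sum>b\<in>Basis. norm (?K' ?z b))\<^sup>2 \<le> (\<Sum>b\<in>Basis. (norm (?K' ?z b))\<^sup>2) * n"
          using sum_squared_le_sum_of_squares[of "\<lambda>b. norm (?K' ?z b)" "Basis :: 'e set"] by (simp add: n_def)
        have ab: "(p + q) * (p + q) \<le> 2 * p\<^sup>2 + 2 * q\<^sup>2" for p q :: real
          using sum_squares_bound[of p q] by (simp add: power2_eq_square algebra_simps)
        have "P ?z * P ?z \<le> 2 * (norm (K ?z))\<^sup>2 + 2 * ((\<Sum>b\<in>Basis. (norm (?K' ?z b))\<^sup>2) * n)"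
          using ab[of "norm (K ?z)" "\<Sum>b\<in>Basis. norm (?K' ?z b)"] sq by (simp add: P_def)
        also have "\<dots> \<le> 2 * (1 + n) * ((norm (K ?z))\<^sup>2 + (\<Sum>b\<in>Basis. (norm (?K' ?z b))\<^sup>2))"
          using n0 by (simp add: algebra_simps sum_nonneg)
        finally show ?thesis by (simp add: \<psi>_def power2_norm_eq_inner)
      qed
      have "\<psi>' t \<le> (2 * norm d + 2 * (n * (C * J) * norm d)) * (P ?z * P ?z)"
        using 1 2 unfolding \<psi>'_def distrib_right by linarith
      also have "\<dots> \<le> (2 * norm d + 2 * (n * (C * J) * norm d)) * (2 * (1 + n) * \<psi> t)"
        using n0 C(1) \<open>J \<ge> 0\<close> by (intro mult_left_mono 3) auto
      finally show ?thesis by (simp add: Ct_def mult_ac)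
    qed
    have "\<psi> 0 = 0" using K1 K1' by (simp add: \<psi>_def c_def)
    moreover have "\<psi> 1 \<ge> 0" by (simp add: \<psi>_def sum_nonneg)
    ultimately have "\<psi> 1 = 0" using Gronwall_zero[OF d\<psi> growth] by blast
    moreover have "\<psi> 1 \<ge> K x \<bullet> K x" by (simp add: \<psi>_def c_def d_def sum_nonneg)
    ultimately have "K x \<bullet> K x \<le> 0" by simp
    then show "K x = 0" using inner_ge_zero[of "K x"] by (metis antisym inner_eq_zero_iff)
  qed
qed

end

subsection \<open>Comparison with a constant metric\<close>

lemma vector_derivative_bound:
  fixes g :: "real \<Rightarrow> 'a::real_normed_vector"
  assumes "\<And>s. s \<in> {0..t} \<Longrightarrow> (g has_vector_derivative g' s) (at s within {0..t})"
    "\<And>s. s \<in> {0..t} \<Longrightarrow> norm (g' s) \<le> B" "s \<in> {0..t}"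
  shows "norm (g s - g 0) \<le> B * s"
proof -
  have "norm (g s - g 0) \<le> B * norm (s - 0)"
  proof (rule differentiable_bound[where S = "{0..t}" and f' = "\<lambda>s h. h *\<^sub>R g' s"])
    fix u assume u: "u \<in> {0..t}"
    show "(g has_derivative (\<lambda>h. h *\<^sub>R g' u)) (at u within {0..t})"
      using assms(1)[OF u] by (simp add: has_vector_derivative_def)
    have "norm (h *\<^sub>R g' u) \<le> B * norm h" for h
      using mult_left_mono[OF assms(2)[OF u], of "\<bar>h\<bar>"] by (simp add: mult.commute)
    then show "onorm (\<lambda>h. h *\<^sub>R g' u) \<le> B" by (rule onorm_le)
  qed (use assms(3) in auto)
  then show ?thesis using assms(3) by simp
qed

text \<open>To first order in time, the difference of two solutions evolves by the linearised
  equation, with an error proportional to the initial difference. That proportionality lets the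
  estimate pass to the derivative of the flow in its initial point.\<close>

lemma flow_difference_expansion:
  fixes k :: "'e::euclidean_space \<Rightarrow> 'e"
  assumes k: "smooth_on S k" "open S" "x0 \<in> S" and e: "e > 0"
  obtains R d where "R > 0" "d > 0" "cball x0 R \<subseteq> S"
    "\<And>t u v. 0 \<le> t \<Longrightarrow> t \<le> d \<Longrightarrow>
      (\<And>s. s \<in> {0..t} \<Longrightarrow> u s \<in> cball x0 R \<and> (u has_vector_derivative k (u s)) (at s within {0..t})) \<Longrightarrow>
      (\<And>s. s \<in> {0..t} \<Longrightarrow> v s \<in> cball x0 R \<and> (v has_vector_derivative k (v s)) (at s within {0..t})) \<Longrightarrow>
      norm (u t - v t - (u 0 - v 0) - t *\<^sub>R frechet_derivative k (at x0) (u 0 - v 0)) \<le> e * t * norm (u 0 - v 0)"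
proof -
  let ?D = "frechet_derivative k (at x0)"
  have e4: "e / 4 > 0" using e by simp
  obtain r where r: "r > 0" "ball x0 r \<subseteq> S"
    "\<And>a b. a \<in> ball x0 r \<Longrightarrow> b \<in> ball x0 r \<Longrightarrow> norm (k a - k b - ?D (a - b)) \<le> (e / 4) * norm (a - b)"
    using smooth_on_strict_derivative[OF k e4] by blast
  have lD: "linear ?D" by (rule smooth_on_linear_frechet[OF k(1,3)])
  define N where "N = (\<Sum>b\<in>Basis. norm (?D b))"
  have N: "N \<ge> 0" "\<And>v. norm (?D v) \<le> N * norm v"
    unfolding N_def using linear_norm_le_sum[OF lD] by (auto intro: sum_nonneg)
  define L where "L = N + e / 4"
  have L: "L > 0" using N e by (simp add: L_def)
  define R where "R = r / 2"
  have R: "R > 0" "cball x0 R \<subseteq> ball x0 r" using r(1) by (auto simp: R_def)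
  \<comment> \<open>The first bound gives \<open>t * L \<le> 1 / 2\<close>, so the difference of the
    solutions at most doubles; the second keeps the drift of the linear term below
    \<open>e / 4\<close> times the largest difference.\<close>
  define d where "d = min (1 / (2 * L)) (e / (4 * (N * L + 1)))"
  have NL: "N * L + 1 > 0" using N L by (simp add: add_nonneg_pos)
  have d0: "d > 0" using L e NL by (simp add: d_def)
  have dL: "d * L \<le> 1 / 2"
  proof -
    have "d * L \<le> 1 / (2 * L) * L" using L by (intro mult_right_mono) (auto simp: d_def)
    then show ?thesis using L by simp
  qed
  have dN: "2 * (N * L * d) \<le> e / 2"
  proof -
    have "N * L * d \<le> (N * L + 1) * d" using d0 by simp
    also have "\<dots> \<le> (N * L + 1) * (e / (4 * (N * L + 1)))"
      using NL by (intro mult_left_mono) (auto simp: d_def)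
    also have "\<dots> = e / 4" using NL by (simp add: field_simps)
    finally show ?thesis by simp
  qed
  have main: "norm (u t - v t - (u 0 - v 0) - t *\<^sub>R ?D (u 0 - v 0)) \<le> e * t * norm (u 0 - v 0)"
    if t: "0 \<le> t" "t \<le> d"
      and u: "\<And>s. s \<in> {0..t} \<Longrightarrow> u s \<in> cball x0 R \<and> (u has_vector_derivative k (u s)) (at s within {0..t})"
      and v: "\<And>s. s \<in> {0..t} \<Longrightarrow> v s \<in> cball x0 R \<and> (v has_vector_derivative k (v s)) (at s within {0..t})" for t u v
  proof -
    define w where "w s = u s - v s" for s
    define w' where "w' s = k (u s) - k (v s)" for s
    have dw: "(w has_vector_derivative w' s) (at s within {0..t})" if "s \<in> {0..t}" for s
      unfolding w_def w'_def using u[OF that] v[OF that] by (intro has_vector_derivative_diff) auto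
    have strict: "norm (w' s - ?D (w s)) \<le> (e / 4) * norm (w s)" if "s \<in> {0..t}" for s
      unfolding w_def w'_def using r(3)[of "u s" "v s"] u[OF that] v[OF that] R(2) by blast
    have w'L: "norm (w' s) \<le> L * norm (w s)" if "s \<in> {0..t}" for s
      using norm_triangle_ineq[of "w' s - ?D (w s)" "?D (w s)"] strict[OF that] N(2)[of "w s"]
      by (simp add: L_def algebra_simps)
    have "continuous_on {0..t} w"
      unfolding continuous_on_eq_continuous_within using has_vector_derivative_continuous[OF dw] by blast
    then have "continuous_on {0..t} (\<lambda>s. norm (w s))" by (rule continuous_on_norm)
    moreover have "{0..t} \<noteq> {}" using t(1) by simp
    ultimately obtain s1 where s1: "s1 \<in> {0..t}" "\<And>s. s \<in> {0..t} \<Longrightarrow> norm (w s) \<le> norm (w s1)"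
      using continuous_attains_sup[OF compact_Icc, of 0 t "\<lambda>s. norm (w s)"] by blast
    define m where "m = norm (w s1)"
    have bw': "norm (w' s) \<le> L * m" if "s \<in> {0..t}" for s
      by (rule order_trans[OF w'L[OF that]]) (use s1(2)[OF that] L in \<open>simp add: m_def mult_left_mono\<close>)
    have dist: "norm (w s - w 0) \<le> t * (L * m)" if "s \<in> {0..t}" for s
    proof -
      have "norm (w s - w 0) \<le> (L * m) * s" by (rule vector_derivative_bound[OF dw bw' that])
      also have "\<dots> \<le> (L * m) * t" using that L by (intro mult_left_mono) (auto simp: m_def)
      finally show ?thesis by (simp add: mult.commute)
    qed
    have tL: "t * L \<le> 1 / 2" using mult_right_mono[OF t(2), of L] dL L by linarith
    \<comment> \<open>The maximum \<open>m\<close> bounds itself; as \<open>t * L\<close> is at most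
      one half, its own contribution is absorbed.\<close>
    have "m \<le> norm (w 0) + t * (L * m)"
      using dist[OF s1(1)] norm_triangle_sub[of "w s1" "w 0"] by (simp add: m_def)
    also have "t * (L * m) \<le> 1 / 2 * m" using mult_right_mono[OF tL, of m] by (simp add: m_def mult.assoc)
    finally have m: "m \<le> 2 * norm (w 0)" by simp
    have "norm (w' s - ?D (w 0)) \<le> e * norm (w 0)" if s: "s \<in> {0..t}" for s
    proof -
      have "norm (w' s - ?D (w 0)) \<le> norm (w' s - ?D (w s)) + norm (?D (w s - w 0))"
        using norm_triangle_ineq[of "w' s - ?D (w s)" "?D (w s - w 0)"] by (simp add: linear_diff[OF lD])
      also have "\<dots> \<le> (e / 4) * m + N * (t * (L * m))"
      proof (rule add_mono)
        show "norm (w' s - ?D (w s)) \<le> (e / 4) * m"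
          by (rule order_trans[OF strict[OF s]]) (use s1(2)[OF s] e in \<open>simp add: m_def\<close>)
        show "norm (?D (w s - w 0)) \<le> N * (t * (L * m))"
          using N(2)[of "w s - w 0"] mult_left_mono[OF dist[OF s] N(1)] by (rule order_trans)
      qed
      also have "N * (t * (L * m)) \<le> N * (d * (L * m))"
        using t N L by (intro mult_left_mono mult_right_mono) (auto simp: m_def)
      also have "(e / 4) * m + N * (d * (L * m)) = (e / 4 + N * L * d) * m" by (simp add: algebra_simps)
      also have "\<dots> \<le> (e / 4 + e / 4) * m" using dN by (intro mult_right_mono) (auto simp: m_def)
      also have "\<dots> \<le> (e / 2) * (2 * norm (w 0))" using m e by simp
      finally show ?thesis by simp
    qed
    then have "norm ((w t - t *\<^sub>R ?D (w 0)) - (w 0 - 0 *\<^sub>R ?D (w 0))) \<le> (e * norm (w 0)) * t"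
      using t(1) dw
      by (intro vector_derivative_bound[where g' = "\<lambda>s. w' s - ?D (w 0)" and g = "\<lambda>s. w s - s *\<^sub>R ?D (w 0)" and t = t])
        (auto intro!: derivative_eq_intros)
    then show ?thesis by (simp add: w_def algebra_simps)
  qed
  show ?thesis by (rule that[OF R(1) d0 _ main]) (use R(2) r(2) in auto)
qed

context minkowski_family
begin

lemma f_nonneg: "x \<in> \<Omega> \<Longrightarrow> 0 \<le> f (x, y)"
  using f_pos[of x y] f_0[of x] by (cases "y = 0") auto

lemma continuous_on_fibre: "x \<in> \<Omega> \<Longrightarrow> continuous_on (UNIV - {0}) (\<lambda>y. f (x, y))"
  by (intro continuous_at_imp_continuous_on ballI)
    (auto intro: has_derivative_continuous fibre_has_derivative)

lemma fibre_bounds: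
  assumes "x \<in> \<Omega>"
  obtains m C where "m > 0" "C > 0" "\<And>y. m * norm y \<le> f (x, y)" "\<And>y. f (x, y) \<le> C * norm y"
  using homogeneous_bounds[OF continuous_on_fibre[OF assms] f_pos[OF assms] f_scale[OF assms] f_0[OF assms]] by blast

lemma fibre_lipschitz:
  assumes "x \<in> \<Omega>"
  obtains C where "C > 0" "\<And>y z. \<bar>f (x, y) - f (x, z)\<bar> \<le> C * norm (y - z)"
proof -
  obtain m C where C: "m > 0" "C > 0" "\<And>y. m * norm y \<le> f (x, y)" "\<And>y. f (x, y) \<le> C * norm y"
    by (rule fibre_bounds[OF assms]) (rule that)
  have "f (x, y) \<le> f (x, z) + C * norm (y - z)" for y z
    using f_triangle[OF assms, of z "y - z"] C(4)[of "y - z"] by simp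
  from this this[unfolded norm_minus_commute] have "\<bar>f (x, y) - f (x, z)\<bar> \<le> C * norm (y - z)" for y z
    by (smt (verit) norm_minus_commute)
  then show ?thesis using that C(2) by blast
qed

text \<open>Uniform continuity on the compact unit sphere bundle over a small ball, spread to all
  vectors by homogeneity.\<close>

lemma fibre_uniform:
  assumes x0: "x0 \<in> \<Omega>" and e: "e > 0"
  obtains r where "r > 0" "cball x0 r \<subseteq> \<Omega>" "\<And>z y. z \<in> cball x0 r \<Longrightarrow> \<bar>f (z, y) - f (x0, y)\<bar> \<le> e * norm y"
proof -
  obtain r1 where r1: "r1 > 0" "cball x0 r1 \<subseteq> \<Omega>" using open_contains_cball open_\<Omega> x0 by blast
  let ?K = "cball x0 r1 \<times> sphere (0::'e) 1"
  have "compact ?K" by (intro compact_Times compact_cball compact_sphere)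
  moreover have "continuous_on ?K f"
    by (rule continuous_on_subset[OF smooth_on_continuous_on[OF smooth_f]]) (use r1 in auto)
  ultimately have "uniformly_continuous_on ?K f" by (simp add: compact_uniformly_continuous)
  then obtain d where d: "d > 0" "\<And>p q. p \<in> ?K \<Longrightarrow> q \<in> ?K \<Longrightarrow> dist q p < d \<Longrightarrow> dist (f q) (f p) < e"
    unfolding uniformly_continuous_on_def using e by metis
  define r where "r = min r1 (d / 2)"
  have r: "r > 0" "r \<le> r1" "r < d" using r1 d by (auto simp: r_def)
  have sub: "cball x0 r \<subseteq> \<Omega>" using r(2) r1(2) subset_cball by blast
  have "\<bar>f (z, y) - f (x0, y)\<bar> \<le> e * norm y" if z: "z \<in> cball x0 r" for z y
  proof (cases "y = 0")
    case True then show ?thesis using z sub x0 f_0 by auto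
  next
    case False
    define u where "u = y /\<^sub>R norm y"
    have u: "norm u = 1" "y = norm y *\<^sub>R u" using False by (auto simp: u_def)
    have "dist (f (z, u)) (f (x0, u)) < e"
      using z r u by (intro d(2)) (auto simp: dist_Pair_Pair dist_commute)
    have "f (z, y) = norm y * f (z, u)" "f (x0, y) = norm y * f (x0, u)"
      using f_scale[of z "norm y" u] f_scale[OF x0, of "norm y" u] False z sub u(2) by auto
    then have "f (z, y) - f (x0, y) = norm y * (f (z, u) - f (x0, u))" by (simp add: algebra_simps)
    then have "\<bar>f (z, y) - f (x0, y)\<bar> = norm y * \<bar>f (z, u) - f (x0, u)\<bar>" by (simp add: abs_mult)
    also have "\<dots> \<le> norm y * e"
      using \<open>dist (f (z, u)) (f (x0, u)) < e\<close> by (intro mult_left_mono) (auto simp: dist_real_def)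
    finally show ?thesis by (simp add: mult.commute)
  qed
  then show ?thesis using that r(1) sub by blast
qed

text \<open>Smoothness is given only off the zero section, while the velocity of a curve may vanish.
  Continuity there comes from the Lipschitz estimate in the fibre and the uniform estimate in the
  base point.\<close>

lemma continuous_on_f: "continuous_on (\<Omega> \<times> UNIV) f"
  unfolding continuous_on_def
proof (safe)
  fix x y :: 'e assume x: "x \<in> \<Omega>"
  obtain C where C: "C > 0" "\<And>y z. \<bar>f (x, y) - f (x, z)\<bar> \<le> C * norm (y - z)" using fibre_lipschitz[OF x] by blast
  show "(f \<longlongrightarrow> f (x, y)) (at (x, y) within \<Omega> \<times> UNIV)"
  proof (rule tendstoI)
    fix e :: real assume e: "e > 0"
    define e' where "e' = e / (2 * (norm y + 1))"
    have ny: "norm y + 1 > 0" by (simp add: add_nonneg_pos)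
    have e': "e' > 0" using e ny by (simp add: e'_def)
    obtain r where r: "r > 0" "cball x r \<subseteq> \<Omega>" "\<And>z y. z \<in> cball x r \<Longrightarrow> \<bar>f (z, y) - f (x, y)\<bar> \<le> e' * norm y"
      by (rule fibre_uniform[OF x e']) (rule that)
    define d where "d = min r (min 1 (e / (2 * C)))"
    have d: "d > 0" "d \<le> r" "d \<le> 1" "C * d \<le> e / 2"
    proof -
      show "d > 0" "d \<le> r" "d \<le> 1" using r e C by (auto simp: d_def)
      have "C * d \<le> C * (e / (2 * C))" using C by (intro mult_left_mono) (auto simp: d_def)
      then show "C * d \<le> e / 2" using C by simp
    qed
    have "dist (f (z, w)) (f (x, y)) < e" if "dist (z, w) (x, y) < d" for z w
    proof -
      have dz: "dist z x < d" "dist w y < d"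
        using that dist_fst_le[of "(z, w)" "(x, y)"] dist_snd_le[of "(z, w)" "(x, y)"] by auto
      have "norm w \<le> norm y + 1" using dz(2) d(3) norm_triangle_sub[of w y] by (simp add: dist_norm)
      then have "e' * norm w \<le> e' * (norm y + 1)" using e' by (intro mult_left_mono) auto
      also have "\<dots> = e / 2" using ny by (simp add: e'_def field_simps)
      finally have 1: "\<bar>f (z, w) - f (x, w)\<bar> \<le> e / 2"
        using r(3)[of z w] dz(1) d(2) by (simp add: dist_commute)
      have "C * norm (w - y) < C * d" using dz(2) C(1) by (simp add: dist_norm)
      then have 2: "\<bar>f (x, w) - f (x, y)\<bar> < e / 2" using C(2)[of w y] d(4) by linarith
      show ?thesis using 1 2 unfolding dist_real_def by linarith
    qed
    then show "\<forall>\<^sub>F p in at (x, y) within \<Omega> \<times> UNIV. dist (f p) (f (x, y)) < e"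
      unfolding eventually_at using d(1) by (intro exI[of _ d]) auto
  qed
qed

text \<open>The difference quotients at \<open>v\<close> are bounded by \<open>f (x, y)\<close>
  through subadditivity, and for \<open>y = v\<close> they equal \<open>f (x, v)\<close> by
  homogeneity. So the derivative is a supporting functional of the unit ball.\<close>

lemma fibre_deriv_le:
  assumes x: "x \<in> \<Omega>" and v: "v \<noteq> 0"
  shows "fibre_deriv x v y \<le> f (x, y)" "fibre_deriv x v v = f (x, v)"
proof -
  have d: "((\<lambda>s. f (x, v + s *\<^sub>R y)) has_real_derivative fibre_deriv x v y) (at 0)" for y
  proof -
    have "((\<lambda>z. f (x, z)) has_derivative fibre_deriv x v) (at (v + 0 *\<^sub>R y))"
      using fibre_has_derivative[OF x v] by simp
    from has_derivative_compose[OF affine_line_has_derivative this] show ?thesis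
      by (simp add: has_field_derivative_def linear_scale[OF linear_fibre_deriv[OF x]] mult_commute_abs)
  qed
  have lim: "((\<lambda>s. (f (x, v + s *\<^sub>R y) - f (x, v)) / s) \<longlongrightarrow> fibre_deriv x v y) (at_right 0)" for y
    using d[of y] by (auto simp: DERIV_def intro: tendsto_mono[OF at_within_le_at])
  show "fibre_deriv x v y \<le> f (x, y)"
  proof (rule tendsto_upperbound[OF lim])
    have "(f (x, v + s *\<^sub>R y) - f (x, v)) / s \<le> f (x, y)" if "s > 0" for s
      using f_triangle[OF x, of v "s *\<^sub>R y"] f_scale[OF x that, of y] that by (simp add: field_simps)
    then show "\<forall>\<^sub>F s in at_right 0. (f (x, v + s *\<^sub>R y) - f (x, v)) / s \<le> f (x, y)"
      by (simp add: eventually_at_filter)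
  qed simp
  have "((\<lambda>s. (f (x, v + s *\<^sub>R v) - f (x, v)) / s) \<longlongrightarrow> f (x, v)) (at_right 0)"
  proof (rule tendsto_eventually)
    have "(f (x, v + s *\<^sub>R v) - f (x, v)) / s = f (x, v)" if "s > 0" for s
    proof -
      have "f (x, v + s *\<^sub>R v) = (1 + s) * f (x, v)"
        using f_scale[OF x, of "1 + s" v] that by (simp add: scaleR_add_left)
      then show ?thesis using that by (simp add: field_simps)
    qed
    then show "\<forall>\<^sub>F s in at_right 0. (f (x, v + s *\<^sub>R v) - f (x, v)) / s = f (x, v)"
      by (simp add: eventually_at_filter)
  qed
  then show "fibre_deriv x v v = f (x, v)"
    using tendsto_unique[OF _ lim] by (simp add: trivial_limit_at_right_real)
qed

text \<open>Calibration by a supporting functional of the constant metric \<open>f (x, _)\<close>.\<close>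

lemma fibre_length_ge:
  assumes x: "x \<in> \<Omega>" and ab: "a \<le> b"
    and u: "\<And>t. t \<in> {a..b} \<Longrightarrow> (u has_vector_derivative u' t) (at t within {a..b})" and cu: "continuous_on {a..b} u'"
  shows "f (x, u b - u a) \<le> integral {a..b} (\<lambda>t. f (x, u' t))"
proof -
  have cf: "continuous_on UNIV (\<lambda>y. f (x, y))"
    by (rule continuous_on_compose2[OF continuous_on_f, of _ "\<lambda>y. (x, y)"]) (use x in \<open>auto intro!: continuous_intros\<close>)
  have int: "(\<lambda>t. f (x, u' t)) integrable_on {a..b}"
    by (intro integrable_continuous_interval continuous_on_compose2[OF cf cu]) auto
  show ?thesis
  proof (cases "u b - u a = 0")
    case True
    then show ?thesis using f_0[OF x] f_nonneg[OF x] int by (simp add: integral_nonneg)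
  next
    case False
    define l where "l = fibre_deriv x (u b - u a)"
    have l: "linear l" unfolding l_def by (rule linear_fibre_deriv[OF x])
    have "(u' has_integral (u b - u a)) {a..b}"
      by (rule fundamental_theorem_of_calculus[OF ab u])
    then have "((l \<circ> u') has_integral l (u b - u a)) {a..b}"
      by (rule has_integral_linear) (use l in \<open>simp add: linear_conv_bounded_linear\<close>)
    moreover have "((\<lambda>t. f (x, u' t)) has_integral integral {a..b} (\<lambda>t. f (x, u' t))) {a..b}"
      using int by (rule integrable_integral)
    ultimately have "l (u b - u a) \<le> integral {a..b} (\<lambda>t. f (x, u' t))"
      by (rule has_integral_le) (use fibre_deriv_le(1)[OF x False] in \<open>auto simp: l_def\<close>)
    then show ?thesis using fibre_deriv_le(2)[OF x False] by (simp add: l_def)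
  qed
qed

text \<open>Recovers \<open>f\<close> from a distance by its first-order behaviour along two curves
  issuing from \<open>x0\<close>. The limit is one-sided because \<open>f\<close> is only positively
  homogeneous.\<close>

lemma strict_metric_limit:
  assumes x0: "x0 \<in> \<Omega>"
    and strict: "\<And>e. e > 0 \<Longrightarrow> \<exists>d>0. \<forall>x\<in>ball x0 d. \<forall>x'\<in>ball x0 d. \<bar>\<delta> x x' - f (x0, x' - x)\<bar> \<le> e * norm (x' - x)"
    and q: "(q1 has_vector_derivative y1) (at 0)" "(q2 has_vector_derivative y2) (at 0)" "q1 0 = x0" "q2 0 = x0"
  shows "((\<lambda>s. \<delta> (q1 s) (q2 s) / s) \<longlongrightarrow> f (x0, y2 - y1)) (at_right 0)"
proof -
  define w where "w s = (q2 s - q1 s) /\<^sub>R s" for s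
  have wlim: "(w \<longlongrightarrow> y2 - y1) (at_right 0)"
  proof -
    have "((\<lambda>s. norm ((1 / norm s) *\<^sub>R ((q2 s - q1 s) - (q2 0 - q1 0) - s *\<^sub>R (y2 - y1)))) \<longlongrightarrow> 0) (at 0)"
      using has_vector_derivative_diff[OF q(2,1)]
      unfolding has_vector_derivative_def has_derivative_at by simp
    then have "((\<lambda>s. (1 / norm s) *\<^sub>R ((q2 s - q1 s) - (q2 0 - q1 0) - s *\<^sub>R (y2 - y1))) \<longlongrightarrow> 0) (at 0)"
      by (rule tendsto_norm_zero_cancel)
    then have "((\<lambda>s. (1 / norm s) *\<^sub>R ((q2 s - q1 s) - (q2 0 - q1 0) - s *\<^sub>R (y2 - y1))) \<longlongrightarrow> 0) (at_right 0)"
      by (rule tendsto_mono[OF at_within_le_at])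
    moreover have "\<forall>\<^sub>F s in at_right 0. (1 / norm s) *\<^sub>R ((q2 s - q1 s) - (q2 0 - q1 0) - s *\<^sub>R (y2 - y1)) = w s - (y2 - y1)"
      by (auto simp: eventually_at_filter w_def q(3,4) scaleR_diff_right divide_inverse)
    ultimately have "((\<lambda>s. w s - (y2 - y1)) \<longlongrightarrow> 0) (at_right 0)" by (rule Lim_transform_eventually)
    then show ?thesis by (rule LIM_zero_cancel)
  qed
  have cf: "isCont (\<lambda>y. f (x0, y)) y" for y
  proof -
    have "continuous_on UNIV (\<lambda>y. f (x0, y))"
      by (rule continuous_on_compose2[OF continuous_on_f, of _ "\<lambda>y. (x0, y)"]) (use x0 in \<open>auto intro!: continuous_intros\<close>)
    then show ?thesis by (simp add: continuous_on_eq_continuous_at)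
  qed
  have flim: "((\<lambda>s. f (x0, w s)) \<longlongrightarrow> f (x0, y2 - y1)) (at_right 0)"
    by (rule isCont_tendsto_compose[OF cf wlim])
  have "((\<lambda>s. \<delta> (q1 s) (q2 s) / s - f (x0, w s)) \<longlongrightarrow> 0) (at_right 0)"
  proof (rule tendstoI)
    fix e :: real assume e: "e > 0"
    define e' where "e' = e / (norm (y2 - y1) + 1)"
    have np: "norm (y2 - y1) + 1 > 0" by (simp add: add_nonneg_pos)
    have e': "e' > 0" using e np by (simp add: e'_def)
    obtain d where d: "d > 0" "\<And>x x'. x \<in> ball x0 d \<Longrightarrow> x' \<in> ball x0 d \<Longrightarrow> \<bar>\<delta> x x' - f (x0, x' - x)\<bar> \<le> e' * norm (x' - x)"
      using strict[OF e'] by blast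
    have c: "(q1 \<longlongrightarrow> x0) (at_right 0)" "(q2 \<longlongrightarrow> x0) (at_right 0)"
      using has_vector_derivative_continuous[OF q(1)] has_vector_derivative_continuous[OF q(2)] q(3,4)
      by (auto simp: continuous_within intro: tendsto_mono[OF at_within_le_at])
    have "\<forall>\<^sub>F s in at_right 0. q1 s \<in> ball x0 d" "\<forall>\<^sub>F s in at_right 0. q2 s \<in> ball x0 d"
      using c d(1) by (auto simp: tendsto_iff dist_commute)
    moreover have "\<forall>\<^sub>F s in at_right 0. norm (w s) < norm (y2 - y1) + 1"
      using order_tendstoD(2)[OF tendsto_norm[OF wlim], of "norm (y2 - y1) + 1"] by simp
    moreover have "\<forall>\<^sub>F s in at_right 0. s > (0::real)" by (simp add: eventually_at_filter)
    ultimately show "\<forall>\<^sub>F s in at_right 0. dist (\<delta> (q1 s) (q2 s) / s - f (x0, w s)) 0 < e"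
    proof eventually_elim
      case (elim s)
      have "f (x0, q2 s - q1 s) = s * f (x0, w s)" using f_scale[OF x0 elim(4), of "w s"] elim(4) by (simp add: w_def)
      then have "\<delta> (q1 s) (q2 s) / s - f (x0, w s) = (\<delta> (q1 s) (q2 s) - f (x0, q2 s - q1 s)) / s"
        using elim(4) by (simp add: field_simps)
      also have "\<bar>\<dots>\<bar> \<le> e' * norm (q2 s - q1 s) / s"
        using d(2)[OF elim(1,2)] elim(4) by (simp add: divide_right_mono)
      also have "\<dots> = e' * norm (w s)" using elim(4) by (simp add: w_def divide_inverse mult_ac)
      also have "\<dots> < e' * (norm (y2 - y1) + 1)" using elim(3) e' by simp
      also have "\<dots> = e" using np by (simp add: e'_def)
      finally show ?case by simp
    qed
  qed
  from tendsto_add[OF this flim] show ?thesis by simp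
qed

end

subsection \<open>Charts and tangent vectors\<close>

locale smooth_mfd =
  fixes X :: "'a topology" and A :: "('a, 'e::euclidean_space) chart set"
  assumes manifold: "smooth_manifold X A"
begin

lemma Hausdorff_X: "Hausdorff_space X"
  using manifold by (simp add: smooth_manifold_def)

lemma charts_cover: "p \<in> topspace X \<Longrightarrow> \<exists>c\<in>A. p \<in> fst c"
  using manifold by (auto simp: smooth_manifold_def smooth_atlas_def)

context
  fixes c assumes cA: "c \<in> A"
begin

lemma is_chart: "is_chart X c"
  using manifold cA by (simp add: smooth_manifold_def smooth_atlas_def)

lemma openin_dom: "openin X (fst c)"
  using is_chart by (simp add: is_chart_def)

lemma dom_subset: "fst c \<subseteq> topspace X"
  using openin_dom by (rule openin_subset)

lemma open_codom: "open (snd c ` fst c)"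
  using is_chart by (simp add: is_chart_def)

lemma topspace_dom: "topspace (subtopology X (fst c)) = fst c"
  using dom_subset by auto

lemma homeo: "homeomorphic_map (subtopology X (fst c)) (top_of_set (snd c ` fst c)) (snd c)"
  using is_chart by (simp add: is_chart_def)

lemma chart_inj: "inj_on (snd c) (fst c)"
  using homeomorphic_imp_injective_map[OF homeo] topspace_dom by simp

lemma chart_inv_chart [simp]: "p \<in> fst c \<Longrightarrow> chart_inv c (snd c p) = p"
  unfolding chart_inv_def by (rule inv_into_f_f[OF chart_inj])

lemma chart_inv_in [simp]: "x \<in> snd c ` fst c \<Longrightarrow> chart_inv c x \<in> fst c"
  unfolding chart_inv_def by (rule inv_into_into)

lemma chart_chart_inv [simp]: "x \<in> snd c ` fst c \<Longrightarrow> snd c (chart_inv c x) = x"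
  unfolding chart_inv_def by (rule f_inv_into_f)

lemma open_chart_image:
  assumes "openin X U"
  shows "open (snd c ` (fst c \<inter> U))"
proof -
  have "openin (subtopology X (fst c)) (fst c \<inter> U)"
    using assms by (auto simp: openin_subtopology Int_commute)
  then have "openin (top_of_set (snd c ` fst c)) (snd c ` (fst c \<inter> U))"
    using homeomorphic_imp_open_map[OF homeo] by (simp add: open_map_def)
  then show ?thesis using open_codom openin_open_trans by blast
qed

lemma continuous_map_chart: "continuous_map (subtopology X (fst c)) euclidean (snd c)"
  using homeomorphic_imp_continuous_map[OF homeo] by (simp add: continuous_map_in_subtopology)

lemma openin_chart_vimage:
  assumes "open W"
  shows "openin X {p \<in> fst c. snd c p \<in> W}"
proof -
  have "openin (subtopology X (fst c)) {p \<in> topspace (subtopology X (fst c)). snd c p \<in> W}"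
    by (rule openin_continuous_map_preimage[OF continuous_map_chart]) (rule open_openin[THEN iffD1, OF assms])
  then show ?thesis unfolding topspace_dom using openin_dom openin_trans_full by blast
qed

lemma continuous_map_chart_inv: "continuous_map (top_of_set (snd c ` fst c)) X (chart_inv c)"
  unfolding continuous_map_def
proof (intro conjI allI impI)
  show "chart_inv c \<in> topspace (top_of_set (snd c ` fst c)) \<rightarrow> topspace X"
    using dom_subset by auto
  fix U assume U: "openin X U"
  have "{x \<in> topspace (top_of_set (snd c ` fst c)). chart_inv c x \<in> U} = snd c ` (fst c \<inter> U)"
    by force
  then show "openin (top_of_set (snd c ` fst c)) {x \<in> topspace (top_of_set (snd c ` fst c)). chart_inv c x \<in> U}"
    using open_chart_image[OF U] by (simp add: open_subset image_mono)
qed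

lemma continuous_on_chart_curve:
  assumes "continuous_map (top_of_set I) X \<gamma>" "J \<subseteq> I" "\<And>t. t \<in> J \<Longrightarrow> \<gamma> t \<in> fst c"
  shows "continuous_on J (snd c \<circ> \<gamma>)"
proof -
  have "continuous_map (top_of_set J) X \<gamma>"
    using continuous_map_from_subtopology_mono[OF assms(1,2)] .
  then have "continuous_map (top_of_set J) (subtopology X (fst c)) \<gamma>"
    using assms(3) by (auto simp: continuous_map_in_subtopology)
  then show ?thesis using continuous_map_compose[OF _ continuous_map_chart] by force
qed

end

lemma smooth_transition:
  "c \<in> A \<Longrightarrow> c' \<in> A \<Longrightarrow> smooth_on (snd c ` (fst c \<inter> fst c')) (snd c' \<circ> chart_inv c)"
  using manifold by (simp add: smooth_manifold_def smooth_atlas_def)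

section \<open>Differentials of coordinate changes and velocities of curves\<close>

definition tr :: "('a, 'e) chart \<Rightarrow> ('a, 'e) chart \<Rightarrow> 'a \<Rightarrow> 'e \<Rightarrow> 'e"
  where "tr c c' p = frechet_derivative (snd c' \<circ> chart_inv c) (at (snd c p))"

lemma tr_has_derivative:
  assumes "c \<in> A" "c' \<in> A" "p \<in> fst c" "p \<in> fst c'"
  shows "((snd c' \<circ> chart_inv c) has_derivative tr c c' p) (at (snd c p))"
  unfolding tr_def by (rule smooth_on_has_derivative[OF smooth_transition]) (use assms in auto)

lemma linear_tr: "c \<in> A \<Longrightarrow> c' \<in> A \<Longrightarrow> p \<in> fst c \<Longrightarrow> p \<in> fst c' \<Longrightarrow> linear (tr c c' p)"
  using tr_has_derivative has_derivative_linear by blast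

lemma tr_same:
  assumes "c \<in> A" "p \<in> fst c"
  shows "tr c c p = (\<lambda>w. w)"
proof -
  have "((snd c \<circ> chart_inv c) has_derivative (\<lambda>w. w)) (at (snd c p))"
    by (rule has_derivative_transform_within_open[OF has_derivative_ident open_codom[OF assms(1)]])
      (use assms in auto)
  then show ?thesis using has_derivative_unique tr_has_derivative[OF assms(1,1,2,2)] by blast
qed

lemma tr_tr:
  assumes c: "c \<in> A" "c' \<in> A" "c'' \<in> A" and p: "p \<in> fst c" "p \<in> fst c'" "p \<in> fst c''"
  shows "tr c' c'' p (tr c c' p w) = tr c c'' p w"
proof -
  have "(snd c' \<circ> chart_inv c) (snd c p) = snd c' p" using c p by simp
  then have "((\<lambda>x. (snd c'' \<circ> chart_inv c') ((snd c' \<circ> chart_inv c) x)) has_derivative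
      (\<lambda>w. tr c' c'' p (tr c c' p w))) (at (snd c p))"
    using has_derivative_compose[OF tr_has_derivative[OF c(1,2) p(1,2)]] tr_has_derivative[OF c(2,3) p(2,3)]
    by metis
  moreover have "openin X (fst c' \<inter> fst c'')" using c openin_dom by blast
  then have "open (snd c ` (fst c \<inter> (fst c' \<inter> fst c'')))" by (rule open_chart_image[OF c(1)])
  ultimately have "((snd c'' \<circ> chart_inv c) has_derivative (\<lambda>w. tr c' c'' p (tr c c' p w))) (at (snd c p))"
    by (rule has_derivative_transform_within_open) (use c p in auto)
  then have "(\<lambda>w. tr c' c'' p (tr c c' p w)) = tr c c'' p"
    using has_derivative_unique tr_has_derivative[OF c(1,3) p(1,3)] by blast
  then show ?thesis by metis
qed

lemma tvec_of_tr: "tvec_of A c p w = (\<lambda>c'. if c' \<in> charts_at A p then tr c c' p w else 0)"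
  unfolding tvec_of_def tr_def by (rule refl)

lemma tangent_space_tr: "tangent_space A p = {v. (\<forall>c. c \<notin> charts_at A p \<longrightarrow> v c = 0) \<and>
    (\<forall>c\<in>charts_at A p. \<forall>c'\<in>charts_at A p. v c' = tr c c' p (v c))}"
  by (simp add: tangent_space_def tr_def)

context
  fixes c p assumes cA: "c \<in> A" and pc: "p \<in> fst c"
begin

lemma tvec_of_in: "tvec_of A c p w \<in> tangent_space A p"
  unfolding tangent_space_tr tvec_of_tr using cA pc tr_tr by (auto simp: charts_at_def)

lemma tvec_of_at [simp]: "tvec_of A c p w c = w"
  unfolding tvec_of_tr using cA pc tr_same by (simp add: charts_at_def)

lemma tvec_of_component:
  assumes "v \<in> tangent_space A p"
  shows "tvec_of A c p (v c) = v"
proof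
  fix c'
  have "c \<in> charts_at A p" using cA pc by (simp add: charts_at_def)
  then have 1: "c' \<in> charts_at A p \<Longrightarrow> v c' = tr c c' p (v c)" and 2: "c' \<notin> charts_at A p \<Longrightarrow> v c' = 0"
    using assms unfolding tangent_space_tr by blast+
  show "tvec_of A c p (v c) c' = v c'"
  proof (cases "c' \<in> charts_at A p")
    case True
    show ?thesis unfolding tvec_of_tr if_P[OF True] by (rule 1[OF True, symmetric])
  next
    case False
    show ?thesis unfolding tvec_of_tr if_not_P[OF False] by (rule 2[OF False, symmetric])
  qed
qed

lemma tvec_of_add: "tvec_of A c p (v + w) = tvec_of A c p v + tvec_of A c p w"
  unfolding tvec_of_tr using linear_add[OF linear_tr[OF cA _ pc]] by (auto simp: fun_vs charts_at_def)

lemma tvec_of_scale: "tvec_of A c p (r *\<^sub>R w) = r *\<^sub>R tvec_of A c p w"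
  unfolding tvec_of_tr using linear_scale[OF linear_tr[OF cA _ pc]] by (auto simp: fun_vs charts_at_def)

lemma tvec_of_zero [simp]: "tvec_of A c p 0 = 0"
  using tvec_of_scale[of 0 0] by simp

lemma tangent_component_eq_0:
  assumes "v \<in> tangent_space A p" "v c = 0"
  shows "v = 0"
  using tvec_of_component[OF assms(1)] assms(2) by simp

end

lemma subspace_tangent_space:
  assumes "p \<in> topspace X"
  shows "subspace (tangent_space A p)"
proof -
  obtain c where c: "c \<in> A" "p \<in> fst c" using charts_cover[OF assms] by blast
  have "tangent_space A p = range (tvec_of A c p)"
    using tvec_of_in[OF c] tvec_of_component[OF c] by (metis image_subset_iff subsetI subset_antisym rangeI UNIV_I)
  moreover have "linear (tvec_of A c p)"
    by (rule linearI) (simp_all add: tvec_of_add[OF c] tvec_of_scale[OF c])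
  ultimately show ?thesis using linear_subspace_image[OF _ subspace_UNIV] by metis
qed

text \<open>The chain rule for the coordinate change. By continuity the curve stays in the chart
  domain near \<open>t\<close>, and \<open>t\<close> has to be a limit point of \<open>I\<close> for
  the derivative within \<open>I\<close> to be unique.\<close>

lemma velocity_eq_tvec_of:
  assumes g: "C1_curve X A I \<gamma>" and t: "t \<in> I" "at t within I \<noteq> bot" and c: "c \<in> A" "\<gamma> t \<in> fst c"
  shows "velocity A I \<gamma> t = tvec_of A c (\<gamma> t) (vector_derivative (snd c \<circ> \<gamma>) (at t within I))"
proof -
  have cont: "continuous_map (top_of_set I) X \<gamma>" using g by (simp add: C1_curve_def)
  have d: "((snd c' \<circ> \<gamma>) has_vector_derivative vector_derivative (snd c' \<circ> \<gamma>) (at t within I)) (at t within I)"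
    if "c' \<in> A" "\<gamma> t \<in> fst c'" for c'
    unfolding vector_derivative_works[symmetric] using g t(1) that by (auto simp: C1_curve_def)
  have "vector_derivative (snd c' \<circ> \<gamma>) (at t within I) = tr c c' (\<gamma> t) (vector_derivative (snd c \<circ> \<gamma>) (at t within I))"
    if c': "c' \<in> A" "\<gamma> t \<in> fst c'" for c'
  proof (rule vector_derivative_within[OF t(2)])
    let ?w = "vector_derivative (snd c \<circ> \<gamma>) (at t within I)"
    have "(snd c \<circ> \<gamma>) t = snd c (\<gamma> t)" by simp
    then have "((snd c' \<circ> chart_inv c) has_derivative tr c c' (\<gamma> t)) (at ((snd c \<circ> \<gamma>) t))"
      using tr_has_derivative[OF c(1) c'(1) c(2) c'(2)] by simp
    from has_derivative_compose[OF d[OF c, unfolded has_vector_derivative_def] this]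
    have "((\<lambda>s. (snd c' \<circ> chart_inv c) ((snd c \<circ> \<gamma>) s)) has_vector_derivative tr c c' (\<gamma> t) ?w) (at t within I)"
      using linear_scale[OF linear_tr[OF c(1) c'(1) c(2) c'(2)]] by (simp add: has_vector_derivative_def)
    moreover have "\<forall>\<^sub>F s in at t within I. (snd c' \<circ> chart_inv c) ((snd c \<circ> \<gamma>) s) = (snd c' \<circ> \<gamma>) s"
    proof -
      have "openin (top_of_set I) {s \<in> topspace (top_of_set I). \<gamma> s \<in> fst c}"
        by (rule openin_continuous_map_preimage[OF cont openin_dom[OF c(1)]])
      then obtain W where W: "open W" "{s \<in> I. \<gamma> s \<in> fst c} = I \<inter> W"
        unfolding openin_open by auto
      have "t \<in> W" using W(2) t(1) c(2) by blast
      moreover have "\<gamma> s \<in> fst c" if "s \<in> I" "s \<in> W" for s using W(2) that by blast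
      ultimately show ?thesis
        unfolding eventually_at_topological using W(1) c(1) by (intro exI[of _ W]) auto
    qed
    ultimately show "((snd c' \<circ> \<gamma>) has_vector_derivative tr c c' (\<gamma> t) ?w) (at t within I)"
      unfolding has_vector_derivative_def
      by (rule has_derivative_transform_eventually) (use c t(1) in auto)
  qed
  then show ?thesis by (auto simp: velocity_def tvec_of_tr charts_at_def fun_eq_iff)
qed

text \<open>The first time outside the open ball is reached on the boundary sphere. The closed
  coordinate ball is compact, hence closed in the Hausdorff space, so the curve cannot leave the
  chart domain without crossing that sphere.\<close>

lemma curve_exit:
  fixes T :: real
  assumes cont: "continuous_map (top_of_set {0..T}) X u" and T: "0 \<le> T" and c: "c \<in> A"
    and ball: "cball x0 r \<subseteq> snd c ` fst c" and start: "u 0 \<in> fst c" "snd c (u 0) \<in> ball x0 r"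
    and leaves: "\<not> (\<forall>t\<in>{0..T}. u t \<in> fst c \<and> snd c (u t) \<in> ball x0 r)"
  obtains s where "s \<in> {0..T}" "\<And>t. t \<in> {0..s} \<Longrightarrow> u t \<in> fst c \<and> snd c (u t) \<in> cball x0 r"
    "dist x0 (snd c (u s)) = r"
proof -
  define W where "W = {p \<in> fst c. snd c p \<in> ball x0 r}"
  define C where "C = chart_inv c ` cball x0 r"
  have W: "openin X W" unfolding W_def by (rule openin_chart_vimage[OF c open_ball])
  have "compactin (top_of_set (snd c ` fst c)) (cball x0 r)"
    using ball by (simp add: compactin_subtopology)
  then have "compactin X C" unfolding C_def by (rule image_compactin[OF _ continuous_map_chart_inv[OF c]])
  then have C: "closedin X C" by (rule compactin_imp_closedin[OF Hausdorff_X])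
  have Ceq: "p \<in> C \<longleftrightarrow> p \<in> fst c \<and> snd c p \<in> cball x0 r" for p
    unfolding C_def using ball chart_inv_in[OF c] chart_chart_inv[OF c] chart_inv_chart[OF c] by (force simp del: mem_cball)
  have utop: "u t \<in> topspace X" if "t \<in> {0..T}" for t
    using continuous_map_image_subset_topspace[OF cont] that by auto
  define Z where "Z = {t \<in> {0..T}. u t \<in> topspace X - W}"
  have "closedin (top_of_set {0..T}) {t \<in> topspace (top_of_set {0..T}). u t \<in> topspace X - W}"
    by (rule closedin_continuous_map_preimage[OF cont]) (use W in \<open>simp add: closedin_diff\<close>)
  then have "closedin (top_of_set {0..T}) Z" by (simp add: Z_def)
  then have "closed Z" by (rule closedin_closed_trans) simp
  then have comp: "compact Z"
    using compact_Int_closed[OF compact_Icc[of 0 T], of Z] by (simp add: Z_def Int_absorb1 subset_iff)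
  obtain t where "t \<in> {0..T}" "\<not> (u t \<in> fst c \<and> snd c (u t) \<in> ball x0 r)" using leaves by blast
  then have "t \<in> Z" using utop by (simp add: W_def Z_def)
  then have "Z \<noteq> {}" by blast
  then obtain s where s: "s \<in> Z" "\<And>t. t \<in> Z \<Longrightarrow> s \<le> t" using compact_attains_inf[OF comp] by blast
  have inW: "u t \<in> W" if "0 \<le> t" "t < s" for t
    using s(2)[of t] that s(1) utop[of t] by (auto simp: not_le[symmetric] Z_def)
  have "s \<noteq> 0" using s(1) start by (auto simp: W_def Z_def)
  then have s0: "s > 0" "s \<le> T" using s(1) by (auto simp: Z_def)
  have "closedin (top_of_set {0..T}) {t \<in> topspace (top_of_set {0..T}). u t \<in> C}"
    by (rule closedin_continuous_map_preimage[OF cont C])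
  then have cl: "closed {t \<in> {0..T}. u t \<in> C}" using closedin_closed_trans[of "{0..T}"] by auto
  have "{0..<s} \<subseteq> {t \<in> {0..T}. u t \<in> C}" using inW s0 by (auto simp: Ceq W_def less_imp_le)
  then have "closure {0..<s} \<subseteq> {t \<in> {0..T}. u t \<in> C}" by (rule closure_minimal[OF _ cl])
  then have sub: "{0..s} \<subseteq> {t \<in> {0..T}. u t \<in> C}" using s0 by simp
  then have in_C: "u t \<in> fst c \<and> snd c (u t) \<in> cball x0 r" if "t \<in> {0..s}" for t using that Ceq by blast
  have "u s \<notin> W" using s(1) by (simp add: Z_def)
  then have "dist x0 (snd c (u s)) = r" using in_C[of s] s0 by (auto simp: W_def)
  then show ?thesis using that[of s] in_C s0 by auto
qed

end

subsection \<open>The Finsler distance\<close>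

locale finsler_mfd = smooth_mfd X A for X :: "'a topology" and A :: "('a, 'e::euclidean_space) chart set" +
  fixes F :: "'a \<Rightarrow> ('a, 'e) tvec \<Rightarrow> real"
  assumes finsler: "finsler_metric X A F"
begin

definition fc :: "('a, 'e) chart \<Rightarrow> 'e \<times> 'e \<Rightarrow> real"
  where "fc c = (\<lambda>(x, w). F (chart_inv c x) (tvec_of A c (chart_inv c x) w))"

lemma F_chart:
  assumes "c \<in> A" "p \<in> fst c" "v \<in> tangent_space A p"
  shows "F p v = fc c (snd c p, v c)"
  using assms tvec_of_component[OF assms] by (simp add: fc_def)

lemma minkowski_family_fc:
  assumes cA: "c \<in> A"
  shows "minkowski_family (snd c ` fst c) (fc c)"
proof
  show "open (snd c ` fst c)" by (rule open_codom[OF cA])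
  show "smooth_on ((snd c ` fst c) \<times> (UNIV - {0})) (fc c)"
    using finsler cA by (simp add: finsler_metric_def fc_def)
  fix x y z :: 'e assume x: "x \<in> snd c ` fst c"
  define p where "p = chart_inv c x"
  have p: "p \<in> fst c" unfolding p_def by (rule chart_inv_in[OF cA x])
  have pX: "p \<in> topspace X" using p dom_subset[OF cA] by blast
  note T = tvec_of_in[OF cA p]
  have f: "fc c (x, w) = F p (tvec_of A c p w)" for w by (simp add: fc_def p_def)
  have hom: "F p (a *\<^sub>R v) = a * F p v" if "v \<in> tangent_space A p" "a > 0" for v a
    using finsler pX that by (auto simp: finsler_metric_def)
  have ne: "tvec_of A c p w \<noteq> 0" if "w \<noteq> 0" for w
    using tvec_of_at[OF cA p, of w] that by (metis zero_fun_def)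
  have posT: "F p v > 0" if "v \<in> tangent_space A p" "v \<noteq> 0" for v
    using finsler pX that by (auto simp: finsler_metric_def)
  have conv: "F p ((1 - t) *\<^sub>R u + t *\<^sub>R v) < 1"
    if "u \<in> tangent_space A p" "v \<in> tangent_space A p" "F p u = 1" "F p v = 1" "u \<noteq> v" "0 < t" "t < 1" for u v t
    using finsler pX that unfolding finsler_metric_def by blast
  show scale: "fc c (x, a *\<^sub>R y) = a * fc c (x, y)" if "a > 0" for a y
    unfolding f tvec_of_scale[OF cA p] by (rule hom[OF T that])
  show pos: "0 < fc c (x, y)" if "y \<noteq> 0" for y
    unfolding f by (rule posT[OF T ne[OF that]])
  have "fc c (x, 0) = 2 * fc c (x, 0)" using scale[of 2 0] by simp
  then show zero: "fc c (x, 0) = 0" by simp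
  show "fc c (x, y + z) \<le> fc c (x, y) + fc c (x, z)"
  proof (cases "y = 0 \<or> z = 0")
    case True then show ?thesis using zero by auto
  next
    case False
    define a b where "a = fc c (x, y)" and "b = fc c (x, z)"
    have ab: "a > 0" "b > 0" using False pos by (auto simp: a_def b_def)
    \<comment> \<open>The sum \<open>y + z\<close> is \<open>a + b\<close> times a convex
      combination of the normalised vectors, so convexity of the unit ball yields the triangle
      inequality.\<close>
    define y' z' where "y' = (1 / a) *\<^sub>R y" and "z' = (1 / b) *\<^sub>R z"
    have u: "fc c (x, y') = 1" "fc c (x, z') = 1"
      using ab scale[of "1 / a" y] scale[of "1 / b" z] by (auto simp: y'_def z'_def a_def b_def)
    define t where "t = b / (a + b)"
    have t: "0 < t" "t < 1" "1 - t = a / (a + b)" using ab by (auto simp: t_def field_simps)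
    have le1: "fc c (x, (1 - t) *\<^sub>R y' + t *\<^sub>R z') \<le> 1"
    proof (cases "y' = z'")
      case True then show ?thesis using u by (simp add: scaleR_add_left[symmetric])
    next
      case False
      then have "tvec_of A c p y' \<noteq> tvec_of A c p z'" using tvec_of_at[OF cA p] by metis
      then have "F p ((1 - t) *\<^sub>R tvec_of A c p y' + t *\<^sub>R tvec_of A c p z') < 1"
        using u t by (intro conv T) (auto simp: f)
      then show ?thesis by (simp add: f tvec_of_add[OF cA p] tvec_of_scale[OF cA p])
    qed
    have "(a + b) *\<^sub>R ((1 - t) *\<^sub>R y' + t *\<^sub>R z') = y + z"
      unfolding t(3) using ab by (simp add: y'_def z'_def t_def scaleR_add_right)
    then have "fc c (x, y + z) = (a + b) * fc c (x, (1 - t) *\<^sub>R y' + t *\<^sub>R z')"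
      using scale[of "a + b"] ab by (metis add_pos_pos)
    also have "\<dots> \<le> (a + b) * 1" using ab le1 by (intro mult_left_mono) auto
    finally show ?thesis by (simp add: a_def b_def)
  qed
qed

abbreviation dst where "dst \<equiv> finsler_dist X A F"

definition speed :: "(real \<Rightarrow> 'a) \<Rightarrow> real \<Rightarrow> real"
  where "speed \<gamma> t = F (\<gamma> t) (velocity A {0..1} \<gamma> t)"

lemma at_unit_interval: "t \<in> {0..1} \<Longrightarrow> at t within {0..1::real} \<noteq> bot"
  by (simp add: trivial_limit_within)

context
  fixes \<gamma> assumes C1: "C1_curve X A {0..1} \<gamma>"
begin

lemma curve_cont: "continuous_map (top_of_set {0..1}) X \<gamma>"
  using C1 by (simp add: C1_curve_def)

lemma curve_in: "t \<in> {0..1} \<Longrightarrow> \<gamma> t \<in> topspace X"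
  using continuous_map_image_subset_topspace[OF curve_cont] by auto

lemma curve_derivative:
  assumes "c \<in> A" "t \<in> {0..1}" "\<gamma> t \<in> fst c"
  shows "((snd c \<circ> \<gamma>) has_vector_derivative velocity A {0..1} \<gamma> t c) (at t within {0..1})"
  using C1 assms unfolding C1_curve_def velocity_def charts_at_def
  by (auto simp: vector_derivative_works[symmetric])

lemma velocity_in: 
  assumes "c \<in> A" "t \<in> {0..1}" "\<gamma> t \<in> fst c"
  shows "velocity A {0..1} \<gamma> t \<in> tangent_space A (\<gamma> t)"
  using velocity_eq_tvec_of[OF C1 assms(2) at_unit_interval[OF assms(2)] assms(1,3)] tvec_of_in[OF assms(1,3)] by simp

lemma speed_chart:
  assumes "c \<in> A" "t \<in> {0..1}" "\<gamma> t \<in> fst c"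
  shows "speed \<gamma> t = fc c (snd c (\<gamma> t), velocity A {0..1} \<gamma> t c)"
  unfolding speed_def by (rule F_chart[OF assms(1,3) velocity_in[OF assms]])

lemma speed_nonneg: "t \<in> {0..1} \<Longrightarrow> 0 \<le> speed \<gamma> t"
proof -
  assume t: "t \<in> {0..1}"
  obtain c where c: "c \<in> A" "\<gamma> t \<in> fst c" using charts_cover[OF curve_in[OF t]] by blast
  interpret minkowski_family "snd c ` fst c" "fc c" by (rule minkowski_family_fc[OF c(1)])
  show ?thesis unfolding speed_chart[OF c(1) t c(2)] by (rule f_nonneg) (use c in auto)
qed

lemma speed_continuous: "continuous_on {0..1} (speed \<gamma>)"
  unfolding continuous_on_eq_continuous_within
proof
  fix t :: real assume t: "t \<in> {0..1}"
  obtain c where c: "c \<in> A" "\<gamma> t \<in> fst c" using charts_cover[OF curve_in[OF t]] by blast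
  interpret minkowski_family "snd c ` fst c" "fc c" by (rule minkowski_family_fc[OF c(1)])
  define J where "J = {0..1} \<inter> \<gamma> -` fst c"
  have "openin (top_of_set {0..1}) {s \<in> topspace (top_of_set {0..1}). \<gamma> s \<in> fst c}"
    by (rule openin_continuous_map_preimage[OF curve_cont openin_dom[OF c(1)]])
  moreover have "{s \<in> topspace (top_of_set {0..1}). \<gamma> s \<in> fst c} = J" by (auto simp: J_def)
  ultimately obtain W where W: "open W" "J = {0..1} \<inter> W" unfolding openin_open by auto
  have cv: "continuous_on J (\<lambda>t. velocity A {0..1} \<gamma> t c)"
    using C1 c(1) by (auto simp: C1_curve_def J_def)
  have cc: "continuous_on J (\<lambda>t. snd c (\<gamma> t))"
    using continuous_on_chart_curve[OF c(1) curve_cont, of J] by (auto simp: J_def o_def)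
  have "continuous_on J (\<lambda>t. fc c (snd c (\<gamma> t), velocity A {0..1} \<gamma> t c))"
    by (rule continuous_on_compose2[OF continuous_on_f continuous_on_Pair[OF cc cv]]) (auto simp: J_def)
  then have "continuous_on J (speed \<gamma>)"
    by (rule continuous_on_eq) (use speed_chart[OF c(1)] in \<open>auto simp: J_def\<close>)
  then have "continuous (at t within J) (speed \<gamma>)"
    using t c(2) by (simp add: continuous_on_eq_continuous_within J_def)
  moreover have "at t within J = at t within {0..1}"
  proof (rule at_within_nhd[of t W])
    show "t \<in> W" using W(2) t c(2) unfolding J_def by blast
  qed (use W in auto)
  ultimately show "continuous (at t within {0..1}) (speed \<gamma>)" by simp
qed

lemma speed_integrable: "a \<in> {0..1} \<Longrightarrow> b \<in> {0..1} \<Longrightarrow> speed \<gamma> integrable_on {a..b}"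
  by (intro integrable_continuous_interval continuous_on_subset[OF speed_continuous]) auto

lemma partial_length_le:
  assumes "s \<in> {0..1}"
  shows "integral {0..s} (speed \<gamma>) \<le> integral {0..1} (speed \<gamma>)"
  by (rule integral_subset_le) (use assms speed_integrable speed_nonneg in auto)

lemma length_nonneg: "0 \<le> integral {0..1} (speed \<gamma>)"
  by (rule integral_nonneg) (use speed_integrable speed_nonneg in auto)

lemma length_ge_fibre:
  assumes c: "c \<in> A" and s: "s \<in> {0..1}" and x0: "x0 \<in> snd c ` fst c" and k: "k \<ge> 0"
    and stay: "\<And>t. t \<in> {0..s} \<Longrightarrow> \<gamma> t \<in> fst c \<and> snd c (\<gamma> t) \<in> B"
    and cmp: "\<And>z y. z \<in> B \<Longrightarrow> k * fc c (x0, y) \<le> fc c (z, y)"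
  shows "k * fc c (x0, snd c (\<gamma> s) - snd c (\<gamma> 0)) \<le> integral {0..s} (speed \<gamma>)"
proof -
  interpret minkowski_family "snd c ` fst c" "fc c" by (rule minkowski_family_fc[OF c])
  let ?v = "\<lambda>t. velocity A {0..1} \<gamma> t c"
  have in01: "t \<in> {0..1}" if "t \<in> {0..s}" for t using that s by auto
  have d: "((snd c \<circ> \<gamma>) has_vector_derivative ?v t) (at t within {0..s})" if t: "t \<in> {0..s}" for t
    by (rule has_vector_derivative_within_subset[OF curve_derivative[OF c in01[OF t]]]) (use stay[OF t] s in auto)
  have cv: "continuous_on {0..s} ?v"
    by (rule continuous_on_subset[of "{0..1} \<inter> \<gamma> -` fst c"]) (use C1 c stay in01 in \<open>auto simp: C1_curve_def\<close>)
  have cf: "continuous_on UNIV (\<lambda>y. fc c (x0, y))"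
    by (rule continuous_on_compose2[OF continuous_on_f, of _ "\<lambda>y. (x0, y)"]) (use x0 in \<open>auto intro!: continuous_intros\<close>)
  have int: "(\<lambda>t. fc c (x0, ?v t)) integrable_on {0..s}"
    by (intro integrable_continuous_interval continuous_on_compose2[OF cf cv]) auto
  have "fc c (x0, snd c (\<gamma> s) - snd c (\<gamma> 0)) \<le> integral {0..s} (\<lambda>t. fc c (x0, ?v t))"
    using fibre_length_ge[OF x0 _ d cv] s by simp
  then have "k * fc c (x0, snd c (\<gamma> s) - snd c (\<gamma> 0)) \<le> integral {0..s} (\<lambda>t. k * fc c (x0, ?v t))"
    using k by (simp add: mult_left_mono)
  also have "\<dots> \<le> integral {0..s} (speed \<gamma>)"
  proof (rule integral_le)
    show "(\<lambda>t. k * fc c (x0, ?v t)) integrable_on {0..s}" using integrable_on_cmult_left[OF int, of k] by simp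
    show "speed \<gamma> integrable_on {0..s}" using speed_integrable s by simp
    show "k * fc c (x0, ?v t) \<le> speed \<gamma> t" if t: "t \<in> {0..s}" for t
      using speed_chart[OF c in01[OF t]] stay[OF t] cmp by simp
  qed
  finally show ?thesis .
qed

end

section \<open>First-order behaviour of the distance\<close>

lemma dst_eq: "dst p q = Inf {integral {0..1} (speed \<gamma>) |\<gamma>. C1_curve X A {0..1} \<gamma> \<and> \<gamma> 0 = p \<and> \<gamma> 1 = q}"
  unfolding finsler_dist_def speed_def ..

lemma dst_le:
  assumes "C1_curve X A {0..1} \<gamma>"
  shows "dst (\<gamma> 0) (\<gamma> 1) \<le> integral {0..1} (speed \<gamma>)"
  unfolding dst_eq
  by (rule cInf_lower) (use assms in \<open>auto intro!: bdd_belowI[of _ 0] length_nonneg\<close>)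

lemma chart_segment:
  assumes c: "c \<in> A" and seg: "\<And>t. t \<in> {0..1} \<Longrightarrow> x + t *\<^sub>R v \<in> snd c ` fst c"
  defines "\<gamma> \<equiv> \<lambda>t. chart_inv c (x + t *\<^sub>R v)"
  shows "C1_curve X A {0..1} \<gamma>" "\<And>t. t \<in> {0..1} \<Longrightarrow> speed \<gamma> t = fc c (x + t *\<^sub>R v, v)"
proof -
  let ?l = "\<lambda>t. x + t *\<^sub>R v"
  have in_c: "\<gamma> t \<in> fst c" "snd c (\<gamma> t) = ?l t" if "t \<in> {0..1}" for t
    using seg[OF that] c by (simp_all add: \<gamma>_def)
  have cl: "continuous_on S ?l" for S by (intro continuous_intros)
  have cont: "continuous_map (top_of_set {0..1}) X \<gamma>"
  proof -
    have "continuous_map (top_of_set {0..1}) (top_of_set (snd c ` fst c)) ?l"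
      using cl seg by (auto simp: continuous_map_in_subtopology)
    from continuous_map_compose[OF this continuous_map_chart_inv[OF c]] show ?thesis
      by (simp add: \<gamma>_def o_def)
  qed
  have D: "((snd c' \<circ> \<gamma>) has_vector_derivative tr c c' (\<gamma> t) v) (at t within {0..1})"
    if c': "c' \<in> A" and t: "t \<in> {0..1}" "\<gamma> t \<in> fst c'" for c' t
  proof -
    have "((snd c' \<circ> chart_inv c) has_derivative tr c c' (\<gamma> t)) (at (?l t))"
      using tr_has_derivative[OF c c' in_c(1)[OF t(1)] t(2)] in_c(2)[OF t(1)] by simp
    from has_derivative_compose[OF affine_line_has_derivative this]
    show ?thesis
      using linear_scale[OF linear_tr[OF c c' in_c(1)[OF t(1)] t(2)]]
      by (simp add: has_vector_derivative_def \<gamma>_def o_def)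
  qed
  have vel: "velocity A {0..1} \<gamma> t c' = tr c c' (\<gamma> t) v" if c': "c' \<in> A" and t: "t \<in> {0..1}" "\<gamma> t \<in> fst c'" for c' t
    using vector_derivative_within[OF at_unit_interval[OF t(1)] D[OF c' t]] c' t(2)
    by (simp add: velocity_def charts_at_def)
  show C1: "C1_curve X A {0..1} \<gamma>"
    unfolding C1_curve_def
  proof (intro conjI cont ballI)
    fix c' t assume c': "c' \<in> A" and "t \<in> {0..1} \<inter> \<gamma> -` fst c'"
    then show "(snd c' \<circ> \<gamma>) differentiable (at t within {0..1})"
      using D[OF c', of t] by (auto simp: has_vector_derivative_def differentiable_def)
  next
    fix c' assume c': "c' \<in> A"
    let ?J = "{0..1} \<inter> \<gamma> -` fst c'"
    have "continuous_on (snd c ` (fst c \<inter> fst c')) (\<lambda>z. frechet_derivative (snd c' \<circ> chart_inv c) (at z) v)"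
      by (intro smooth_on_continuous_on smooth_on_frechet_derivative smooth_transition c c')
    then have "continuous_on ?J (\<lambda>t. frechet_derivative (snd c' \<circ> chart_inv c) (at (?l t)) v)"
      by (rule continuous_on_compose2[OF _ cl]) (use in_c in \<open>force simp del: atLeastAtMost_iff\<close>)
    then show "continuous_on ?J (\<lambda>t. velocity A {0..1} \<gamma> t c')"
      by (rule continuous_on_eq) (use vel[OF c'] in_c(2) in \<open>auto simp: tr_def simp del: atLeastAtMost_iff\<close>)
  qed
  show "speed \<gamma> t = fc c (?l t, v)" if t: "t \<in> {0..1}" for t
    using speed_chart[OF C1 c t in_c(1)[OF t]] vel[OF c t in_c(1)[OF t]] in_c(2)[OF t] tr_same[OF c in_c(1)[OF t]] by simp
qed

text \<open>The Busemann--Mayer theorem, with both endpoints varying.\<close>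

theorem strict_metric_derivative:
  assumes c: "c \<in> A" and x0: "x0 \<in> snd c ` fst c" and e: "e > 0"
  shows "\<exists>d>0. \<forall>x\<in>ball x0 d. \<forall>x'\<in>ball x0 d.
    \<bar>dst (chart_inv c x) (chart_inv c x') - fc c (x0, x' - x)\<bar> \<le> e * norm (x' - x)"
proof -
  interpret minkowski_family "snd c ` fst c" "fc c" by (rule minkowski_family_fc[OF c])
  obtain m C where mC: "m > 0" "C > 0" "\<And>y. m * norm y \<le> fc c (x0, y)" "\<And>y. fc c (x0, y) \<le> C * norm y"
    by (rule fibre_bounds[OF x0]) (rule that)
  \<comment> \<open>The three bounds serve the upper estimate, the inequality
    \<open>k \<ge> 1 / 2\<close>, and the replacement of \<open>(1 - k) * fc c (x0, v)\<close> by
    \<open>e * norm v\<close>.\<close>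
  define e' where "e' = min e (min (m / 2) (e * m / C))"
  have e': "e' > 0" "e' \<le> e" "e' \<le> m / 2" "e' \<le> e * m / C"
  proof -
    show "e' > 0" using e mC by (simp add: e'_def)
    show "e' \<le> e" unfolding e'_def by (rule min.cobounded1)
    show "e' \<le> m / 2" unfolding e'_def by (rule order_trans[OF min.cobounded2 min.cobounded1])
    show "e' \<le> e * m / C" unfolding e'_def by (rule order_trans[OF min.cobounded2 min.cobounded2])
  qed
  obtain r where r: "r > 0" "cball x0 r \<subseteq> snd c ` fst c"
    "\<And>z y. z \<in> cball x0 r \<Longrightarrow> \<bar>fc c (z, y) - fc c (x0, y)\<bar> \<le> e' * norm y"
    by (rule fibre_uniform[OF x0 e'(1)]) (rule that)
  define k where "k = 1 - e' / m"
  have k: "k \<ge> 1 / 2" "k \<ge> 0" using e' mC by (auto simp: k_def field_simps)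
  have cmp: "k * fc c (x0, y) \<le> fc c (z, y)" if z: "z \<in> cball x0 r" for z y
  proof -
    have "e' * norm y = (e' / m) * (m * norm y)" using mC by simp
    also have "\<dots> \<le> (e' / m) * fc c (x0, y)" using mC e' by (intro mult_left_mono) auto
    finally have "fc c (x0, y) - (e' / m) * fc c (x0, y) \<le> fc c (z, y)" using r(3)[OF z, of y] by linarith
    then show ?thesis by (simp add: k_def algebra_simps)
  qed
  define d where "d = min (r / 2) (m * r / (8 * C))"
  have d: "d > 0" "d \<le> r / 2" "d \<le> m * r / (8 * C)" using r mC by (auto simp: d_def)
  have "\<bar>dst (chart_inv c x) (chart_inv c x') - fc c (x0, x' - x)\<bar> \<le> e * norm (x' - x)"
    if x: "x \<in> ball x0 d" and x': "x' \<in> ball x0 d" for x x'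
  proof -
    define v where "v = x' - x"
    have xr: "x \<in> ball x0 r" "x' \<in> ball x0 r" using x x' d r by auto
    have xO: "x \<in> snd c ` fst c" "x' \<in> snd c ` fst c" using xr r(2) ball_subset_cball by blast+
    have seg: "x + t *\<^sub>R v \<in> cball x0 r" if "t \<in> {0..1}" for t
    proof -
      have "x + t *\<^sub>R v = (1 - t) *\<^sub>R x + t *\<^sub>R x'" by (simp add: v_def algebra_simps)
      then have "x + t *\<^sub>R v \<in> ball x0 r" using convexD[OF convex_ball xr, of "1 - t" t] that by simp
      then show ?thesis by auto
    qed
    have segO: "x + t *\<^sub>R v \<in> snd c ` fst c" if "t \<in> {0..1}" for t using seg[OF that] r(2) by blast
    let ?\<gamma> = "\<lambda>t. chart_inv c (x + t *\<^sub>R v)"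
    have line1: "C1_curve X A {0..1} ?\<gamma>" by (rule chart_segment(1)[OF c segO])
    have line2: "speed ?\<gamma> t = fc c (x + t *\<^sub>R v, v)" if "t \<in> {0..1}" for t
      by (rule chart_segment(2)[OF c segO that])
    have ends: "?\<gamma> 0 = chart_inv c x" "?\<gamma> 1 = chart_inv c x'" by (auto simp: v_def)
    have upper: "dst (chart_inv c x) (chart_inv c x') \<le> fc c (x0, v) + e' * norm v"
    proof -
      have "integral {0..1} (speed ?\<gamma>) \<le> integral {0..1} (\<lambda>t::real. fc c (x0, v) + e' * norm v)"
      proof (rule integral_le)
        show "speed ?\<gamma> integrable_on {0..1}" using speed_integrable[OF line1, of 0 1] by simp
        show "speed ?\<gamma> t \<le> fc c (x0, v) + e' * norm v" if "t \<in> {0..1}" for t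
          using r(3)[OF seg[OF that], of v] line2[OF that] by linarith
      qed (rule integrable_const_ivl)
      then show ?thesis using dst_le[OF line1] ends by simp
    qed
    have lower: "k * fc c (x0, v) \<le> dst (chart_inv c x) (chart_inv c x')"
      unfolding dst_eq
    proof (rule cInf_greatest)
      show "{integral {0..1} (speed \<gamma>) |\<gamma>. C1_curve X A {0..1} \<gamma> \<and> \<gamma> 0 = chart_inv c x \<and> \<gamma> 1 = chart_inv c x'} \<noteq> {}"
        using line1 ends by blast
      fix l assume "l \<in> {integral {0..1} (speed \<gamma>) |\<gamma>. C1_curve X A {0..1} \<gamma> \<and> \<gamma> 0 = chart_inv c x \<and> \<gamma> 1 = chart_inv c x'}"
      then obtain \<gamma> where l: "l = integral {0..1} (speed \<gamma>)" and C1: "C1_curve X A {0..1} \<gamma>"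
        and g: "\<gamma> 0 = chart_inv c x" "\<gamma> 1 = chart_inv c x'" by blast
      have g0: "\<gamma> 0 \<in> fst c" "snd c (\<gamma> 0) = x" "snd c (\<gamma> 1) = x'" using g xO c by auto
      show "k * fc c (x0, v) \<le> l"
      proof (cases "\<forall>t\<in>{0..1}. \<gamma> t \<in> fst c \<and> snd c (\<gamma> t) \<in> ball x0 r")
        case True
        have "k * fc c (x0, snd c (\<gamma> 1) - snd c (\<gamma> 0)) \<le> integral {0..1} (speed \<gamma>)"
          by (rule length_ge_fibre[OF C1 c _ x0 k(2), of _ "cball x0 r"]) (use True cmp in \<open>auto simp: less_imp_le\<close>)
        then show ?thesis using l g0 by (simp add: v_def)
      next
        case False
        obtain s where s: "s \<in> {0..1}" "\<And>t. t \<in> {0..s} \<Longrightarrow> \<gamma> t \<in> fst c \<and> snd c (\<gamma> t) \<in> cball x0 r"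
          "dist x0 (snd c (\<gamma> s)) = r"
          by (rule curve_exit[OF curve_cont[OF C1] _ c r(2) g0(1) _ False]) (use g0(2) xr(1) that in auto)
        have "k * fc c (x0, v) \<le> 1 * fc c (x0, v)"
          using e' mC f_nonneg[OF x0] by (intro mult_right_mono) (auto simp: k_def)
        also have "\<dots> \<le> C * (2 * d)"
        proof -
          have "norm v \<le> dist x x0 + dist x0 x'" unfolding v_def by (metis dist_norm dist_triangle dist_commute)
          also have "\<dots> \<le> 2 * d" using x x' by (simp add: dist_commute)
          finally have "C * norm v \<le> C * (2 * d)" using mC by simp
          then show ?thesis using mC(4)[of v] by simp
        qed
        also have "\<dots> \<le> C * (2 * (m * r / (8 * C)))" using d mC by (intro mult_left_mono) auto
        also have "\<dots> = (1 / 2) * (m * (r / 2))" using mC by (simp add: field_simps)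
        also have "\<dots> \<le> k * (m * norm (snd c (\<gamma> s) - snd c (\<gamma> 0)))"
        proof -
          have "r \<le> dist x0 x + dist x (snd c (\<gamma> s))" using s(3) dist_triangle[of x0 "snd c (\<gamma> s)" x] by simp
          then have "r / 2 \<le> norm (snd c (\<gamma> s) - snd c (\<gamma> 0))"
            using x d(2) g0(2) by (simp add: dist_norm norm_minus_commute)
          then show ?thesis using k mC r by (intro mult_mono) auto
        qed
        also have "\<dots> \<le> k * fc c (x0, snd c (\<gamma> s) - snd c (\<gamma> 0))"
          using k mC by (intro mult_left_mono) auto
        also have "\<dots> \<le> integral {0..s} (speed \<gamma>)"
          by (rule length_ge_fibre[OF C1 c s(1) x0 k(2) s(2) cmp])
        also have "\<dots> \<le> l" unfolding l by (rule partial_length_le[OF C1 s(1)])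
        finally show ?thesis .
      qed
    qed
    have "fc c (x0, v) - e * norm v \<le> k * fc c (x0, v)"
    proof -
      have "(e' / m) * fc c (x0, v) \<le> (e' / m) * (C * norm v)"
        using e' mC by (intro mult_left_mono) auto
      also have "\<dots> = (e' * C / m) * norm v" by simp
      also have "\<dots> \<le> e * norm v" using e'(4) mC by (intro mult_right_mono) (auto simp: field_simps)
      finally show ?thesis by (simp add: k_def algebra_simps)
    qed
    moreover have "e' * norm v \<le> e * norm v" using e' by (intro mult_right_mono) auto
    ultimately show ?thesis using upper lower by (simp add: abs_le_iff v_def)
  qed
  then show ?thesis using d(1) by blast
qed

subsection \<open>Almost isometries and almost Killing vector fields\<close>

definition kc :: "('a \<Rightarrow> ('a, 'e) tvec) \<Rightarrow> ('a, 'e) chart \<Rightarrow> 'e \<Rightarrow> 'e"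
  where "kc K c = (\<lambda>x. K (chart_inv c x) c)"

text \<open>
  An almost isometry changes the distance by a coboundary, hence, infinitesimally, the metric by a
  one-form.
\<close>

lemma almost_isometry_one_form:
  assumes ai: "almost_isometry X A F U V \<phi>" and U: "openin X U" and c: "c \<in> A"
    and p: "p \<in> U" "p \<in> fst c" "\<phi> p \<in> fst c"
  defines "g \<equiv> snd c \<circ> \<phi> \<circ> chart_inv c" and "x0 \<equiv> snd c p"
  defines "E \<equiv> frechet_derivative g (at x0)"
  shows "(g has_derivative E) (at x0)"
    and "fc c (snd c (\<phi> p), E (y + z)) - fc c (x0, y + z)
      = (fc c (snd c (\<phi> p), E y) - fc c (x0, y)) + (fc c (snd c (\<phi> p), E z) - fc c (x0, z))"
proof -
  interpret minkowski_family "snd c ` fst c" "fc c" by (rule minkowski_family_fc[OF c])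
  have sm: "smooth_map_on X A U \<phi>" using ai by (simp add: almost_isometry_def diffeomorphism_on_def)
  then have cm: "continuous_map (subtopology X U) X \<phi>" by (simp add: smooth_map_on_def)
  have "smooth_on (snd c ` (fst c \<inter> U \<inter> \<phi> -` fst c)) g"
    using sm c by (simp add: smooth_map_on_def g_def o_assoc)
  moreover have "x0 \<in> snd c ` (fst c \<inter> U \<inter> \<phi> -` fst c)" using p by (auto simp: x0_def)
  ultimately show gE: "(g has_derivative E) (at x0)"
    unfolding E_def by (rule smooth_on_has_derivative)
  then have lE: "linear E" by (rule has_derivative_linear)
  have x0: "x0 \<in> snd c ` fst c" and gx0: "g x0 = snd c (\<phi> p)" using p c by (auto simp: x0_def g_def)
  have gx0': "g x0 \<in> snd c ` fst c" using p(3) by (simp add: gx0)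
  have "openin X {q \<in> U. \<phi> q \<in> fst c}"
  proof -
    have "openin (subtopology X U) {q \<in> topspace (subtopology X U). \<phi> q \<in> fst c}"
      by (rule openin_continuous_map_preimage[OF cm openin_dom[OF c]])
    moreover have "topspace (subtopology X U) = U" using openin_subset[OF U] by auto
    ultimately show ?thesis using U openin_trans_full by metis
  qed
  then have opn: "open (snd c ` (fst c \<inter> {q \<in> U. \<phi> q \<in> fst c}))" by (rule open_chart_image[OF c])
  define \<delta> where "\<delta> x x' = dst (chart_inv c x) (chart_inv c x')" for x x'
  \<comment> \<open>The change of the distance under \<phi>; equality of triangle defects means that
    it is additive over consecutive points.\<close>
  define \<Delta> where "\<Delta> s u v = \<delta> (g (x0 + s *\<^sub>R u)) (g (x0 + s *\<^sub>R v)) - \<delta> (x0 + s *\<^sub>R u) (x0 + s *\<^sub>R v)" for s :: real and u v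
  have line: "((\<lambda>s. x0 + s *\<^sub>R u) has_vector_derivative u) (at 0)" for u
    unfolding has_vector_derivative_def by (rule affine_line_has_derivative)
  have gline: "((\<lambda>s. g (x0 + s *\<^sub>R u)) has_vector_derivative E u) (at 0)" for u
  proof -
    have "(g has_derivative E) (at (x0 + 0 *\<^sub>R u))" using gE by simp
    from has_derivative_compose[OF affine_line_has_derivative this] show ?thesis
      by (simp add: has_vector_derivative_def linear_scale[OF lE])
  qed
  have lim: "((\<lambda>s. \<Delta> s u v / s) \<longlongrightarrow> fc c (snd c (\<phi> p), E (v - u)) - fc c (x0, v - u)) (at_right 0)" for u v
  proof -
    have 1: "((\<lambda>s. \<delta> (x0 + s *\<^sub>R u) (x0 + s *\<^sub>R v) / s) \<longlongrightarrow> fc c (x0, v - u)) (at_right 0)"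
      by (rule strict_metric_limit[OF x0 _ line line])
        (use strict_metric_derivative[OF c x0] in \<open>auto simp: \<delta>_def\<close>)
    have 2: "((\<lambda>s. \<delta> (g (x0 + s *\<^sub>R u)) (g (x0 + s *\<^sub>R v)) / s) \<longlongrightarrow> fc c (g x0, E v - E u)) (at_right 0)"
      by (rule strict_metric_limit[OF gx0' _ gline gline])
        (use strict_metric_derivative[OF c gx0'] in \<open>auto simp: \<delta>_def\<close>)
    show ?thesis
      using tendsto_diff[OF 2 1] by (simp add: \<Delta>_def diff_divide_distrib linear_diff[OF lE] gx0)
  qed
  have ev: "\<forall>\<^sub>F s in at_right 0. x0 + s *\<^sub>R u \<in> snd c ` (fst c \<inter> {q \<in> U. \<phi> q \<in> fst c})" for u
  proof -
    have "((\<lambda>s. x0 + s *\<^sub>R u) \<longlongrightarrow> x0 + 0 *\<^sub>R u) (at_right 0)" by (intro tendsto_intros)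
    then show ?thesis
      by (rule topological_tendstoD[OF _ opn]) (use p in \<open>auto simp: x0_def\<close>)
  qed
  have td: "triangle_defect X A F q1 q2 q3 = triangle_defect X A F (\<phi> q1) (\<phi> q2) (\<phi> q3)"
    if "q1 \<in> U" "q2 \<in> U" "q3 \<in> U" for q1 q2 q3
    using ai that by (simp add: almost_isometry_def)
  have "\<forall>\<^sub>F s in at_right 0. \<Delta> s 0 y / s + \<Delta> s y (y + z) / s = \<Delta> s 0 (y + z) / s"
    using ev[of 0] ev[of y] ev[of "y + z"]
  proof eventually_elim
    case (elim s)
    have \<phi>c: "chart_inv c (g x) = \<phi> (chart_inv c x) \<and> chart_inv c x \<in> U"
      if "x \<in> snd c ` (fst c \<inter> {q \<in> U. \<phi> q \<in> fst c})" for x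
      using that c by (auto simp: g_def)
    note e = \<phi>c[OF elim(1)] \<phi>c[OF elim(2)] \<phi>c[OF elim(3)]
    \<comment> \<open>Additivity over the three points with displacements \<open>0\<close>,
      \<open>s\<close> times \<open>y\<close> and \<open>s\<close> times \<open>y + z\<close>; after
      division by \<open>s\<close> the limit is additivity of the change of the metric.\<close>
    have "\<Delta> s 0 y + \<Delta> s y (y + z) = \<Delta> s 0 (y + z)"
      using td[of "chart_inv c (x0 + s *\<^sub>R 0)" "chart_inv c (x0 + s *\<^sub>R y)" "chart_inv c (x0 + s *\<^sub>R (y + z))"] e
      unfolding \<Delta>_def \<delta>_def triangle_defect_def by simp
    then show ?case by (simp add: add_divide_distrib[symmetric])
  qed
  then have "((\<lambda>s. \<Delta> s 0 (y + z) / s) \<longlongrightarrow>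
      (fc c (snd c (\<phi> p), E (y - 0)) - fc c (x0, y - 0))
      + (fc c (snd c (\<phi> p), E (y + z - y)) - fc c (x0, y + z - y))) (at_right 0)"
    by (rule Lim_transform_eventually[OF tendsto_add[OF lim lim]])
  from tendsto_unique[OF trivial_limit_at_right_real lim this]
  show "fc c (snd c (\<phi> p), E (y + z)) - fc c (x0, y + z)
      = (fc c (snd c (\<phi> p), E y) - fc c (x0, y)) + (fc c (snd c (\<phi> p), E z) - fc c (x0, z))"
    by simp
qed

lemma integral_curve_chart:
  assumes "integral_curve X A K I \<gamma>" "c \<in> A" "s \<in> I" "\<gamma> s \<in> fst c"
  shows "((snd c \<circ> \<gamma>) has_vector_derivative kc K c ((snd c \<circ> \<gamma>) s)) (at s within I)"
proof -
  have "(snd c \<circ> \<gamma>) differentiable (at s within I)"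
    using assms unfolding integral_curve_def C1_curve_def by blast
  then have "((snd c \<circ> \<gamma>) has_vector_derivative vector_derivative (snd c \<circ> \<gamma>) (at s within I)) (at s within I)"
    by (simp add: vector_derivative_works)
  moreover have "vector_derivative (snd c \<circ> \<gamma>) (at s within I) = velocity A I \<gamma> s c"
    using assms by (simp add: velocity_def charts_at_def)
  moreover have "velocity A I \<gamma> s = K (\<gamma> s)" using assms by (simp add: integral_curve_def)
  ultimately show ?thesis using assms(2,4) by (simp add: kc_def)
qed

text \<open>On the compact ball the field has norm at most \<open>M\<close>, so a solution starting
  within \<open>R / 2\<close> of the centre cannot reach the sphere of radius \<open>R\<close>
  before time \<open>R / (2 * M)\<close>. Hence one time serves all starting points.\<close>

lemma flow_stays:
  assumes flow: "local_flow X A K U \<epsilon> \<Phi>" and eps: "\<epsilon> > 0" and c: "c \<in> A"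
    and sK: "smooth_on (snd c ` fst c) (kc K c)" and R: "R > 0" "cball x0 R \<subseteq> snd c ` fst c"
  obtains \<tau> where "\<tau> > 0" "\<tau> < \<epsilon>"
    "\<And>q t. q \<in> U \<Longrightarrow> q \<in> fst c \<Longrightarrow> snd c q \<in> ball x0 (R / 2) \<Longrightarrow> t \<in> {0..\<tau>} \<Longrightarrow>
      \<Phi> t q \<in> fst c \<and> snd c (\<Phi> t q) \<in> cball x0 R"
proof -
  have "compact (kc K c ` cball x0 R)"
    by (intro compact_continuous_image continuous_on_subset[OF smooth_on_continuous_on[OF sK] R(2)] compact_cball)
  then obtain M where M: "M > 0" "\<And>x. x \<in> cball x0 R \<Longrightarrow> norm (kc K c x) \<le> M"
    using compact_imp_bounded bounded_pos by (metis imageI)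
  define \<tau> where "\<tau> = min (\<epsilon> / 2) (R / (4 * M))"
  have \<tau>: "\<tau> > 0" "\<tau> < \<epsilon>" "M * \<tau> < R / 2"
  proof -
    show "\<tau> > 0" "\<tau> < \<epsilon>" using eps R M by (auto simp: \<tau>_def min_def)
    have "M * \<tau> \<le> M * (R / (4 * M))" using M by (intro mult_left_mono) (auto simp: \<tau>_def)
    also have "\<dots> < R / 2" using M R by simp
    finally show "M * \<tau> < R / 2" .
  qed
  have "\<Phi> t q \<in> fst c \<and> snd c (\<Phi> t q) \<in> cball x0 R"
    if q: "q \<in> U" "q \<in> fst c" "snd c q \<in> ball x0 (R / 2)" and t: "t \<in> {0..\<tau>}" for q t
  proof -
    let ?I = "{-\<epsilon><..<\<epsilon>}"
    have q0: "\<Phi> 0 q = q" and ic: "integral_curve X A K ?I (\<lambda>t. \<Phi> t q)"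
      using flow q(1) by (auto simp: local_flow_def)
    have sub: "{0..\<tau>} \<subseteq> ?I" using \<tau> eps by auto
    have cont: "continuous_map (top_of_set {0..\<tau>}) X (\<lambda>t. \<Phi> t q)"
      using ic sub continuous_map_from_subtopology_mono by (auto simp: integral_curve_def C1_curve_def)
    have "\<forall>t\<in>{0..\<tau>}. \<Phi> t q \<in> fst c \<and> snd c (\<Phi> t q) \<in> ball x0 R"
    proof (rule ccontr)
      assume leaves: "\<not> ?thesis"
      obtain s where s: "s \<in> {0..\<tau>}" "\<And>t. t \<in> {0..s} \<Longrightarrow> \<Phi> t q \<in> fst c \<and> snd c (\<Phi> t q) \<in> cball x0 R"
        "dist x0 (snd c (\<Phi> s q)) = R"
        by (rule curve_exit[OF cont _ c R(2) _ _ leaves]) (use \<tau> q q0 R that in auto)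
      have "norm ((snd c \<circ> (\<lambda>t. \<Phi> t q)) s - (snd c \<circ> (\<lambda>t. \<Phi> t q)) 0) \<le> M * s"
      proof (rule vector_derivative_bound[where t = s])
        fix t assume t: "t \<in> {0..s}"
        have tI: "t \<in> ?I" "{0..s} \<subseteq> ?I" using t s(1) \<tau>(1,2) eps by auto
        show "((snd c \<circ> (\<lambda>t. \<Phi> t q)) has_vector_derivative kc K c ((snd c \<circ> (\<lambda>t. \<Phi> t q)) t)) (at t within {0..s})"
          by (rule has_vector_derivative_within_subset[OF integral_curve_chart[OF ic c tI(1)] tI(2)]) (use s(2)[OF t] in auto)
        show "norm (kc K c ((snd c \<circ> (\<lambda>t. \<Phi> t q)) t)) \<le> M" using s(2)[OF t] M(2) by simp
      qed (use s(1) in auto)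
      also have "M * s \<le> M * \<tau>" using s(1) M by (intro mult_left_mono) auto
      finally have "dist (snd c q) (snd c (\<Phi> s q)) < R / 2"
        using \<tau>(3) q0 by (simp add: dist_norm norm_minus_commute)
      then show False using s(3) q(3) dist_triangle[of x0 "snd c (\<Phi> s q)" "snd c q"] by simp
    qed
    then show ?thesis using t by (auto simp: less_imp_le)
  qed
  then show ?thesis using that \<tau> by blast
qed

end

text \<open>A Lipschitz bound at the base point passes to the derivative by rescaling along
  rays.\<close>

lemma derivative_norm_le:
  fixes h :: "'e::euclidean_space \<Rightarrow> 'b::real_normed_vector"
  assumes h: "(h has_derivative h') (at x0)" and d: "d > 0"
    and le: "\<And>x. x \<in> ball x0 d \<Longrightarrow> norm (h x - h x0) \<le> B * norm (x - x0)"
  shows "norm (h' y) \<le> B * norm y"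
proof -
  have "(h has_derivative h') (at (x0 + 0 *\<^sub>R y))" using h by simp
  from has_derivative_compose[OF affine_line_has_derivative this]
  have "((\<lambda>s. h (x0 + s *\<^sub>R y)) has_vector_derivative h' y) (at 0)"
    using linear_scale[OF has_derivative_linear[OF h]] by (simp add: has_vector_derivative_def)
  then have "((\<lambda>s. (norm (h (x0 + s *\<^sub>R y) - h x0 - s *\<^sub>R h' y)) / norm s) \<longlongrightarrow> 0) (at 0)"
    by (simp add: has_vector_derivative_def has_derivative_at)
  then have lim: "((\<lambda>s. (norm (h (x0 + s *\<^sub>R y) - h x0 - s *\<^sub>R h' y)) / norm s + B * norm y) \<longlongrightarrow> 0 + B * norm y) (at_right 0)"
    by (intro tendsto_add tendsto_const) (rule tendsto_mono[OF at_within_le_at])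
  have "((\<lambda>s. x0 + s *\<^sub>R y) \<longlongrightarrow> x0 + 0 *\<^sub>R y) (at_right 0)" by (intro tendsto_intros)
  then have "\<forall>\<^sub>F s in at_right 0. x0 + s *\<^sub>R y \<in> ball x0 d"
    by (rule topological_tendstoD) (use d in auto)
  moreover have "\<forall>\<^sub>F s in at_right 0. s > (0::real)" by (simp add: eventually_at_filter)
  ultimately have "\<forall>\<^sub>F s in at_right 0. norm (h' y) \<le> norm (h (x0 + s *\<^sub>R y) - h x0 - s *\<^sub>R h' y) / norm s + B * norm y"
  proof eventually_elim
    case (elim s)
    have "s * norm (h' y) = norm ((h (x0 + s *\<^sub>R y) - h x0) - (h (x0 + s *\<^sub>R y) - h x0 - s *\<^sub>R h' y))"
      using elim(2) by simp
    also have "\<dots> \<le> norm (h (x0 + s *\<^sub>R y) - h x0) + norm (h (x0 + s *\<^sub>R y) - h x0 - s *\<^sub>R h' y)"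
      by (rule norm_triangle_ineq4)
    also have "norm (h (x0 + s *\<^sub>R y) - h x0) \<le> B * (s * norm y)"
      using le[OF elim(1)] elim(2) by simp
    finally show ?case using elim(2) by (simp add: field_simps)
  qed
  then show ?thesis using tendsto_lowerbound[OF lim] by simp
qed

context finsler_mfd
begin

text \<open>The change of the metric under the flow at a small positive time is additive in the
  fibre variable; divided by the time it converges to the Lie derivative, which is therefore
  additive. Homogeneity is inherited for positive factors only and is extended by the oddness that
  additivity entails.\<close>

theorem almost_killing_imp_field:
  assumes K: "almost_killing X A F K" and c: "c \<in> A"
  shows "minkowski_family.almost_killing_field (snd c ` fst c) (fc c) (kc K c)"
proof -
  interpret M: minkowski_family "snd c ` fst c" "fc c" by (rule minkowski_family_fc[OF c])
  let ?k = "kc K c"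
  have sK: "smooth_on (snd c ` fst c) ?k"
    using K c by (simp add: almost_killing_def smooth_vector_field_def kc_def)
  have "linear (M.lie ?k x0)" if x0: "x0 \<in> snd c ` fst c" for x0
  proof -
    define p where "p = chart_inv c x0"
    have p: "p \<in> fst c" "snd c p = x0" using x0 c by (auto simp: p_def)
    have "p \<in> topspace X" using p dom_subset[OF c] by blast
    then obtain U \<epsilon> \<Phi> where U: "openin X U" "p \<in> U" and eps: "\<epsilon> > 0"
      and flow: "local_flow X A K U \<epsilon> \<Phi>"
      and ai: "\<And>t. \<bar>t\<bar> < \<epsilon> \<Longrightarrow> almost_isometry X A F U (\<Phi> t ` U) (\<Phi> t)"
      using K unfolding almost_killing_def by blast
    let ?I = "{-\<epsilon><..<\<epsilon>}"
    let ?D = "frechet_derivative ?k (at x0)"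
    have ic: "integral_curve X A K ?I (\<lambda>t. \<Phi> t q)" and \<Phi>0: "\<Phi> 0 q = q" if "q \<in> U" for q
      using flow that by (auto simp: local_flow_def)
    define g where "g t = snd c \<circ> \<Phi> t \<circ> chart_inv c" for t
    define E where "E t = frechet_derivative (g t) (at x0)" for t
    define a where "a t = snd c (\<Phi> t p)" for t
    have opU: "open (snd c ` (fst c \<inter> U))" by (rule open_chart_image[OF c U(1)])
    have x0U: "x0 \<in> snd c ` (fst c \<inter> U)" using p U by auto
    \<comment> \<open>The differential of the flow at \<open>x0\<close> is the identity plus
      \<open>t\<close> times \<open>?D\<close>, up to an error small relative to \<open>t\<close>;
      this comes from comparing the orbits of nearby points.\<close>
    have expand: "\<exists>\<tau>>0. \<tau> < \<epsilon> \<and> (\<forall>t\<in>{0..\<tau>}. \<Phi> t p \<in> fst c \<and> (\<forall>y. norm (E t y - y - t *\<^sub>R ?D y) \<le> e * t * norm y))"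
      if e: "e > 0" for e
    proof -
      obtain R d where R: "R > 0" "d > 0" "cball x0 R \<subseteq> snd c ` fst c"
        and fd: "\<And>t u v. 0 \<le> t \<Longrightarrow> t \<le> d \<Longrightarrow>
          (\<And>s. s \<in> {0..t} \<Longrightarrow> u s \<in> cball x0 R \<and> (u has_vector_derivative ?k (u s)) (at s within {0..t})) \<Longrightarrow>
          (\<And>s. s \<in> {0..t} \<Longrightarrow> v s \<in> cball x0 R \<and> (v has_vector_derivative ?k (v s)) (at s within {0..t})) \<Longrightarrow>
          norm (u t - v t - (u 0 - v 0) - t *\<^sub>R ?D (u 0 - v 0)) \<le> e * t * norm (u 0 - v 0)"
        using flow_difference_expansion[OF sK open_codom[OF c] x0 e] by metis
      obtain \<tau>0 where \<tau>0: "\<tau>0 > 0" "\<tau>0 < \<epsilon>"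
        and stay: "\<And>q t. q \<in> U \<Longrightarrow> q \<in> fst c \<Longrightarrow> snd c q \<in> ball x0 (R / 2) \<Longrightarrow> t \<in> {0..\<tau>0} \<Longrightarrow>
          \<Phi> t q \<in> fst c \<and> snd c (\<Phi> t q) \<in> cball x0 R"
        using flow_stays[OF flow eps c sK R(1,3)] by metis
      define \<tau> where "\<tau> = min \<tau>0 d"
      have \<tau>: "\<tau> > 0" "\<tau> < \<epsilon>" "\<tau> \<le> \<tau>0" "\<tau> \<le> d" using \<tau>0 R by (auto simp: \<tau>_def)
      obtain \<rho> where \<rho>: "\<rho> > 0" "ball x0 \<rho> \<subseteq> snd c ` (fst c \<inter> U)"
        using opU x0U open_contains_ball by blast
      define \<rho>' where "\<rho>' = min \<rho> (R / 2)"
      have \<rho>': "\<rho>' > 0" "ball x0 \<rho>' \<subseteq> ball x0 \<rho>" "ball x0 \<rho>' \<subseteq> ball x0 (R / 2)"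
        using \<rho> R by (auto simp: \<rho>'_def)
      have q: "chart_inv c x \<in> U" "chart_inv c x \<in> fst c" "snd c (chart_inv c x) = x" if x: "x \<in> ball x0 \<rho>'" for x
      proof -
        obtain q where "q \<in> fst c" "q \<in> U" "x = snd c q" using \<rho>'(2) \<rho>(2) x by blast
        then show "chart_inv c x \<in> U" "chart_inv c x \<in> fst c" "snd c (chart_inv c x) = x" using c by auto
      qed
      have sol: "(snd c \<circ> (\<lambda>t. \<Phi> t (chart_inv c x))) s \<in> cball x0 R \<and>
          ((snd c \<circ> (\<lambda>t. \<Phi> t (chart_inv c x))) has_vector_derivative
            ?k ((snd c \<circ> (\<lambda>t. \<Phi> t (chart_inv c x))) s)) (at s within {0..t})"
        if x: "x \<in> ball x0 \<rho>'" and t: "t \<in> {0..\<tau>}" and s: "s \<in> {0..t}" for x t s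
      proof -
        have st: "\<Phi> s (chart_inv c x) \<in> fst c \<and> snd c (\<Phi> s (chart_inv c x)) \<in> cball x0 R"
          by (rule stay) (use q[OF x] x \<rho>'(3) t s \<tau> in auto)
        have sI: "s \<in> ?I" "{0..t} \<subseteq> ?I" using s t \<tau> eps by auto
        show ?thesis
          using has_vector_derivative_within_subset[OF integral_curve_chart[OF ic[OF q(1)[OF x]] c sI(1)] sI(2)] st
          by simp
      qed
      have x0\<rho>: "x0 \<in> ball x0 \<rho>'" using \<rho>' by simp
      have "\<Phi> t p \<in> fst c \<and> (\<forall>y. norm (E t y - y - t *\<^sub>R ?D y) \<le> e * t * norm y)" if t: "t \<in> {0..\<tau>}" for t
      proof -
        have \<Phi>p: "\<Phi> t p \<in> fst c" using stay[of p t] p U t \<tau> R by auto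
        have lD: "linear ?D" by (rule smooth_on_linear_frechet[OF sK x0])
        have gE: "(g t has_derivative E t) (at x0)"
          using almost_isometry_one_form(1)[OF ai U(1) c U(2) p(1) \<Phi>p] t \<tau> by (simp add: g_def E_def p(2))
        \<comment> \<open>With the expected linear part subtracted, the flow estimate is a Lipschitz
          bound for \<open>h\<close> at \<open>x0\<close>, which \<open>derivative_norm_le\<close>
          transfers to the derivative.\<close>
        define h where "h x = g t x - x - t *\<^sub>R ?D x" for x
        have hd: "(h has_derivative (\<lambda>y. E t y - y - t *\<^sub>R ?D y)) (at x0)"
          unfolding h_def
          by (intro has_derivative_diff gE has_derivative_ident has_derivative_scaleR_right linear_imp_has_derivative lD)
        have "norm (E t y - y - t *\<^sub>R ?D y) \<le> e * t * norm y" for y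
        proof (rule derivative_norm_le[OF hd \<rho>'(1)])
          fix x assume x: "x \<in> ball x0 \<rho>'"
          have "norm (g t x - g t x0 - (x - x0) - t *\<^sub>R ?D (x - x0)) \<le> e * t * norm (x - x0)"
            using fd[of t "snd c \<circ> (\<lambda>t. \<Phi> t (chart_inv c x))" "snd c \<circ> (\<lambda>t. \<Phi> t (chart_inv c x0))"]
              sol[OF x t] sol[OF x0\<rho> t] t \<tau> \<Phi>0[OF q(1)[OF x]] \<Phi>0[OF q(1)[OF x0\<rho>]] q(3)[OF x] q(3)[OF x0\<rho>]
            by (simp add: g_def)
          moreover have "g t x - g t x0 - (x - x0) - t *\<^sub>R ?D (x - x0) = h x - h x0"
            by (simp add: h_def linear_diff[OF lD] algebra_simps)
          ultimately show "norm (h x - h x0) \<le> e * t * norm (x - x0)" by simp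
        qed
        then show ?thesis using \<Phi>p by blast
      qed
      then show ?thesis using \<tau> by blast
    qed
    obtain \<tau>1 where \<tau>1: "\<tau>1 > 0" "\<tau>1 < \<epsilon>" "\<And>t. t \<in> {0..\<tau>1} \<Longrightarrow> \<Phi> t p \<in> fst c"
      "\<And>t y. t \<in> {0..\<tau>1} \<Longrightarrow> norm (E t y - y - t *\<^sub>R ?D y) \<le> 1 * t * norm y"
      using expand[of 1] by auto
    let ?S = "{0..\<tau>1}"
    have E0: "E 0 y = y" for y using \<tau>1(4)[of 0 y] \<tau>1(1) by simp
    have a0: "a 0 = x0" using \<Phi>0[OF U(2)] p by (simp add: a_def)
    have da: "(a has_vector_derivative ?k x0) (at 0 within ?S)"
    proof -
      have "((snd c \<circ> (\<lambda>t. \<Phi> t p)) has_vector_derivative ?k ((snd c \<circ> (\<lambda>t. \<Phi> t p)) 0)) (at 0 within ?I)"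
        by (rule integral_curve_chart[OF ic[OF U(2)] c]) (use eps p \<Phi>0[OF U(2)] in auto)
      moreover have "snd c \<circ> (\<lambda>t. \<Phi> t p) = a" by (auto simp: a_def)
      ultimately have "(a has_vector_derivative ?k x0) (at 0 within ?I)" using a0 by simp
      then show ?thesis by (rule has_vector_derivative_within_subset) (use \<tau>1 eps in auto)
    qed
    have dE: "((\<lambda>t. E t y) has_vector_derivative ?D y) (at 0 within ?S)" for y
      unfolding has_vector_derivative_def has_derivative_within_alt
    proof (intro conjI allI impI)
      show "bounded_linear (\<lambda>h. h *\<^sub>R ?D y)" by (rule bounded_linear_scaleR_left)
      fix e :: real assume e: "e > 0"
      define e' where "e' = e / (norm y + 1)"
      have ny: "norm y + 1 > 0" by (simp add: add_nonneg_pos)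
      have e': "e' > 0" "e' * norm y \<le> e" using e ny by (auto simp: e'_def field_simps)
      obtain \<tau> where \<tau>: "\<tau> > 0" "\<And>t y. t \<in> {0..\<tau>} \<Longrightarrow> norm (E t y - y - t *\<^sub>R ?D y) \<le> e' * t * norm y"
        using expand[OF e'(1)] by blast
      show "\<exists>d>0. \<forall>t\<in>?S. norm (t - 0) < d \<longrightarrow> norm (E t y - E 0 y - (t - 0) *\<^sub>R ?D y) \<le> e * norm (t - 0)"
      proof (intro exI[of _ \<tau>] conjI \<tau>(1) ballI impI)
        fix t assume t: "t \<in> ?S" "norm (t - 0) < \<tau>"
        then have "norm (E t y - y - t *\<^sub>R ?D y) \<le> (e' * norm y) * t" using \<tau>(2)[of t y] by (simp add: mult_ac)
        also have "\<dots> \<le> e * t" using e' t by (intro mult_right_mono) auto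
        finally show "norm (E t y - E 0 y - (t - 0) *\<^sub>R ?D y) \<le> e * norm (t - 0)" using t E0 by simp
      qed
    qed
    define h where "h t y = fc c (a t, E t y) - fc c (x0, y)" for t y
    have h0: "h t 0 = 0" if "t \<in> ?S" for t
    proof -
      have lE: "linear (E t)"
        using almost_isometry_one_form(1)[OF ai U(1) c U(2) p(1) \<tau>1(3)[OF that]] that \<tau>1
        by (auto simp: g_def E_def p(2) intro: has_derivative_linear)
      then show ?thesis
        using linear_0[OF lE] M.f_0[OF x0] M.f_0[of "a t"] \<tau>1(3)[OF that] by (auto simp: h_def a_def)
    qed
    have lim: "((\<lambda>t. h t y / t) \<longlongrightarrow> M.lie ?k x0 y) (at_right 0)" for y
    proof (cases "y = 0")
      case True
      have "\<forall>\<^sub>F t in at_right 0. t < \<tau>1" using \<tau>1(1) by (simp add: eventually_at_right_field) blast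
      moreover have "\<forall>\<^sub>F t in at_right 0. t > (0::real)" by (simp add: eventually_at_filter)
      ultimately have "\<forall>\<^sub>F t in at_right 0. h t y / t = 0"
        by eventually_elim (use h0 True in auto)
      then show ?thesis using True by (auto simp: M.lie_def intro: tendsto_eventually)
    next
      case False
      have "((\<lambda>t. (a t, E t y)) has_derivative (\<lambda>s. (s *\<^sub>R ?k x0, s *\<^sub>R ?D y))) (at 0 within ?S)"
        using has_derivative_Pair[OF da[unfolded has_vector_derivative_def] dE[unfolded has_vector_derivative_def]] .
      moreover have "(fc c has_derivative frechet_derivative (fc c) (at (x0, y))) (at (a 0, E 0 y))"
        using M.f_has_derivative[OF x0 False] by (simp add: a0 E0)
      ultimately have "((\<lambda>t. fc c (a t, E t y)) has_derivative
          (\<lambda>s. frechet_derivative (fc c) (at (x0, y)) (s *\<^sub>R ?k x0, s *\<^sub>R ?D y))) (at 0 within ?S)"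
        by (rule has_derivative_compose)
      moreover have "(s *\<^sub>R ?k x0, s *\<^sub>R ?D y) = s *\<^sub>R (?k x0, ?D y)" for s by simp
      ultimately have "((\<lambda>t. fc c (a t, E t y)) has_real_derivative M.lie ?k x0 y) (at 0 within ?S)"
        using False linear_scale[OF has_derivative_linear[OF M.f_has_derivative[OF x0 False]]]
        by (simp add: has_field_derivative_def M.lie_def mult_commute_abs del: scaleR_Pair)
      then have "((\<lambda>t. h t y / t) \<longlongrightarrow> M.lie ?k x0 y) (at 0 within ?S)"
        by (simp add: has_field_derivative_iff h_def a0 E0)
      then show ?thesis using at_within_Icc_at_right[OF \<tau>1(1)] by simp
    qed
    have inS: "\<forall>\<^sub>F t in at_right 0. t \<in> ?S"
    proof -
      have "\<forall>\<^sub>F t in at_right 0. t < \<tau>1" using \<tau>1(1) by (simp add: eventually_at_right_field) blast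
      moreover have "\<forall>\<^sub>F t in at_right 0. t > (0::real)" by (simp add: eventually_at_filter)
      ultimately show ?thesis by eventually_elim auto
    qed
    have add: "h t (y + z) = h t y + h t z" if t: "t \<in> ?S" for t y z
      using almost_isometry_one_form(2)[OF ai U(1) c U(2) p(1) \<tau>1(3)[OF t], of y z] t \<tau>1
      by (simp add: h_def a_def E_def g_def p(2))
    have lie_add: "M.lie ?k x0 (y + z) = M.lie ?k x0 y + M.lie ?k x0 z" for y z
    proof (rule tendsto_unique[OF trivial_limit_at_right_real lim])
      have "\<forall>\<^sub>F t in at_right 0. h t y / t + h t z / t = h t (y + z) / t"
        using inS by eventually_elim (simp add: add add_divide_distrib)
      then show "((\<lambda>t. h t (y + z) / t) \<longlongrightarrow> M.lie ?k x0 y + M.lie ?k x0 z) (at_right 0)"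
        by (rule Lim_transform_eventually[OF tendsto_add[OF lim lim]])
    qed
    have scale_pos: "M.lie ?k x0 (r *\<^sub>R y) = r * M.lie ?k x0 y" if r: "r > 0" for r y
    proof (rule tendsto_unique[OF trivial_limit_at_right_real lim])
      have "\<forall>\<^sub>F t in at_right 0. r * (h t y / t) = h t (r *\<^sub>R y) / t"
        using inS
      proof eventually_elim
        case (elim t)
        have "linear (E t)"
          using almost_isometry_one_form(1)[OF ai U(1) c U(2) p(1) \<tau>1(3)[OF elim]] elim \<tau>1
          by (auto simp: g_def E_def p(2) intro: has_derivative_linear)
        then have "h t (r *\<^sub>R y) = r * h t y"
          using M.f_scale[OF x0 r] M.f_scale[of "a t" r "E t y"] r \<tau>1(3)[OF elim]
          by (simp add: h_def a_def linear_scale algebra_simps)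
        then show ?case by simp
      qed
      then show "((\<lambda>t. h t (r *\<^sub>R y) / t) \<longlongrightarrow> r * M.lie ?k x0 y) (at_right 0)"
        by (rule Lim_transform_eventually[OF tendsto_mult_left[OF lim]])
    qed
    have neg: "M.lie ?k x0 (- y) = - M.lie ?k x0 y" for y
      using lie_add[of y "- y"] by (simp add: M.lie_def)
    show ?thesis
    proof (rule linearI)
      fix y z :: 'e and r :: real
      show "M.lie ?k x0 (y + z) = M.lie ?k x0 y + M.lie ?k x0 z" by (rule lie_add)
      consider "r > 0" | "r = 0" | "r < 0" by linarith
      then show "M.lie ?k x0 (r *\<^sub>R y) = r *\<^sub>R M.lie ?k x0 y"
      proof cases
        case 1 then show ?thesis using scale_pos by simp
      next
        case 2 then show ?thesis by (simp add: M.lie_def)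
      next
        case 3
        then have "M.lie ?k x0 ((- r) *\<^sub>R y) = (- r) * M.lie ?k x0 y" by (intro scale_pos) simp
        then show ?thesis using neg[of "(- r) *\<^sub>R y"] by simp
      qed
    qed
  qed
  then show ?thesis using sK by (simp add: M.almost_killing_field_def)
qed

end

subsection \<open>The isotropy algebra\<close>

text \<open>Each functional costs at most one dimension: if it is nonzero at \<open>b0\<close>,
  subtracting multiples of \<open>b0\<close> moves the other vectors into its kernel and stays
  injective on their span. The space of vector fields is infinite-dimensional, so the count is made
  on finite independent sets.\<close>

lemma independent_kernel_of_functionals:
  fixes B :: "'v::real_vector set" and \<Phi> :: "('v \<Rightarrow> real) set"
  assumes "finite \<Phi>" "\<And>\<phi>. \<phi> \<in> \<Phi> \<Longrightarrow> linear \<phi>" "finite B" "independent B"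
  shows "\<exists>B'. finite B' \<and> independent B' \<and> B' \<subseteq> span B \<and> card B \<le> card B' + card \<Phi> \<and> (\<forall>\<phi>\<in>\<Phi>. \<forall>b\<in>B'. \<phi> b = 0)"
  using assms(1,2)
proof (induction \<Phi> rule: finite_induct)
  case empty
  then show ?case using assms(3,4) span_superset by (intro exI[of _ B]) auto
next
  case (insert \<phi> \<Phi>)
  then obtain C where C: "finite C" "independent C" "C \<subseteq> span B" "card B \<le> card C + card \<Phi>" "\<forall>\<phi>\<in>\<Phi>. \<forall>b\<in>C. \<phi> b = 0"
    by auto
  have l\<phi>: "linear \<phi>" using insert.prems by simp
  have card: "card (insert \<phi> \<Phi>) = Suc (card \<Phi>)" using insert.hyps by simp
  show ?case
  proof (cases "\<forall>b\<in>C. \<phi> b = 0")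
    case True
    then show ?thesis using C card by (intro exI[of _ C]) auto
  next
    case False
    then obtain b0 where b0: "b0 \<in> C" "\<phi> b0 \<noteq> 0" by blast
    define f where "f v = v - (\<phi> v / \<phi> b0) *\<^sub>R b0" for v
    have lf: "linear f"
      by (rule linearI)
        (auto simp: f_def linear_add[OF l\<phi>] linear_scale[OF l\<phi>] add_divide_distrib scaleR_add_left scaleR_diff_right)
    let ?C = "C - {b0}"
    have indC: "independent ?C" by (rule independent_mono[OF C(2)]) auto
    have "b0 \<notin> span ?C" using C(2) b0(1) by (auto simp: dependent_def)
    have inj: "inj_on f (span ?C)"
    proof (rule inj_onI)
      fix u v assume uv: "u \<in> span ?C" "v \<in> span ?C" "f u = f v"
      then have "f (u - v) = 0" by (simp add: linear_diff[OF lf])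
      then have eq: "u - v = (\<phi> (u - v) / \<phi> b0) *\<^sub>R b0" by (simp add: f_def)
      have "\<phi> (u - v) / \<phi> b0 = 0"
      proof (rule ccontr)
        assume k: "\<phi> (u - v) / \<phi> b0 \<noteq> 0"
        have "b0 = (1 / (\<phi> (u - v) / \<phi> b0)) *\<^sub>R ((\<phi> (u - v) / \<phi> b0) *\<^sub>R b0)" using k by simp
        also have "\<dots> = (1 / (\<phi> (u - v) / \<phi> b0)) *\<^sub>R (u - v)" using eq by simp
        also have "\<dots> \<in> span ?C" using uv by (intro span_scale span_diff)
        finally show False using \<open>b0 \<notin> span ?C\<close> by simp
      qed
      then have "u - v = 0" using eq by (simp only: scaleR_zero_left)
      then show "u = v" by simp
    qed
    have ind: "independent (f ` ?C)" by (rule linear_independent_injective_image[OF lf indC inj])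
    have "inj_on f ?C" by (rule inj_on_subset[OF inj span_superset])
    then have "card (f ` ?C) = card ?C" by (rule card_image)
    then have "card B \<le> card (f ` ?C) + card (insert \<phi> \<Phi>)" using C(1,4) b0(1) card by (simp add: card_Diff_singleton)
    moreover have "f ` ?C \<subseteq> span B"
      using C(3) b0(1) unfolding f_def by (auto intro!: span_diff span_scale)
    moreover have "\<psi> (f b) = 0" if "\<psi> \<in> insert \<phi> \<Phi>" "b \<in> ?C" for \<psi> b
    proof -
      have l: "linear \<psi>" using insert.prems that(1) by simp
      show ?thesis
        using that b0 C(5) by (auto simp: f_def linear_diff[OF l] linear_scale[OF l])
    qed
    ultimately show ?thesis using C(1) ind by (intro exI[of _ "f ` ?C"]) auto
  qed
qed

lemma C_diff_on_scaleR: "open S \<Longrightarrow> C_diff_on k S f \<Longrightarrow> C_diff_on k S (\<lambda>x. r *\<^sub>R f x)"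
proof (induction k arbitrary: f)
  case 0 then show ?case by (auto intro: continuous_intros)
next
  case (Suc k)
  have hd: "((\<lambda>x. r *\<^sub>R f x) has_derivative (\<lambda>v. r *\<^sub>R frechet_derivative f (at x) v)) (at x)" if "x \<in> S" for x
    using Suc.prems that by (auto intro!: has_derivative_scaleR_right simp: frechet_derivative_works[symmetric])
  have c: "C_diff_on k S (\<lambda>x. r *\<^sub>R frechet_derivative f (at x) v)" for v
    by (rule Suc.IH) (use Suc.prems in auto)
  have "C_diff_on k S (\<lambda>x. frechet_derivative (\<lambda>x. r *\<^sub>R f x) (at x) v)" for v
    by (rule C_diff_on_cong[OF Suc.prems(1) fun_cong[OF frechet_derivative_at[OF hd]] c])
  then show ?case using hd by (auto simp: differentiable_def)
qed

lemma smooth_on_scaleR: "open S \<Longrightarrow> smooth_on S f \<Longrightarrow> smooth_on S (\<lambda>x. r *\<^sub>R f x)"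
  unfolding smooth_on_def using C_diff_on_scaleR by blast

lemma frechet_derivative_combination:
  assumes "(f has_derivative f') (at x)" "(g has_derivative g') (at x)"
  shows "frechet_derivative (\<lambda>x. a *\<^sub>R f x + b *\<^sub>R g x) (at x) = (\<lambda>v. a *\<^sub>R f' v + b *\<^sub>R g' v)"
proof -
  have "((\<lambda>x. a *\<^sub>R f x + b *\<^sub>R g x) has_derivative (\<lambda>v. a *\<^sub>R f' v + b *\<^sub>R g' v)) (at x)"
    by (intro has_derivative_add has_derivative_scaleR_right assms)
  then show ?thesis by (rule frechet_derivative_at[symmetric])
qed

lemma (in minkowski_family) almost_killing_field_combination:
  assumes "almost_killing_field K" "almost_killing_field L"
  shows "almost_killing_field (\<lambda>x. a *\<^sub>R K x + b *\<^sub>R L x)"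
proof -
  have s: "smooth_on \<Omega> K" "smooth_on \<Omega> L" using assms by (auto simp: almost_killing_field_def)
  have "linear (lie (\<lambda>x. a *\<^sub>R K x + b *\<^sub>R L x) x)" if x: "x \<in> \<Omega>" for x
  proof -
    have l: "linear (lie K x)" "linear (lie L x)" using assms x by (auto simp: almost_killing_field_def)
    have "lie (\<lambda>x. a *\<^sub>R K x + b *\<^sub>R L x) x y = a *\<^sub>R lie K x y + b *\<^sub>R lie L x y" for y
    proof (cases "y = 0")
      case False
      note lf = has_derivative_linear[OF f_has_derivative[OF x False]]
      show ?thesis
        using False linear_add[OF lf] linear_scale[OF lf]
        unfolding lie_def frechet_derivative_combination[OF smooth_on_has_derivative[OF s(1) x] smooth_on_has_derivative[OF s(2) x]]
        by (simp flip: scaleR_Pair add_Pair)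
    qed (simp add: lie_def)
    moreover have "linear (\<lambda>y. a *\<^sub>R lie K x y + b *\<^sub>R lie L x y)"
      using l by (intro linear_compose_add linear_compose_scale_right)
    ultimately show ?thesis by presburger
  qed
  then show ?thesis
    using s open_\<Omega> by (simp add: almost_killing_field_def smooth_on_add smooth_on_scaleR)
qed

context finsler_mfd
begin

text \<open>The infinitesimal condition replaces the flow condition because it is evidently stable
  under linear combinations, whereas the flow of a sum of two fields is not readily expressed by
  their flows.\<close>

definition good :: "('a \<Rightarrow> ('a, 'e) tvec) \<Rightarrow> bool"
  where "good K \<longleftrightarrow> (\<forall>p\<in>topspace X. K p \<in> tangent_space A p) \<and> (\<forall>p. p \<notin> topspace X \<longrightarrow> K p = 0) \<and>
    (\<forall>c\<in>A. minkowski_family.almost_killing_field (snd c ` fst c) (fc c) (kc K c))"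

lemma almost_killing_good: "almost_killing X A F K \<Longrightarrow> good K"
  using almost_killing_imp_field by (auto simp: good_def almost_killing_def smooth_vector_field_def)

lemma kc_combination: "kc (a *\<^sub>R K + b *\<^sub>R L) c = (\<lambda>x. a *\<^sub>R kc K c x + b *\<^sub>R kc L c x)"
  by (simp add: kc_def fun_vs)

lemma good_combination:
  assumes "good K" "good L"
  shows "good (a *\<^sub>R K + b *\<^sub>R L)"
  unfolding good_def
proof (intro conjI ballI allI impI)
  fix p assume p: "p \<in> topspace X"
  have "a *\<^sub>R K p + b *\<^sub>R L p \<in> tangent_space A p"
    using assms p subspace_tangent_space[OF p] by (intro subspace_add subspace_scale) (auto simp: good_def)
  then show "(a *\<^sub>R K + b *\<^sub>R L) p \<in> tangent_space A p" by (simp add: fun_vs)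
next
  fix p assume "p \<notin> topspace X"
  then show "(a *\<^sub>R K + b *\<^sub>R L) p = 0" using assms by (simp add: good_def fun_vs)
next
  fix c assume c: "c \<in> A"
  interpret minkowski_family "snd c ` fst c" "fc c" by (rule minkowski_family_fc[OF c])
  show "almost_killing_field (kc (a *\<^sub>R K + b *\<^sub>R L) c)"
    unfolding kc_combination using assms c by (intro almost_killing_field_combination) (auto simp: good_def)
qed

lemma good_smooth:
  assumes "good K" "c \<in> A"
  shows "smooth_on (snd c ` fst c) (kc K c)"
proof -
  interpret minkowski_family "snd c ` fst c" "fc c" by (rule minkowski_family_fc[OF assms(2)])
  have "almost_killing_field (kc K c)" using assms unfolding good_def by blast
  then show ?thesis unfolding almost_killing_field_def by blast
qed

text \<open>The vanishing locus of the first jet is open and closed.\<close>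

lemma good_unique:
  assumes conn: "connected_space X" and K: "good K" and c: "c \<in> A" and x0: "x0 \<in> snd c ` fst c"
    and jet: "kc K c x0 = 0" "\<And>v. frechet_derivative (kc K c) (at x0) v = 0"
  shows "K = 0"
proof -
  define Z where "Z = {p \<in> topspace X. \<exists>N. openin X N \<and> p \<in> N \<and> (\<forall>q\<in>N. K q = 0)}"
  \<comment> \<open>Each point has a neighbourhood on which a vanishing first jet at any one point
    forces the field to vanish. \<open>Z\<close>, the interior of the zero set, is open anyway; the
    freedom in the choice of that point makes it closed.\<close>
  have "\<exists>W. openin X W \<and> p \<in> W \<and> W \<subseteq> fst c \<and> ((\<exists>q\<in>W. kc K c (snd c q) = 0 \<and>
      (\<forall>v. frechet_derivative (kc K c) (at (snd c q)) v = 0)) \<longrightarrow> (\<forall>q\<in>W. K q = 0))"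
    if c: "c \<in> A" and p: "p \<in> fst c" for c p
  proof -
    interpret minkowski_family "snd c ` fst c" "fc c" by (rule minkowski_family_fc[OF c])
    have kf: "almost_killing_field (kc K c)" using K c by (simp add: good_def)
    obtain r where r: "r > 0" and un: "\<And>x1 x. x1 \<in> ball (snd c p) r \<Longrightarrow> kc K c x1 = 0 \<Longrightarrow>
        (\<forall>v. frechet_derivative (kc K c) (at x1) v = 0) \<Longrightarrow> x \<in> ball (snd c p) r \<Longrightarrow> kc K c x = 0"
      using almost_killing_field_unique[of "snd c p"] p kf by blast
    define W where "W = {q \<in> fst c. snd c q \<in> ball (snd c p) r}"
    have "openin X W" unfolding W_def by (rule openin_chart_vimage[OF c open_ball])
    moreover have "p \<in> W" using p r by (simp add: W_def)
    moreover have "K q' = 0" if q: "q \<in> W" "kc K c (snd c q) = 0"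
      "\<forall>v. frechet_derivative (kc K c) (at (snd c q)) v = 0" and q': "q' \<in> W" for q q'
    proof -
      have "kc K c (snd c q') = 0" using un[of "snd c q" "snd c q'"] q q' by (simp add: W_def)
      then have "K q' c = 0" using q' c by (simp add: kc_def W_def)
      moreover have "K q' \<in> tangent_space A q'"
        using K q' dom_subset[OF c] by (auto simp: good_def W_def)
      ultimately show ?thesis using tangent_component_eq_0[OF c, of q'] q' by (simp add: W_def)
    qed
    ultimately show ?thesis by (intro exI[of _ W]) (auto simp: W_def)
  qed
  then obtain W where W: "\<And>c p. c \<in> A \<Longrightarrow> p \<in> fst c \<Longrightarrow> openin X (W c p) \<and> p \<in> W c p \<and> W c p \<subseteq> fst c \<and>
      ((\<exists>q\<in>W c p. kc K c (snd c q) = 0 \<and>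
      (\<forall>v. frechet_derivative (kc K c) (at (snd c q)) v = 0)) \<longrightarrow> (\<forall>q\<in>W c p. K q = 0))"
    by metis
  have Zsub: "Z \<subseteq> topspace X" by (auto simp: Z_def)
  have opZ: "openin X Z"
  proof (subst openin_subopen, intro ballI)
    fix p assume "p \<in> Z"
    then obtain N where N: "openin X N" "p \<in> N" "\<forall>q\<in>N. K q = 0" by (auto simp: Z_def)
    then have "N \<subseteq> Z" using openin_subset[OF N(1)] by (auto simp: Z_def)
    then show "\<exists>T. openin X T \<and> p \<in> T \<and> T \<subseteq> Z" using N by blast
  qed
  have "openin X (topspace X - Z)"
  proof (subst openin_subopen, intro ballI)
    fix p assume p: "p \<in> topspace X - Z"
    obtain c where c: "c \<in> A" "p \<in> fst c" using charts_cover p by blast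
    note Wp = W[OF c]
    have "q \<notin> Z" if q: "q \<in> W c p" for q
    proof
      assume "q \<in> Z"
      then obtain N where N: "openin X N" "q \<in> N" "\<forall>q\<in>N. K q = 0" by (auto simp: Z_def)
      have qc: "q \<in> fst c" using q Wp by blast
      have "kc K c y = 0" if "y \<in> snd c ` (fst c \<inter> N)" for y
        using that N(3) c(1) by (auto simp: kc_def)
      then have "(kc K c has_derivative (\<lambda>v. 0)) (at (snd c q))"
        by (intro has_derivative_transform_within_open[OF has_derivative_const open_chart_image[OF c(1) N(1)]])
          (use qc N(2) in auto)
      then have "frechet_derivative (kc K c) (at (snd c q)) v = 0" for v
        using frechet_derivative_at by metis
      moreover have "kc K c (snd c q) = 0" using N qc c(1) by (simp add: kc_def)
      ultimately have "\<forall>q\<in>W c p. K q = 0" using Wp q by blast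
      then have "p \<in> Z" using Wp p by (auto simp: Z_def)
      then show False using p by blast
    qed
    then show "\<exists>T. openin X T \<and> p \<in> T \<and> T \<subseteq> topspace X - Z"
      using Wp openin_subset by blast
  qed
  then have "closedin X Z" using Zsub by (simp add: closedin_def)
  moreover have "Z \<noteq> {}"
  proof -
    obtain p where p: "p \<in> fst c" "x0 = snd c p" using x0 by blast
    have "\<forall>q\<in>W c p. K q = 0" using W[OF c p(1)] jet p(2) by blast
    then have "p \<in> Z" using W[OF c p(1)] dom_subset[OF c] p(1) by (auto simp: Z_def)
    then show ?thesis by blast
  qed
  ultimately have "Z = topspace X" using conn opZ by (auto simp: connected_space_clopen_in)
  then have "K q = 0" for q
    using K unfolding good_def Z_def by (cases "q \<in> topspace X") blast+
  then show ?thesis by (intro ext) (simp only: zero_fun_apply)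
qed

definition jet :: "('a, 'e) chart \<Rightarrow> 'e \<Rightarrow> ('a \<Rightarrow> ('a, 'e) tvec) \<Rightarrow> 'e \<Rightarrow> 'e"
  where "jet c x K = frechet_derivative (kc K c) (at x)"

lemma jet_combination:
  assumes "good K" "good L" "c \<in> A" "x \<in> snd c ` fst c"
  shows "jet c x (a *\<^sub>R K + b *\<^sub>R L) = a *\<^sub>R jet c x K + b *\<^sub>R jet c x L"
  unfolding jet_def kc_combination
    frechet_derivative_combination[OF smooth_on_has_derivative[OF good_smooth[OF assms(1,3)] assms(4)]
      smooth_on_has_derivative[OF good_smooth[OF assms(2,3)] assms(4)]]
  by (rule ext) (simp add: fun_vs)

lemma good_zero: "good K \<Longrightarrow> good 0"
  using good_combination[of K K 0 0] by simp

lemma jet_sum: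
  assumes "finite S" "\<And>K. K \<in> S \<Longrightarrow> good K" "good K0" and c: "c \<in> A" "x \<in> snd c ` fst c"
  shows "good (\<Sum>K\<in>S. u K *\<^sub>R K) \<and> jet c x (\<Sum>K\<in>S. u K *\<^sub>R K) = (\<Sum>K\<in>S. u K *\<^sub>R jet c x K)"
  using assms(1,2)
proof (induction S rule: finite_induct)
  case empty
  have "jet c x 0 = 0"
    using jet_combination[OF assms(3,3) c, of 0 0] by (simp only: scaleR_zero_left add_0)
  then show ?case using good_zero[OF assms(3)] by (simp only: sum.empty)
next
  case (insert L S)
  then have IH: "good (\<Sum>K\<in>S. u K *\<^sub>R K)" "jet c x (\<Sum>K\<in>S. u K *\<^sub>R K) = (\<Sum>K\<in>S. u K *\<^sub>R jet c x K)"
    and L: "good L" by auto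
  show ?case
    using good_combination[OF L IH(1), of "u L" 1] jet_combination[OF L IH(1) c, of "u L" 1]
    by (simp only: sum.insert[OF insert.hyps] scaleR_one IH(2))
qed

lemma subspace_good: "good K0 \<Longrightarrow> subspace {K. good K}"
  unfolding subspace_def using good_zero good_combination[of _ _ 1 1] good_combination[of _ _ _ 0] by auto

text \<open>Vanishing at the point imposes n scalar conditions, and on the remaining fields the
  first jet is injective by unique continuation. Their linear parts thus supply more than
  (n-1)(n-2)/2 independent maps.\<close>

lemma pointwise_Randers:
  assumes conn: "connected_space X" and dim2: "2 \<le> DIM('e)"
    and dims: "dim_greater {K. almost_killing X A F K} ((real DIM('e) ^ 2 - real DIM('e)) / 2 + 1)"
    and c: "c \<in> A" and x0: "x0 \<in> snd c ` fst c"
  shows "\<exists>(T :: 'e \<Rightarrow> 'e) k l. linear T \<and> bij T \<and> k > 0 \<and> linear l \<and> (\<forall>y. fc c (x0, T y) = k * norm y + l y)"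
proof -
  interpret minkowski_family "snd c ` fst c" "fc c" by (rule minkowski_family_fc[OF c])
  obtain B where B: "B \<subseteq> {K. almost_killing X A F K}" "finite B" "independent B"
    "real (card B) > (real DIM('e) ^ 2 - real DIM('e)) / 2 + 1"
    using dims unfolding dim_greater_def by blast
  define p where "p = chart_inv c x0"
  have p: "p \<in> fst c" "snd c p = x0" using x0 c by (auto simp: p_def)
  \<comment> \<open>Vanishing of a tangent vector can be tested in the single chart
    \<open>c\<close>, with one functional per basis vector.\<close>
  define \<Phi> where "\<Phi> = (\<lambda>b K. (K p c :: 'e) \<bullet> b) ` (Basis :: 'e set)"
  have fin: "finite \<Phi>" and card\<Phi>: "card \<Phi> \<le> DIM('e)" by (auto simp: \<Phi>_def card_image_le)
  have lin\<Phi>: "linear \<phi>" if "\<phi> \<in> \<Phi>" for \<phi>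
    using that by (auto simp: \<Phi>_def linear_iff fun_vs inner_simps)
  obtain B' where B': "finite B'" "independent B'" "B' \<subseteq> span B" "card B \<le> card B' + card \<Phi>"
    "\<forall>\<phi>\<in>\<Phi>. \<forall>b\<in>B'. \<phi> b = 0"
    using independent_kernel_of_functionals[OF fin lin\<Phi> B(2,3)] by blast
  have "card B > 0"
  proof -
    have "real DIM('e) ^ 2 \<ge> real DIM('e)" using dim2 by (simp add: power2_eq_square)
    then have "real (card B) > 0" using B(4) by (smt (verit) divide_nonneg_nonneg)
    then show ?thesis by simp
  qed
  then obtain K0 where K0: "good K0" using B(1) almost_killing_good by (metis Collect_mem_eq Collect_mono_iff card_gt_0_iff ex_in_conv)
  have good: "good K" if "K \<in> span B" for K
  proof -
    have "span B \<subseteq> {K. good K}"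
      by (rule span_minimal[OF _ subspace_good[OF K0]]) (use B(1) almost_killing_good in blast)
    then show ?thesis using that by blast
  qed
  have good': "good K" if "K \<in> B'" for K using good B'(3) that by blast
  have Kp: "kc K c x0 = 0" if "K \<in> span B'" for K
  proof -
    have "span B' \<subseteq> {K. \<forall>\<phi>\<in>\<Phi>. \<phi> K = 0}"
      by (rule span_minimal) (use B'(5) lin\<Phi> in \<open>auto simp: subspace_def linear_0 linear_add linear_scale\<close>)
    then have kb: "K p c \<bullet> b = 0" if "b \<in> Basis" for b using \<open>K \<in> span B'\<close> that by (auto simp: \<Phi>_def)
    have "K p c = 0" by (rule euclidean_eqI) (simp only: inner_zero_left kb)
    then show ?thesis by (simp add: kc_def p_def)
  qed
  have zero: "K = 0" if K: "K \<in> span B'" and j: "jet c x0 K = 0" for K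
  proof (rule good_unique[OF conn _ c x0 Kp[OF K]])
    have "span B' \<subseteq> span B" using B'(3) span_minimal subspace_span by blast
    then show "good K" using good K by blast
    show "frechet_derivative (kc K c) (at x0) v = 0" for v using j by (simp add: jet_def zero_fun_def)
  qed
  have inj: "inj_on (jet c x0) B'"
  proof (rule inj_onI)
    fix K L assume KL: "K \<in> B'" "L \<in> B'" "jet c x0 K = jet c x0 L"
    have "jet c x0 (1 *\<^sub>R K + (-1) *\<^sub>R L) = 0"
      unfolding jet_combination[OF good'[OF KL(1)] good'[OF KL(2)] c x0] using KL(3) by simp
    moreover have "1 *\<^sub>R K + (-1) *\<^sub>R L \<in> span B'" using KL by (intro span_add span_scale span_base)
    ultimately have "1 *\<^sub>R K + (-1) *\<^sub>R L = 0" by (intro zero)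
    then show "K = L" by simp
  qed
  have finJ: "finite (jet c x0 ` B')" using B'(1) by simp
  have ind: "independent (jet c x0 ` B')"
    unfolding dependent_finite[OF finJ]
  proof (rule notI, elim exE conjE bexE)
    fix u D assume D: "D \<in> jet c x0 ` B'" "u D \<noteq> 0" and s: "(\<Sum>D\<in>jet c x0 ` B'. u D *\<^sub>R D) = 0"
    define S where "S = (\<Sum>K\<in>B'. u (jet c x0 K) *\<^sub>R K)"
    have "jet c x0 S = (\<Sum>K\<in>B'. u (jet c x0 K) *\<^sub>R jet c x0 K)"
      unfolding S_def by (rule conjunct2[OF jet_sum[OF B'(1) good' K0 c x0]])
    also have "\<dots> = 0" using s by (simp add: sum.reindex[OF inj] o_def)
    finally have "jet c x0 S = 0" .
    moreover have "S \<in> span B'" unfolding S_def by (intro span_sum span_scale span_base)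
    ultimately have "S = 0" by (intro zero)
    have "\<not> (\<exists>w. (\<exists>v\<in>B'. w v \<noteq> 0) \<and> (\<Sum>v\<in>B'. w v *\<^sub>R v) = 0)"
      using B'(2) unfolding dependent_finite[OF B'(1)] .
    then have "\<not> ((\<exists>v\<in>B'. u (jet c x0 v) \<noteq> 0) \<and> S = 0)"
      unfolding S_def by (rule contrapos_nn) (rule exI[of _ "\<lambda>K. u (jet c x0 K)"])
    then show False using D \<open>S = 0\<close> by blast
  qed
  have cardJ: "card (jet c x0 ` B') = card B'" by (rule card_image[OF inj])
  show ?thesis
  proof (rule Randers_at_point[OF x0 dim2 finJ ind])
    obtain m where m: "DIM('e) = m + 2" using dim2 by (metis add.commute le_Suc_ex)
    have "real (card B) \<le> real (card B') + real DIM('e)" using B'(4) card\<Phi> by linarith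
    \<comment> \<open>With n = m + 2 the number n(n-1)/2 + 1 - n becomes (m+1)m/2, and truncated
      subtraction disappears.\<close>
    then have "real ((m + 1) * m) < real (2 * card B')"
      using B(4) by (simp add: m power2_eq_square field_simps)
    then show "(DIM('e) - 1) * (DIM('e) - 2) < 2 * card (jet c x0 ` B')"
      unfolding cardJ of_nat_less_iff by (simp add: m)
    fix D assume "D \<in> jet c x0 ` B'"
    then obtain K where K: "K \<in> B'" "D = jet c x0 K" by blast
    have kf: "almost_killing_field (kc K c)" using good'[OF K(1)] c by (simp add: good_def)
    then have l: "linear (lie (kc K c) x0)" using x0 unfolding almost_killing_field_def by blast
    \<comment> \<open>The base component of the complete lift vanishes with \<open>K\<close> at the
      point, so only the fibre derivative survives.\<close>
    have "lie (kc K c) x0 = (\<lambda>y. fibre_deriv x0 y (D y))"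
      using Kp[OF span_base[OF K(1)]] K(2) by (auto simp: lie_def fibre_deriv_def jet_def fun_eq_iff)
    moreover have "linear D"
      unfolding K(2) jet_def by (rule smooth_on_linear_frechet[OF good_smooth[OF good'[OF K(1)] c] x0])
    ultimately show "linear D \<and> linear (\<lambda>y. fibre_deriv x0 y (D y))" using l by simp
  qed
qed

end

section \<open>The global Riemannian metric and one-form\<close>

lemma (in minkowski_family) smooth_on_base:
  "smooth_on \<Omega> (\<lambda>x. f (x, w))"
proof (cases "w = 0")
  case True
  show ?thesis by (rule smooth_on_cong[OF open_\<Omega> _ smooth_on_const[of _ 0]]) (use True f_0 in auto)
next
  case False
  have bl: "bounded_linear (\<lambda>x::'e. (x, 0::'e))"
    by (intro bounded_linear_Pair bounded_linear_ident bounded_linear_zero)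
  have "smooth_on \<Omega> (\<lambda>x. f ((0, w) + (x, 0)))"
    by (rule smooth_on_affine_compose[OF open_slit open_\<Omega> bl _ smooth_f]) (use False in auto)
  then show ?thesis by simp
qed

text \<open>The pointwise frames involve choices and need not vary smoothly. The metric and the form
  are therefore read off from \<open>F\<close>: the even part in each fibre is the norm,
  polarisation turns it into an inner product, and the odd part is the one-form. Smoothness in
  charts comes from \<open>F\<close>; the frames serve only for identities at a single
  point.\<close>

theorem theorem4:
  fixes X :: "'a topology"
    and A :: "('a, 'e::euclidean_space) chart set"
    and F :: "'a \<Rightarrow> ('a, 'e) tvec \<Rightarrow> real"
    and n :: nat
  assumes "smooth_manifold X A"
    and "connected_space X"
    and "n = DIM('e)"
    and "n \<ge> 2"
    and "finsler_metric X A F"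
    and "dim_greater {K. almost_killing X A F K} ((real n ^ 2 - real n) / 2 + 1)"
  shows "randers_metric X A F"
proof -
  interpret finsler_mfd X A F by unfold_locales (use assms in auto)
  \<comment> \<open>\<alpha> absorbs the factor \<open>k\<close> and identifies the tangent space
    with the model space, with inverse \<theta>. The maps are linear on the whole function type,
    while the identities for \<open>F\<close> are confined to the tangent space.\<close>
  have pointwise: "\<exists>\<alpha> \<beta> \<theta>. linear (\<alpha> :: ('a, 'e) tvec \<Rightarrow> 'e) \<and> linear \<beta> \<and> linear \<theta> \<and>
      (\<forall>u\<in>tangent_space A p. F p u = norm (\<alpha> u) + \<beta> u \<and> \<theta> (\<alpha> u) = u) \<and>
      (\<forall>e. \<theta> e \<in> tangent_space A p \<and> \<alpha> (\<theta> e) = e)" if p: "p \<in> topspace X" for p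
  proof -
    obtain c where c: "c \<in> A" "p \<in> fst c" using charts_cover[OF p] by blast
    obtain T :: "'e \<Rightarrow> 'e" and k l where T: "linear T" "bij T" and k: "k > 0" and l: "linear l"
      and f: "\<And>y. fc c (snd c p, T y) = k * norm y + l y"
      using pointwise_Randers[OF assms(2) _ _ c(1), of "snd c p"] assms c(2) by auto
    have TiT: "inv T (T y) = y" and TTi: "T (inv T y) = y" for y :: 'e
      using T(2) by (simp_all add: bij_is_inj bij_is_surj surj_f_inv_f)
    have lTi: "linear (inv T)" by (rule linear_inv_bij[OF T(1,2)])
    define \<alpha> where "\<alpha> u = k *\<^sub>R inv T (u c)" for u :: "('a, 'e) tvec"
    define \<beta> where "\<beta> u = l (inv T (u c))" for u :: "('a, 'e) tvec"
    define \<theta> where "\<theta> e = tvec_of A c p (T ((1 / k) *\<^sub>R e))" for e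
    have "linear \<alpha>"
      by (rule linearI) (simp_all add: \<alpha>_def fun_vs linear_add[OF lTi] linear_scale[OF lTi] scaleR_add_right)
    moreover have "linear \<beta>"
      by (rule linearI)
        (simp_all add: \<beta>_def fun_vs linear_add[OF lTi] linear_scale[OF lTi] linear_add[OF l] linear_scale[OF l])
    moreover have "linear \<theta>"
      by (rule linearI) (simp_all add: \<theta>_def linear_add[OF T(1)] linear_scale[OF T(1)] scaleR_add_right
          tvec_of_add[OF c] tvec_of_scale[OF c] mult.commute)
    moreover have "F p u = norm (\<alpha> u) + \<beta> u \<and> \<theta> (\<alpha> u) = u" if u: "u \<in> tangent_space A p" for u
      using F_chart[OF c u] f[of "inv T (u c)"] k tvec_of_component[OF c u] by (simp add: \<alpha>_def \<beta>_def \<theta>_def TTi)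
    moreover have "\<theta> e \<in> tangent_space A p \<and> \<alpha> (\<theta> e) = e" for e
      using k by (simp add: \<theta>_def \<alpha>_def tvec_of_in[OF c] tvec_of_at[OF c] TiT)
    ultimately show ?thesis by blast
  qed
  define N where "N p v = (F p v + F p (- v)) / 2" for p v
  define g where "g p u v = ((N p (u + v))\<^sup>2 - (N p (u - v))\<^sup>2) / 4" for p u v
  define \<tau> where "\<tau> p v = (F p v - F p (- v)) / 2" for p v
  have rep: "\<exists>\<alpha> \<beta> \<theta>. linear (\<alpha> :: ('a, 'e) tvec \<Rightarrow> 'e) \<and> linear \<beta> \<and> linear \<theta> \<and>
      (\<forall>u\<in>tangent_space A p. \<tau> p u = \<beta> u \<and> F p u = norm (\<alpha> u) + \<beta> u \<and> \<theta> (\<alpha> u) = u) \<and>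
      (\<forall>u\<in>tangent_space A p. \<forall>v\<in>tangent_space A p. g p u v = \<alpha> u \<bullet> \<alpha> v) \<and>
      (\<forall>e. \<theta> e \<in> tangent_space A p \<and> \<alpha> (\<theta> e) = e)" if p: "p \<in> topspace X" for p
  proof -
    obtain \<alpha> :: "('a, 'e) tvec \<Rightarrow> 'e" and \<beta> \<theta> where l: "linear \<alpha>" "linear \<beta>" "linear \<theta>"
      and F: "\<And>u. u \<in> tangent_space A p \<Longrightarrow> F p u = norm (\<alpha> u) + \<beta> u"
      and \<theta>: "\<And>u. u \<in> tangent_space A p \<Longrightarrow> \<theta> (\<alpha> u) = u" "\<And>e. \<theta> e \<in> tangent_space A p" "\<And>e. \<alpha> (\<theta> e) = e"
      using pointwise[OF p] by metis
    note s = subspace_tangent_space[OF p]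
    have N: "N p u = norm (\<alpha> u)" and \<tau>: "\<tau> p u = \<beta> u" if u: "u \<in> tangent_space A p" for u
      using F[OF u] F[OF subspace_neg[OF s u]] linear_neg[OF l(1), of u] linear_neg[OF l(2), of u]
      by (simp_all add: N_def \<tau>_def)
    have "g p u v = \<alpha> u \<bullet> \<alpha> v" if uv: "u \<in> tangent_space A p" "v \<in> tangent_space A p" for u v
      unfolding g_def N[OF subspace_add[OF s uv]] N[OF subspace_diff[OF s uv]]
        linear_add[OF l(1)] linear_diff[OF l(1)] power2_norm_eq_inner
      by (simp add: inner_simps inner_commute)
    then show ?thesis using l F \<theta> \<tau> by blast
  qed
  have riem: "riemannian_metric X A g"
    unfolding riemannian_metric_def
  proof (intro conjI ballI allI impI)
    fix p u v w assume p: "p \<in> topspace X" and u: "u \<in> tangent_space A p" and v: "v \<in> tangent_space A p"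
    note s = subspace_tangent_space[OF p]
    obtain \<alpha> :: "('a, 'e) tvec \<Rightarrow> 'e" where l: "linear \<alpha>"
      and g: "\<And>u v. u \<in> tangent_space A p \<Longrightarrow> v \<in> tangent_space A p \<Longrightarrow> g p u v = \<alpha> u \<bullet> \<alpha> v"
      using rep[OF p] by metis
    show "g p u v = g p v u" using g[OF u v] g[OF v u] by (simp add: inner_commute)
    fix a b assume w: "w \<in> tangent_space A p"
    have "a *\<^sub>R u + b *\<^sub>R v \<in> tangent_space A p" using s u v by (intro subspace_add subspace_scale)
    then show "g p (a *\<^sub>R u + b *\<^sub>R v) w = a * g p u w + b * g p v w"
      using g u v w by (simp add: linear_add[OF l] linear_scale[OF l] inner_simps)
  next
    fix p v assume p: "p \<in> topspace X" and v: "v \<in> tangent_space A p" "v \<noteq> 0"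
    obtain \<alpha> :: "('a, 'e) tvec \<Rightarrow> 'e" and \<theta> where l: "linear \<theta>" and \<theta>: "\<theta> (\<alpha> v) = v" and g: "g p v v = \<alpha> v \<bullet> \<alpha> v"
      using rep[OF p] v(1) by metis
    have "\<alpha> v \<noteq> 0" using \<theta> v(2) linear_0[OF l] by metis
    then show "g p v v > 0" by (simp add: g)
  next
    fix c :: "('a, 'e) chart" and w w' assume c: "c \<in> A"
    interpret minkowski_family "snd c ` fst c" "fc c" by (rule minkowski_family_fc[OF c])
    define Nc where "Nc w x = (1/2) * (fc c (x, w) + fc c (x, - w))" for w x
    have sN: "smooth_on (snd c ` fst c) (Nc w)" for w
      unfolding Nc_def by (intro smooth_on_mult smooth_on_add smooth_on_const smooth_on_base open_\<Omega>)
    have "smooth_on (snd c ` fst c)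
        (\<lambda>x. (1/4) * (Nc (w + w') x * Nc (w + w') x + (-1) * (Nc (w - w') x * Nc (w - w') x)))"
      by (intro smooth_on_mult smooth_on_add smooth_on_const sN open_\<Omega>)
    then show "smooth_on (snd c ` fst c)
        (\<lambda>x. g (chart_inv c x) (tvec_of A c (chart_inv c x) w) (tvec_of A c (chart_inv c x) w'))"
    proof (rule smooth_on_cong[OF open_\<Omega>, rotated])
      fix x assume x: "x \<in> snd c ` fst c"
      note i = c chart_inv_in[OF c x]
      have neg: "- tvec_of A c (chart_inv c x) w = tvec_of A c (chart_inv c x) (- w)" for w
        using tvec_of_scale[OF i, of "-1" w] by simp
      have NN: "N (chart_inv c x) (tvec_of A c (chart_inv c x) w) = Nc w x" for w
        by (simp add: N_def Nc_def neg fc_def)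
      have sub: "tvec_of A c (chart_inv c x) w - tvec_of A c (chart_inv c x) w'
          = tvec_of A c (chart_inv c x) (w - w')"
        using tvec_of_add[OF i, of w "- w'"] neg[of w'] by simp
      show "(1/4) * (Nc (w + w') x * Nc (w + w') x + (-1) * (Nc (w - w') x * Nc (w - w') x))
          = g (chart_inv c x) (tvec_of A c (chart_inv c x) w) (tvec_of A c (chart_inv c x) w')"
        by (simp add: g_def sub NN power2_eq_square flip: tvec_of_add[OF i])
    qed
  qed
  have form: "smooth_one_form X A \<tau>"
    unfolding smooth_one_form_def
  proof (intro conjI ballI allI)
    fix p u v a b assume p: "p \<in> topspace X" and u: "u \<in> tangent_space A p" and v: "v \<in> tangent_space A p"
    obtain \<beta> where l: "linear \<beta>" and \<tau>: "\<And>u. u \<in> tangent_space A p \<Longrightarrow> \<tau> p u = \<beta> u"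
      using rep[OF p] by metis
    have "a *\<^sub>R u + b *\<^sub>R v \<in> tangent_space A p"
      using subspace_tangent_space[OF p] u v by (intro subspace_add subspace_scale)
    then show "\<tau> p (a *\<^sub>R u + b *\<^sub>R v) = a * \<tau> p u + b * \<tau> p v"
      using \<tau> u v by (simp add: linear_add[OF l] linear_scale[OF l])
  next
    fix c :: "('a, 'e) chart" and w assume c: "c \<in> A"
    interpret minkowski_family "snd c ` fst c" "fc c" by (rule minkowski_family_fc[OF c])
    have "smooth_on (snd c ` fst c) (\<lambda>x. (1/2) * (fc c (x, w) + (-1) * fc c (x, - w)))"
      by (intro smooth_on_mult smooth_on_add smooth_on_const smooth_on_base open_\<Omega>)
    then show "smooth_on (snd c ` fst c) (\<lambda>x. \<tau> (chart_inv c x) (tvec_of A c (chart_inv c x) w))"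
    proof (rule smooth_on_cong[OF open_\<Omega>, rotated])
      fix x assume x: "x \<in> snd c ` fst c"
      have "- tvec_of A c (chart_inv c x) w = tvec_of A c (chart_inv c x) (- w)"
        using tvec_of_scale[OF c chart_inv_in[OF c x], of "-1" w] by simp
      then show "(1/2) * (fc c (x, w) + (-1) * fc c (x, - w)) = \<tau> (chart_inv c x) (tvec_of A c (chart_inv c x) w)"
        by (simp add: \<tau>_def fc_def)
    qed
  qed
  have small: "one_form_norm A g \<tau> p < 1" if p: "p \<in> topspace X" for p
  proof -
    obtain \<alpha> :: "('a, 'e) tvec \<Rightarrow> 'e" and \<beta> \<theta> where l: "linear \<alpha>" "linear \<beta>" "linear \<theta>"
      and a: "\<forall>u\<in>tangent_space A p. \<tau> p u = \<beta> u \<and> F p u = norm (\<alpha> u) + \<beta> u \<and> \<theta> (\<alpha> u) = u"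
        "\<forall>u\<in>tangent_space A p. \<forall>v\<in>tangent_space A p. g p u v = \<alpha> u \<bullet> \<alpha> v"
        "\<forall>e. \<theta> e \<in> tangent_space A p \<and> \<alpha> (\<theta> e) = e"
      using rep[OF p] by (elim exE conjE)
    have F: "F p u = norm (\<alpha> u) + \<beta> u" and \<tau>: "\<tau> p u = \<beta> u" and g: "g p u u = \<alpha> u \<bullet> \<alpha> u"
      and \<theta>1: "\<theta> (\<alpha> u) = u" if "u \<in> tangent_space A p" for u using a(1,2) that by auto
    have \<theta>2: "\<theta> e \<in> tangent_space A p" "\<alpha> (\<theta> e) = e" for e using a(3) by auto
    note \<theta> = \<theta>1 \<theta>2
    \<comment> \<open>Through \<theta> the unit ball of \<open>g\<close> becomes the compact
      Euclidean ball, so the supremum is attained and strictness can be checked at one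
      vector.\<close>
    have set_eq: "{\<bar>\<tau> p v\<bar> |v. v \<in> tangent_space A p \<and> g p v v \<le> 1} = (\<lambda>e. \<bar>\<beta> (\<theta> e)\<bar>) ` cball 0 1" (is "?L = ?R")
    proof (intro equalityI subsetI)
      fix x assume "x \<in> ?L"
      then obtain v where v: "v \<in> tangent_space A p" "g p v v \<le> 1" "x = \<bar>\<tau> p v\<bar>" by blast
      then have "norm (\<alpha> v) \<le> 1" using g[OF v(1)] by (simp add: norm_le_square)
      then show "x \<in> ?R" using v \<tau> \<theta>(1) by (intro image_eqI[of _ _ "\<alpha> v"]) auto
    next
      fix x assume "x \<in> ?R"
      then obtain e where e: "norm e \<le> 1" "x = \<bar>\<beta> (\<theta> e)\<bar>" by auto
      have "g p (\<theta> e) (\<theta> e) \<le> 1" using g[OF \<theta>(2)] \<theta>(3) e(1) by (simp add: norm_le_square)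
      then show "x \<in> ?L" using \<theta>(2) \<tau> e(2) by force
    qed
    have lb: "linear (\<lambda>e. \<beta> (\<theta> e))" using linear_compose[OF l(3,2)] by (simp add: o_def)
    have "continuous_on (cball 0 1) (\<lambda>e. \<bar>\<beta> (\<theta> e)\<bar>)"
      using linear_continuous_on[OF lb[unfolded linear_conv_bounded_linear]] by (intro continuous_on_rabs)
    then obtain e where e: "e \<in> cball 0 1" "\<And>y. y \<in> cball 0 1 \<Longrightarrow> \<bar>\<beta> (\<theta> y)\<bar> \<le> \<bar>\<beta> (\<theta> e)\<bar>"
      using continuous_attains_sup[OF compact_cball, of 0 1 "\<lambda>e. \<bar>\<beta> (\<theta> e)\<bar>"] by auto
    have "one_form_norm A g \<tau> p = \<bar>\<beta> (\<theta> e)\<bar>"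
      unfolding one_form_norm_def set_eq using e by (intro cSup_eq_maximum) auto
    also have "\<dots> < 1"
    proof (cases "e = 0")
      case True
      then show ?thesis using linear_0[OF lb] by simp
    next
      case False
      have pos: "F p v > 0" if "v \<in> tangent_space A p" "v \<noteq> 0" for v
        using finsler p that by (auto simp: finsler_metric_def)
      \<comment> \<open>Positivity of \<open>F\<close> at a vector and at its negative bounds the
        linear form strictly by the norm.\<close>
      have "0 < norm y + \<beta> (\<theta> y)" if "y \<noteq> 0" for y
      proof -
        have "\<theta> y \<noteq> 0" using \<theta>(3)[of y] that linear_0[OF l(1)] by metis
        then show ?thesis using pos[OF \<theta>(2)] F[OF \<theta>(2)] \<theta>(3) by metis
      qed
      from this[OF False] this[of "- e"] False have "\<bar>\<beta> (\<theta> e)\<bar> < norm e"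
        using linear_neg[OF lb, of e] by (simp add: abs_less_iff)
      then show ?thesis using e(1) by simp
    qed
    finally show ?thesis .
  qed
  have repr: "F p v = sqrt (g p v v) + \<tau> p v" if p: "p \<in> topspace X" and v: "v \<in> tangent_space A p" for p v
  proof -
    obtain \<alpha> :: "('a, 'e) tvec \<Rightarrow> 'e" and \<beta> where "F p v = norm (\<alpha> v) + \<beta> v" "\<tau> p v = \<beta> v" "g p v v = \<alpha> v \<bullet> \<alpha> v"
      using rep[OF p] v by metis
    then show ?thesis by (simp add: norm_eq_sqrt_inner)
  qed
  show ?thesis
    unfolding randers_metric_def using riem form small repr by blast
qed

end
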